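(* Let $(K,S,\{f_s\}_{s\in S})$ be a self-similar structure, $r\in(0,1)$, $j_s\in\mathbb N$ ($s\in S$), with the associated partition and self-similar measure $\mu$ of the context, and suppose there is a metric $d$ on $K$ giving its topology for which the standing assumption (A) of the context holds (with this partition, this $r$ and this $\mu$). Suppose that $p>\dim_{AR}(K,d)$ and that $K$ is $p$-conductively homogeneous; let $\sigma$ be the constant with $c\sigma^m\le\sigma_{p,m,n}\le c'\sigma^m$ for all $m,n\ge 1$ (some $c,c'>0$), let $\tau_p=-\log\sigma/\log r$, and let $\mathcal W^p,\mathcal N_p$ be as in the context. Then: (1) For any finite word $w$ over $S$ and $f\in\mathcal W^p$, $f\circ f_w\in\mathcal W^p$. (2) There exists $\mathcal E_p:\mathcal W^p\to[0,\infty)$ satisfying: (a) $(\mathcal E_p)^{1/p}$ is a semi-norm on $\mathcal W^p$ and there exist $c_1,c_2>0$ such that $c_1\mathcal N_p(f)\le\mathcal E_p(f)^{1/p}\le c_2\mathcal N_p(f)$ for all $f\in\mathcal W^p$ and $$c_1d(x,y)^{\tau_p}\le\sup_{f\in\mathcal W^p,\ \mathcal E_p(f)\ne0}\frac{|f(x)-f(y)|^p}{\mathcal E_p(f)}\le c_2d(x,y)^{\tau_p}\quad\text{for all }x,y\in K;$$ (b) for any $f\in\mathcal W^p$, $\overline f:=\min\{\max\{f,0\},1\}\in\mathcal W^p$ and $\mathcal E_p(\overline f)\le\mathcal E_p(f)$; (c) for any $f\in\mathcal W^p$, $\mathcal E_p(f)=\sum_{s\in S}\sigma^{j_s}\mathcal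 E_p(f\circ f_s)$. In particular, for $p=2$, $(\mathcal E_2,\mathcal W^2)$ is a local regular Dirichlet form on $L^2(K,\mu)$.
   Context: Self-similar structure. $K$ is a compact metrizable space, $S$ a finite set, $f_s:K\to K$ continuous injective, and there is a continuous surjection $\chi:S^{\mathbb N}\to K$ with $\chi(s_1s_2\ldots)=f_{s_1}(\chi(s_2s_3\ldots))$. For a word $w=w_1\ldots w_m\in S^m$, $f_w=f_{w_1}\circ\cdots\circ f_{w_m}$, $K_w=f_w(K)$ ($f_\phi=\mathrm{id}$ for the empty word $\phi$), $j(w)=\sum_ij_{w_i}$, $g(w)=r^{j(w)}$. Associated tree and partition. $\Lambda_0=\{\phi\}$ and, for $n\ge1$, $\Lambda_n=\{w_1\ldots w_m: g(w_1\ldots w_{m-1})>r^n\ge g(w_1\ldots w_m)\}$. $T_n=\{(n,w):w\in\Lambda_n\}$, $T=\bigcup_nT_n$, rooted at $(0,\phi)$; $(n+1,w)$ is a child of $(n,v)$ iff $w=v$ or $v$ is $w$ with its last letter removed. The partition is $K_{(n,w)}:=K_w$. $\alpha_H$ is defined by $\sum_sr^{j_s\alpha_H}=1$, and $\mu$ is the self-similar probability measure on $K$ with weights $(r^{j_s\alpha_H})_{s\in S}$. Tree notation. $|x|=n$ for $x\in T_n$, $\pi(x)$ is the parent (the root is its own parent), $S(x)$ the set of children, $S^0(x)=\{x\}$, $S^{k+1}(x)=\bigcup_{y\in S(x)}S^k(y)$, $S^k(A)=\bigcup_{x\in A}S^k(x)$. For $A\subseteq T_n$, $w\in A$, $M\ge0$,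 $\Gamma^A_M(w)$ is the set of $u\in A$ for which there are $u(0)=w,\dots,u(M)=u$ in $A$ with $K_{u(i)}\cap K_{u(i+1)}\ne\emptyset$; $\Gamma_M(w)=\Gamma_M^{T_n}(w)$. $E_n^*=\{(w,v)\in T_n^2:w\ne v,K_w\cap K_v\neq\emptyset\}$. Standing assumption (A). $(T,\text{parent-child adjacency})$ is a locally finite tree in which every vertex has at least two neighbours; $(K,d)$ is a compact connected metric space of diameter $1$; $\{K_w\}_{w\in T}$ is a partition ($K_w$ non-empty compact without isolated points, equal to the union of its children's sets, and shrinking to a single point along each ray) that is minimal ($K_w\setminus\bigcup_{v\in T_{|w|},v\ne w}K_v\ne\emptyset$) and uniformly finite ($\sup_w\#\Gamma_1(w)<\infty$); and: (1) every $K_w$ is connected. (2) There is $M_*\ge1$ with: (2A) $c_1r^{|w|}\le\mathrm{diam}(K_w,d)\le c_2r^{|w|}$ for all $w\in T$; (2B) with $U_M(x:n)=\bigcup_{w\in T_n,x\in K_w}\bigcup_{v\in\Gamma_M(w)}K_v$, $B_d(x,c_1r^n)\subseteq U_{M_*}(x:n)\subseteq B_d(x,c_2r^n)$ for all $x\in K,n\ge1$; (2C) there is $c>0$ such that each $K_w$, $w\in T_n$, $n\ge 1$, contains a ball $B_d(x,cr^n)$ with $x\in K_w$. (3) $\mu$ is a Borel regular probability measure with the volume doubling property w.r.t. $d$, $\mu(K_w)=\sum_{v\in S(w)}\mu(K_v)$, and exponential: there are $\gamma,\gamma_1\in(0,1)$, $m_1\ge1$ with $\mu(K_w)\ge\gamma\mu(K_{\pi(w)})$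 and $\mu(K_v)\le\gamma_1\mu(K_w)$ for all $w\in T,v\in S^{m_1}(w)$. (4) There is $M_0\ge M_*$ with $\Gamma_{M_*}(u)\cap S^k(w)\subseteq\Gamma^{S^k(w)}_{M_0}(u)$ for all $w\in T,k\ge1,u\in S^k(w)$. (5) $\pi(\Gamma_{M_*+1}(w))\subseteq\Gamma_{M_*}(\pi(w))$ for all $w$. Constants. For $A\subseteq T_n$, $f:A\to\mathbb R$: $\mathcal E^n_{p,A}(f)=\frac12\sum_{u,v\in A,(u,v)\in E_n^*}|f(u)-f(v)|^p$, $\mathcal E_p^n=\mathcal E^n_{p,T_n}$. $\mathcal E_{M_*,p,m}=\sup_{w\in T,|w|\ge1}\inf\{\mathcal E_p^{|w|+m}(f): f=1\text{ on }S^m(w), f=0\text{ on }S^m(T_{|w|}\setminus\Gamma_{M_*}(w))\}$. With $(f)_A$ the $\mu(K_\cdot)$-weighted average of $f$ over $A$, for $(w,v)\in E_n^*$ let $\sigma_{p,m}(w,v)=\sup_f|(f)_{S^m(w)}-(f)_{S^m(v)}|^p/\mathcal E^{n+m}_{p,S^m(w)\cup S^m(v)}(f)$ over non-constant $f$; $\sigma_{p,m,n}=\sup_{(w,v)\in E_n^*}\sigma_{p,m}(w,v)$, $\sigma_{p,m}=\sup_{n\ge1}\sigma_{p,m,n}$. $K$ is $p$-conductively homogeneous if $\sup_{m\ge0}\sigma_{p,m}\mathcal E_{M_*,p,m}<\infty$. Function space. $(P_nf)(w)=\mu(K_w)^{-1}\int_{K_w}f\,d\mu$, $\mathcal N_p(f)=(\sup_{n\ge1}\sigma^n\mathcal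 E_p^n(P_nf))^{1/p}$, $\mathcal W^p=\{f\in L^p(K,\mu):\mathcal N_p(f)<\infty\}$; under the hypotheses elements of $\mathcal W^p$ have continuous representatives and $\mathcal W^p$ is regarded as a subset of $C(K)$. $\dim_{AR}(K,d)$ is the infimum of all $\alpha$ for which there exist a metric $\rho$ on $K$ quasisymmetric to $d$ and a Borel regular measure that is $\alpha$-Ahlfors regular with respect to $\rho$. *)

theory Defs
  imports "HOL-Probability.Probability"
begin

section \<open>Trees with a family of cells\<close>

text \<open>
  The space \<open>K\<close> is the whole of a metric space type; the metric \<open>d\<close> is \<^const>\<open>dist\<close>.
  \<open>cell w\<close> is the set \<open>K\<^sub>w\<close>.
\<close>

record ('t, 'k) cell_tree =
  tree_root :: 't
  vertices :: "'t set"
  depth :: "'t \<Rightarrow> nat"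
  children :: "'t \<Rightarrow> 't set"
  cell :: "'t \<Rightarrow> 'k set"

definition level :: "('t, 'k) cell_tree \<Rightarrow> nat \<Rightarrow> 't set" where
  "level P n = {x \<in> vertices P. depth P x = n}"

definition parent :: "('t, 'k) cell_tree \<Rightarrow> 't \<Rightarrow> 't" where
  "parent P x =
    (if x = tree_root P then x else (THE y. y \<in> vertices P \<and> x \<in> children P y))"

primrec descendants :: "('t, 'k) cell_tree \<Rightarrow> nat \<Rightarrow> 't \<Rightarrow> 't set" where
  "descendants P 0 x = {x}"
| "descendants P (Suc k) x = (\<Union>y\<in>children P x. descendants P k y)"

definition descendants_of_set :: "('t, 'k) cell_tree \<Rightarrow> nat \<Rightarrow> 't set \<Rightarrow> 't set" where
  "descendants_of_set P k A = (\<Union>x\<in>A. descendants P k x)"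

definition nbhd_in :: "('t, 'k) cell_tree \<Rightarrow> 't set \<Rightarrow> nat \<Rightarrow> 't \<Rightarrow> 't set" where
  "nbhd_in P A M w = {u. \<exists>h :: nat \<Rightarrow> 't. h 0 = w \<and> h M = u \<and> (\<forall>i\<le>M. h i \<in> A) \<and>
     (\<forall>i<M. cell P (h i) \<inter> cell P (h (Suc i)) \<noteq> {})}"

definition nbhd :: "('t, 'k) cell_tree \<Rightarrow> nat \<Rightarrow> 't \<Rightarrow> 't set" where
  "nbhd P M w = nbhd_in P (level P (depth P w)) M w"

definition edges :: "('t, 'k) cell_tree \<Rightarrow> nat \<Rightarrow> ('t \<times> 't) set" where
  "edges P n = {(w, v). w \<in> level P n \<and> v \<in> level P n \<and> w \<noteq> v \<and> cell P w \<inter> cell P v \<noteq> {}}"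

definition adjacent :: "('t, 'k) cell_tree \<Rightarrow> 't \<Rightarrow> 't \<Rightarrow> bool" where
  "adjacent P x y \<longleftrightarrow> x \<in> vertices P \<and> y \<in> vertices P \<and> (y \<in> children P x \<or> x \<in> children P y)"

definition simple_path_between :: "('t, 'k) cell_tree \<Rightarrow> 't \<Rightarrow> 't list \<Rightarrow> 't \<Rightarrow> bool" where
  "simple_path_between P x xs y \<longleftrightarrow> xs \<noteq> [] \<and> hd xs = x \<and> last xs = y \<and>
     set xs \<subseteq> vertices P \<and> distinct xs \<and> successively (adjacent P) xs"

definition locally_finite_tree :: "('t, 'k) cell_tree \<Rightarrow> bool" where
  "locally_finite_tree P \<longleftrightarrow>
     tree_root P \<in> vertices P \<and>
     (\<forall>x\<in>vertices P. \<forall>y\<in>vertices P. \<exists>!xs. simple_path_between P x xs y) \<and>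
     (\<forall>x\<in>vertices P. finite {y. adjacent P x y})"

definition is_partition :: "('t, 'k::metric_space) cell_tree \<Rightarrow> bool" where
  "is_partition P \<longleftrightarrow>
     cell P (tree_root P) = UNIV \<and>
     (\<forall>w\<in>vertices P. cell P w \<noteq> {} \<and> compact (cell P w) \<and>
        (\<forall>x\<in>cell P w. x islimpt cell P w) \<and>
        cell P w = (\<Union>v\<in>children P w. cell P v)) \<and>
     (\<forall>\<omega> :: nat \<Rightarrow> 't. \<omega> 0 = tree_root P \<and> (\<forall>n. \<omega> (Suc n) \<in> children P (\<omega> n)) \<longrightarrow>
        (\<exists>x. (\<Inter>n. cell P (\<omega> n)) = {x}))"

definition minimal_partition :: "('t, 'k) cell_tree \<Rightarrow> bool" where
  "minimal_partition P \<longleftrightarrow>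
     (\<forall>w\<in>vertices P. cell P w - (\<Union>v\<in>level P (depth P w) - {w}. cell P v) \<noteq> {})"

definition uniformly_finite :: "('t, 'k) cell_tree \<Rightarrow> bool" where
  "uniformly_finite P \<longleftrightarrow>
     (\<exists>N. \<forall>w\<in>vertices P. finite (nbhd P 1 w) \<and> card (nbhd P 1 w) \<le> N)"

definition cell_nbhd :: "('t, 'k) cell_tree \<Rightarrow> nat \<Rightarrow> 'k \<Rightarrow> nat \<Rightarrow> 'k set" where
  "cell_nbhd P M x n = (\<Union>w\<in>{w \<in> level P n. x \<in> cell P w}. \<Union>v\<in>nbhd P M w. cell P v)"


section \<open>The standing assumption\<close>

text \<open>
  A Borel regular measure is represented by its restriction to the Borel sets, which
  determines it.
\<close>

definition volume_doubling :: "'k::metric_space measure \<Rightarrow> bool" where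
  "volume_doubling \<mu> \<longleftrightarrow>
     (\<exists>C>0. \<forall>x. \<forall>s>0. measure \<mu> (ball x (2 * s)) \<le> C * measure \<mu> (ball x s))"

definition exponential_measure :: "('t, 'k) cell_tree \<Rightarrow> 'k measure \<Rightarrow> bool" where
  "exponential_measure P \<mu> \<longleftrightarrow>
     (\<exists>\<gamma> \<gamma>\<^sub>1 :: real. \<exists>m\<^sub>1 :: nat. 0 < \<gamma> \<and> \<gamma> < 1 \<and> 0 < \<gamma>\<^sub>1 \<and> \<gamma>\<^sub>1 < 1 \<and> 1 \<le> m\<^sub>1 \<and>
        (\<forall>w\<in>vertices P. measure \<mu> (cell P w) \<ge> \<gamma> * measure \<mu> (cell P (parent P w))) \<and>
        (\<forall>w\<in>vertices P. \<forall>v\<in>descendants P m\<^sub>1 w.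
           measure \<mu> (cell P v) \<le> \<gamma>\<^sub>1 * measure \<mu> (cell P w)))"

definition standing_assumption ::
  "('t, 'k::metric_space) cell_tree \<Rightarrow> real \<Rightarrow> 'k measure \<Rightarrow> nat \<Rightarrow> bool" where
  "standing_assumption P r \<mu> M \<longleftrightarrow>
     locally_finite_tree P \<and>
     (\<forall>x\<in>vertices P. 2 \<le> card {y. adjacent P x y}) \<and>
     compact (UNIV :: 'k set) \<and> connected (UNIV :: 'k set) \<and> diameter (UNIV :: 'k set) = 1 \<and>
     is_partition P \<and> minimal_partition P \<and> uniformly_finite P \<and>
     (\<forall>w\<in>vertices P. connected (cell P w)) \<and>
     1 \<le> M \<and>
     (\<exists>c\<^sub>1>0. \<exists>c\<^sub>2>0.
        (\<forall>w\<in>vertices P. c\<^sub>1 * r ^ depth P w \<le> diameter (cell P w) \<and>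
           diameter (cell P w) \<le> c\<^sub>2 * r ^ depth P w) \<and>
        (\<forall>x. \<forall>n\<ge>1. ball x (c\<^sub>1 * r ^ n) \<subseteq> cell_nbhd P M x n \<and>
           cell_nbhd P M x n \<subseteq> ball x (c\<^sub>2 * r ^ n))) \<and>
     (\<exists>c>0. \<forall>n\<ge>1. \<forall>w\<in>level P n. \<exists>x\<in>cell P w. ball x (c * r ^ n) \<subseteq> cell P w) \<and>
     sets \<mu> = sets borel \<and> prob_space \<mu> \<and> volume_doubling \<mu> \<and>
     (\<forall>w\<in>vertices P. measure \<mu> (cell P w) = (\<Sum>v\<in>children P w. measure \<mu> (cell P v))) \<and>
     exponential_measure P \<mu> \<and>
     (\<exists>M\<^sub>0\<ge>M. \<forall>w\<in>vertices P. \<forall>k\<ge>1. \<forall>u\<in>descendants P k w.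
        nbhd P M u \<inter> descendants P k w \<subseteq> nbhd_in P (descendants P k w) M\<^sub>0 u) \<and>
     (\<forall>w\<in>vertices P. parent P ` nbhd P (M + 1) w \<subseteq> nbhd P M (parent P w))"


section \<open>Discrete energies and conductive homogeneity\<close>

text \<open>
  A function on a set \<open>A\<close> of vertices is represented by a total function of which only the
  values on \<open>A\<close> matter. Suprema and infima of non-negative quantities are taken in \<^typ>\<open>ennreal\<close>.
\<close>

definition energy_on ::
  "('t, 'k) cell_tree \<Rightarrow> real \<Rightarrow> nat \<Rightarrow> 't set \<Rightarrow> ('t \<Rightarrow> real) \<Rightarrow> real" where
  "energy_on P p n A f = (1/2) * (\<Sum>(u, v)\<in>edges P n \<inter> A \<times> A. \<bar>f u - f v\<bar> powr p)"

definition energy :: "('t, 'k) cell_tree \<Rightarrow> real \<Rightarrow> nat \<Rightarrow> ('t \<Rightarrow> real) \<Rightarrow> real" where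
  "energy P p n f = energy_on P p n (level P n) f"

definition conductance :: "('t, 'k) cell_tree \<Rightarrow> nat \<Rightarrow> real \<Rightarrow> nat \<Rightarrow> ennreal" where
  "conductance P M p m =
     (SUP w\<in>{w \<in> vertices P. 1 \<le> depth P w}.
        INF f\<in>{f. (\<forall>u\<in>descendants P m w. f u = 1) \<and>
                  (\<forall>u\<in>descendants_of_set P m (level P (depth P w) - nbhd P M w). f u = 0)}.
          ennreal (energy P p (depth P w + m) f))"

definition weighted_mean ::
  "('t, 'k) cell_tree \<Rightarrow> 'k measure \<Rightarrow> 't set \<Rightarrow> ('t \<Rightarrow> real) \<Rightarrow> real" where
  "weighted_mean P \<mu> A f =
     (\<Sum>u\<in>A. f u * measure \<mu> (cell P u)) / (\<Sum>u\<in>A. measure \<mu> (cell P u))"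

definition nbr_disparity_pair ::
  "('t, 'k) cell_tree \<Rightarrow> 'k measure \<Rightarrow> real \<Rightarrow> nat \<Rightarrow> nat \<Rightarrow> 't \<Rightarrow> 't \<Rightarrow> ennreal" where
  "nbr_disparity_pair P \<mu> p m n w v =
     (SUP f\<in>{f. \<not> f constant_on (descendants P m w \<union> descendants P m v)}.
        ennreal (\<bar>weighted_mean P \<mu> (descendants P m w) f
                   - weighted_mean P \<mu> (descendants P m v) f\<bar> powr p) /
        ennreal (energy_on P p (n + m) (descendants P m w \<union> descendants P m v) f))"

definition nbr_disparity_level ::
  "('t, 'k) cell_tree \<Rightarrow> 'k measure \<Rightarrow> real \<Rightarrow> nat \<Rightarrow> nat \<Rightarrow> ennreal" where
  "nbr_disparity_level P \<mu> p m n = (SUP (w, v)\<in>edges P n. nbr_disparity_pair P \<mu> p m n w v)"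

definition nbr_disparity :: "('t, 'k) cell_tree \<Rightarrow> 'k measure \<Rightarrow> real \<Rightarrow> nat \<Rightarrow> ennreal" where
  "nbr_disparity P \<mu> p m = (SUP n\<in>{1..}. nbr_disparity_level P \<mu> p m n)"

definition conductively_homogeneous ::
  "('t, 'k) cell_tree \<Rightarrow> 'k measure \<Rightarrow> nat \<Rightarrow> real \<Rightarrow> bool" where
  "conductively_homogeneous P \<mu> M p \<longleftrightarrow>
     (SUP m. nbr_disparity P \<mu> p m * conductance P M p m) < \<infinity>"

definition disparity_rate ::
  "('t, 'k) cell_tree \<Rightarrow> 'k measure \<Rightarrow> real \<Rightarrow> real \<Rightarrow> bool" where
  "disparity_rate P \<mu> p \<sigma> \<longleftrightarrow> 0 < \<sigma> \<and>
     (\<exists>c>0. \<exists>c'>0. \<forall>m\<ge>1. \<forall>n\<ge>1.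
        ennreal (c * \<sigma> ^ m) \<le> nbr_disparity_level P \<mu> p m n \<and>
        nbr_disparity_level P \<mu> p m n \<le> ennreal (c' * \<sigma> ^ m))"


section \<open>The function space\<close>

definition Lp_functions :: "'k measure \<Rightarrow> real \<Rightarrow> ('k \<Rightarrow> real) set" where
  "Lp_functions \<mu> p = {f \<in> borel_measurable \<mu>. integrable \<mu> (\<lambda>x. \<bar>f x\<bar> powr p)}"

definition cell_mean :: "('t, 'k) cell_tree \<Rightarrow> 'k measure \<Rightarrow> ('k \<Rightarrow> real) \<Rightarrow> 't \<Rightarrow> real" where
  "cell_mean P \<mu> f w = (LINT x:cell P w|\<mu>. f x) / measure \<mu> (cell P w)"

text \<open>\<open>Np_power\<close> is the supremum \<open>\<N>\<^sub>p(f)\<^sup>p\<close>, possibly infinite; \<open>Np\<close> is \<open>\<N>\<^sub>p(f)\<close> for those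
  \<open>f\<close> for which it is finite.\<close>

definition Np_power ::
  "('t, 'k) cell_tree \<Rightarrow> 'k measure \<Rightarrow> real \<Rightarrow> real \<Rightarrow> ('k \<Rightarrow> real) \<Rightarrow> ennreal" where
  "Np_power P \<mu> p \<sigma> f = (SUP n\<in>{1..}. ennreal (\<sigma> ^ n * energy P p n (cell_mean P \<mu> f)))"

definition Np ::
  "('t, 'k) cell_tree \<Rightarrow> 'k measure \<Rightarrow> real \<Rightarrow> real \<Rightarrow> ('k \<Rightarrow> real) \<Rightarrow> real" where
  "Np P \<mu> p \<sigma> f = enn2real (Np_power P \<mu> p \<sigma> f) powr (1 / p)"

text \<open>The elements of \<open>\<W>\<^sup>p\<close> are given by their continuous representatives.\<close>

definition Wp ::
  "('t, 'k::metric_space) cell_tree \<Rightarrow> 'k measure \<Rightarrow> real \<Rightarrow> real \<Rightarrow> ('k \<Rightarrow> real) set" where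
  "Wp P \<mu> p \<sigma> =
     {f \<in> Lp_functions \<mu> p. Np_power P \<mu> p \<sigma> f < \<infinity> \<and> continuous_on UNIV f}"

definition function_space :: "('k \<Rightarrow> real) set \<Rightarrow> bool" where
  "function_space V \<longleftrightarrow> (\<lambda>x. 0) \<in> V \<and>
     (\<forall>f\<in>V. \<forall>g\<in>V. (\<lambda>x. f x + g x) \<in> V) \<and> (\<forall>a. \<forall>f\<in>V. (\<lambda>x. a * f x) \<in> V)"

definition seminorm_on_space :: "('k \<Rightarrow> real) set \<Rightarrow> (('k \<Rightarrow> real) \<Rightarrow> real) \<Rightarrow> bool" where
  "seminorm_on_space V q \<longleftrightarrow> function_space V \<and>
     (\<forall>f\<in>V. 0 \<le> q f) \<and>
     (\<forall>a. \<forall>f\<in>V. q (\<lambda>x. a * f x) = \<bar>a\<bar> * q f) \<and>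
     (\<forall>f\<in>V. \<forall>g\<in>V. q (\<lambda>x. f x + g x) \<le> q f + q g)"

definition unit_truncation :: "('k \<Rightarrow> real) \<Rightarrow> 'k \<Rightarrow> real" where
  "unit_truncation f = (\<lambda>x. min (max (f x) 0) 1)"


section \<open>Ahlfors regular conformal dimension\<close>

definition quasisymmetric_metric :: "('k::metric_space \<Rightarrow> 'k \<Rightarrow> real) \<Rightarrow> bool" where
  "quasisymmetric_metric \<rho> \<longleftrightarrow>
     Metric_space UNIV \<rho> \<and> Metric_space.mtopology UNIV \<rho> = euclidean \<and>
     (\<exists>\<eta> \<theta> :: real \<Rightarrow> real. homeomorphism {0..} {0..} \<eta> \<theta> \<and>
        (\<forall>x y z. x \<noteq> z \<longrightarrow> \<rho> x y / \<rho> x z \<le> \<eta> (dist x y / dist x z)))"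

definition ahlfors_regular ::
  "('k::metric_space \<Rightarrow> 'k \<Rightarrow> real) \<Rightarrow> 'k measure \<Rightarrow> real \<Rightarrow> bool" where
  "ahlfors_regular \<rho> \<nu> \<alpha> \<longleftrightarrow>
     (\<exists>c\<^sub>1>0. \<exists>c\<^sub>2>0. \<forall>x s. 0 < s \<and> s \<le> (SUP (y, z). \<rho> y z) \<longrightarrow>
        ennreal (c\<^sub>1 * s powr \<alpha>) \<le> emeasure \<nu> (Metric_space.mball UNIV \<rho> x s) \<and>
        emeasure \<nu> (Metric_space.mball UNIV \<rho> x s) \<le> ennreal (c\<^sub>2 * s powr \<alpha>))"

definition dim_AR :: "'k::metric_space itself \<Rightarrow> ereal" where
  "dim_AR _ = Inf (ereal ` {\<alpha>. \<exists>(\<rho> :: 'k \<Rightarrow> 'k \<Rightarrow> real) \<nu>. quasisymmetric_metric \<rho> \<and>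
     sets \<nu> = sets borel \<and> ahlfors_regular \<rho> \<nu> \<alpha>})"


section \<open>Self-similar structures\<close>

text \<open>Infinite words are indexed from \<open>0\<close>.\<close>

definition self_similar_structure :: "'s set \<Rightarrow> ('s \<Rightarrow> 'k::metric_space \<Rightarrow> 'k) \<Rightarrow> bool" where
  "self_similar_structure S f \<longleftrightarrow>
     compact (UNIV :: 'k set) \<and> finite S \<and>
     (\<forall>s\<in>S. continuous_on UNIV (f s) \<and> inj (f s)) \<and>
     (\<exists>\<kappa> :: (nat \<Rightarrow> 's) \<Rightarrow> 'k.
        continuous_map (product_topology (\<lambda>_. discrete_topology S) UNIV) euclidean \<kappa> \<and>
        \<kappa> ` {\<omega>. range \<omega> \<subseteq> S} = UNIV \<and>
        (\<forall>\<omega>. range \<omega> \<subseteq> S \<longrightarrow> \<kappa> \<omega> = f (\<omega> 0) (\<kappa> (\<lambda>n. \<omega> (Suc n)))))"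

definition word_map :: "('s \<Rightarrow> 'k \<Rightarrow> 'k) \<Rightarrow> 's list \<Rightarrow> 'k \<Rightarrow> 'k" where
  "word_map f w = foldr (\<lambda>s h. f s \<circ> h) w id"

definition word_weight :: "real \<Rightarrow> ('s \<Rightarrow> nat) \<Rightarrow> 's list \<Rightarrow> real" where
  "word_weight r j w = r ^ (\<Sum>s\<leftarrow>w. j s)"

definition scale_words :: "'s set \<Rightarrow> real \<Rightarrow> ('s \<Rightarrow> nat) \<Rightarrow> nat \<Rightarrow> 's list set" where
  "scale_words S r j n =
     (if n = 0 then {[]}
      else {w \<in> lists S. w \<noteq> [] \<and> word_weight r j (butlast w) > r ^ n \<and>
              r ^ n \<ge> word_weight r j w})"

definition self_similar_tree ::
  "'s set \<Rightarrow> ('s \<Rightarrow> 'k \<Rightarrow> 'k) \<Rightarrow> real \<Rightarrow> ('s \<Rightarrow> nat) \<Rightarrow> (nat \<times> 's list, 'k) cell_tree" where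
  "self_similar_tree S f r j =
     \<lparr>tree_root = (0, []),
      vertices = {(n, w). w \<in> scale_words S r j n},
      depth = fst,
      children = (\<lambda>(n, v). {(Suc n, w) |w. w \<in> scale_words S r j (Suc n) \<and> (w = v \<or> v = butlast w)}),
      cell = (\<lambda>(n, w). range (word_map f w))\<rparr>"

definition self_similar_measure ::
  "'s set \<Rightarrow> ('s \<Rightarrow> 'k::metric_space \<Rightarrow> 'k) \<Rightarrow> ('s \<Rightarrow> real) \<Rightarrow> 'k measure \<Rightarrow> bool" where
  "self_similar_measure S f q \<mu> \<longleftrightarrow>
     sets \<mu> = sets borel \<and> prob_space \<mu> \<and>
     (\<forall>A\<in>sets borel. measure \<mu> A = (\<Sum>s\<in>S. q s * measure \<mu> (f s -` A)))"


section \<open>Dirichlet forms\<close>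

text \<open>
  The domain \<open>D\<close> is a space of representatives of elements of \<open>L\<^sup>2(\<mu>)\<close>; the form must be
  compatible with equality almost everywhere.
\<close>

definition form_one :: "'k measure \<Rightarrow> (('k \<Rightarrow> real) \<Rightarrow> ('k \<Rightarrow> real) \<Rightarrow> real) \<Rightarrow> ('k \<Rightarrow> real) \<Rightarrow> real" where
  "form_one \<mu> B u = B u u + (LINT x|\<mu>. (u x)\<^sup>2)"

definition symmetric_form ::
  "'k measure \<Rightarrow> ('k \<Rightarrow> real) set \<Rightarrow> (('k \<Rightarrow> real) \<Rightarrow> ('k \<Rightarrow> real) \<Rightarrow> real) \<Rightarrow> bool" where
  "symmetric_form \<mu> D B \<longleftrightarrow>
     function_space D \<and> D \<subseteq> Lp_functions \<mu> 2 \<and>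
     (\<forall>u\<in>D. \<forall>v\<in>D. B u v = B v u) \<and>
     (\<forall>u\<in>D. \<forall>v\<in>D. \<forall>w\<in>D. B (\<lambda>x. u x + v x) w = B u w + B v w) \<and>
     (\<forall>a. \<forall>u\<in>D. \<forall>v\<in>D. B (\<lambda>x. a * u x) v = a * B u v) \<and>
     (\<forall>u\<in>D. 0 \<le> B u u) \<and>
     (\<forall>u\<in>D. \<forall>v\<in>D. (AE x in \<mu>. u x = 0) \<longrightarrow> B u v = 0) \<and>
     (\<forall>f\<in>Lp_functions \<mu> 2. \<forall>\<epsilon>>0. \<exists>u\<in>D. (LINT x|\<mu>. (f x - u x)\<^sup>2) < \<epsilon>)"

definition closed_form ::
  "'k measure \<Rightarrow> ('k \<Rightarrow> real) set \<Rightarrow> (('k \<Rightarrow> real) \<Rightarrow> ('k \<Rightarrow> real) \<Rightarrow> real) \<Rightarrow> bool" where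
  "closed_form \<mu> D B \<longleftrightarrow>
     (\<forall>u :: nat \<Rightarrow> 'k \<Rightarrow> real. (\<forall>n. u n \<in> D) \<and>
        (\<forall>\<epsilon>>0. \<exists>N. \<forall>m\<ge>N. \<forall>n\<ge>N. form_one \<mu> B (\<lambda>x. u m x - u n x) < \<epsilon>) \<longrightarrow>
        (\<exists>v\<in>D. (\<lambda>n. form_one \<mu> B (\<lambda>x. u n x - v x)) \<longlonglongrightarrow> 0))"

definition markovian_form ::
  "'k measure \<Rightarrow> ('k \<Rightarrow> real) set \<Rightarrow> (('k \<Rightarrow> real) \<Rightarrow> ('k \<Rightarrow> real) \<Rightarrow> real) \<Rightarrow> bool" where
  "markovian_form \<mu> D B \<longleftrightarrow>
     (\<forall>u\<in>D. \<exists>v\<in>D. (AE x in \<mu>. v x = unit_truncation u x) \<and> B v v \<le> B u u)"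

definition dirichlet_form ::
  "'k measure \<Rightarrow> ('k \<Rightarrow> real) set \<Rightarrow> (('k \<Rightarrow> real) \<Rightarrow> ('k \<Rightarrow> real) \<Rightarrow> real) \<Rightarrow> bool" where
  "dirichlet_form \<mu> D B \<longleftrightarrow> symmetric_form \<mu> D B \<and> closed_form \<mu> D B \<and> markovian_form \<mu> D B"

text \<open>In the next two notions the underlying space is meant to be compact, so that no
  condition on compactness of supports appears.\<close>

definition regular_form ::
  "'k::metric_space measure \<Rightarrow> ('k \<Rightarrow> real) set \<Rightarrow> (('k \<Rightarrow> real) \<Rightarrow> ('k \<Rightarrow> real) \<Rightarrow> real) \<Rightarrow> bool" where
  "regular_form \<mu> D B \<longleftrightarrow>
     (\<forall>u\<in>D. \<forall>\<epsilon>>0. \<exists>v\<in>D. continuous_on UNIV v \<and> form_one \<mu> B (\<lambda>x. u x - v x) < \<epsilon>) \<and>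
     (\<forall>h. continuous_on UNIV h \<longrightarrow>
        (\<forall>\<epsilon>>0. \<exists>v\<in>D. continuous_on UNIV v \<and> (\<forall>x. \<bar>h x - v x\<bar> < \<epsilon>)))"

definition ae_support :: "'k::metric_space measure \<Rightarrow> ('k \<Rightarrow> real) \<Rightarrow> 'k set" where
  "ae_support \<mu> u = - \<Union>{U. open U \<and> (AE x in \<mu>. x \<in> U \<longrightarrow> u x = 0)}"

definition local_form ::
  "'k::metric_space measure \<Rightarrow> ('k \<Rightarrow> real) set \<Rightarrow> (('k \<Rightarrow> real) \<Rightarrow> ('k \<Rightarrow> real) \<Rightarrow> real) \<Rightarrow> bool" where
  "local_form \<mu> D B \<longleftrightarrow>
     (\<forall>u\<in>D. \<forall>v\<in>D. ae_support \<mu> u \<inter> ae_support \<mu> v = {} \<longrightarrow> B u v = 0)"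

end

theory Submission
  imports Defs
begin

text \<open>
  For \<open>u\<close> in the space \<open>\<W>\<^sup>p\<close> put \<open>D\<^sub>n(u) = \<sigma>\<^sup>n \<Sum>\<^sub>w Q(u \<circ> f\<^sub>w)\<close>, summed over the scale-\<open>n\<close> words, with
  \<open>Q(g) = \<integral>\<integral> |g(x) - g(y)|\<^sup>p d\<mu> d\<mu>\<close>. Each \<open>D\<^sub>n\<close> is convex, \<open>p\<close>-homogeneous, decreases under
  truncation, is quadratic for \<open>p = 2\<close>, and satisfies \<open>D\<^sub>n(u) = \<Sum>\<^sub>s \<sigma>\<^bsup>j(s)\<^esup> D\<^bsub>n-j(s)\<^esub>(u \<circ> f\<^sub>s)\<close>
  exactly for large \<open>n\<close>. Cesaro averages turn the shift by \<open>j(s)\<close> into an error tending to zero, so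
  the limit \<open>\<E>\<^sub>p\<close> of the averages along a filter on which all of them converge inherits
  every property. Comparability with \<open>\<N>\<^sub>p\<close> comes from telescoping cell means through the levels: the
  disparity bound gives a Morrey estimate on every cell because \<open>\<sigma> > 1\<close>. That
  \<open>p > 1\<close> and \<open>\<sigma> > 1\<close> follows from \<open>p > dim\<^sub>A\<^sub>R\<close>: cut-off functions built from a quasisymmetric
  Ahlfors regular metric make the conductances arbitrarily small, whereas for \<open>p \<le> 1\<close> they are at
  least one half, and disparity times conductance is always bounded below. Functions in \<open>\<W>\<^sup>p\<close> are produced as limits of near-minimizers of the
  conductances, which are bounded by a multiple of \<open>\<sigma>\<^bsup>-m\<^esup>\<close> by conductive homogeneity.
\<close>

section \<open>Powers, averages and limits along filters\<close>

text \<open>Discrete energies of cell means resist exact self-similarity, because edges join cells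
  whose words begin with different letters, and truncation does not commute with taking means.
  Replacing them by \<open>variation\<close> on single cells removes both defects, at the price that
  one \<open>level_energy\<close> alone is not seen to bound \<open>Np\<close>: only the series of
  \<open>\<kappa> ^ k * level_energy (n + k) u\<close> does. As \<kappa> < 1 and shifted averages
  have the same limit, that series collapses to E/(1 - \<kappa>) after averaging. The number
  \<kappa> = \<sigma>^(-1/p) is the weight for which one telescoping step loses only the factor
  \<kappa>\<sigma> < \<sigma>. The function space is uncountable, so no subsequence need serve all
  its members; compactness of a product of intervals supplies a common filter, and the same device
  gives limits of near-minimizers. Closure of the space under lattice and algebra operations goes
  through oscillations on cells, which respond directly to Lipschitz operations, unlike means. For p
  = 2 bilinearity survives because each level energy is polarized before the limit is taken.\<close>

lemma powr_add_le:
  fixes a b p :: real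
  assumes "0 \<le> a" "0 \<le> b" "0 \<le> p"
  shows "(a + b) powr p \<le> 2 powr p * (a powr p + b powr p)"
proof -
  have "(a + b) powr p \<le> (2 * max a b) powr p"
    using assms by (intro powr_mono2) auto
  also have "\<dots> = 2 powr p * max a b powr p"
    using assms by (simp add: powr_mult)
  also have "\<dots> \<le> 2 powr p * (a powr p + b powr p)"
    by (intro mult_left_mono) (auto simp: max_def)
  finally show ?thesis .
qed

text \<open>Convexity of the power on the positive reals extends to zero by continuity, shifting
  both arguments by \<open>e n\<close>; monotonicity of the power then absorbs the triangle
  inequality for the absolute value.\<close>

lemma convex_on_abs_powr:
  fixes p c :: real
  assumes "1 \<le> p"
  shows "convex_on UNIV (\<lambda>x. \<bar>x - c\<bar> powr p)"
proof (rule convex_onI)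
  fix t x y :: real
  assume t: "0 < t" "t < 1"
  have powr_pos: "((1 - t) * a + t * b) powr p \<le> (1 - t) * a powr p + t * b powr p"
    if "0 < a" "0 < b" for a b :: real
    using convex_onD[OF powr_convex[OF assms], of t a b] t that by simp
  have *: "((1 - t) * a + t * b) powr p \<le> (1 - t) * a powr p + t * b powr p"
    if "0 \<le> a" "0 \<le> b" for a b :: real
  proof (rule tendsto_le[OF sequentially_bot])
    define e where "e n = inverse (real (Suc n))" for n
    have e: "e \<longlonglongrightarrow> 0" unfolding e_def[abs_def] by (rule LIMSEQ_inverse_real_of_nat)
    have e_pos: "0 < e n" for n by (simp add: e_def)
    show "(\<lambda>n. (1 - t) * (a + e n) powr p + t * (b + e n) powr p)
        \<longlonglongrightarrow> (1 - t) * a powr p + t * b powr p"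
      using assms that e by (auto intro!: tendsto_eq_intros eventuallyI add_nonneg_nonneg mult_nonneg_nonneg less_imp_le[OF e_pos])
    show "(\<lambda>n. ((1 - t) * (a + e n) + t * (b + e n)) powr p)
        \<longlonglongrightarrow> ((1 - t) * a + t * b) powr p"
      using assms that e t by (auto intro!: tendsto_eq_intros eventuallyI add_nonneg_nonneg mult_nonneg_nonneg less_imp_le[OF e_pos])
    show "\<forall>\<^sub>F n in sequentially. ((1 - t) * (a + e n) + t * (b + e n)) powr p
        \<le> (1 - t) * (a + e n) powr p + t * (b + e n) powr p"
      using that by (intro eventuallyI powr_pos add_nonneg_pos e_pos) auto
  qed
  have "\<bar>(1 - t) *\<^sub>R x + t *\<^sub>R y - c\<bar> = \<bar>(1 - t) * (x - c) + t * (y - c)\<bar>"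
    by (simp add: algebra_simps)
  also have "\<dots> \<le> (1 - t) * \<bar>x - c\<bar> + t * \<bar>y - c\<bar>"
    using t abs_triangle_ineq[of "(1 - t) * (x - c)" "t * (y - c)"] by (simp add: abs_mult)
  finally have "\<bar>(1 - t) *\<^sub>R x + t *\<^sub>R y - c\<bar> powr p \<le> ((1 - t) * \<bar>x - c\<bar> + t * \<bar>y - c\<bar>) powr p"
    using assms by (intro powr_mono2) auto
  also have "\<dots> \<le> (1 - t) * \<bar>x - c\<bar> powr p + t * \<bar>y - c\<bar> powr p"
    by (rule *) auto
  finally show "\<bar>(1 - t) *\<^sub>R x + t *\<^sub>R y - c\<bar> powr p \<le> (1 - t) * \<bar>x - c\<bar> powr p + t * \<bar>y - c\<bar> powr p" .
qed auto

lemma abs_convex_combination_powr: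
  fixes p t x y :: real
  assumes "1 \<le> p" "0 \<le> t" "t \<le> 1"
  shows "\<bar>(1 - t) * x + t * y\<bar> powr p \<le> (1 - t) * \<bar>x\<bar> powr p + t * \<bar>y\<bar> powr p"
  using convex_onD[OF convex_on_abs_powr[OF assms(1), of 0], of t x y] assms by simp

text \<open>A weighted form of \<open>(a + b)\<^sup>p \<le> \<dots>\<close> whose second factor stays below any prescribed
  number greater than one; this is what makes multiscale telescoping converge.\<close>

lemma powr_add_weighted:
  fixes a b p \<theta> :: real
  assumes "1 \<le> p" "0 < \<theta>" "\<theta> < 1" "0 \<le> a" "0 \<le> b"
  shows "(a + b) powr p \<le> (1 - \<theta>) powr (1 - p) * a powr p + \<theta> powr (1 - p) * b powr p"
proof -
  have "a + b = (1 - \<theta>) * (a / (1 - \<theta>)) + \<theta> * (b / \<theta>)"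
    using assms by simp
  then have "(a + b) powr p \<le> (1 - \<theta>) * (a / (1 - \<theta>)) powr p + \<theta> * (b / \<theta>) powr p"
    using abs_convex_combination_powr[OF assms(1), of \<theta> "a / (1 - \<theta>)" "b / \<theta>"] assms by simp
  also have "\<dots> = (1 - \<theta>) powr (1 - p) * a powr p + \<theta> powr (1 - p) * b powr p"
    using assms by (simp add: powr_divide powr_diff)
  finally show ?thesis .
qed

text \<open>The Minkowski functional argument: the set where \<Phi> is at most 1 is convex, and
  homogeneity rescales u and v into it. The slack e/2 keeps both scaling factors positive even where
  \<Phi> vanishes.\<close>

lemma homogeneous_convex_triangle:
  fixes \<Phi> :: "('a \<Rightarrow> real) \<Rightarrow> real" and p :: real
  assumes p: "1 \<le> p" and V: "function_space V"
    and nonneg: "\<And>u. u \<in> V \<Longrightarrow> 0 \<le> \<Phi> u"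
    and hom: "\<And>a u. u \<in> V \<Longrightarrow> \<Phi> (\<lambda>x. a * u x) = \<bar>a\<bar> powr p * \<Phi> u"
    and conv: "\<And>t u v. u \<in> V \<Longrightarrow> v \<in> V \<Longrightarrow> 0 \<le> t \<Longrightarrow> t \<le> 1 \<Longrightarrow>
      \<Phi> (\<lambda>x. (1 - t) * u x + t * v x) \<le> (1 - t) * \<Phi> u + t * \<Phi> v"
    and uv: "u \<in> V" "v \<in> V"
  shows "\<Phi> (\<lambda>x. u x + v x) powr (1 / p) \<le> \<Phi> u powr (1 / p) + \<Phi> v powr (1 / p)"
proof (rule field_le_epsilon)
  fix e :: real
  assume e: "0 < e"
  define a where "a = \<Phi> u powr (1 / p) + e / 2"
  define b where "b = \<Phi> v powr (1 / p) + e / 2"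
  have ab: "0 < a" "0 < b" using e by (auto simp: a_def b_def intro: add_nonneg_pos)
  have scaled: "\<Phi> (\<lambda>x. (1 / c) * w x) \<le> 1" if "w \<in> V" "0 < c" "\<Phi> w powr (1 / p) \<le> c" for w c
  proof -
    have "(\<Phi> w powr (1 / p)) powr p \<le> c powr p"
      using that p by (intro powr_mono2) auto
    then have "\<Phi> w \<le> c powr p" using p nonneg[OF that(1)] by (simp add: powr_powr)
    then show ?thesis
      using hom[OF that(1), of "1 / c"] that p by (simp add: powr_divide)
  qed
  have in_V: "(\<lambda>x. (1 / a) * u x) \<in> V" "(\<lambda>x. (1 / b) * v x) \<in> V" "(\<lambda>x. u x + v x) \<in> V"
    using V uv unfolding function_space_def by blast+
  \<comment> \<open>The weight for which the convex combination of u/a and v/b is (u + v)/(a +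
    b).\<close>
  define t where "t = b / (a + b)"
  have t: "0 \<le> t" "t \<le> 1" "1 - t = a / (a + b)" using ab by (auto simp: t_def field_simps)
  have "(\<lambda>x. (1 - t) * ((1 / a) * u x) + t * ((1 / b) * v x)) = (\<lambda>x. (1 / (a + b)) * (u x + v x))"
  proof -
    have "(1 - t) * (1 / a) = 1 / (a + b)" "t * (1 / b) = 1 / (a + b)"
      unfolding t(3) using ab by (simp_all add: t_def)
    then show ?thesis by (simp only: mult.assoc[symmetric] distrib_left)
  qed
  then have "\<Phi> (\<lambda>x. (1 / (a + b)) * (u x + v x)) \<le> (1 - t) * \<Phi> (\<lambda>x. (1 / a) * u x) + t * \<Phi> (\<lambda>x. (1 / b) * v x)"
    using conv[OF in_V(1,2) t(1,2)] by simp
  also have "\<dots> \<le> (1 - t) * 1 + t * 1"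
    using t ab uv e by (intro add_mono mult_left_mono scaled) (auto simp: a_def b_def)
  finally have "\<Phi> (\<lambda>x. u x + v x) \<le> (a + b) powr p"
    using hom[OF in_V(3), of "1 / (a + b)"] ab by (simp add: powr_divide pos_divide_le_eq)
  then have "\<Phi> (\<lambda>x. u x + v x) powr (1 / p) \<le> ((a + b) powr p) powr (1 / p)"
    using p nonneg[OF in_V(3)] by (intro powr_mono2) auto
  also have "\<dots> = a + b" using p ab by (simp add: powr_powr)
  finally show "\<Phi> (\<lambda>x. u x + v x) powr (1 / p) \<le> \<Phi> u powr (1 / p) + \<Phi> v powr (1 / p) + e"
    by (simp add: a_def b_def)
qed

text \<open>Bounds that depend only on i place all the maps \<open>a n\<close> in a product of
  compact intervals; \<open>F\<close> cuts \<open>sequentially\<close> down to the preimages of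
  neighbourhoods of a cluster point. A diagonal subsequence would require a countable index
  type.\<close>

lemma bounded_family_filter:
  fixes a :: "nat \<Rightarrow> 'i \<Rightarrow> real"
  assumes "\<And>n i. \<bar>a n i\<bar> \<le> B i"
  obtains F where "F \<noteq> bot" "F \<le> sequentially" "\<And>i. \<exists>l. ((\<lambda>n. a n i) \<longlongrightarrow> l) F"
proof -
  have "compact (PiE UNIV (\<lambda>i. {- B i..B i}))"
    unfolding compactin_euclidean_iff[symmetric] euclidean_product_topology[symmetric] compactin_PiE
    by auto
  moreover have "filtermap a sequentially \<noteq> bot"
    by (simp add: filtermap_bot_iff)
  moreover have "eventually (\<lambda>x. x \<in> PiE UNIV (\<lambda>i. {- B i..B i})) (filtermap a sequentially)"
    using assms by (auto simp: eventually_filtermap PiE_UNIV_domain abs_le_iff minus_le_iff)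
  ultimately obtain x where x: "inf (nhds x) (filtermap a sequentially) \<noteq> bot"
    unfolding compact_filter by blast
  define F where "F = inf sequentially (filtercomap a (nhds x))"
  have "F \<noteq> bot"
  proof
    assume "F = bot"
    then have "eventually (\<lambda>_. False) F" by simp
    then obtain Q R where QR: "eventually Q sequentially" "eventually R (nhds x)"
      "\<And>n. Q n \<Longrightarrow> R (a n) \<Longrightarrow> False"
      unfolding F_def eventually_inf eventually_filtercomap by metis
    have "eventually (\<lambda>y. \<not> R y) (filtermap a sequentially)"
      unfolding eventually_filtermap by (rule eventually_mono[OF QR(1)]) (use QR(3) in blast)
    then have "eventually (\<lambda>_. False) (inf (nhds x) (filtermap a sequentially))"
      unfolding eventually_inf using QR(2) by blast
    then show False using x by (simp add: trivial_limit_def)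
  qed
  moreover have "F \<le> sequentially" by (simp add: F_def)
  moreover have "\<exists>l. ((\<lambda>n. a n i) \<longlongrightarrow> l) F" for i
  proof -
    have "filterlim a (nhds x) (filtercomap a (nhds x))"
      by (rule filterlim_filtercomap)
    then have "filterlim a (nhds x) F"
      by (rule filterlim_mono[OF _ order_refl]) (simp add: F_def)
    moreover have "((\<lambda>y. y i) \<longlongrightarrow> x i) (nhds x)"
    proof -
      have "continuous_on UNIV (\<lambda>y::'i \<Rightarrow> real. y i)" by (rule continuous_on_product_coordinates)
      then have "((\<lambda>y. y i) \<longlongrightarrow> x i) (at x)" by (simp add: continuous_on_def)
      then show ?thesis
        using tendsto_at_iff_tendsto_nhds[of "\<lambda>y. y i" x] by simp
    qed
    ultimately have "((\<lambda>n. a n i) \<longlongrightarrow> x i) F"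
      by (rule filterlim_compose[rotated])
    then show ?thesis by blast
  qed
  ultimately show ?thesis using that by blast
qed

text \<open>Cesaro means. The sum starts at 1 so that, after a shift by the sum of all
  \<open>j s\<close>, every index strictly exceeds each single \<open>j s\<close>.\<close>

definition average :: "(nat \<Rightarrow> real) \<Rightarrow> nat \<Rightarrow> real" where
  "average g n = (\<Sum>i=1..n. g i) / real n"

text \<open>After cancellation only k terms at either end of the range survive.\<close>

lemma average_shift:
  assumes "\<And>i. 1 \<le> i \<Longrightarrow> \<bar>g i\<bar> \<le> B"
  shows "\<bar>average (\<lambda>i. g (i + k)) n - average g n\<bar> \<le> 2 * real k * B / real n"
proof -
  have "(\<Sum>i=1..n. g (i + k)) + (\<Sum>i=1..k. g i) = (\<Sum>i=1..n. g i) + (\<Sum>i=n+1..n+k. g i)"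
  proof -
    have "(\<Sum>i=1..n. g (i + k)) = (\<Sum>i=1+k..n+k. g i)"
      by (simp only: sum.shift_bounds_cl_nat_ivl)
    moreover have "(\<Sum>i=1..k. g i) + (\<Sum>i=k+1..k+n. g i) = (\<Sum>i=1..k+n. g i)"
      using sum.ub_add_nat[of 1 k g n] by simp
    moreover have "(\<Sum>i=1..n. g i) + (\<Sum>i=n+1..n+k. g i) = (\<Sum>i=1..n+k. g i)"
      using sum.ub_add_nat[of 1 n g k] by simp
    ultimately show ?thesis by (simp add: add.commute)
  qed
  then have "(\<Sum>i=1..n. g (i + k)) - (\<Sum>i=1..n. g i) = (\<Sum>i=n+1..n+k. g i) - (\<Sum>i=1..k. g i)"
    by linarith
  moreover have "\<bar>\<Sum>i=n+1..n+k. g i\<bar> \<le> real (card {n+1..n+k}) * B"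
    by (rule order.trans[OF sum_abs], rule sum_bounded_above) (use assms in auto)
  moreover have "\<bar>\<Sum>i=1..k. g i\<bar> \<le> real (card {1..k}) * B"
    by (rule order.trans[OF sum_abs], rule sum_bounded_above) (use assms in auto)
  ultimately have "\<bar>(\<Sum>i=1..n. g (i + k)) - (\<Sum>i=1..n. g i)\<bar> \<le> 2 * real k * B"
    by simp
  then show ?thesis
    unfolding average_def diff_divide_distrib[symmetric] abs_divide
    by (simp add: divide_right_mono)
qed

lemma average_shift_tendsto:
  assumes "\<And>i. 1 \<le> i \<Longrightarrow> \<bar>g i\<bar> \<le> B"
  shows "(\<lambda>n. average (\<lambda>i. g (i + k)) n - average g n) \<longlonglongrightarrow> 0"
proof (rule Lim_null_comparison)
  show "\<forall>\<^sub>F n in sequentially. norm (average (\<lambda>i. g (i + k)) n - average g n) \<le> 2 * real k * B / real n"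
    using average_shift[OF assms] by (intro eventuallyI) simp
  show "(\<lambda>n. 2 * real k * B / real n) \<longlonglongrightarrow> 0"
    by (rule lim_const_over_n)
qed

lemma average_mono:
  "(\<And>i. 1 \<le> i \<Longrightarrow> g i \<le> h i) \<Longrightarrow> average g n \<le> average h n"
  unfolding average_def by (intro divide_right_mono sum_mono) auto

lemma average_abs_le:
  assumes "\<And>i. 1 \<le> i \<Longrightarrow> \<bar>g i\<bar> \<le> B" "0 \<le> B"
  shows "\<bar>average g n\<bar> \<le> B"
proof (cases "n = 0")
  case False
  have "\<bar>\<Sum>i=1..n. g i\<bar> \<le> real (card {1..n}) * B"
    by (rule order.trans[OF sum_abs], rule sum_bounded_above) (use assms in auto)
  then show ?thesis using False by (simp add: average_def abs_divide field_simps)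
qed (simp add: average_def assms(2))

lemma average_linear:
  "average (\<lambda>i. a * g i + b * h i) n = a * average g n + b * average h n"
  by (simp add: average_def sum.distrib sum_distrib_left add_divide_distrib)

lemma average_sum:
  "average (\<lambda>i. \<Sum>s\<in>S. c s * g s i) n = (\<Sum>s\<in>S. c s * average (g s) n)"
  unfolding average_def
  by (subst sum.swap) (simp add: sum_distrib_left sum_divide_distrib)

lemma average_const: "1 \<le> n \<Longrightarrow> average (\<lambda>_. c) n = c"
  by (simp add: average_def)

section \<open>Trees of cells\<close>

text \<open>What the analysis needs from the standing assumption, without words or letters. One
  constant \<open>a\<close> serves for diameters, neighbourhood balls and inner balls, and one
  \<open>N\<close> bounds both children and neighbours. \<open>nbhd_parent\<close> is the clause on
  parents of neighbourhoods with the function \<open>parent\<close> eliminated;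
  \<open>overlap_null\<close> is a consequence of additivity of the measure over children.\<close>

locale cell_space =
  fixes P :: "('t, 'k::metric_space) cell_tree" and \<mu> :: "'k measure"
    and r a b :: real and M N :: nat
  assumes r: "0 < r" "r < 1"
    and scale_pos: "0 < a" "0 < b"
    and level_0: "level P 0 = {tree_root P}"
    and cell_root: "cell P (tree_root P) = UNIV"
    and finite_level: "finite (level P n)"
    and level_Suc: "level P (Suc n) = (\<Union>x\<in>level P n. children P x)"
    and children_disjoint: "\<lbrakk>x \<in> level P n; y \<in> level P n; x \<noteq> y\<rbrakk> \<Longrightarrow> children P x \<inter> children P y = {}"
    and card_children: "x \<in> level P n \<Longrightarrow> card (children P x) \<le> N"
    and cell_children: "x \<in> level P n \<Longrightarrow> cell P x = (\<Union>y\<in>children P x. cell P y)"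
    and cell_nonempty: "x \<in> level P n \<Longrightarrow> cell P x \<noteq> {}"
    and compact_cell: "x \<in> level P n \<Longrightarrow> compact (cell P x)"
    and connected_cell: "x \<in> level P n \<Longrightarrow> connected (cell P x)"
    and card_nbhd: "x \<in> level P n \<Longrightarrow> card (nbhd P 1 x) \<le> N"
    and sets_\<mu>: "sets \<mu> = sets borel"
    and prob_space_\<mu>: "prob_space \<mu>"
    and measure_cell_pos: "x \<in> level P n \<Longrightarrow> 0 < measure \<mu> (cell P x)"
    and overlap_null: "\<lbrakk>x \<in> level P n; y \<in> level P n; x \<noteq> y\<rbrakk> \<Longrightarrow> measure \<mu> (cell P x \<inter> cell P y) = 0"
    and diameter_UNIV: "diameter (UNIV :: 'k set) = 1"
    and diameter_cell: "x \<in> level P n \<Longrightarrow> a * r ^ n \<le> diameter (cell P x)"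
      "x \<in> level P n \<Longrightarrow> diameter (cell P x) \<le> b * r ^ n"
    and ball_cell_nbhd: "1 \<le> n \<Longrightarrow> ball z (a * r ^ n) \<subseteq> cell_nbhd P M z n"
      "1 \<le> n \<Longrightarrow> cell_nbhd P M z n \<subseteq> ball z (b * r ^ n)"
    and ball_in_cell: "\<lbrakk>1 \<le> n; x \<in> level P n\<rbrakk> \<Longrightarrow> \<exists>z\<in>cell P x. ball z (a * r ^ n) \<subseteq> cell P x"
    and nbhd_parent: "\<lbrakk>x \<in> level P n; y \<in> level P n; u \<in> children P x; v \<in> children P y;
        v \<in> nbhd P (M + 1) u\<rbrakk> \<Longrightarrow> y \<in> nbhd P M x"
begin

sublocale prob_space \<mu> by (rule prob_space_\<mu>)

section \<open>Levels, descendants and covering by cells\<close>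

lemma depth_level: "x \<in> level P n \<Longrightarrow> depth P x = n"
  by (simp add: level_def)

lemma descendants_level: "x \<in> level P n \<Longrightarrow> descendants P m x \<subseteq> level P (n + m)"
proof (induction m arbitrary: x n)
  case (Suc m)
  then have "y \<in> level P (Suc n)" if "y \<in> children P x" for y
    using level_Suc that by auto
  then show ?case using Suc.IH by fastforce
qed simp

lemma level_add: "level P (n + m) = (\<Union>x\<in>level P n. descendants P m x)"
proof (induction m arbitrary: n)
  case (Suc m)
  have "level P (n + Suc m) = level P (Suc n + m)" by simp
  also have "\<dots> = (\<Union>x\<in>level P (Suc n). descendants P m x)" by (rule Suc.IH)
  finally show ?case by (simp add: level_Suc)
qed simp

lemma descendants_disjoint:
  "\<lbrakk>x \<in> level P n; y \<in> level P n; x \<noteq> y\<rbrakk> \<Longrightarrow> descendants P m x \<inter> descendants P m y = {}"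
proof (induction m arbitrary: x y n)
  case (Suc m)
  have "descendants P m u \<inter> descendants P m v = {}" if "u \<in> children P x" "v \<in> children P y" for u v
  proof (rule Suc.IH[of _ "Suc n"])
    show "u \<in> level P (Suc n)" "v \<in> level P (Suc n)" using that Suc.prems by (auto simp: level_Suc)
    show "u \<noteq> v" using children_disjoint[OF Suc.prems] that by blast
  qed
  then show ?case by auto
qed simp

lemma descendants_add: "descendants P (m + k) x = (\<Union>y\<in>descendants P m x. descendants P k y)"
  by (induction m arbitrary: x) auto

lemma cell_descendants: "x \<in> level P n \<Longrightarrow> cell P x = (\<Union>y\<in>descendants P m x. cell P y)"
proof (induction m arbitrary: x n)
  case (Suc m)
  have "cell P x = (\<Union>y\<in>children P x. cell P y)" by (rule cell_children[OF Suc.prems])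
  also have "\<dots> = (\<Union>y\<in>children P x. \<Union>z\<in>descendants P m y. cell P z)"
  proof (rule SUP_cong[OF refl])
    fix y assume "y \<in> children P x"
    then have "y \<in> level P (Suc n)" using Suc.prems by (auto simp: level_Suc)
    then show "cell P y = (\<Union>z\<in>descendants P m y. cell P z)" by (rule Suc.IH)
  qed
  finally show ?case by simp
qed simp

lemma cell_subset: "\<lbrakk>x \<in> level P n; y \<in> descendants P m x\<rbrakk> \<Longrightarrow> cell P y \<subseteq> cell P x"
  using cell_descendants by blast

lemma finite_descendants: "x \<in> level P n \<Longrightarrow> finite (descendants P m x)"
  by (rule finite_subset[OF descendants_level finite_level])

lemma descendants_nonempty: "x \<in> level P n \<Longrightarrow> descendants P m x \<noteq> {}"
  using cell_descendants[of x n m] cell_nonempty[of x n] by auto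

lemma cover_level: "(\<Union>x\<in>level P n. cell P x) = UNIV"
  using cell_descendants[of "tree_root P" 0 n] level_add[of 0 n] by (simp add: level_0 cell_root)

lemma level_nonempty: "level P n \<noteq> {}"
  using cover_level[of n] by auto

lemma descendant_at:
  assumes "x \<in> level P n" "z \<in> cell P x"
  obtains y where "y \<in> descendants P m x" "z \<in> cell P y"
  using cell_descendants[OF assms(1), of m] assms(2) by blast

lemma ancestor_at:
  assumes "y \<in> level P (n + m)"
  obtains x where "x \<in> level P n" "y \<in> descendants P m x"
  using assms level_add[of n m] by blast

lemma sum_level_add:
  "(\<Sum>y\<in>level P (n + m). g y) = (\<Sum>x\<in>level P n. \<Sum>y\<in>descendants P m x. g y)"
  unfolding level_add
  by (rule sum.UNION_disjoint) (auto simp: finite_level finite_descendants dest: descendants_disjoint)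

lemma compact_UNIV: "compact (UNIV :: 'k set)"
  using compact_cell[of "tree_root P" 0] by (simp add: level_0 cell_root)

lemma connected_UNIV_space: "connected (UNIV :: 'k set)"
  using connected_cell[of "tree_root P" 0] by (simp add: level_0 cell_root)

lemma bounded_space: "bounded (A :: 'k set)"
  by (rule bounded_subset[OF compact_imp_bounded[OF compact_UNIV]]) simp

lemma dist_le_1: "dist x y \<le> 1" for x y :: 'k
  using diameter_bounded_bound[OF bounded_space, of x UNIV y] by (simp add: diameter_UNIV)

lemma dist_cell: "\<lbrakk>x \<in> level P n; z \<in> cell P x; z' \<in> cell P x\<rbrakk> \<Longrightarrow> dist z z' \<le> b * r ^ n"
  using diameter_bounded_bound[OF bounded_space, of z "cell P x" z'] diameter_cell(2) by force

lemma cell_sets: "x \<in> level P n \<Longrightarrow> cell P x \<in> sets \<mu>"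
  unfolding sets_\<mu> by (intro borel_closed compact_imp_closed compact_cell)

lemma space_\<mu>: "space \<mu> = UNIV"
  using sets_eq_imp_space_eq[OF sets_\<mu>] by simp

subsection \<open>Adjacency of cells\<close>

lemma edges_sym: "(x, y) \<in> edges P n \<Longrightarrow> (y, x) \<in> edges P n"
  by (auto simp: edges_def)

lemma finite_edges: "finite (edges P n)"
  by (rule finite_subset[of _ "level P n \<times> level P n"]) (auto simp: edges_def finite_level)

lemma nbhd_in_level: "x \<in> level P n \<Longrightarrow> nbhd P k x \<subseteq> level P n"
  by (auto simp: nbhd_def nbhd_in_def depth_level)

lemma nbhd_0: "x \<in> level P n \<Longrightarrow> nbhd P 0 x = {x}"
  by (auto simp: nbhd_def nbhd_in_def depth_level)

lemma nbhd_Suc: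
  assumes "x \<in> level P n"
  shows "z \<in> nbhd P (Suc k) x \<longleftrightarrow> z \<in> level P n \<and> (\<exists>y\<in>nbhd P k x. cell P y \<inter> cell P z \<noteq> {})"
proof
  assume "z \<in> nbhd P (Suc k) x"
  then obtain h where h: "h 0 = x" "h (Suc k) = z" "\<forall>i\<le>Suc k. h i \<in> level P n"
    "\<forall>i<Suc k. cell P (h i) \<inter> cell P (h (Suc i)) \<noteq> {}"
    using assms by (auto simp: nbhd_def nbhd_in_def depth_level)
  then have "h k \<in> nbhd P k x"
    using assms by (auto simp: nbhd_def nbhd_in_def depth_level intro!: exI[of _ h])
  moreover have "z \<in> level P n" "cell P (h k) \<inter> cell P z \<noteq> {}" using h by auto
  ultimately show "z \<in> level P n \<and> (\<exists>y\<in>nbhd P k x. cell P y \<inter> cell P z \<noteq> {})" by blast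
next
  assume "z \<in> level P n \<and> (\<exists>y\<in>nbhd P k x. cell P y \<inter> cell P z \<noteq> {})"
  then obtain h where z: "z \<in> level P n" and h: "h 0 = x" "\<forall>i\<le>k. h i \<in> level P n"
    "\<forall>i<k. cell P (h i) \<inter> cell P (h (Suc i)) \<noteq> {}" "cell P (h k) \<inter> cell P z \<noteq> {}"
    using assms by (auto simp: nbhd_def nbhd_in_def depth_level)
  let ?h = "\<lambda>i. if i \<le> k then h i else z"
  have "?h 0 = x \<and> ?h (Suc k) = z \<and> (\<forall>i\<le>Suc k. ?h i \<in> level P n) \<and>
      (\<forall>i<Suc k. cell P (?h i) \<inter> cell P (?h (Suc i)) \<noteq> {})"
    using z h by (auto simp: less_Suc_eq_le Suc_le_eq)
  then show "z \<in> nbhd P (Suc k) x"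
    unfolding nbhd_def nbhd_in_def using assms by (auto simp: depth_level intro!: exI[of _ ?h])
qed

lemma nbhd_1: "x \<in> level P n \<Longrightarrow> z \<in> nbhd P 1 x \<longleftrightarrow> z \<in> level P n \<and> cell P x \<inter> cell P z \<noteq> {}"
  using nbhd_Suc[of x n z 0] by (simp add: nbhd_0)

lemma nbhd_Suc_mono: "x \<in> level P n \<Longrightarrow> nbhd P k x \<subseteq> nbhd P (Suc k) x"
proof
  fix z assume x: "x \<in> level P n" and z: "z \<in> nbhd P k x"
  then have "z \<in> level P n" using nbhd_in_level by blast
  moreover from this have "cell P z \<inter> cell P z \<noteq> {}" using cell_nonempty by simp
  ultimately show "z \<in> nbhd P (Suc k) x" using nbhd_Suc[OF x] z by blast
qed

lemma nbhd_mono: "\<lbrakk>x \<in> level P n; k \<le> l\<rbrakk> \<Longrightarrow> nbhd P k x \<subseteq> nbhd P l x"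
  by (rule lift_Suc_mono_le[of "\<lambda>k. nbhd P k x"]) (auto dest: nbhd_Suc_mono)

lemma self_in_nbhd: "x \<in> level P n \<Longrightarrow> x \<in> nbhd P k x"
  using nbhd_mono[of x n 0 k] nbhd_0 by auto

lemma finite_nbhd: "x \<in> level P n \<Longrightarrow> finite (nbhd P k x)"
  using nbhd_in_level finite_level finite_subset by metis

lemma N_pos: "1 \<le> N"
proof -
  obtain x where x: "x \<in> level P 0" using level_nonempty by blast
  then have "card (nbhd P 1 x) \<noteq> 0" using self_in_nbhd[OF x, of 1] finite_nbhd[OF x, of 1] by auto
  then show ?thesis using card_nbhd[OF x] by linarith
qed

text \<open>All cells of one level through z meet each other at z, so they lie in the neighbourhood
  of any one of them.\<close>

lemma card_cells_at: "card {x \<in> level P n. z \<in> cell P x} \<le> N"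
proof (cases "{x \<in> level P n. z \<in> cell P x} = {}")
  case False
  then obtain x where x: "x \<in> level P n" "z \<in> cell P x" by blast
  have "{x \<in> level P n. z \<in> cell P x} \<subseteq> nbhd P 1 x" using x by (auto simp: nbhd_1[simplified])
  then show ?thesis using card_mono[OF finite_nbhd[OF x(1)]] card_nbhd[OF x(1)] order.trans by blast
next
  case True
  then show ?thesis by (simp only: card.empty)
qed

lemma nbhd_dist:
  assumes "x \<in> level P n" "y \<in> nbhd P k x" "z \<in> cell P x" "z' \<in> cell P y"
  shows "dist z z' \<le> (real k + 1) * b * r ^ n"
  using assms(2,4)
proof (induction k arbitrary: y z')
  case 0
  then show ?case using dist_cell assms by (simp add: nbhd_0)
next
  case (Suc k)
  then obtain w q where w: "w \<in> nbhd P k x" "q \<in> cell P w" "q \<in> cell P y" and y: "y \<in> level P n"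
    using nbhd_Suc[OF assms(1)] by blast
  have "dist z z' \<le> dist z q + dist q z'" by (rule dist_triangle)
  also have "\<dots> \<le> (real k + 1) * b * r ^ n + b * r ^ n"
    by (intro add_mono Suc.IH[OF w(1,2)] dist_cell[OF y w(3) Suc.prems(2)])
  finally show ?case by (simp add: algebra_simps)
qed

text \<open>Two levels suffice to absorb the loss of two neighbourhood steps through \<open>nbhd_parent\<close>.\<close>

lemma far_cells_dist:
  assumes n: "x \<in> level P n" "y \<in> level P n" "y \<notin> nbhd P M x" and z: "z \<in> cell P x" "z' \<in> cell P y"
  shows "a * r ^ (n + 2) \<le> dist z z'"
proof (rule ccontr)
  assume "\<not> ?thesis"
  then have "z' \<in> ball z (a * r ^ (n + 2))" by simp
  then have "z' \<in> cell_nbhd P M z (n + 2)" using ball_cell_nbhd(1)[of "n + 2" z] by auto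
  then obtain w v where w: "w \<in> level P (n + 2)" "z \<in> cell P w" and v: "v \<in> nbhd P M w" "z' \<in> cell P v"
    by (auto simp: cell_nbhd_def)
  obtain x2 where x2: "x2 \<in> descendants P (Suc 1) x" "z \<in> cell P x2"
    using descendant_at[OF n(1) z(1)] by metis
  obtain y2 where y2: "y2 \<in> descendants P (Suc 1) y" "z' \<in> cell P y2"
    using descendant_at[OF n(2) z(2)] by metis
  from x2 obtain x1 where x1: "x1 \<in> children P x" "x2 \<in> children P x1" by auto
  from y2 obtain y1 where y1: "y1 \<in> children P y" "y2 \<in> children P y1" by auto
  have l1: "x1 \<in> level P (Suc n)" "y1 \<in> level P (Suc n)" using x1 y1 n by (auto simp: level_Suc)
  have l2: "x2 \<in> level P (n + 2)" "y2 \<in> level P (n + 2)" using x1 y1 l1 by (auto simp: level_Suc)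
  have vl: "v \<in> level P (n + 2)" using v nbhd_in_level w by blast
  have sym: "v \<in> nbhd P (M + 1) x2"
  proof -
    have *: "v \<in> nbhd P (Suc k) x2" if "v \<in> nbhd P k w" for k v
      using that
    proof (induction k arbitrary: v)
      case 0
      then show ?case using w x2 l2 nbhd_1[OF l2(1)] by (auto simp: nbhd_0)
    next
      case (Suc k)
      then show ?case using nbhd_Suc[OF w(1), of v k] nbhd_Suc[OF l2(1), of v "Suc k"] by blast
    qed
    then show ?thesis using v by simp
  qed
  obtain v1 where v1: "v1 \<in> level P (Suc n)" "v \<in> children P v1"
    using vl level_Suc[of "Suc n"] by auto
  have "v1 \<in> nbhd P M x1" by (rule nbhd_parent[OF l1(1) v1(1) x1(2) v1(2) sym])
  moreover have "z' \<in> cell P v1" "z' \<in> cell P y1"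
    using cell_subset[OF v1(1), of v 1] cell_subset[OF l1(2), of y2 1] v1 y1 v y2 by auto
  ultimately have "y1 \<in> nbhd P (M + 1) x1"
    using l1 nbhd_Suc[OF l1(1), of y1 M] by auto
  then have "y \<in> nbhd P M x" by (rule nbhd_parent[OF n(1,2) x1(1) y1(1)])
  then show False using n by blast
qed

text \<open>Reachable and unreachable cells would otherwise split a connected set into two disjoint
  nonempty closed parts; finiteness of a level makes both unions closed.\<close>

lemma edge_path:
  assumes A: "A \<subseteq> level P n" "connected (\<Union>x\<in>A. cell P x)" and xy: "x \<in> A" "y \<in> A"
  shows "(x, y) \<in> (edges P n \<inter> A \<times> A)\<^sup>*"
proof (rule ccontr)
  assume not: "(x, y) \<notin> (edges P n \<inter> A \<times> A)\<^sup>*"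
  define B where "B = {z \<in> A. (x, z) \<in> (edges P n \<inter> A \<times> A)\<^sup>*}"
  let ?U = "\<Union>z\<in>B. cell P z" and ?V = "\<Union>z\<in>A - B. cell P z"
  have fin: "finite A" using A finite_level finite_subset by blast
  have closed: "closed ?U" "closed ?V"
    using A by (auto simp: B_def intro!: closed_UN finite_subset[OF _ fin] compact_imp_closed compact_cell)
  have disjoint: "cell P u \<inter> cell P v = {}" if "u \<in> B" "v \<in> A - B" for u v
  proof (rule ccontr)
    assume "cell P u \<inter> cell P v \<noteq> {}"
    then have "(u, v) \<in> edges P n \<inter> A \<times> A" using that A by (auto simp: edges_def B_def)
    then have "v \<in> B" using that by (auto simp: B_def intro: rtrancl_into_rtrancl)
    then show False using that by blast
  qed
  have "?U \<inter> (\<Union>x\<in>A. cell P x) = {} \<or> ?V \<inter> (\<Union>x\<in>A. cell P x) = {}"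
  proof (rule connected_closedD[OF A(2) _ _ closed])
    show "?U \<inter> ?V \<inter> (\<Union>x\<in>A. cell P x) = {}" using disjoint by fast
  qed blast
  moreover have "x \<in> B" "y \<in> A - B" using xy not by (auto simp: B_def)
  then have "cell P x \<subseteq> ?U" "cell P y \<subseteq> ?V" by blast+
  moreover have "cell P x \<subseteq> (\<Union>x\<in>A. cell P x)" "cell P y \<subseteq> (\<Union>x\<in>A. cell P x)" using xy by blast+
  moreover have "cell P x \<noteq> {}" "cell P y \<noteq> {}" using xy A cell_nonempty by blast+
  ultimately show False by blast
qed

text \<open>In a finite relation every reachable point is reached within \<open>card R\<close>
  steps, which bounds the length of the chain uniformly.\<close>

lemma path_difference_le:
  fixes h :: "'t \<Rightarrow> real" and e :: real
  assumes R: "finite R" "\<And>u v. (u, v) \<in> R \<Longrightarrow> \<bar>h u - h v\<bar> \<le> e" and e: "0 \<le> e" and xy: "(x, y) \<in> R\<^sup>*"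
  shows "\<bar>h x - h y\<bar> \<le> card R * e"
proof -
  obtain n where n: "n \<le> card R" "(x, y) \<in> R ^^ n"
    using xy rtrancl_finite_eq_relpow[OF R(1)] by auto
  have "\<bar>h x - h y\<bar> \<le> real n * e" using n(2)
  proof (induction n arbitrary: y)
    case (Suc n)
    then obtain w where "(x, w) \<in> R ^^ n" "(w, y) \<in> R" by auto
    then have "\<bar>h x - h w\<bar> \<le> real n * e" "\<bar>h w - h y\<bar> \<le> e" using Suc.IH R(2) by auto
    then show ?case by (simp add: algebra_simps)
  qed simp
  also have "\<dots> \<le> card R * e" using n e by (intro mult_right_mono) auto
  finally show ?thesis .
qed

lemma nbhd_difference_le:
  fixes h :: "'t \<Rightarrow> real" and e :: real
  assumes "x \<in> level P n" "y \<in> nbhd P k x" "\<And>u v. (u, v) \<in> edges P n \<Longrightarrow> \<bar>h u - h v\<bar> \<le> e" "0 \<le> e"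
  shows "\<bar>h x - h y\<bar> \<le> real k * e"
  using assms(2)
proof (induction k arbitrary: y)
  case 0
  then show ?case using assms by (simp add: nbhd_0)
next
  case (Suc k)
  then obtain w where w: "w \<in> nbhd P k x" "cell P w \<inter> cell P y \<noteq> {}" "y \<in> level P n"
    using nbhd_Suc[OF assms(1)] by blast
  have "\<bar>h w - h y\<bar> \<le> e"
    using assms(3)[of w y] w nbhd_in_level[OF assms(1)] assms(4) by (cases "w = y") (auto simp: edges_def)
  moreover have "\<bar>h x - h w\<bar> \<le> real k * e" using Suc w by blast
  ultimately show ?case by (simp add: algebra_simps)
qed

subsection \<open>Discrete energies\<close>

text \<open>The two orientations of the edge together cancel the factor 1/2 of the energy.\<close>

lemma edge_le_energy_on:
  assumes "(u, v) \<in> edges P n" "u \<in> A" "v \<in> A"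
  shows "\<bar>h u - h v\<bar> powr p \<le> energy_on P p n A h"
proof -
  have "u \<noteq> v" using assms by (auto simp: edges_def)
  note uv = this edges_sym[OF assms(1)]
  have "(\<Sum>(u, v)\<in>{(u, v), (v, u)}. \<bar>h u - h v\<bar> powr p) \<le> (\<Sum>(u, v)\<in>edges P n \<inter> A \<times> A. \<bar>h u - h v\<bar> powr p)"
    using assms uv by (intro sum_mono2) (auto simp: finite_edges)
  then show ?thesis using uv by (simp add: energy_on_def abs_minus_commute)
qed

lemma energy_on_nonneg: "0 \<le> energy_on P p n A h"
  unfolding energy_on_def by (intro mult_nonneg_nonneg sum_nonneg) auto

lemma energy_nonneg: "0 \<le> energy P p n h"
  unfolding energy_def by (rule energy_on_nonneg)

lemma energy_on_mono: "A \<subseteq> B \<Longrightarrow> energy_on P p n A h \<le> energy_on P p n B h"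
  unfolding energy_on_def by (intro mult_left_mono sum_mono2) (auto simp: finite_edges)

lemma energy_on_cong: "(\<And>u. u \<in> A \<Longrightarrow> h u = h' u) \<Longrightarrow> energy_on P p n A h = energy_on P p n A h'"
  unfolding energy_on_def by (auto intro!: sum.cong)

text \<open>Subtrees below different cells share no edge; only the edges between subtrees are lost,
  hence an inequality.\<close>

lemma sum_energy_on_descendants:
  assumes "n \<le> k"
  shows "(\<Sum>x\<in>level P n. energy_on P p k (descendants P (k - n) x) h) \<le> energy P p k h"
proof -
  let ?E = "\<lambda>x. edges P k \<inter> descendants P (k - n) x \<times> descendants P (k - n) x"
  have "(\<Sum>x\<in>level P n. \<Sum>(u, v)\<in>?E x. \<bar>h u - h v\<bar> powr p)
      = (\<Sum>(u, v)\<in>(\<Union>x\<in>level P n. ?E x). \<bar>h u - h v\<bar> powr p)"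
    using descendants_disjoint by (intro sum.UNION_disjoint[symmetric]) (fastforce simp: finite_level finite_edges)+
  also have "\<dots> \<le> (\<Sum>(u, v)\<in>edges P k \<inter> level P k \<times> level P k. \<bar>h u - h v\<bar> powr p)"
  proof (intro sum_mono2)
    show "(\<Union>x\<in>level P n. ?E x) \<subseteq> edges P k \<inter> level P k \<times> level P k" by (auto simp: edges_def)
  qed (auto simp: finite_edges)
  finally show ?thesis unfolding energy_def energy_on_def sum_distrib_left[symmetric] by simp
qed

text \<open>By symmetry of the edge set both summands contribute equally, which cancels the factor
  1/2, and each vertex starts at most \<open>N\<close> edges.\<close>

lemma energy_le_double_sum:
  fixes g h :: "'t \<Rightarrow> real"
  assumes "\<And>u v. (u, v) \<in> edges P n \<Longrightarrow> \<bar>h u - h v\<bar> powr p \<le> g u + g v" "\<And>u. 0 \<le> g u"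
  shows "energy P p n h \<le> N * (\<Sum>u\<in>level P n. g u)"
proof -
  have "(\<Sum>(u, v)\<in>edges P n. \<bar>h u - h v\<bar> powr p) \<le> (\<Sum>(u, v)\<in>edges P n. g u + g v)"
    by (intro sum_mono) (use assms in auto)
  also have "\<dots> = (\<Sum>(u, v)\<in>edges P n. g u) + (\<Sum>(u, v)\<in>edges P n. g v)"
    by (simp add: sum.distrib case_prod_unfold)
  also have "(\<Sum>(u, v)\<in>edges P n. g v) = (\<Sum>(u, v)\<in>edges P n. g u)"
    by (rule sum.reindex_bij_witness[of _ prod.swap prod.swap]) (auto dest: edges_sym)
  also have "(\<Sum>(u, v)\<in>edges P n. g u) \<le> (\<Sum>u\<in>level P n. \<Sum>v\<in>nbhd P 1 u. g u)"
  proof -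
    have "(\<Sum>u\<in>level P n. \<Sum>v\<in>nbhd P 1 u. g u) = (\<Sum>(u, v)\<in>Sigma (level P n) (nbhd P 1). g u)"
      using finite_nbhd by (intro sum.Sigma) (auto simp: finite_level)
    moreover have "(\<Sum>(u, v)\<in>edges P n. g u) \<le> (\<Sum>(u, v)\<in>Sigma (level P n) (nbhd P 1). g u)"
    proof (rule sum_mono2)
      show "edges P n \<subseteq> Sigma (level P n) (nbhd P 1)" by (auto simp: edges_def nbhd_1[simplified])
    qed (auto simp: finite_level finite_nbhd assms(2))
    ultimately show ?thesis by simp
  qed
  also have "(\<Sum>u\<in>level P n. \<Sum>v\<in>nbhd P 1 u. g u) \<le> (\<Sum>u\<in>level P n. N * g u)"
    using card_nbhd by (intro sum_mono) (simp add: assms(2) mult_right_mono)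
  finally show ?thesis
    unfolding energy_def energy_on_def sum_distrib_left[symmetric]
    by (simp add: edges_def Int_absorb2 subset_iff)
qed

end

section \<open>Means over cells\<close>

context cell_space
begin

lemma AE_not_overlap:
  "AE z in \<mu>. \<forall>x\<in>level P n. \<forall>y\<in>level P n. x \<noteq> y \<longrightarrow> z \<notin> cell P x \<inter> cell P y"
proof (intro AE_finite_allI finite_level)
  fix x y assume xy: "x \<in> level P n" "y \<in> level P n"
  show "AE z in \<mu>. x \<noteq> y \<longrightarrow> z \<notin> cell P x \<inter> cell P y"
  proof (cases "x = y")
    case False
    then have "cell P x \<inter> cell P y \<in> null_sets \<mu>"
      using xy overlap_null[OF xy False] by (intro null_setsI) (auto simp: emeasure_eq_measure cell_sets)
    from AE_not_in[OF this] show ?thesis by eventually_elim auto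
  qed simp
qed

text \<open>Overlaps of cells are null, so the indicators of the descendants add up to that of the
  cell almost everywhere.\<close>

lemma integral_cell_descendants:
  fixes u :: "'k \<Rightarrow> real"
  assumes x: "x \<in> level P n" and u: "integrable \<mu> u"
  shows "(LINT z:cell P x|\<mu>. u z) = (\<Sum>y\<in>descendants P m x. LINT z:cell P y|\<mu>. u z)"
proof -
  have D: "y \<in> level P (n + m)" if "y \<in> descendants P m x" for y using descendants_level[OF x] that by blast
  have int: "integrable \<mu> (\<lambda>z. indicator (cell P y) z *\<^sub>R u z)" if "y \<in> descendants P m x" for y
    using cell_sets[OF D[OF that]] u by (rule integrable_mult_indicator)
  have "AE z in \<mu>. indicator (cell P x) z *\<^sub>R u z = (\<Sum>y\<in>descendants P m x. indicator (cell P y) z *\<^sub>R u z)"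
    using AE_not_overlap[of "n + m"]
  proof eventually_elim
    fix z assume z: "\<forall>x\<in>level P (n + m). \<forall>y\<in>level P (n + m). x \<noteq> y \<longrightarrow> z \<notin> cell P x \<inter> cell P y"
    show "indicator (cell P x) z *\<^sub>R u z = (\<Sum>y\<in>descendants P m x. indicator (cell P y) z *\<^sub>R u z)"
    proof (cases "z \<in> cell P x")
      case True
      then obtain y0 where y0: "y0 \<in> descendants P m x" "z \<in> cell P y0"
        using descendant_at[OF x] by metis
      have "(\<Sum>y\<in>descendants P m x. indicator (cell P y) z *\<^sub>R u z)
          = (\<Sum>y\<in>descendants P m x. if y = y0 then u z else 0)"
        using y0 z D by (intro sum.cong) (auto simp: indicator_def)
      then show ?thesis using True y0 finite_descendants[OF x, of m] by simp
    next
      case False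
      then have "z \<notin> cell P y" if "y \<in> descendants P m x" for y using cell_subset[OF x that] by blast
      then show ?thesis using False by simp
    qed
  qed
  then have "(LINT z:cell P x|\<mu>. u z) = (\<integral>z. (\<Sum>y\<in>descendants P m x. indicator (cell P y) z *\<^sub>R u z) \<partial>\<mu>)"
    unfolding set_lebesgue_integral_def using x cell_sets[OF x] u D cell_sets
    by (intro integral_cong_AE) (auto intro!: borel_measurable_sum borel_measurable_scaleR borel_measurable_indicator)
  also have "\<dots> = (\<Sum>y\<in>descendants P m x. LINT z:cell P y|\<mu>. u z)"
    unfolding set_lebesgue_integral_def by (rule Bochner_Integration.integral_sum) (rule int)
  finally show ?thesis .
qed

lemma set_integral_const: "x \<in> level P n \<Longrightarrow> (LINT z:cell P x|\<mu>. c) = c * measure \<mu> (cell P x)" for c :: real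
  by (simp add: set_lebesgue_integral_def cell_sets space_\<mu> mult.commute)

lemma measure_cell_descendants:
  assumes "x \<in> level P n"
  shows "measure \<mu> (cell P x) = (\<Sum>y\<in>descendants P m x. measure \<mu> (cell P y))"
proof -
  have "(LINT z:cell P y|\<mu>. 1 :: real) = measure \<mu> (cell P y)" if "y \<in> descendants P m x" for y
    using set_integral_const[of y "n + m" 1] descendants_level[OF assms] that by auto
  then show ?thesis
    using integral_cell_descendants[OF assms, of "\<lambda>_. 1 :: real" m] set_integral_const[OF assms, of 1] by simp
qed

lemma weighted_mean_descendants:
  "x \<in> level P n \<Longrightarrow> weighted_mean P \<mu> (descendants P m x) h =
    (\<Sum>y\<in>descendants P m x. h y * measure \<mu> (cell P y)) / measure \<mu> (cell P x)"
  unfolding weighted_mean_def using measure_cell_descendants by simp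

lemma weighted_mean_0: "x \<in> level P n \<Longrightarrow> weighted_mean P \<mu> (descendants P 0 x) h = h x"
  using measure_cell_pos[of x n] by (simp add: weighted_mean_def)

lemma weighted_mean_dist_le:
  assumes x: "x \<in> level P n" and h: "\<And>y. y \<in> descendants P m x \<Longrightarrow> \<bar>h y - c\<bar> \<le> e"
  shows "\<bar>weighted_mean P \<mu> (descendants P m x) h - c\<bar> \<le> e"
proof -
  let ?w = "\<lambda>y. measure \<mu> (cell P y)"
  have "\<bar>(\<Sum>y\<in>descendants P m x. h y * ?w y) - c * ?w x\<bar> = \<bar>\<Sum>y\<in>descendants P m x. (h y - c) * ?w y\<bar>"
    by (simp add: measure_cell_descendants[OF x, of m] sum_distrib_left sum_subtractf left_diff_distrib)
  also have "\<dots> \<le> (\<Sum>y\<in>descendants P m x. e * ?w y)"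
    by (rule order.trans[OF sum_abs sum_mono]) (simp add: abs_mult mult_right_mono h)
  also have "\<dots> = e * ?w x"
    by (simp add: measure_cell_descendants[OF x, of m] sum_distrib_left)
  finally have "\<bar>(\<Sum>y\<in>descendants P m x. h y * ?w y) - c * ?w x\<bar> \<le> e * ?w x" .
  moreover have "(\<Sum>y\<in>descendants P m x. h y * ?w y) / ?w x - c = ((\<Sum>y\<in>descendants P m x. h y * ?w y) - c * ?w x) / ?w x"
    using measure_cell_pos[OF x] by (simp add: field_simps)
  ultimately show ?thesis
    using measure_cell_pos[OF x] by (simp add: weighted_mean_descendants[OF x] abs_divide pos_divide_le_eq)
qed

lemma weighted_mean_const:
  "x \<in> level P n \<Longrightarrow> (\<And>y. y \<in> descendants P m x \<Longrightarrow> h y = c) \<Longrightarrow> weighted_mean P \<mu> (descendants P m x) h = c"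
  using weighted_mean_dist_le[of x n m h c 0] by simp

text \<open>The tower property of conditional expectations: the weight of each intermediate cell
  cancels the normalisation of its mean.\<close>

lemma weighted_mean_tower:
  assumes x: "x \<in> level P n"
  shows "weighted_mean P \<mu> (descendants P m x) (\<lambda>y. weighted_mean P \<mu> (descendants P k y) h)
    = weighted_mean P \<mu> (descendants P (m + k) x) h"
proof -
  have D: "y \<in> level P (n + m)" if "y \<in> descendants P m x" for y using descendants_level[OF x] that by blast
  have "(\<Sum>y\<in>descendants P m x. weighted_mean P \<mu> (descendants P k y) h * measure \<mu> (cell P y))
      = (\<Sum>y\<in>descendants P m x. \<Sum>z\<in>descendants P k y. h z * measure \<mu> (cell P z))"
  proof (rule sum.cong[OF refl])
    fix y assume "y \<in> descendants P m x"
    from D[OF this] show "weighted_mean P \<mu> (descendants P k y) h * measure \<mu> (cell P y)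
        = (\<Sum>z\<in>descendants P k y. h z * measure \<mu> (cell P z))"
      using measure_cell_pos by (simp add: weighted_mean_descendants less_imp_neq[symmetric])
  qed
  also have "\<dots> = (\<Sum>z\<in>descendants P (m + k) x. h z * measure \<mu> (cell P z))"
    unfolding descendants_add using D descendants_disjoint
    by (intro sum.UNION_disjoint[symmetric]) (blast intro: finite_descendants[OF x] finite_descendants)+
  finally show ?thesis by (simp add: weighted_mean_descendants[OF x])
qed

section \<open>Means of continuous functions\<close>

lemma continuous_integrable: "continuous_on UNIV u \<Longrightarrow> integrable \<mu> (u :: 'k \<Rightarrow> real)"
proof -
  assume u: "continuous_on UNIV u"
  then have "bounded (range u)"
    by (intro compact_imp_bounded compact_continuous_image compact_UNIV)
  then obtain B where "\<forall>x. norm (u x) \<le> B" by (auto simp: bounded_iff)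
  moreover have "u \<in> borel_measurable \<mu>"
    using borel_measurable_continuous_onI[OF u] measurable_cong_sets[OF sets_\<mu> refl] by blast
  ultimately show ?thesis by (intro integrable_const_bound[of _ B]) auto
qed

lemma cell_mean_dist_le:
  assumes x: "x \<in> level P n" and u: "continuous_on UNIV u" and le: "\<And>z. z \<in> cell P x \<Longrightarrow> \<bar>u z - c\<bar> \<le> e"
  shows "\<bar>cell_mean P \<mu> u x - c\<bar> \<le> e"
proof -
  have int: "set_integrable \<mu> (cell P x) u" "set_integrable \<mu> (cell P x) (\<lambda>z. c)"
    unfolding set_integrable_def using cell_sets[OF x] continuous_integrable[OF u]
    by (auto intro!: integrable_mult_indicator simp del: real_scaleR_def)
  have "\<bar>(LINT z:cell P x|\<mu>. u z) - c * measure \<mu> (cell P x)\<bar> = \<bar>LINT z:cell P x|\<mu>. u z - c\<bar>"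
    using set_integral_diff(2)[OF int] set_integral_const[OF x] by simp
  also have "\<dots> \<le> (LINT z:cell P x|\<mu>. e)"
    unfolding set_lebesgue_integral_def
  proof (rule order.trans[OF integral_abs_bound integral_mono])
    show "integrable \<mu> (\<lambda>z. \<bar>indicator (cell P x) z *\<^sub>R (u z - c)\<bar>)"
      using set_integral_diff(1)[OF int] unfolding set_integrable_def by (rule integrable_abs)
    show "integrable \<mu> (\<lambda>z. indicator (cell P x) z *\<^sub>R e)"
      using cell_sets[OF x] by (intro integrable_mult_indicator) auto
    show "\<bar>indicator (cell P x) z *\<^sub>R (u z - c)\<bar> \<le> indicator (cell P x) z *\<^sub>R e" for z
      using le by (auto simp: indicator_def)
  qed
  also have "\<dots> = e * measure \<mu> (cell P x)" by (rule set_integral_const[OF x])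
  finally have "\<bar>(LINT z:cell P x|\<mu>. u z) - c * measure \<mu> (cell P x)\<bar> \<le> e * measure \<mu> (cell P x)" .
  moreover have "cell_mean P \<mu> u x - c = ((LINT z:cell P x|\<mu>. u z) - c * measure \<mu> (cell P x)) / measure \<mu> (cell P x)"
    using measure_cell_pos[OF x] by (simp add: cell_mean_def field_simps)
  ultimately show ?thesis
    using measure_cell_pos[OF x] by (simp add: abs_divide pos_divide_le_eq)
qed

text \<open>A martingale for the filtration generated by the levels. The notion covers at once the
  cell means of an integrable function and limits of averaged discrete functions for which no
  function on the space is known yet.\<close>

definition martingale :: "('t \<Rightarrow> real) \<Rightarrow> bool" where
  "martingale h \<longleftrightarrow> (\<forall>n m. \<forall>x\<in>level P n. h x = weighted_mean P \<mu> (descendants P m x) h)"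

lemma martingaleD: "martingale h \<Longrightarrow> x \<in> level P n \<Longrightarrow> weighted_mean P \<mu> (descendants P m x) h = h x"
  by (simp add: martingale_def)

lemma martingale_cell_mean: "integrable \<mu> u \<Longrightarrow> martingale (cell_mean P \<mu> u)"
  unfolding martingale_def
proof (intro allI ballI)
  fix n m x assume u: "integrable \<mu> u" and x: "x \<in> level P n"
  have "(\<Sum>y\<in>descendants P m x. cell_mean P \<mu> u y * measure \<mu> (cell P y))
      = (\<Sum>y\<in>descendants P m x. LINT z:cell P y|\<mu>. u z)"
  proof (rule sum.cong[OF refl])
    fix y assume "y \<in> descendants P m x"
    then have "measure \<mu> (cell P y) > 0" using descendants_level[OF x] measure_cell_pos by blast
    then show "cell_mean P \<mu> u y * measure \<mu> (cell P y) = (LINT z:cell P y|\<mu>. u z)" by (simp add: cell_mean_def)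
  qed
  then show "cell_mean P \<mu> u x = weighted_mean P \<mu> (descendants P m x) (cell_mean P \<mu> u)"
    using integral_cell_descendants[OF x u, of m] by (simp add: weighted_mean_descendants[OF x] cell_mean_def)
qed

subsection \<open>Oscillations\<close>

lemma oscillation_le:
  fixes u :: "'k \<Rightarrow> real"
  assumes "continuous_on UNIV u" "z \<in> A" "z' \<in> A"
  shows "\<bar>u z - u z'\<bar> \<le> diameter (u ` A)"
proof -
  have "bounded (range u)"
    using assms(1) by (intro compact_imp_bounded compact_continuous_image compact_UNIV)
  then have "bounded (u ` A)" by (rule bounded_subset) auto
  then show ?thesis using diameter_bounded_bound[of "u ` A" "u z" "u z'"] assms by (simp add: dist_real_def)
qed

lemma oscillation_leI:
  fixes u :: "'k \<Rightarrow> real"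
  assumes "0 \<le> e" "\<And>z z'. z \<in> A \<Longrightarrow> z' \<in> A \<Longrightarrow> \<bar>u z - u z'\<bar> \<le> e"
  shows "diameter (u ` A) \<le> e"
  by (rule diameter_le) (use assms in auto)

lemma oscillation_nonneg: "continuous_on UNIV u \<Longrightarrow> 0 \<le> diameter (u ` A)" for u :: "'k \<Rightarrow> real"
  by (cases "A = {}") (use oscillation_le[of u _ A] in force)+

lemma oscillation_small:
  fixes u :: "'k \<Rightarrow> real"
  assumes u: "continuous_on UNIV u" and e: "0 < e"
  shows "\<exists>n\<^sub>0. \<forall>n\<ge>n\<^sub>0. \<forall>x\<in>level P n. diameter (u ` cell P x) \<le> e"
proof -
  have "uniformly_continuous_on UNIV u"
    using compact_uniformly_continuous[OF u compact_UNIV] .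
  then obtain d where d: "0 < d" "\<And>z z'. dist z' z < d \<Longrightarrow> dist (u z') (u z) < e"
    using e unfolding uniformly_continuous_on_def by auto
  have "(\<lambda>n. b * r ^ n) \<longlonglongrightarrow> b * 0"
    using r by (intro tendsto_intros LIMSEQ_realpow_zero) auto
  then have "eventually (\<lambda>n. b * r ^ n < d) sequentially"
    using d by (auto dest!: order_tendstoD(2))
  then obtain n\<^sub>0 where n\<^sub>0: "\<And>n. n\<^sub>0 \<le> n \<Longrightarrow> b * r ^ n < d" by (auto simp: eventually_sequentially)
  have "diameter (u ` cell P x) \<le> e" if "n\<^sub>0 \<le> n" "x \<in> level P n" for n x
  proof (rule oscillation_leI)
    fix z z' assume "z \<in> cell P x" "z' \<in> cell P x"
    then have "dist z z' < d" using dist_cell[OF that(2)] n\<^sub>0[OF that(1)] by force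
    then show "\<bar>u z - u z'\<bar> \<le> e" using d(2)[of z z'] by (simp add: dist_real_def)
  qed (use e in simp)
  then show ?thesis by blast
qed

definition osc_sum :: "real \<Rightarrow> nat \<Rightarrow> ('k \<Rightarrow> real) \<Rightarrow> real" where
  "osc_sum p n u = (\<Sum>x\<in>level P n. diameter (u ` cell P x) powr p)"

lemma cell_mean_osc:
  assumes "x \<in> level P n" "continuous_on UNIV u" "z \<in> cell P x"
  shows "\<bar>cell_mean P \<mu> u x - u z\<bar> \<le> diameter (u ` cell P x)"
  using assms by (intro cell_mean_dist_le[OF assms(1,2)] oscillation_le)

text \<open>Adjacent cells share a point z, and each of the two means differs from u(z) by at most
  the oscillation on its own cell.\<close>

lemma energy_le_osc_sum:
  assumes u: "continuous_on UNIV u" and p: "0 \<le> p"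
  shows "energy P p n (cell_mean P \<mu> u) \<le> N * 2 powr p * osc_sum p n u"
proof -
  have "energy P p n (cell_mean P \<mu> u) \<le> N * (\<Sum>x\<in>level P n. 2 powr p * diameter (u ` cell P x) powr p)"
  proof (rule energy_le_double_sum)
    fix x y assume "(x, y) \<in> edges P n"
    then obtain z where z: "x \<in> level P n" "y \<in> level P n" "z \<in> cell P x" "z \<in> cell P y"
      by (auto simp: edges_def)
    have "\<bar>cell_mean P \<mu> u x - cell_mean P \<mu> u y\<bar> powr p
        \<le> (diameter (u ` cell P x) + diameter (u ` cell P y)) powr p"
      using cell_mean_osc[OF z(1) u z(3)] cell_mean_osc[OF z(2) u z(4)] p by (intro powr_mono2) auto
    also have "\<dots> \<le> 2 powr p * (diameter (u ` cell P x) powr p + diameter (u ` cell P y) powr p)"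
      using oscillation_nonneg[OF u] p by (intro powr_add_le) auto
    finally show "\<bar>cell_mean P \<mu> u x - cell_mean P \<mu> u y\<bar> powr p
        \<le> 2 powr p * diameter (u ` cell P x) powr p + 2 powr p * diameter (u ` cell P y) powr p"
      by (simp add: distrib_left)
  qed simp
  then show ?thesis by (simp add: osc_sum_def sum_distrib_left mult.assoc)
qed

subsection \<open>The function space\<close>

abbreviation energy_bound :: "real \<Rightarrow> real \<Rightarrow> ('t \<Rightarrow> real) \<Rightarrow> real \<Rightarrow> bool" where
  "energy_bound p \<sigma> h B \<equiv> \<forall>n\<ge>1. \<sigma> ^ n * energy P p n h \<le> B"

lemma Np_power_le: "0 \<le> B \<Longrightarrow> Np_power P \<mu> p \<sigma> u \<le> ennreal B \<longleftrightarrow> energy_bound p \<sigma> (cell_mean P \<mu> u) B"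
  by (auto simp: Np_power_def SUP_le_iff ennreal_le_iff)

text \<open>On a compact space with a probability measure the integrability clause follows from
  continuity, so only a uniform bound on the energies remains. Replacing B by its absolute value
  makes it expressible in \<open>ennreal\<close>.\<close>

lemma Wp_iff:
  assumes p: "0 < p"
  shows "u \<in> Wp P \<mu> p \<sigma> \<longleftrightarrow>
    continuous_on UNIV u \<and> (\<exists>B. energy_bound p \<sigma> (cell_mean P \<mu> u) B)"
proof -
  have "u \<in> Lp_functions \<mu> p" if u: "continuous_on UNIV u"
  proof -
    have "continuous_on UNIV (\<lambda>x. \<bar>u x\<bar> powr p)"
      using u p by (intro continuous_on_powr' continuous_intros) auto
    then show ?thesis
      using continuous_integrable[OF u] continuous_integrable by (simp add: Lp_functions_def)
  qed
  moreover have "Np_power P \<mu> p \<sigma> u < \<infinity> \<longleftrightarrow> (\<exists>B. energy_bound p \<sigma> (cell_mean P \<mu> u) B)"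
  proof
    assume "Np_power P \<mu> p \<sigma> u < \<infinity>"
    then have "Np_power P \<mu> p \<sigma> u \<le> ennreal (enn2real (Np_power P \<mu> p \<sigma> u))"
      by (simp add: less_top[symmetric])
    then show "\<exists>B. energy_bound p \<sigma> (cell_mean P \<mu> u) B"
      by (subst (asm) Np_power_le) auto
  next
    assume "\<exists>B. energy_bound p \<sigma> (cell_mean P \<mu> u) B"
    then obtain B where "energy_bound p \<sigma> (cell_mean P \<mu> u) B" by blast
    then have "energy_bound p \<sigma> (cell_mean P \<mu> u) \<bar>B\<bar>" by force
    then have "Np_power P \<mu> p \<sigma> u \<le> ennreal \<bar>B\<bar>" by (subst Np_power_le) auto
    then show "Np_power P \<mu> p \<sigma> u < \<infinity>"
      using ennreal_less_top le_less_trans by (metis infinity_ennreal_def)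
  qed
  ultimately show ?thesis by (auto simp: Wp_def)
qed

text \<open>The p-th power of the seminorm \<open>Np\<close>, as a real number.\<close>

abbreviation Np_real :: "real \<Rightarrow> real \<Rightarrow> ('k \<Rightarrow> real) \<Rightarrow> real" where
  "Np_real p \<sigma> u \<equiv> enn2real (Np_power P \<mu> p \<sigma> u)"

lemma energy_bound_Np:
  assumes "u \<in> Wp P \<mu> p \<sigma>"
  shows "energy_bound p \<sigma> (cell_mean P \<mu> u) (Np_real p \<sigma> u)"
proof -
  have "Np_power P \<mu> p \<sigma> u \<le> ennreal (Np_real p \<sigma> u)"
    using assms by (simp add: Wp_def less_top[symmetric])
  then show ?thesis by (subst (asm) Np_power_le) auto
qed

lemma Np_real_le:
  assumes "energy_bound p \<sigma> (cell_mean P \<mu> u) B" "0 \<le> B"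
  shows "Np_real p \<sigma> u \<le> B"
  using assms by (simp add: Np_power_le enn2real_leI)

end

section \<open>Consequences of the disparity bound\<close>

text \<open>Only positivity of p and \<sigma> is assumed at this stage: the estimates proved here
  are an ingredient of the proof that both exceed 1.\<close>

locale disparity_space = cell_space P \<mu> r a b M N
  for P :: "('t, 'k::metric_space) cell_tree" and \<mu> :: "'k measure"
    and r a b :: real and M N :: nat +
  fixes p \<sigma> C :: real
  assumes p_pos: "0 < p" and \<sigma>_pos: "0 < \<sigma>" and C_ge_1: "1 \<le> C"
    and disparity_le: "\<lbrakk>1 \<le> m; 1 \<le> n\<rbrakk> \<Longrightarrow> nbr_disparity_level P \<mu> p m n \<le> ennreal (C * \<sigma> ^ m)"
begin

text \<open>For m at least 1 this unfolds the supremum defining the disparity. Functions constant on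
  both subtrees, which that supremum excludes, have equal means; zero energy with different means
  would make the quotient infinite, against the bound. For m = 0 the left side is one edge of the
  energy, and C is at least 1.\<close>

lemma mean_difference_le:
  assumes n: "1 \<le> n" and xy: "(x, y) \<in> edges P n"
  shows "\<bar>weighted_mean P \<mu> (descendants P m x) h - weighted_mean P \<mu> (descendants P m y) h\<bar> powr p
    \<le> C * \<sigma> ^ m * energy_on P p (n + m) (descendants P m x \<union> descendants P m y) h"
    (is "?d \<le> C * \<sigma> ^ m * ?E")
proof -
  have E: "0 \<le> ?E" by (rule energy_on_nonneg)
  have l: "x \<in> level P n" "y \<in> level P n" using xy by (auto simp: edges_def)
  show ?thesis
  proof (cases "m = 0")
    case True
    have "?d \<le> ?E"
      using edge_le_energy_on[OF xy, of "{x, y}" h p] l by (simp add: True weighted_mean_0[simplified] insert_commute)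
    then show ?thesis using C_ge_1 mult_mono[of 1 C ?E ?E] E by (simp add: True)
  next
    case False
    show ?thesis
    proof (cases "h constant_on (descendants P m x \<union> descendants P m y)")
      case True
      then obtain c where "\<And>z. z \<in> descendants P m x \<union> descendants P m y \<Longrightarrow> h z = c"
        by (auto simp: constant_on_def)
      then have "?d = 0"
        using weighted_mean_const[OF l(1), of m h c] weighted_mean_const[OF l(2), of m h c] by simp
      then show ?thesis using C_ge_1 \<sigma>_pos E by simp
    next
      case h: False
      have "ennreal ?d / ennreal ?E \<le> nbr_disparity_pair P \<mu> p m n x y"
        unfolding nbr_disparity_pair_def by (rule SUP_upper) (use h in simp)
      also have "\<dots> \<le> nbr_disparity_level P \<mu> p m n"
        unfolding nbr_disparity_level_def using SUP_upper[OF xy, of "\<lambda>(w, v). nbr_disparity_pair P \<mu> p m n w v"] by simp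
      also have "\<dots> \<le> ennreal (C * \<sigma> ^ m)" using False n by (intro disparity_le) auto
      finally have *: "ennreal ?d / ennreal ?E \<le> ennreal (C * \<sigma> ^ m)" .
      show ?thesis
      proof (cases "?E = 0")
        case True
        then have "?d = 0"
        proof (rule_tac ccontr)
          assume "?d \<noteq> 0"
          then have "ennreal ?d / ennreal ?E = \<top>" using True by (simp add: ennreal_divide_eq_top_iff)
          then show False using * by (simp add: top_unique)
        qed
        then show ?thesis using True by simp
      next
        case False
        then have "ennreal (?d / ?E) \<le> ennreal (C * \<sigma> ^ m)" using * E by (simp add: divide_ennreal)
        then have "?d / ?E \<le> C * \<sigma> ^ m" using C_ge_1 \<sigma>_pos by (simp add: ennreal_le_iff)
        then show ?thesis using False E by (simp add: pos_divide_le_eq)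
      qed
    qed
  qed
qed

definition K1 :: real where "K1 = N * C"

lemma K1_pos: "0 < K1"
  using N_pos C_ge_1 by (simp add: K1_def)

text \<open>\<open>mean_difference_le\<close> is summed over the coarse edges. The right side only
  involves fine edges below A, and this localisation is what later allows summation over disjoint
  subtrees.\<close>

lemma energy_on_mean_le:
  assumes n: "1 \<le> n" and A: "A \<subseteq> level P n"
  shows "energy_on P p n A (\<lambda>x. weighted_mean P \<mu> (descendants P m x) h)
    \<le> K1 * \<sigma> ^ m * energy_on P p (n + m) (descendants_of_set P m A) h"
proof -
  let ?E = "edges P n \<inter> A \<times> A"
  let ?D = "descendants_of_set P m A"
  let ?E' = "edges P (n + m) \<inter> ?D \<times> ?D"
  let ?U = "\<lambda>(x, y). descendants P m x \<union> descendants P m y"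
  let ?g = "\<lambda>(u, v). \<bar>h u - h v\<bar> powr p"
  let ?m = "\<lambda>x. weighted_mean P \<mu> (descendants P m x) h"
  \<comment> \<open>How often a fine edge is counted: its first endpoint has a unique ancestor
    \<open>x0\<close>, which must be one end of the coarse edge, and the other end is a neighbour of
    \<open>x0\<close>.\<close>
  have mult: "card {e \<in> ?E. e' \<in> ?U e \<times> ?U e} \<le> 2 * N" if e': "e' \<in> ?E'" for e'
  proof -
    obtain u v where uv: "e' = (u, v)" "u \<in> ?D" using e' by auto
    then obtain x0 where x0: "x0 \<in> A" "u \<in> descendants P m x0" by (auto simp: descendants_of_set_def)
    have x0l: "x0 \<in> level P n" using x0 A by blast
    let ?nb = "nbhd P 1 x0"
    have "{e \<in> ?E. e' \<in> ?U e \<times> ?U e} \<subseteq> {x0} \<times> ?nb \<union> ?nb \<times> {x0}"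
    proof
      fix e assume e: "e \<in> {e \<in> ?E. e' \<in> ?U e \<times> ?U e}"
      obtain x y where xy: "e = (x, y)" by (cases e)
      have l: "x \<in> level P n" "y \<in> level P n" "cell P x \<inter> cell P y \<noteq> {}" using e xy by (auto simp: edges_def)
      have "u \<in> descendants P m x \<or> u \<in> descendants P m y" using e xy uv by auto
      then have "x = x0 \<or> y = x0"
        using descendants_disjoint[OF l(1) x0l] descendants_disjoint[OF l(2) x0l] x0 by blast
      then show "e \<in> {x0} \<times> ?nb \<union> ?nb \<times> {x0}"
        using l xy nbhd_1[OF x0l] by auto
    qed
    then have "card {e \<in> ?E. e' \<in> ?U e \<times> ?U e} \<le> card ({x0} \<times> ?nb \<union> ?nb \<times> {x0})"
      using finite_nbhd[OF x0l] by (intro card_mono) auto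
    also have "\<dots> \<le> card ({x0} \<times> ?nb) + card (?nb \<times> {x0})" by (rule card_Un_le)
    also have "\<dots> \<le> 2 * N" using card_nbhd[OF x0l] by (simp add: card_cartesian_product)
    finally show ?thesis .
  qed
  have "(\<Sum>(x, y)\<in>?E. \<bar>?m x - ?m y\<bar> powr p)
      \<le> (\<Sum>e\<in>?E. C * \<sigma> ^ m * ((1/2) * (\<Sum>e'\<in>{e' \<in> ?E'. e' \<in> ?U e \<times> ?U e}. ?g e')))"
  proof (rule sum_mono)
    fix e assume e: "e \<in> ?E"
    obtain x y where xy: "e = (x, y)" by (cases e)
    have "edges P (n + m) \<inter> ?U e \<times> ?U e = {e' \<in> ?E'. e' \<in> ?U e \<times> ?U e}"
      using e xy by (auto simp: descendants_of_set_def)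
    then show "(case e of (x, y) \<Rightarrow> \<bar>?m x - ?m y\<bar> powr p)
        \<le> C * \<sigma> ^ m * ((1/2) * (\<Sum>e'\<in>{e' \<in> ?E'. e' \<in> ?U e \<times> ?U e}. ?g e'))"
      using mean_difference_le[OF n, of x y m h] e xy by (simp add: energy_on_def)
  qed
  also have "\<dots> = C * \<sigma> ^ m * (1/2) * (\<Sum>e\<in>?E. \<Sum>e'\<in>{e' \<in> ?E'. e' \<in> ?U e \<times> ?U e}. ?g e')"
    by (simp add: sum_distrib_left sum_divide_distrib)
  also have "(\<Sum>e\<in>?E. \<Sum>e'\<in>{e' \<in> ?E'. e' \<in> ?U e \<times> ?U e}. ?g e')
      = (\<Sum>e'\<in>?E'. \<Sum>e\<in>{e \<in> ?E. e' \<in> ?U e \<times> ?U e}. ?g e')"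
    by (rule sum.swap_restrict) (auto simp: finite_edges)
  also have "\<dots> \<le> (\<Sum>e'\<in>?E'. (2 * N) * ?g e')"
  proof (rule sum_mono)
    fix e' assume e': "e' \<in> ?E'"
    have "0 \<le> ?g e'" by (cases e') simp
    then have "real (card {e \<in> ?E. e' \<in> ?U e \<times> ?U e}) * ?g e' \<le> real (2 * N) * ?g e'"
      using mult[OF e'] by (intro mult_right_mono) (simp_all only: of_nat_le_iff)
    then show "(\<Sum>e\<in>{e \<in> ?E. e' \<in> ?U e \<times> ?U e}. ?g e') \<le> real (2 * N) * ?g e'"
      by simp
  qed
  finally have "(\<Sum>(x, y)\<in>?E. \<bar>?m x - ?m y\<bar> powr p) \<le> C * \<sigma> ^ m * (1/2) * (\<Sum>e'\<in>?E'. (2 * N) * ?g e')"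
    using C_ge_1 \<sigma>_pos by (simp add: mult_left_mono)
  also have "\<dots> = 2 * (K1 * \<sigma> ^ m * energy_on P p (n + m) ?D h)"
    by (simp add: energy_on_def K1_def sum_distrib_left[symmetric] mult_ac)
  finally show ?thesis by (simp add: energy_on_def)
qed

lemma energy_mean_le:
  assumes "1 \<le> n"
  shows "energy P p n (\<lambda>x. weighted_mean P \<mu> (descendants P m x) h) \<le> K1 * \<sigma> ^ m * energy P p (n + m) h"
  using energy_on_mean_le[OF assms order_refl, of m h] level_add[of n m]
  by (simp add: energy_def descendants_of_set_def)

text \<open>Weak monotonicity: coarse values of a martingale are means of its fine values, so the
  rescaled energies can decrease only by a bounded factor when the level is refined.\<close>

lemma energy_martingale_le:
  assumes "1 \<le> n" "n \<le> k" "martingale h"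
  shows "\<sigma> ^ n * energy P p n h \<le> K1 * (\<sigma> ^ k * energy P p k h)"
proof -
  have "energy P p n h = energy P p n (\<lambda>x. weighted_mean P \<mu> (descendants P (k - n) x) h)"
    unfolding energy_def using martingaleD[OF assms(3)] by (intro energy_on_cong) simp
  also have "\<dots> \<le> K1 * \<sigma> ^ (k - n) * energy P p (n + (k - n)) h" by (rule energy_mean_le[OF assms(1)])
  finally have "\<sigma> ^ n * energy P p n h \<le> \<sigma> ^ n * (K1 * \<sigma> ^ (k - n) * energy P p k h)"
    using \<sigma>_pos assms(2) by (intro mult_left_mono) auto
  also have "\<dots> = K1 * (\<sigma> ^ (n + (k - n)) * energy P p k h)" by (simp add: power_add)
  finally show ?thesis using assms(2) by simp
qed

text \<open>Chain x to y inside A; each edge costs at most the p-th root of the energy, and there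
  are at most \<open>card A * card A\<close> edges.\<close>

lemma connected_difference_le:
  assumes A: "A \<subseteq> level P n" "connected (\<Union>x\<in>A. cell P x)" and xy: "x \<in> A" "y \<in> A"
  shows "\<bar>h x - h y\<bar> powr p \<le> (real (card A) * real (card A)) powr p * energy_on P p n A h"
proof -
  let ?R = "edges P n \<inter> A \<times> A"
  let ?E = "energy_on P p n A h"
  have finA: "finite A" using A finite_level finite_subset by blast
  have "\<bar>h x - h y\<bar> \<le> card ?R * ?E powr (1 / p)"
  proof (rule path_difference_le[OF _ _ _ edge_path[OF A xy]])
    fix u v assume "(u, v) \<in> ?R"
    then have "\<bar>h u - h v\<bar> powr p \<le> ?E" by (intro edge_le_energy_on) auto
    then have "(\<bar>h u - h v\<bar> powr p) powr (1 / p) \<le> ?E powr (1 / p)" using p_pos by (intro powr_mono2) auto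
    then show "\<bar>h u - h v\<bar> \<le> ?E powr (1 / p)" using p_pos by (simp add: powr_powr)
  qed (auto simp: finite_edges)
  also have "\<dots> \<le> (card A * card A) * ?E powr (1 / p)"
    using card_mono[of "A \<times> A" ?R] finA
    by (intro mult_right_mono) (auto simp: card_cartesian_product of_nat_mult[symmetric] simp del: of_nat_mult)
  finally have "\<bar>h x - h y\<bar> powr p \<le> ((card A * card A) * ?E powr (1 / p)) powr p"
    using p_pos by (intro powr_mono2) auto
  also have "\<dots> = (real (card A) * real (card A)) powr p * ?E"
    using p_pos energy_on_nonneg[of p n A h] by (simp add: powr_mult powr_powr)
  finally show ?thesis .
qed

definition K2 :: real where "K2 = (real N * real N) powr p * K1"

lemma K2_pos: "0 < K2"
  using K1_pos N_pos by (simp add: K2_def)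

text \<open>The value at x is a mean of values at its children, whose cells together form the
  connected cell of x, so chains through siblings suffice. The energy among the siblings is then
  bounded by the energy at level k below x alone.\<close>

lemma child_difference_le:
  assumes h: "martingale h" and x: "x \<in> level P n" and y: "y \<in> children P x" and k: "Suc n \<le> k"
  shows "\<bar>h x - h y\<bar> powr p \<le> K2 * (\<sigma> ^ k * energy_on P p k (descendants P (k - n) x) h) / \<sigma> ^ Suc n"
proof -
  let ?A = "children P x"
  have A: "?A \<subseteq> level P (Suc n)" "connected (\<Union>x\<in>?A. cell P x)"
    using x level_Suc connected_cell[OF x] cell_children[OF x] by auto
  have diff: "\<bar>h z - h y\<bar> \<le> ((real N * real N) powr p * energy_on P p (Suc n) ?A h) powr (1 / p)" if "z \<in> ?A" for z
  proof -
    have "\<bar>h z - h y\<bar> powr p \<le> (real (card ?A) * real (card ?A)) powr p * energy_on P p (Suc n) ?A h"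
      by (rule connected_difference_le[OF A that y])
    also have "\<dots> \<le> (real N * real N) powr p * energy_on P p (Suc n) ?A h"
      using card_children[OF x] p_pos
      by (intro mult_right_mono powr_mono2 mult_mono energy_on_nonneg) auto
    finally have "(\<bar>h z - h y\<bar> powr p) powr (1 / p) \<le> ((real N * real N) powr p * energy_on P p (Suc n) ?A h) powr (1 / p)"
      using p_pos by (intro powr_mono2) auto
    then show ?thesis using p_pos by (simp add: powr_powr)
  qed
  have "energy_on P p (Suc n) ?A h = energy_on P p (Suc n) ?A (\<lambda>z. weighted_mean P \<mu> (descendants P (k - Suc n) z) h)"
    using martingaleD[OF h] A(1) by (intro energy_on_cong) (auto simp: subset_iff)
  also have "\<dots> \<le> K1 * \<sigma> ^ (k - Suc n) * energy_on P p (Suc n + (k - Suc n)) (descendants_of_set P (k - Suc n) ?A) h"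
    by (rule energy_on_mean_le[OF _ A(1)]) simp
  also have "descendants_of_set P (k - Suc n) ?A = descendants P (k - n) x"
  proof -
    have "k - n = Suc (k - Suc n)" using k by simp
    then show ?thesis by (simp add: descendants_of_set_def)
  qed
  also have "\<sigma> ^ (k - Suc n) = \<sigma> ^ k / \<sigma> ^ Suc n" using k \<sigma>_pos by (subst power_diff) auto
  finally have en: "energy_on P p (Suc n) ?A h \<le> K1 * (\<sigma> ^ k / \<sigma> ^ Suc n) * energy_on P p k (descendants P (k - n) x) h"
    using k by simp
  have "\<bar>h x - h y\<bar> \<le> ((real N * real N) powr p * energy_on P p (Suc n) ?A h) powr (1 / p)"
    using weighted_mean_dist_le[OF x, of "Suc 0" h "h y"] diff martingaleD[OF h x, of "Suc 0"] by simp
  then have "\<bar>h x - h y\<bar> powr p \<le> (((real N * real N) powr p * energy_on P p (Suc n) ?A h) powr (1 / p)) powr p"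
    using p_pos by (intro powr_mono2) auto
  also have "\<dots> = (real N * real N) powr p * energy_on P p (Suc n) ?A h"
    using p_pos energy_on_nonneg[of p "Suc n" ?A h] by (simp add: powr_powr)
  also have "\<dots> \<le> (real N * real N) powr p * (K1 * (\<sigma> ^ k / \<sigma> ^ Suc n) * energy_on P p k (descendants P (k - n) x) h)"
    using en by (intro mult_left_mono) auto
  finally show ?thesis by (simp add: K2_def mult_ac)
qed

end

section \<open>Spaces with disparity growing and conductance decaying geometrically\<close>

text \<open>The two strict inequalities are discharged by \<open>exponents_gt_1\<close>, the bound
  on conductances by \<open>disparity_rate_conductance\<close>.\<close>

locale conductive_space = disparity_space P \<mu> r a b M N p \<sigma> C
  for P :: "('t, 'k::metric_space) cell_tree" and \<mu> :: "'k measure"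
    and r a b :: real and M N :: nat and p \<sigma> C :: real +
  assumes p_gt_1: "1 < p" and \<sigma>_gt_1: "1 < \<sigma>"
    and conductance_le: "1 \<le> m \<Longrightarrow> conductance P M p m \<le> ennreal (C / \<sigma> ^ m)"
begin

text \<open>The splitting weight for \<open>powr_add_weighted\<close>. With it the factor in front
  of the remaining telescope is \<kappa>^(1 - p) = \<kappa>\<sigma>, so dividing by the \<sigma>
  gained from one level leaves \<kappa> < 1.\<close>

definition \<kappa> :: real where "\<kappa> = \<sigma> powr (- 1 / p)"

lemma \<kappa>: "0 < \<kappa>" "\<kappa> < 1"
proof -
  show "0 < \<kappa>" using \<sigma>_pos by (simp add: \<kappa>_def)
  have "\<sigma> powr (- 1 / p) < \<sigma> powr 0" using \<sigma>_gt_1 p_pos by (intro powr_less_mono) auto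
  then show "\<kappa> < 1" using \<sigma>_pos by (simp add: \<kappa>_def)
qed

lemma \<kappa>_powr: "\<kappa> powr (1 - p) = \<kappa> * \<sigma>"
proof -
  have "\<kappa> powr (1 - p) = \<sigma> powr ((- 1 / p) * (1 - p))" by (simp add: \<kappa>_def powr_powr)
  also have "(- 1 / p) * (1 - p) = - 1 / p + 1" using p_pos by (simp add: field_simps)
  also have "\<sigma> powr (- 1 / p + 1) = \<sigma> powr (- 1 / p) * \<sigma> powr 1" by (rule powr_add)
  also have "\<dots> = \<kappa> * \<sigma>" using \<sigma>_pos by (simp add: \<kappa>_def)
  finally show ?thesis .
qed

text \<open>Chosen so that the cost of one step to a child equals (1 - \<kappa>) K3; together with
  the share \<kappa> K3 inherited from the child the constant then reproduces itself.\<close>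

definition K3 :: real where "K3 = (1 - \<kappa>) powr (1 - p) * K2 / (1 - \<kappa>)"

lemma K3_pos: "0 < K3"
  using K2_pos \<kappa> by (simp add: K3_def)

text \<open>The geometric decay of the level contributions is summed by absorbing a factor \<open>\<kappa>\<close>
  at each step of the induction.\<close>

lemma descendant_difference_le:
  assumes h: "martingale h" and x: "x \<in> level P n" and y: "y \<in> descendants P m x" and k: "n + m \<le> k"
  shows "\<bar>h x - h y\<bar> powr p \<le> K3 * (\<sigma> ^ k * energy_on P p k (descendants P (k - n) x) h) / \<sigma> ^ n"
  using x y k
proof (induction m arbitrary: x n)
  case 0
  then show ?case using K3_pos \<sigma>_pos energy_on_nonneg by simp
next
  case (Suc m)
  obtain z where z: "z \<in> children P x" "y \<in> descendants P m z" using Suc.prems by auto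
  have zl: "z \<in> level P (Suc n)" using z Suc.prems by (auto simp: level_Suc)
  define X where "X = \<sigma> ^ k * energy_on P p k (descendants P (k - n) x) h"
  define Z where "Z = \<sigma> ^ k * energy_on P p k (descendants P (k - Suc n) z) h"
  have "descendants P (k - Suc n) z \<subseteq> descendants P (k - n) x"
  proof -
    have "k - n = Suc (k - Suc n)" using Suc.prems by simp
    then show ?thesis using z by auto
  qed
  then have ZX: "Z \<le> X" using \<sigma>_pos by (auto simp: Z_def X_def intro!: mult_left_mono energy_on_mono)
  have X: "0 \<le> X" using \<sigma>_pos energy_on_nonneg by (simp add: X_def)
  have "\<bar>h x - h y\<bar> powr p \<le> (\<bar>h x - h z\<bar> + \<bar>h z - h y\<bar>) powr p"
    using p_pos by (intro powr_mono2) auto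
  also have "\<dots> \<le> (1 - \<kappa>) powr (1 - p) * \<bar>h x - h z\<bar> powr p + \<kappa> powr (1 - p) * \<bar>h z - h y\<bar> powr p"
    using p_gt_1 \<kappa> by (intro powr_add_weighted) auto
  also have "\<dots> \<le> (1 - \<kappa>) powr (1 - p) * (K2 * X / \<sigma> ^ Suc n) + \<kappa> powr (1 - p) * (K3 * X / \<sigma> ^ Suc n)"
  proof (intro add_mono mult_left_mono)
    show "\<bar>h x - h z\<bar> powr p \<le> K2 * X / \<sigma> ^ Suc n"
      unfolding X_def using Suc.prems by (intro child_difference_le[OF h _ z(1)]) auto
    have "\<bar>h z - h y\<bar> powr p \<le> K3 * Z / \<sigma> ^ Suc n"
      unfolding Z_def using Suc.prems by (intro Suc.IH[OF zl z(2)]) auto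
    also have "\<dots> \<le> K3 * X / \<sigma> ^ Suc n"
      using ZX K3_pos \<sigma>_pos by (intro divide_right_mono mult_left_mono) auto
    finally show "\<bar>h z - h y\<bar> powr p \<le> K3 * X / \<sigma> ^ Suc n" .
  qed auto
  also have "\<dots> = ((1 - \<kappa>) * K3 / \<sigma> + \<kappa> * K3) * (X / \<sigma> ^ n)"
  proof -
    have "(1 - \<kappa>) powr (1 - p) * (K2 * X / \<sigma> ^ Suc n) = ((1 - \<kappa>) powr (1 - p) * K2) / \<sigma> * (X / \<sigma> ^ n)"
      by simp
    also have "(1 - \<kappa>) powr (1 - p) * K2 = (1 - \<kappa>) * K3" using \<kappa> by (simp add: K3_def)
    finally have 1: "(1 - \<kappa>) powr (1 - p) * (K2 * X / \<sigma> ^ Suc n) = (1 - \<kappa>) * K3 / \<sigma> * (X / \<sigma> ^ n)" .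
    have 2: "\<kappa> powr (1 - p) * (K3 * X / \<sigma> ^ Suc n) = \<kappa> * K3 * (X / \<sigma> ^ n)"
      using \<sigma>_pos by (simp add: \<kappa>_powr)
    show ?thesis unfolding 1 2 by (simp only: distrib_right)
  qed
  also have "\<dots> \<le> ((1 - \<kappa>) * K3 + \<kappa> * K3) * (X / \<sigma> ^ n)"
    using \<kappa> K3_pos \<sigma>_gt_1 X by (intro mult_right_mono add_mono) (auto simp: pos_divide_le_eq)
  also have "\<dots> = K3 * X / \<sigma> ^ n" by (simp add: algebra_simps)
  finally show ?case by (simp add: X_def)
qed

lemma edge_difference_le:
  assumes "energy_bound p \<sigma> h B" "1 \<le> n" "(x, y) \<in> edges P n"
  shows "\<bar>h x - h y\<bar> powr p \<le> B / \<sigma> ^ n"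
proof -
  have "\<bar>h x - h y\<bar> powr p \<le> energy P p n h"
    unfolding energy_def by (rule edge_le_energy_on[OF assms(3)]) (use assms(3) in \<open>auto simp: edges_def\<close>)
  moreover have "energy P p n h \<le> B / \<sigma> ^ n"
    using assms(1,2) \<sigma>_pos by (simp add: pos_le_divide_eq mult.commute)
  ultimately show ?thesis by simp
qed

lemma energy_bound_nonneg: "energy_bound p \<sigma> h B \<Longrightarrow> 0 \<le> B"
  using \<sigma>_pos energy_nonneg[of p 1 h] by (metis le_refl mult_nonneg_nonneg order.trans zero_le_power less_imp_le)

lemma descendant_difference_bound:
  assumes h: "martingale h" "energy_bound p \<sigma> h B" and x: "x \<in> level P n" "y \<in> descendants P m x"
  shows "\<bar>h x - h y\<bar> powr p \<le> K3 * B / \<sigma> ^ n"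
proof -
  \<comment> \<open>The successor keeps the level positive when n and m are zero, since
    \<open>energy_bound\<close> says nothing about level 0.\<close>
  let ?k = "Suc (n + m)"
  have "\<bar>h x - h y\<bar> powr p \<le> K3 * (\<sigma> ^ ?k * energy_on P p ?k (descendants P (?k - n) x) h) / \<sigma> ^ n"
    by (rule descendant_difference_le[OF h(1) x]) simp
  also have "\<dots> \<le> K3 * B / \<sigma> ^ n"
  proof -
    have "energy_on P p ?k (descendants P (?k - n) x) h \<le> energy P p ?k h"
      unfolding energy_def using descendants_level[OF x(1), of "?k - n"] by (intro energy_on_mono) simp
    then have "\<sigma> ^ ?k * energy_on P p ?k (descendants P (?k - n) x) h \<le> \<sigma> ^ ?k * energy P p ?k h"
      using \<sigma>_pos by (intro mult_left_mono) auto
    also have "\<dots> \<le> B" using h(2) by auto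
    finally show ?thesis using K3_pos \<sigma>_pos by (intro divide_right_mono mult_left_mono) auto
  qed
  finally show ?thesis .
qed

definition K4 :: real where "K4 = 4 powr p * K3"

lemma K4_pos: "0 < K4"
  using K3_pos by (simp add: K4_def)

text \<open>A Morrey estimate. Point values are replaced by means at a level k so deep that u hardly
  oscillates there, and those means are compared with the mean at x by
  \<open>descendant_difference_le\<close>. Each comparison uses only energy below x, so the sum over
  x is at most the total energy at level k, whatever k is.\<close>

lemma osc_sum_le:
  assumes u: "continuous_on UNIV u" and B: "energy_bound p \<sigma> (cell_mean P \<mu> u) B"
  shows "\<sigma> ^ n * osc_sum p n u \<le> K4 * B"
proof -
  let ?h = "cell_mean P \<mu> u"
  have mart: "martingale ?h" by (rule martingale_cell_mean[OF continuous_integrable[OF u]])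
  have "osc_sum p n u \<le> K4 * B / \<sigma> ^ n + e" if e: "0 < e" for e
  proof -
    \<comment> \<open>The constant c exceeds by one the total weight with which the error e/c enters
      the sum over level n, and \<epsilon> solves (2\<epsilon>)^p = e/c; the total error is
      therefore at most e.\<close>
    define c where "c = 2 powr p * real (card (level P n)) + 1"
    have c: "0 < c" by (simp add: c_def add_nonneg_pos)
    define \<epsilon> where "\<epsilon> = (e / c) powr (1 / p) / 2"
    have \<epsilon>: "0 < \<epsilon>" using e c by (simp add: \<epsilon>_def)
    obtain n\<^sub>0 where n\<^sub>0: "\<And>k x. n\<^sub>0 \<le> k \<Longrightarrow> x \<in> level P k \<Longrightarrow> diameter (u ` cell P x) \<le> \<epsilon>"
      using oscillation_small[OF u \<epsilon>] by blast
    define k where "k = max n\<^sub>0 (Suc n)"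
    have k: "n\<^sub>0 \<le> k" "n \<le> k" "1 \<le> k" by (auto simp: k_def)
    define X where "X x = \<sigma> ^ k * energy_on P p k (descendants P (k - n) x) ?h" for x
    define T where "T x = 2 * (K3 * X x / \<sigma> ^ n) powr (1 / p)" for x
    have X: "0 \<le> X x" for x using \<sigma>_pos energy_on_nonneg by (simp add: X_def)
    have near: "\<bar>u z - ?h x\<bar> \<le> \<epsilon> + T x / 2" if x: "x \<in> level P n" and z: "z \<in> cell P x" for x z
    proof -
      obtain y where y: "y \<in> descendants P (k - n) x" "z \<in> cell P y" using descendant_at[OF x z] by metis
      have yl: "y \<in> level P k" using descendants_level[OF x, of "k - n"] y k by auto
      have "\<bar>?h y - u z\<bar> \<le> \<epsilon>"
        using cell_mean_osc[OF yl u y(2)] n\<^sub>0[OF k(1) yl] by simp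
      moreover have "\<bar>?h x - ?h y\<bar> powr p \<le> K3 * X x / \<sigma> ^ n"
        unfolding X_def using k by (intro descendant_difference_le[OF mart x y(1)]) simp
      then have "(\<bar>?h x - ?h y\<bar> powr p) powr (1 / p) \<le> (K3 * X x / \<sigma> ^ n) powr (1 / p)"
        using p_pos by (intro powr_mono2) auto
      then have "\<bar>?h x - ?h y\<bar> \<le> T x / 2" using p_pos by (simp add: powr_powr T_def)
      ultimately show ?thesis by linarith
    qed
    have "osc_sum p n u \<le> (\<Sum>x\<in>level P n. 4 powr p * K3 / \<sigma> ^ n * X x + e / c * 2 powr p)"
      unfolding osc_sum_def
    proof (rule sum_mono)
      fix x assume x: "x \<in> level P n"
      have "diameter (u ` cell P x) \<le> T x + 2 * \<epsilon>"
      proof (rule oscillation_leI)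
        fix z z' assume "z \<in> cell P x" "z' \<in> cell P x"
        then show "\<bar>u z - u z'\<bar> \<le> T x + 2 * \<epsilon>" using near[OF x, of z] near[OF x, of z'] by linarith
      qed (use \<epsilon> in \<open>simp add: T_def\<close>)
      then have "diameter (u ` cell P x) powr p \<le> (T x + 2 * \<epsilon>) powr p"
        using p_pos oscillation_nonneg[OF u] by (intro powr_mono2) auto
      also have "\<dots> \<le> 2 powr p * (T x powr p + (2 * \<epsilon>) powr p)"
        using p_pos \<epsilon> by (intro powr_add_le) (auto simp: T_def)
      also have "(2 * \<epsilon>) powr p = e / c" using p_pos e c by (simp add: \<epsilon>_def powr_powr)
      also have "T x powr p = 2 powr p * (K3 * X x / \<sigma> ^ n)"
        using p_pos K3_pos X \<sigma>_pos by (simp add: T_def powr_mult powr_powr)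
      also have "2 powr p * (2 powr p * (K3 * X x / \<sigma> ^ n) + e / c) = 4 powr p * K3 / \<sigma> ^ n * X x + e / c * 2 powr p"
        using powr_mult[of 2 2 p] by (simp add: algebra_simps)
      finally show "diameter (u ` cell P x) powr p \<le> 4 powr p * K3 / \<sigma> ^ n * X x + e / c * 2 powr p" .
    qed
    also have "\<dots> = 4 powr p * K3 / \<sigma> ^ n * (\<Sum>x\<in>level P n. X x) + e / c * (c - 1)"
      by (simp add: sum.distrib sum_distrib_left c_def)
    also have "\<dots> \<le> 4 powr p * K3 / \<sigma> ^ n * B + e"
    proof (intro add_mono mult_left_mono)
      have "(\<Sum>x\<in>level P n. X x) \<le> \<sigma> ^ k * energy P p k ?h"
        unfolding X_def sum_distrib_left[symmetric]
        using \<sigma>_pos k by (intro mult_left_mono sum_energy_on_descendants) auto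
      also have "\<dots> \<le> B" using B k by blast
      finally show "(\<Sum>x\<in>level P n. X x) \<le> B" .
      show "e / c * (c - 1) \<le> e" using e c by (simp add: field_simps)
    qed (use K3_pos \<sigma>_pos in auto)
    finally show ?thesis by (simp add: K4_def)
  qed
  then have "osc_sum p n u \<le> K4 * B / \<sigma> ^ n" by (rule field_le_epsilon)
  then show ?thesis using \<sigma>_pos by (simp add: pos_le_divide_eq mult.commute)
qed

lemma osc_cell_le:
  assumes "continuous_on UNIV u" "energy_bound p \<sigma> (cell_mean P \<mu> u) B" "x \<in> level P n"
  shows "diameter (u ` cell P x) powr p \<le> K4 * B / \<sigma> ^ n"
proof -
  have "diameter (u ` cell P x) powr p \<le> osc_sum p n u"
    unfolding osc_sum_def by (rule member_le_sum[OF assms(3)]) (auto simp: finite_level)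
  moreover have "osc_sum p n u \<le> K4 * B / \<sigma> ^ n"
    using osc_sum_le[OF assms(1,2), of n] \<sigma>_pos by (simp add: pos_le_divide_eq mult.commute)
  ultimately show ?thesis by simp
qed

text \<open>Membership in terms of oscillations, the form in which stability under Lipschitz
  operations and under composition with the \<open>f s\<close> can be seen.\<close>

lemma Wp_osc_iff:
  "u \<in> Wp P \<mu> p \<sigma> \<longleftrightarrow> continuous_on UNIV u \<and> (\<exists>B. \<forall>n\<ge>1. \<sigma> ^ n * osc_sum p n u \<le> B)"
proof -
  have "\<exists>B. energy_bound p \<sigma> (cell_mean P \<mu> u) B"
    if u: "continuous_on UNIV u" and B: "\<forall>n\<ge>1. \<sigma> ^ n * osc_sum p n u \<le> B" for B
  proof (intro exI allI impI)
    fix n :: nat assume n: "1 \<le> n"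
    have "\<sigma> ^ n * energy P p n (cell_mean P \<mu> u) \<le> \<sigma> ^ n * (N * 2 powr p * osc_sum p n u)"
      using \<sigma>_pos p_pos by (intro mult_left_mono energy_le_osc_sum[OF u]) auto
    also have "\<dots> = N * 2 powr p * (\<sigma> ^ n * osc_sum p n u)" by (simp add: mult_ac)
    also have "\<dots> \<le> N * 2 powr p * B" using B n by (intro mult_left_mono) auto
    finally show "\<sigma> ^ n * energy P p n (cell_mean P \<mu> u) \<le> N * 2 powr p * B" .
  qed
  then show ?thesis unfolding Wp_iff[OF p_pos] using osc_sum_le by blast
qed

end

context conductive_space
begin

section \<open>From martingales to continuous functions\<close>

lemma powr_level: "0 \<le> B \<Longrightarrow> (B / \<sigma> ^ n) powr (1 / p) = B powr (1 / p) * \<kappa> ^ n"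
proof -
  assume "0 \<le> B"
  have "(\<sigma> ^ n) powr (1 / p) = \<sigma> powr (n / p)"
    using \<sigma>_pos by (simp add: powr_realpow[symmetric] powr_powr)
  moreover have "\<kappa> ^ n = \<sigma> powr (- (n / p))"
    using \<sigma>_pos \<kappa> by (simp add: powr_realpow[symmetric] \<kappa>_def powr_powr)
  moreover have "(B / \<sigma> ^ n) powr (1 / p) = B powr (1 / p) / (\<sigma> ^ n) powr (1 / p)"
    by (rule powr_divide)
  ultimately show ?thesis by (simp add: powr_minus divide_inverse)
qed

lemma le_powr_inverse: "\<bar>t\<bar> powr p \<le> s \<Longrightarrow> \<bar>t\<bar> \<le> s powr (1 / p)"
proof -
  assume "\<bar>t\<bar> powr p \<le> s"
  then have "(\<bar>t\<bar> powr p) powr (1 / p) \<le> s powr (1 / p)" using p_pos by (intro powr_mono2) auto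
  then show ?thesis using p_pos by (simp add: powr_powr)
qed

lemma \<kappa>_tendsto: "(\<lambda>n. c * \<kappa> ^ n) \<longlonglongrightarrow> 0"
  using tendsto_mult_left[OF LIMSEQ_realpow_zero[of \<kappa>], of c] \<kappa> by simp

lemma \<kappa>_small: "0 < e \<Longrightarrow> \<exists>n\<ge>1. c * \<kappa> ^ n < e"
proof -
  assume "0 < e"
  then have "\<forall>\<^sub>F n in sequentially. c * \<kappa> ^ n < e" using order_tendstoD(2)[OF \<kappa>_tendsto] by blast
  then obtain n0 where "\<forall>n\<ge>n0. c * \<kappa> ^ n < e" by (auto simp: eventually_sequentially)
  then show ?thesis by (intro exI[of _ "max 1 n0"]) auto
qed

definition K5 :: real where "K5 = 1 + K3 powr (1 / p)"

lemma weighted_mean_diff: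
  "weighted_mean P \<mu> A g - weighted_mean P \<mu> A h = weighted_mean P \<mu> A (\<lambda>y. g y - h y)"
  by (simp add: weighted_mean_def diff_divide_distrib sum_subtractf left_diff_distrib)

lemma weighted_mean_cong:
  "(\<And>y. y \<in> A \<Longrightarrow> g y = h y) \<Longrightarrow> weighted_mean P \<mu> A g = weighted_mean P \<mu> A h"
  by (simp add: weighted_mean_def)

text \<open>Values along cells containing a fixed point form a Cauchy sequence with rate \<kappa>^n,
  whichever cells are picked, and nearby points are joined by M adjacent cells. This turns discrete
  data of bounded energy into an element of the function space.\<close>

lemma martingale_limit:
  assumes h: "martingale h" and B: "energy_bound p \<sigma> h B"
  obtains u where "continuous_on UNIV u" "\<And>n x. x \<in> level P n \<Longrightarrow> cell_mean P \<mu> u x = h x"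
    "\<And>n x z. 1 \<le> n \<Longrightarrow> x \<in> level P n \<Longrightarrow> z \<in> cell P x \<Longrightarrow> \<bar>h x - u z\<bar> \<le> K5 * B powr (1 / p) * \<kappa> ^ n"
proof -
  define e where "e n = B powr (1 / p) * \<kappa> ^ n" for n
  have B0: "0 \<le> B" by (rule energy_bound_nonneg[OF B])
  have e0: "0 \<le> e n" for n using \<kappa> by (simp add: e_def)
  have e_small: "\<exists>n\<ge>1. c * e n < \<epsilon>" if "0 < \<epsilon>" for c \<epsilon> :: real
    using \<kappa>_small[OF that, of "c * B powr (1 / p)"] by (simp add: e_def mult.assoc)
  have desc: "\<bar>h x - h y\<bar> \<le> K3 powr (1 / p) * e n" if "x \<in> level P n" "y \<in> descendants P m x" for x y n m
  proof -
    have "\<bar>h x - h y\<bar> \<le> (K3 * B / \<sigma> ^ n) powr (1 / p)"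
      by (rule le_powr_inverse[OF descendant_difference_bound[OF h B that]])
    also have "\<dots> = (K3 * B) powr (1 / p) * \<kappa> ^ n" using K3_pos B0 by (intro powr_level) simp
    finally show ?thesis using K3_pos B0 by (simp add: e_def powr_mult mult.assoc)
  qed
  have edge: "\<bar>h x - h y\<bar> \<le> e n" if "1 \<le> n" "(x, y) \<in> edges P n" for x y n
    using le_powr_inverse[OF edge_difference_le[OF B that]] powr_level[OF B0, of n] by (simp add: e_def)
  \<comment> \<open>The two cells need not be nested. The level-n ancestor w of y contains z too,
    hence equals x or is adjacent to it; this is the summand 1 in \<open>K5\<close>.\<close>
  have both: "\<bar>h x - h y\<bar> \<le> K5 * e n"
    if n: "1 \<le> n" "n \<le> l" and x: "x \<in> level P n" "z \<in> cell P x" and y: "y \<in> level P l" "z \<in> cell P y" for x y n l z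
  proof -
    obtain w where w: "w \<in> level P n" "y \<in> descendants P (l - n) w"
      using ancestor_at[of y n "l - n"] y n by auto
    have "z \<in> cell P w" using cell_subset[OF w] y by blast
    then have "\<bar>h x - h w\<bar> \<le> e n"
      using edge[OF n(1), of x w] x w e0 by (cases "x = w") (auto simp: edges_def)
    moreover have "\<bar>h w - h y\<bar> \<le> K3 powr (1 / p) * e n" by (rule desc[OF w])
    ultimately show ?thesis by (simp add: K5_def algebra_simps)
  qed
  define X where "X n z = (SOME x. x \<in> level P n \<and> z \<in> cell P x)" for n z
  have X: "X n z \<in> level P n" "z \<in> cell P (X n z)" for n z
  proof -
    have "\<exists>x. x \<in> level P n \<and> z \<in> cell P x" using cover_level[of n] by blast
    then have "X n z \<in> level P n \<and> z \<in> cell P (X n z)" unfolding X_def by (rule someI_ex)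
    then show "X n z \<in> level P n" "z \<in> cell P (X n z)" by auto
  qed
  define u where "u z = lim (\<lambda>n. h (X n z))" for z
  have conv: "(\<lambda>n. h (X n z)) \<longlonglongrightarrow> u z" for z
  proof -
    have "Cauchy (\<lambda>n. h (X n z))"
    proof (rule metric_CauchyI)
      fix \<epsilon> :: real assume "0 < \<epsilon>"
      then obtain n where n: "1 \<le> n" "(2 * K5) * e n < \<epsilon>" using e_small by blast
      have "dist (h (X l z)) (h (X l' z)) < \<epsilon>" if "n \<le> l" "n \<le> l'" for l l'
        using both[OF n(1) that(1) X X, of z] both[OF n(1) that(2) X X, of z] n(2)
        unfolding dist_real_def by linarith
      then show "\<exists>n. \<forall>l\<ge>n. \<forall>l'\<ge>n. dist (h (X l z)) (h (X l' z)) < \<epsilon>" by blast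
    qed
    then show ?thesis unfolding u_def using Cauchy_convergent_iff convergent_LIMSEQ_iff by blast
  qed
  have lim: "\<bar>h x - u z\<bar> \<le> K5 * e n" if n: "1 \<le> n" "x \<in> level P n" "z \<in> cell P x" for n x z
  proof (rule tendsto_upperbound)
    show "(\<lambda>l. \<bar>h x - h (X l z)\<bar>) \<longlonglongrightarrow> \<bar>h x - u z\<bar>" by (intro tendsto_intros conv)
    show "\<forall>\<^sub>F l in sequentially. \<bar>h x - h (X l z)\<bar> \<le> K5 * e n"
      using both[OF n(1) _ n(2,3) X] by (auto simp: eventually_sequentially)
  qed simp
  have cont: "continuous_on UNIV u"
    unfolding continuous_on_iff
  proof (intro ballI allI impI)
    fix z :: 'k and \<epsilon> :: real assume "0 < \<epsilon>"
    then obtain n where n: "1 \<le> n" "(real M + 2 * K5) * e n < \<epsilon>" using e_small by blast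
    have "dist (u z') (u z) < \<epsilon>" if "dist z' z < a * r ^ n" for z'
    proof -
      have "z' \<in> cell_nbhd P M z n" using ball_cell_nbhd(1)[OF n(1), of z] that by (auto simp: dist_commute)
      then obtain w v where w: "w \<in> level P n" "z \<in> cell P w" and v: "v \<in> nbhd P M w" "z' \<in> cell P v"
        by (auto simp: cell_nbhd_def)
      have "\<bar>h w - h v\<bar> \<le> real M * e n"
        by (rule nbhd_difference_le[OF w(1) v(1) edge[OF n(1)] e0])
      moreover have "\<bar>h w - u z\<bar> \<le> K5 * e n" by (rule lim[OF n(1) w])
      moreover have "\<bar>h v - u z'\<bar> \<le> K5 * e n"
        using nbhd_in_level[OF w(1)] v by (intro lim[OF n(1)]) auto
      ultimately have "\<bar>u z' - u z\<bar> \<le> (real M + 2 * K5) * e n" by (simp add: distrib_right)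
      then show ?thesis using n(2) by (simp add: dist_real_def)
    qed
    moreover have "0 < a * r ^ n" using scale_pos r by simp
    ultimately show "\<exists>d>0. \<forall>z'\<in>UNIV. dist z' z < d \<longrightarrow> dist (u z') (u z) < \<epsilon>" by blast
  qed
  \<comment> \<open>Both sides are martingales, so their difference at x is a mean of differences at
    arbitrarily deep levels, which tend to 0. \<open>Suc m\<close> guarantees a positive level, as
    \<open>lim\<close> demands.\<close>
  have mean: "cell_mean P \<mu> u x = h x" if x: "x \<in> level P n" for n x
  proof -
    have mu: "martingale (cell_mean P \<mu> u)" by (rule martingale_cell_mean[OF continuous_integrable[OF cont]])
    have "\<bar>cell_mean P \<mu> u x - h x\<bar> \<le> K5 * B powr (1 / p) * \<kappa> ^ (n + Suc m)" for m
    proof -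
      have "cell_mean P \<mu> u x - h x = weighted_mean P \<mu> (descendants P (Suc m) x) (\<lambda>y. cell_mean P \<mu> u y - h y)"
        unfolding weighted_mean_diff[symmetric] martingaleD[OF mu x] martingaleD[OF h x] by (rule refl)
      also have "\<bar>\<dots> - 0\<bar> \<le> K5 * e (n + Suc m)"
      proof (rule weighted_mean_dist_le[OF x])
        fix y assume "y \<in> descendants P (Suc m) x"
        then have y: "y \<in> level P (n + Suc m)" using descendants_level[OF x] by blast
        have "\<bar>cell_mean P \<mu> u y - h y\<bar> \<le> K5 * e (n + Suc m)"
          using lim[OF _ y] by (intro cell_mean_dist_le[OF y cont]) (auto simp: abs_minus_commute)
        then show "\<bar>cell_mean P \<mu> u y - h y - 0\<bar> \<le> K5 * e (n + Suc m)" by simp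
      qed
      finally show ?thesis by (simp add: e_def mult.assoc)
    qed
    moreover have "(\<lambda>m. K5 * B powr (1 / p) * \<kappa> ^ (n + Suc m)) \<longlonglongrightarrow> 0"
      using LIMSEQ_ignore_initial_segment[OF \<kappa>_tendsto, of "K5 * B powr (1 / p)" "Suc n"] by (simp add: add_ac)
    ultimately have "\<bar>cell_mean P \<mu> u x - h x\<bar> \<le> 0"
      by (intro tendsto_lowerbound[of _ 0]) auto
    then show ?thesis by simp
  qed
  show ?thesis using that[OF cont mean] lim by (simp add: e_def mult.assoc)
qed

section \<open>Hoelder continuity\<close>

definition \<tau> :: real where "\<tau> = - ln \<sigma> / ln r"

lemma \<tau>_pos: "0 < \<tau>"
  using \<sigma>_gt_1 r by (simp add: \<tau>_def divide_pos_neg ln_less_zero)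

lemma power_\<tau>: "(r ^ n) powr \<tau> = 1 / \<sigma> ^ n"
proof -
  have "(r ^ n) powr \<tau> = exp (\<tau> * (n * ln r))" using r by (simp add: powr_def ln_realpow)
  also have "\<tau> * (n * ln r) = - (n * ln \<sigma>)" using r by (simp add: \<tau>_def)
  also have "exp (- (n * ln \<sigma>)) = 1 / \<sigma> ^ n"
    using \<sigma>_pos by (simp add: exp_minus exp_of_nat_mult inverse_eq_divide)
  finally show ?thesis .
qed

text \<open>\<open>K4\<close> covers points at large distance, the second summand two oscillations
  and a chain of M edges. The factor \<sigma> / a^\<tau> pays for passing from level n to the scale
  a r^(n+1) of the distance.\<close>

definition K6 :: real where
  "K6 = (K4 + (2 * K4 powr (1 / p) + M) powr p) * \<sigma> / a powr \<tau>"

text \<open>The root cell is the whole space, and the oscillation estimate includes level 0.\<close>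

lemma global_oscillation:
  assumes "continuous_on UNIV u" "energy_bound p \<sigma> (cell_mean P \<mu> u) B"
  shows "\<bar>u z - u z'\<bar> powr p \<le> K4 * B"
proof -
  have "\<bar>u z - u z'\<bar> powr p \<le> diameter (u ` cell P (tree_root P)) powr p"
    using oscillation_le[OF assms(1), of z "cell P (tree_root P)" z'] p_pos
    by (intro powr_mono2) (auto simp: cell_root)
  also have "\<dots> \<le> K4 * B" using osc_cell_le[OF assms, of "tree_root P" 0] by (simp add: level_0)
  finally show ?thesis .
qed

text \<open>Take the last level n at which a r^n still exceeds the distance. The points then lie in
  cells joined by M adjacencies, and every error on this route has p-th power of order \<sigma>^(-n)
  = r^(n\<tau>).\<close>

lemma holder:
  assumes u: "continuous_on UNIV u" and B: "energy_bound p \<sigma> (cell_mean P \<mu> u) B"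
  shows "\<bar>u z - u z'\<bar> powr p \<le> K6 * B * dist z z' powr \<tau>"
proof (cases "z = z'")
  case False
  let ?c = "K4 + (2 * K4 powr (1 / p) + M) powr p"
  have B0: "0 \<le> B" by (rule energy_bound_nonneg[OF B])
  have d: "0 < dist z z'" using False by simp
  have *: "\<bar>u z - u z'\<bar> powr p \<le> K6 * B * dist z z' powr \<tau>"
    if le: "a * r ^ Suc n \<le> dist z z'" and est: "\<bar>u z - u z'\<bar> powr p \<le> ?c * B / \<sigma> ^ n" for n
  proof -
    have "1 / \<sigma> ^ Suc n = (r ^ Suc n) powr \<tau>" by (rule power_\<tau>[symmetric])
    also have "\<dots> \<le> (dist z z' / a) powr \<tau>"
      using le r scale_pos \<tau>_pos by (intro powr_mono2) (auto simp: pos_le_divide_eq mult.commute)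
    also have "\<dots> = dist z z' powr \<tau> / a powr \<tau>" using d scale_pos by (simp add: powr_divide)
    finally have "?c * B * \<sigma> * (1 / \<sigma> ^ Suc n) \<le> ?c * B * \<sigma> * (dist z z' powr \<tau> / a powr \<tau>)"
      using B0 K4_pos \<sigma>_pos by (intro mult_left_mono) auto
    then show ?thesis using est \<sigma>_pos by (simp add: K6_def mult_ac)
  qed
  show ?thesis
  proof (cases "a * r \<le> dist z z'")
    case True
    have "\<bar>u z - u z'\<bar> powr p \<le> ?c * B / \<sigma> ^ 0"
      using global_oscillation[OF u B, of z z'] B0 by (simp add: distrib_right)
        (metis add_increasing2 mult_nonneg_nonneg powr_ge_zero)
    then show ?thesis using True by (intro *[of 0]) auto
  next
    case less: False
    have "(\<lambda>n. a * r ^ n) \<longlonglongrightarrow> a * 0" using r by (intro tendsto_intros LIMSEQ_realpow_zero) auto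
    then have "\<forall>\<^sub>F n in sequentially. a * r ^ n < dist z z'" using d by (intro order_tendstoD(2)) auto
    then have ex: "\<exists>n. a * r ^ n \<le> dist z z'" by (auto simp: eventually_sequentially intro: less_imp_le)
    define k where "k = (LEAST n. a * r ^ n \<le> dist z z')"
    have k: "a * r ^ k \<le> dist z z'" unfolding k_def by (rule LeastI_ex[OF ex])
    have kmin: "dist z z' < a * r ^ n" if "n < k" for n using not_less_Least[of n "\<lambda>n. a * r ^ n \<le> dist z z'"] that by (simp add: k_def not_le)
    \<comment> \<open>The comparison of balls with cell neighbourhoods is available from level 1 on,
      so n = k - 1 must be positive; larger distances were treated by the global bound.\<close>
    have "k \<noteq> 0" "k \<noteq> 1"
    proof -
      have "a * r ^ 1 < a" using r scale_pos by simp
      then show "k \<noteq> 0" "k \<noteq> 1" using k less by (auto intro: ccontr)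
    qed
    then obtain n where n: "k = Suc n" "1 \<le> n" by (cases k) auto
    have "z' \<in> ball z (a * r ^ n)" using kmin[of n] n by simp
    then have "z' \<in> cell_nbhd P M z n" using ball_cell_nbhd(1)[OF n(2)] by blast
    then obtain w v where w: "w \<in> level P n" "z \<in> cell P w" and v: "v \<in> nbhd P M w" "z' \<in> cell P v"
      by (auto simp: cell_nbhd_def)
    have vl: "v \<in> level P n" using nbhd_in_level[OF w(1)] v by blast
    define e where "e = (B / \<sigma> ^ n) powr (1 / p)"
    have osc: "\<bar>cell_mean P \<mu> u x - u y\<bar> \<le> K4 powr (1 / p) * e" if "x \<in> level P n" "y \<in> cell P x" for x y
    proof -
      have "\<bar>cell_mean P \<mu> u x - u y\<bar> powr p \<le> diameter (u ` cell P x) powr p"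
        using cell_mean_osc[OF that(1) u that(2)] p_pos by (intro powr_mono2) auto
      also have "\<dots> \<le> K4 * (B / \<sigma> ^ n)" using osc_cell_le[OF u B that(1)] by simp
      finally have "\<bar>cell_mean P \<mu> u x - u y\<bar> \<le> (K4 * (B / \<sigma> ^ n)) powr (1 / p)" by (rule le_powr_inverse)
      also have "\<dots> = K4 powr (1 / p) * e" unfolding e_def by (rule powr_mult)
      finally show ?thesis .
    qed
    have "\<bar>cell_mean P \<mu> u w - cell_mean P \<mu> u v\<bar> \<le> M * e"
      unfolding e_def using le_powr_inverse[OF edge_difference_le[OF B n(2)]]
      by (intro nbhd_difference_le[OF w(1) v(1)]) auto
    then have "\<bar>u z - u z'\<bar> \<le> (2 * K4 powr (1 / p) + M) * e"
      using osc[OF w] osc[OF vl v(2)] unfolding distrib_right by linarith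
    then have "\<bar>u z - u z'\<bar> powr p \<le> ((2 * K4 powr (1 / p) + M) * e) powr p"
      using p_pos by (intro powr_mono2) auto
    also have "\<dots> = (2 * K4 powr (1 / p) + M) powr p * (B / \<sigma> ^ n)"
      using p_pos B0 \<sigma>_pos by (simp add: e_def powr_mult powr_powr)
    also have "\<dots> \<le> ?c * (B / \<sigma> ^ n)" using K4_pos B0 \<sigma>_pos by (intro mult_right_mono) auto
    finally show ?thesis using k n by (intro *[of n]) auto
  qed
qed simp

section \<open>Bump functions\<close>

text \<open>2 C is the rescaled energy of a near-minimizer; K1 is lost in averaging it to coarser
  levels.\<close>

definition K7 :: real where "K7 = 2 * C * K1"

lemma K7_pos: "0 < K7"
  using C_ge_1 K1_pos by (simp add: K7_def)

text \<open>Doubling the bound makes the inequality strict, so some admissible function attains it;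
  clipping to [0, 1] lowers the energy and keeps the prescribed values 0 and 1.\<close>

lemma conductance_minimizer:
  assumes m: "1 \<le> m" and n: "1 \<le> n" and x: "x \<in> level P n"
  obtains f where "\<And>y. y \<in> descendants P m x \<Longrightarrow> f y = 1"
    "\<And>y. y \<in> descendants_of_set P m (level P n - nbhd P M x) \<Longrightarrow> f y = 0"
    "\<And>y. 0 \<le> f y" "\<And>y. f y \<le> 1" "\<sigma> ^ m * energy P p (n + m) f \<le> 2 * C"
proof -
  let ?F = "{f. (\<forall>u\<in>descendants P m x. f u = 1) \<and>
      (\<forall>u\<in>descendants_of_set P m (level P (depth P x) - nbhd P M x). f u = (0::real))}"
  have d: "depth P x = n" by (rule depth_level[OF x])
  have "(INF f\<in>?F. ennreal (energy P p (depth P x + m) f)) \<le> conductance P M p m"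
    unfolding conductance_def using x n d
    by (intro SUP_upper2[of x]) (auto simp: level_def)
  also have "\<dots> \<le> ennreal (C / \<sigma> ^ m)" by (rule conductance_le[OF m])
  also have "\<dots> < ennreal (2 * C / \<sigma> ^ m)"
    using C_ge_1 \<sigma>_pos by (intro ennreal_lessI) (auto simp: divide_strict_right_mono)
  finally obtain f where f: "f \<in> ?F" "ennreal (energy P p (n + m) f) < ennreal (2 * C / \<sigma> ^ m)"
    unfolding INF_less_iff d by blast
  then have fe: "energy P p (n + m) f \<le> 2 * C / \<sigma> ^ m"
    using energy_nonneg[of p "n + m" f] by (subst (asm) ennreal_less_iff) auto
  define g where "g y = min 1 (max 0 (f y))" for y
  have "energy P p (n + m) g \<le> energy P p (n + m) f"
    unfolding energy_def energy_on_def
    using p_pos by (intro mult_left_mono sum_mono) (auto simp: g_def intro!: powr_mono2)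
  then have "energy P p (n + m) g \<le> 2 * C / \<sigma> ^ m" using fe by simp
  then have "\<sigma> ^ m * energy P p (n + m) g \<le> 2 * C" using \<sigma>_pos by (simp add: pos_le_divide_eq mult.commute)
  then show ?thesis using f(1) by (intro that[of g]) (auto simp: g_def d)
qed

lemma tendsto_abs_powr:
  assumes "(f \<longlongrightarrow> s) F" "(g \<longlongrightarrow> t) F"
  shows "((\<lambda>x. \<bar>f x - g x :: real\<bar> powr p) \<longlongrightarrow> \<bar>s - t\<bar> powr p) F"
  using assms p_pos by (intro tendsto_powr' tendsto_intros) auto

text \<open>Near-minimizers at ever deeper levels are averaged down to all coarser levels. These
  averages are bounded by 1, so a filter makes them converge at every vertex simultaneously; the
  limit is a martingale, keeps the uniform energy bound, and \<open>martingale_limit\<close>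
  applies.\<close>

lemma bump:
  assumes n: "1 \<le> n" and x: "x \<in> level P n"
  obtains u where "continuous_on UNIV u" "energy_bound p \<sigma> (cell_mean P \<mu> u) (K7 * \<sigma> ^ n)"
    "\<And>z. z \<in> cell P x \<Longrightarrow> u z = 1" "\<And>y z. y \<in> level P n - nbhd P M x \<Longrightarrow> z \<in> cell P y \<Longrightarrow> u z = 0"
proof -
  let ?Z = "level P n - nbhd P M x"
  have "\<exists>f. (\<forall>y\<in>descendants P (Suc m) x. f y = 1) \<and> (\<forall>y\<in>descendants_of_set P (Suc m) ?Z. f y = 0) \<and>
      (\<forall>y. 0 \<le> f y \<and> f y \<le> 1) \<and> \<sigma> ^ Suc m * energy P p (n + Suc m) f \<le> 2 * C" for m
    by (rule conductance_minimizer[OF _ n x, of "Suc m"], simp, blast)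
  then obtain f where f: "\<And>m y. y \<in> descendants P (Suc m) x \<Longrightarrow> f m y = 1"
    "\<And>m y. y \<in> descendants_of_set P (Suc m) ?Z \<Longrightarrow> f m y = 0"
    "\<And>m y. 0 \<le> f m y" "\<And>m y. f m y \<le> 1" "\<And>m. \<sigma> ^ Suc m * energy P p (n + Suc m) (f m) \<le> 2 * C"
    by metis
  \<comment> \<open>The first condition says that y is a vertex. Vertices deeper than the level of
    \<open>f m\<close> receive the default 0, harmless because every fixed depth is eventually
    exceeded along F.\<close>
  define g where "g m y = (if y \<in> level P (depth P y) \<and> depth P y \<le> n + Suc m
      then weighted_mean P \<mu> (descendants P (n + Suc m - depth P y) y) (f m) else 0)" for m y
  have g: "g m y = weighted_mean P \<mu> (descendants P (n + Suc m - k) y) (f m)" if "y \<in> level P k" "k \<le> n + Suc m" for m k y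
    using that depth_level[OF that(1)] by (simp add: g_def)
  have "\<bar>g m y\<bar> \<le> 1" for m y
    using weighted_mean_dist_le[of y "depth P y" "n + Suc m - depth P y" "f m" 0 1] f(3,4)
    by (auto simp: g_def)
  then obtain F where F: "F \<noteq> bot" "F \<le> sequentially" "\<And>y. \<exists>l. ((\<lambda>m. g m y) \<longlongrightarrow> l) F"
    using bounded_family_filter[of g "\<lambda>_. 1"] by blast
  then obtain h where h: "\<And>y. ((\<lambda>m. g m y) \<longlongrightarrow> h y) F" by metis
  have ev: "eventually (\<lambda>m. k \<le> n + Suc m) F" for k
    by (rule filter_leD[OF F(2)]) (auto simp: eventually_sequentially intro!: exI[of _ k])
  have mart: "martingale h"
    unfolding martingale_def
  proof (intro allI ballI)
    fix k j y assume y: "y \<in> level P k"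
    show "h y = weighted_mean P \<mu> (descendants P j y) h"
    proof (rule tendsto_unique[OF F(1) h])
      have "((\<lambda>m. weighted_mean P \<mu> (descendants P j y) (g m)) \<longlongrightarrow> weighted_mean P \<mu> (descendants P j y) h) F"
        unfolding weighted_mean_descendants[OF y] using measure_cell_pos[OF y]
        by (intro tendsto_intros h) auto
      moreover have "eventually (\<lambda>m. weighted_mean P \<mu> (descendants P j y) (g m) = g m y) F"
        using ev[of "k + j"]
      proof eventually_elim
        fix m assume m: "k + j \<le> n + Suc m"
        have "weighted_mean P \<mu> (descendants P j y) (g m)
            = weighted_mean P \<mu> (descendants P j y) (\<lambda>v. weighted_mean P \<mu> (descendants P (n + Suc m - (k + j)) v) (f m))"
          using g[OF _ m] descendants_level[OF y, of j] by (intro weighted_mean_cong) blast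
        also have "\<dots> = weighted_mean P \<mu> (descendants P (j + (n + Suc m - (k + j))) y) (f m)"
          by (rule weighted_mean_tower[OF y])
        also have "j + (n + Suc m - (k + j)) = n + Suc m - k" using m by simp
        finally show "weighted_mean P \<mu> (descendants P j y) (g m) = g m y" using g[OF y] m by simp
      qed
      ultimately show "((\<lambda>m. g m y) \<longlongrightarrow> weighted_mean P \<mu> (descendants P j y) h) F"
        by (rule Lim_transform_eventually)
    qed
  qed
  have bound: "energy_bound p \<sigma> h (K7 * \<sigma> ^ n)"
  proof (intro allI impI)
    fix k :: nat assume k: "1 \<le> k"
    have lim: "((\<lambda>m. \<sigma> ^ k * energy P p k (g m)) \<longlongrightarrow> \<sigma> ^ k * energy P p k h) F"
      unfolding energy_def energy_on_def case_prod_unfold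
      by (intro tendsto_intros tendsto_abs_powr h)
    have "eventually (\<lambda>m. \<sigma> ^ k * energy P p k (g m) \<le> K7 * \<sigma> ^ n) F"
      using ev[of k]
    proof eventually_elim
      fix m assume m: "k \<le> n + Suc m"
      have "energy P p k (g m) = energy P p k (\<lambda>y. weighted_mean P \<mu> (descendants P (n + Suc m - k) y) (f m))"
        unfolding energy_def using g[OF _ m] by (intro energy_on_cong) auto
      also have "\<dots> \<le> K1 * \<sigma> ^ (n + Suc m - k) * energy P p (k + (n + Suc m - k)) (f m)"
        by (rule energy_mean_le[OF k])
      finally have "\<sigma> ^ k * energy P p k (g m) \<le> \<sigma> ^ k * (K1 * \<sigma> ^ (n + Suc m - k) * energy P p (n + Suc m) (f m))"
        using \<sigma>_pos m by (intro mult_left_mono) auto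
      also have "\<dots> = K1 * (\<sigma> ^ (k + (n + Suc m - k)) * energy P p (n + Suc m) (f m))"
        by (simp only: power_add mult_ac)
      also have "\<dots> = K1 * \<sigma> ^ n * (\<sigma> ^ Suc m * energy P p (n + Suc m) (f m))"
        using m by (simp add: power_add mult_ac)
      also have "\<dots> \<le> K1 * \<sigma> ^ n * (2 * C)"
        using K1_pos \<sigma>_pos by (intro mult_left_mono f(5)) auto
      finally show "\<sigma> ^ k * energy P p k (g m) \<le> K7 * \<sigma> ^ n" by (simp add: K7_def mult_ac)
    qed
    then show "\<sigma> ^ k * energy P p k h \<le> K7 * \<sigma> ^ n"
      by (rule tendsto_upperbound[OF lim _ F(1)])
  qed
  obtain u where u: "continuous_on UNIV u" "\<And>k y. y \<in> level P k \<Longrightarrow> cell_mean P \<mu> u y = h y"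
    "\<And>k y z. 1 \<le> k \<Longrightarrow> y \<in> level P k \<Longrightarrow> z \<in> cell P y \<Longrightarrow> \<bar>h y - u z\<bar> \<le> K5 * (K7 * \<sigma> ^ n) powr (1 / p) * \<kappa> ^ k"
    by (rule martingale_limit[OF mart bound], rule that) blast+
  \<comment> \<open>Means of a function constant below w equal that constant, so h is constant on
    the whole subtree of w, and u(z) is a limit of h along deeper cells around z.\<close>
  have const: "u z = c" if w: "w \<in> level P n" "z \<in> cell P w" and c: "\<And>m y. y \<in> descendants P (Suc m) w \<Longrightarrow> f m y = c" for w z c
  proof -
    have hc: "h y = c" if y: "y \<in> descendants P j w" for j y
    proof (rule tendsto_unique[OF F(1) h])
      have "eventually (\<lambda>m. g m y = c) F" using ev[of "n + j"]
      proof eventually_elim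
        fix m assume m: "n + j \<le> n + Suc m"
        have "v \<in> descendants P (Suc m) w" if "v \<in> descendants P (n + Suc m - (n + j)) y" for v
        proof -
          have "Suc m = j + (n + Suc m - (n + j))" using m by simp
          then have "descendants P (Suc m) w = (\<Union>y\<in>descendants P j w. descendants P (n + Suc m - (n + j)) y)"
            by (metis descendants_add)
          then show ?thesis using y that by blast
        qed
        moreover have "y \<in> level P (n + j)" using descendants_level[OF w(1)] y by blast
        ultimately show "g m y = c" using g[OF _ m] weighted_mean_const c by metis
      qed
      then show "((\<lambda>m. g m y) \<longlongrightarrow> c) F" by (rule tendsto_eventually)
    qed
    have "\<bar>c - u z\<bar> \<le> K5 * (K7 * \<sigma> ^ n) powr (1 / p) * \<kappa> ^ (n + j)" for j
    proof -
      obtain y where y: "y \<in> descendants P j w" "z \<in> cell P y" using descendant_at[OF w] by metis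
      then have "y \<in> level P (n + j)" using descendants_level[OF w(1)] by blast
      then show ?thesis using u(3)[of "n + j" y z] y n hc[OF y(1)] by simp
    qed
    moreover have "(\<lambda>j. K5 * (K7 * \<sigma> ^ n) powr (1 / p) * \<kappa> ^ (n + j)) \<longlonglongrightarrow> 0"
      using LIMSEQ_ignore_initial_segment[OF \<kappa>_tendsto, of "K5 * (K7 * \<sigma> ^ n) powr (1 / p)" n] by (simp add: add_ac)
    ultimately have "\<bar>c - u z\<bar> \<le> 0" by (intro tendsto_lowerbound[of _ 0]) auto
    then show ?thesis by simp
  qed
  have "energy_bound p \<sigma> (cell_mean P \<mu> u) (K7 * \<sigma> ^ n)"
  proof -
    have "energy P p k (cell_mean P \<mu> u) = energy P p k h" for k
      unfolding energy_def using u(2) by (intro energy_on_cong) auto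
    then show ?thesis using bound by simp
  qed
  moreover have "u z = 1" if "z \<in> cell P x" for z
    using const[OF x that] f(1) by blast
  moreover have "u z = 0" if "y \<in> ?Z" "z \<in> cell P y" for y z
  proof (rule const[of y])
    show "f m v = 0" if "v \<in> descendants P (Suc m) y" for m v
      using that \<open>y \<in> ?Z\<close> by (intro f(2)) (auto simp only: descendants_of_set_def)
  qed (use that in auto)
  ultimately show ?thesis using that u(1) by blast
qed

text \<open>The summand 1 treats the case that level 1 already separates the points, b^\<tau> all
  other cases, and \<sigma> the difference between the exponents k and k + 1.\<close>

definition K8 :: real where "K8 = K7 * \<sigma> * (1 + b powr \<tau>)"

lemma K8_pos: "0 < K8"
  using K7_pos \<sigma>_pos by (simp add: K8_def add_pos_nonneg)

text \<open>A bump at the first positive level whose cell neighbourhoods are too small to reach from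
  z to z'. Minimality of that level bounds its energy by a power of the distance.\<close>

lemma separating_function:
  assumes zz: "z \<noteq> z'"
  obtains u where "continuous_on UNIV u" "u z = 1" "u z' = 0"
    "energy_bound p \<sigma> (cell_mean P \<mu> u) (K8 * dist z z' powr (- \<tau>))"
proof -
  have d: "0 < dist z z'" using zz by simp
  have "(\<lambda>n. b * r ^ n) \<longlonglongrightarrow> b * 0" using r by (intro tendsto_intros LIMSEQ_realpow_zero) auto
  then have "\<forall>\<^sub>F n in sequentially. b * r ^ n < dist z z'" using d by (intro order_tendstoD(2)) auto
  then obtain n0 where "\<forall>n\<ge>n0. b * r ^ n < dist z z'" by (auto simp: eventually_sequentially)
  then have "b * r ^ Suc n0 \<le> dist z z'" by (meson le_SucI order_refl less_imp_le)
  then have "\<exists>n. b * r ^ Suc n \<le> dist z z'" by blast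
  then obtain k where k: "b * r ^ Suc k \<le> dist z z'" and kmin: "\<And>i. i < k \<Longrightarrow> dist z z' < b * r ^ Suc i"
    using exists_least_iff[of "\<lambda>n. b * r ^ Suc n \<le> dist z z'"] by (auto simp: not_le)
  let ?n = "Suc k"
  obtain x where x: "x \<in> level P ?n" "z \<in> cell P x" using cover_level[of ?n] by blast
  obtain y where y: "y \<in> level P ?n" "z' \<in> cell P y" using cover_level[of ?n] by blast
  have "z' \<notin> cell_nbhd P M z ?n" using ball_cell_nbhd(2)[of ?n z] k by auto
  then have "y \<notin> nbhd P M x" using x y by (auto simp: cell_nbhd_def)
  obtain u where u: "continuous_on UNIV u" "energy_bound p \<sigma> (cell_mean P \<mu> u) (K7 * \<sigma> ^ ?n)"
    "\<And>z. z \<in> cell P x \<Longrightarrow> u z = 1" "\<And>y z. y \<in> level P ?n - nbhd P M x \<Longrightarrow> z \<in> cell P y \<Longrightarrow> u z = 0"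
    by (rule bump[OF _ x(1)]) auto
  have "\<sigma> ^ k \<le> (1 + b powr \<tau>) * dist z z' powr (- \<tau>)"
  proof (cases k)
    case 0
    \<comment> \<open>The normalisation of the diameter to 1 enters here.\<close>
    have "1 \<le> dist z z' powr (- \<tau>)"
      using dist_le_1[of z z'] d \<tau>_pos powr_mono2'[of "- \<tau>" "dist z z'" 1] by simp
    then show ?thesis using 0 mult_mono[of 1 "1 + b powr \<tau>" 1 "dist z z' powr (- \<tau>)"] by simp
  next
    case (Suc i)
    then have "dist z z' / b \<le> r ^ k" using kmin[of i] scale_pos by (simp add: pos_divide_le_eq mult.commute)
    then have "(dist z z' / b) powr \<tau> \<le> (r ^ k) powr \<tau>" using d scale_pos \<tau>_pos by (intro powr_mono2) auto
    then have "dist z z' powr \<tau> * \<sigma> ^ k \<le> b powr \<tau>"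
      using d scale_pos \<sigma>_pos by (simp add: power_\<tau> powr_divide field_simps)
    then have "\<sigma> ^ k \<le> b powr \<tau> * dist z z' powr (- \<tau>)"
      using d by (simp add: powr_minus field_simps)
    also have "\<dots> \<le> (1 + b powr \<tau>) * dist z z' powr (- \<tau>)" by (intro mult_right_mono) auto
    finally show ?thesis .
  qed
  then have le: "K7 * \<sigma> ^ ?n \<le> K8 * dist z z' powr (- \<tau>)"
    using K7_pos \<sigma>_pos by (simp add: K8_def mult_left_mono mult.assoc)
  have "energy_bound p \<sigma> (cell_mean P \<mu> u) (K8 * dist z z' powr (- \<tau>))"
    using u(2) le order.trans by blast
  then show ?thesis using that[of u] u(1,3,4) x y \<open>y \<notin> nbhd P M x\<close> by blast
qed

section \<open>Lattice and algebra properties\<close>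

lemma Wp_continuous: "u \<in> Wp P \<mu> p \<sigma> \<Longrightarrow> continuous_on UNIV u"
  by (simp add: Wp_def)

text \<open>The hypothesis passes to oscillations on every cell and then to their p-th power sums.
  Sums, multiples, truncations and products are all instances.\<close>

lemma Wp_lipschitz:
  assumes u: "u \<in> Wp P \<mu> p \<sigma>" and v: "v \<in> Wp P \<mu> p \<sigma>" and w: "continuous_on UNIV w"
    and c: "0 \<le> c" "0 \<le> d"
    and le: "\<And>z z'. \<bar>w z - w z'\<bar> \<le> c * \<bar>u z - u z'\<bar> + d * \<bar>v z - v z'\<bar>"
  shows "w \<in> Wp P \<mu> p \<sigma>"
proof -
  note cu = Wp_continuous[OF u] and cv = Wp_continuous[OF v]
  obtain B where B: "\<forall>n\<ge>1. \<sigma> ^ n * osc_sum p n u \<le> B" using u Wp_osc_iff by blast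
  obtain D where D: "\<forall>n\<ge>1. \<sigma> ^ n * osc_sum p n v \<le> D" using v Wp_osc_iff by blast
  have "\<sigma> ^ n * osc_sum p n w \<le> 2 powr p * (c powr p * B + d powr p * D)" if n: "1 \<le> n" for n
  proof -
    have "osc_sum p n w \<le> (\<Sum>x\<in>level P n. 2 powr p * (c powr p * diameter (u ` cell P x) powr p + d powr p * diameter (v ` cell P x) powr p))"
      unfolding osc_sum_def
    proof (rule sum_mono)
      fix x
      let ?U = "diameter (u ` cell P x)" and ?V = "diameter (v ` cell P x)"
      have "diameter (w ` cell P x) \<le> c * ?U + d * ?V"
      proof (rule oscillation_leI)
        fix z z' assume "z \<in> cell P x" "z' \<in> cell P x"
        then have "c * \<bar>u z - u z'\<bar> + d * \<bar>v z - v z'\<bar> \<le> c * ?U + d * ?V"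
          using c by (intro add_mono mult_left_mono oscillation_le cu cv) auto
        then show "\<bar>w z - w z'\<bar> \<le> c * ?U + d * ?V" using le[of z z'] by linarith
      qed (use c oscillation_nonneg[OF cu] oscillation_nonneg[OF cv] in auto)
      then have "diameter (w ` cell P x) powr p \<le> (c * ?U + d * ?V) powr p"
        using p_pos oscillation_nonneg[OF w] by (intro powr_mono2) auto
      also have "\<dots> \<le> 2 powr p * ((c * ?U) powr p + (d * ?V) powr p)"
        using p_pos c oscillation_nonneg[OF cu] oscillation_nonneg[OF cv] by (intro powr_add_le) auto
      finally show "diameter (w ` cell P x) powr p \<le> 2 powr p * (c powr p * ?U powr p + d powr p * ?V powr p)"
        using c oscillation_nonneg[OF cu] oscillation_nonneg[OF cv] by (simp add: powr_mult)
    qed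
    also have "\<dots> = 2 powr p * (c powr p * osc_sum p n u + d powr p * osc_sum p n v)"
      by (simp add: osc_sum_def sum.distrib sum_distrib_left distrib_left)
    finally have "\<sigma> ^ n * osc_sum p n w \<le> \<sigma> ^ n * (2 powr p * (c powr p * osc_sum p n u + d powr p * osc_sum p n v))"
      using \<sigma>_pos by (intro mult_left_mono) auto
    also have "\<dots> = 2 powr p * (c powr p * (\<sigma> ^ n * osc_sum p n u) + d powr p * (\<sigma> ^ n * osc_sum p n v))"
      by (simp add: algebra_simps)
    also have "\<dots> \<le> 2 powr p * (c powr p * B + d powr p * D)"
      using B D n by (intro mult_left_mono add_mono) auto
    finally show ?thesis .
  qed
  then show ?thesis using w unfolding Wp_osc_iff by blast
qed

lemma const_in_Wp: "(\<lambda>x. c) \<in> Wp P \<mu> p \<sigma>"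
proof -
  have "osc_sum p n (\<lambda>x::'k. c) = 0" for n
    unfolding osc_sum_def
  proof (intro sum.neutral ballI)
    fix x
    have "diameter ((\<lambda>x::'k. c) ` cell P x) \<le> 0" by (rule oscillation_leI) auto
    moreover have "0 \<le> diameter ((\<lambda>x::'k. c) ` cell P x)" by (rule oscillation_nonneg) simp
    ultimately show "diameter ((\<lambda>x::'k. c) ` cell P x) powr p = 0" by simp
  qed
  then show ?thesis unfolding Wp_osc_iff by auto
qed

lemma function_space_Wp: "function_space (Wp P \<mu> p \<sigma>)"
  unfolding function_space_def
proof (intro conjI ballI allI)
  show "(\<lambda>x. 0) \<in> Wp P \<mu> p \<sigma>" by (rule const_in_Wp)
  show "(\<lambda>x. u x + v x) \<in> Wp P \<mu> p \<sigma>" if "u \<in> Wp P \<mu> p \<sigma>" "v \<in> Wp P \<mu> p \<sigma>" for u v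
  proof (rule Wp_lipschitz[OF that, of _ 1 1])
    show "continuous_on UNIV (\<lambda>x. u x + v x)" using that by (intro continuous_intros Wp_continuous)
  qed auto
  show "(\<lambda>x. c * u x) \<in> Wp P \<mu> p \<sigma>" if "u \<in> Wp P \<mu> p \<sigma>" for u c
  proof (rule Wp_lipschitz[OF that that, of _ "\<bar>c\<bar>" 0])
    show "continuous_on UNIV (\<lambda>x. c * u x)" using that by (intro continuous_intros Wp_continuous)
  qed (auto simp: right_diff_distrib[symmetric] abs_mult)
qed

lemma truncation_in_Wp: "u \<in> Wp P \<mu> p \<sigma> \<Longrightarrow> unit_truncation u \<in> Wp P \<mu> p \<sigma>"
  unfolding unit_truncation_def
proof (rule Wp_lipschitz[of u u _ 1 0])
  assume "u \<in> Wp P \<mu> p \<sigma>"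
  then show "continuous_on UNIV (\<lambda>x. min (max (u x) 0) 1)"
    by (intro continuous_on_min continuous_on_max continuous_on_const Wp_continuous)
qed auto

lemma mult_in_Wp:
  assumes u: "u \<in> Wp P \<mu> p \<sigma>" and v: "v \<in> Wp P \<mu> p \<sigma>"
  shows "(\<lambda>x. u x * v x) \<in> Wp P \<mu> p \<sigma>"
proof -
  have "bounded (range u)" "bounded (range v)"
    using u v by (auto intro!: compact_imp_bounded compact_continuous_image compact_UNIV Wp_continuous)
  then obtain U V where U: "\<And>x. \<bar>u x\<bar> \<le> U" and V: "\<And>x. \<bar>v x\<bar> \<le> V" by (auto simp: bounded_iff)
  have UV: "0 \<le> U" "0 \<le> V" using U[of undefined] V[of undefined] by linarith+
  show ?thesis
  proof (rule Wp_lipschitz[OF u v _ UV(2,1)])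
    show "continuous_on UNIV (\<lambda>x. u x * v x)" using u v by (intro continuous_intros Wp_continuous)
    fix z z'
    have "u z * v z - u z' * v z' = v z * (u z - u z') + u z' * (v z - v z')" by (simp add: algebra_simps)
    then have "\<bar>u z * v z - u z' * v z'\<bar> \<le> \<bar>v z\<bar> * \<bar>u z - u z'\<bar> + \<bar>u z'\<bar> * \<bar>v z - v z'\<bar>"
      using abs_triangle_ineq[of "v z * (u z - u z')" "u z' * (v z - v z')"] by (simp add: abs_mult)
    also have "\<dots> \<le> V * \<bar>u z - u z'\<bar> + U * \<bar>v z - v z'\<bar>" using U V by (intro add_mono mult_right_mono) auto
    finally show "\<bar>u z * v z - u z' * v z'\<bar> \<le> V * \<bar>u z - u z'\<bar> + U * \<bar>v z - v z'\<bar>" .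
  qed
qed

text \<open>Stone-Weierstrass for the algebra formed by the space; it contains constants, and
  \<open>separating_function\<close> separates points.\<close>

lemma Wp_dense:
  assumes "continuous_on UNIV g" "0 < e"
  obtains u where "u \<in> Wp P \<mu> p \<sigma>" "\<And>x. \<bar>g x - u x\<bar> < e"
proof -
  interpret function_ring_on "Wp P \<mu> p \<sigma>" UNIV
  proof
    show "compact (UNIV :: 'k set)" by (rule compact_UNIV)
    show "\<exists>f\<in>Wp P \<mu> p \<sigma>. f x \<noteq> f y" if neq: "x \<noteq> y" for x y
    proof -
      obtain u where "continuous_on UNIV u" "u x = 1" "u y = 0"
        "energy_bound p \<sigma> (cell_mean P \<mu> u) (K8 * dist x y powr (- \<tau>))"
        by (rule separating_function[OF neq])
      then show ?thesis using Wp_iff[OF p_pos] by (intro bexI[of _ u]) auto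
    qed
  qed (use function_space_Wp in \<open>auto simp: function_space_def Wp_continuous mult_in_Wp const_in_Wp\<close>)
  show ?thesis using Stone_Weierstrass_basic[OF assms] that by blast
qed

end

section \<open>Conductances above the Ahlfors regular conformal dimension\<close>

text \<open>A continuous injection of an interval is strictly monotone. If 0 were attained at a
  positive point, a strictly monotone function would be negative on one side of it; this fixes the
  value at 0 and the direction of monotonicity.\<close>

lemma homeomorphism_halfline:
  fixes \<eta> \<theta> :: "real \<Rightarrow> real"
  assumes "homeomorphism {0..} {0..} \<eta> \<theta>"
  shows "\<eta> 0 = 0" "0 \<le> s \<Longrightarrow> s \<le> t \<Longrightarrow> \<eta> s \<le> \<eta> t" "continuous_on {0..} \<eta>" "0 \<le> t \<Longrightarrow> 0 \<le> \<eta> t"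
proof -
  have im: "\<eta> ` {0..} = {0..}" and cont: "continuous_on {0..} \<eta>" and inv: "\<And>x. 0 \<le> x \<Longrightarrow> \<theta> (\<eta> x) = x"
    using assms by (auto simp: homeomorphism_def)
  have inj: "inj_on \<eta> {0..}" by (rule inj_on_inverseI[of _ \<theta>]) (use inv in auto)
  have nonneg: "0 \<le> \<eta> t" if "0 \<le> t" for t using im that by auto
  have mono: "(\<eta> 0 < \<eta> s \<and> \<eta> s < \<eta> t) \<or> (\<eta> t < \<eta> s \<and> \<eta> s < \<eta> 0)" if "0 < s" "s < t" for s t
    by (rule continuous_inj_imp_mono[OF that])
      (auto intro!: continuous_on_subset[OF cont] inj_on_subset[OF inj])
  obtain t0 where t0: "0 \<le> t0" "\<eta> t0 = 0" using im by force
  have "t0 = 0"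
  proof (rule ccontr)
    assume "t0 \<noteq> 0"
    then have "0 < t0" "t0 < t0 + 1" using t0 by auto
    from mono[OF this] show False using nonneg[of 0] nonneg[of "t0 + 1"] t0 by auto
  qed
  then show zero: "\<eta> 0 = 0" using t0 by simp
  show "\<eta> s \<le> \<eta> t" if st: "0 \<le> s" "s \<le> t" for s t
  proof -
    consider "s = 0" | "s = t" | "0 < s" "s < t" using st by linarith
    then show ?thesis
    proof cases
      case 1
      then show ?thesis using nonneg[of t] st zero by simp
    next
      case 3
      from mono[OF this] nonneg[OF st(1)] show ?thesis unfolding zero by linarith
    qed simp
  qed
  show "continuous_on {0..} \<eta>" by (rule cont)
  show "0 \<le> \<eta> t" if "0 \<le> t" for t by (rule nonneg[OF that])
qed

text \<open>Ahlfors regularity and quasisymmetry in the form used for cut-off functions: \<rho> is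
  bounded by R, the upper volume bound holds for all radii, the lower one up to R, and quasisymmetry
  is free of quotients.\<close>

locale ahlfors_space = cell_space P \<mu> r a b M N
  for P :: "('t, 'k::metric_space) cell_tree" and \<mu> :: "'k measure"
    and r a b :: real and M N :: nat +
  fixes \<rho> :: "'k \<Rightarrow> 'k \<Rightarrow> real" and \<nu> :: "'k measure" and \<eta> :: "real \<Rightarrow> real" and \<alpha> c c' R :: real
  assumes \<rho>_pos: "x \<noteq> y \<Longrightarrow> 0 < \<rho> x y" and \<rho>_refl: "\<rho> x x = 0" and \<rho>_sym: "\<rho> x y = \<rho> y x"
    and \<rho>_triangle: "\<rho> x z \<le> \<rho> x y + \<rho> y z" and \<rho>_le: "\<rho> x y \<le> R"
    and \<eta>_mono: "0 \<le> s \<Longrightarrow> s \<le> t \<Longrightarrow> \<eta> s \<le> \<eta> t" and \<eta>_nonneg: "0 \<le> t \<Longrightarrow> 0 \<le> \<eta> t"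
    and \<eta>_small: "0 < e \<Longrightarrow> \<exists>d>0. \<forall>t. 0 \<le> t \<and> t < d \<longrightarrow> \<eta> t < e"
    and quasisymmetric: "\<lbrakk>x \<noteq> z; dist x y \<le> t * dist x z; 0 \<le> t\<rbrakk> \<Longrightarrow> \<rho> x y \<le> \<eta> t * \<rho> x z"
    and finite_\<nu>: "finite_measure \<nu>" and sets_\<nu>: "sets \<nu> = sets borel"
    and \<rho>_ball: "{y. \<rho> x y < s} \<in> sets borel"
    and \<nu>_lower: "\<lbrakk>0 < s; s \<le> R\<rbrakk> \<Longrightarrow> c * s powr \<alpha> \<le> measure \<nu> {y. \<rho> x y < s}"
    and \<nu>_upper: "0 < s \<Longrightarrow> measure \<nu> {y. \<rho> x y < s} \<le> c' * s powr \<alpha>"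
    and c_pos: "0 < c" "0 < c'" and \<alpha>_nonneg: "0 \<le> \<alpha>"
begin

lemma \<rho>_nonneg: "0 \<le> \<rho> x y"
  by (cases "x = y") (auto simp: \<rho>_refl less_imp_le[OF \<rho>_pos])

lemma cell_sets_\<nu>: "x \<in> level P n \<Longrightarrow> cell P x \<in> sets \<nu>"
  using cell_sets sets_\<mu> sets_\<nu> by simp

text \<open>Overlaps of cells are known to be null for \<mu> but not for \<nu>, so multiplicity is
  bounded instead: at most \<open>N\<close> cells pass through any point.\<close>

lemma sum_measure_cells_le:
  assumes B: "B \<subseteq> level P n"
  shows "(\<Sum>x\<in>B. measure \<nu> (cell P x)) \<le> N * measure \<nu> (\<Union>x\<in>B. cell P x)"
proof -
  interpret \<nu>: finite_measure \<nu> by (rule finite_\<nu>)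
  have fin: "finite B" using B finite_level finite_subset by blast
  have meas: "cell P x \<in> sets \<nu>" if "x \<in> B" for x using that B cell_sets_\<nu> by blast
  have UN: "(\<Union>x\<in>B. cell P x) \<in> sets \<nu>" using fin meas by (intro sets.finite_UN) auto
  have sp: "space \<nu> = UNIV" using sets_eq_imp_space_eq[OF sets_\<nu>] by simp
  have "(\<Sum>x\<in>B. measure \<nu> (cell P x)) = (\<Sum>x\<in>B. \<integral>z. indicator (cell P x) z \<partial>\<nu>)"
    using meas by (intro sum.cong) (auto simp: sp)
  also have "\<dots> = (\<integral>z. (\<Sum>x\<in>B. indicator (cell P x) z) \<partial>\<nu>)"
    using meas by (intro Bochner_Integration.integral_sum[symmetric]) (auto simp: \<nu>.emeasure_eq_measure)
  also have "\<dots> \<le> (\<integral>z. real N * indicator (\<Union>x\<in>B. cell P x) z \<partial>\<nu>)"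
  proof (rule integral_mono)
    show "integrable \<nu> (\<lambda>z. \<Sum>x\<in>B. indicator (cell P x) z :: real)"
      using meas by (intro Bochner_Integration.integrable_sum) (auto simp: \<nu>.emeasure_eq_measure)
    show "integrable \<nu> (\<lambda>z. real N * indicator (\<Union>x\<in>B. cell P x) z :: real)"
      using UN by (intro integrable_mult_right) (auto simp: \<nu>.emeasure_eq_measure)
    fix z
    have "(\<Sum>x\<in>B. indicator (cell P x) z :: real) = card {x \<in> B. z \<in> cell P x}"
      using fin by (simp add: indicator_def sum.If_cases Int_def)
    also have "\<dots> \<le> N"
      using card_cells_at[of n z] card_mono[of "{x \<in> level P n. z \<in> cell P x}" "{x \<in> B. z \<in> cell P x}"] B finite_level
      by (force intro: order.trans)
    finally have "(\<Sum>x\<in>B. indicator (cell P x) z :: real) \<le> N" .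
    then show "(\<Sum>x\<in>B. indicator (cell P x) z) \<le> real N * indicator (\<Union>x\<in>B. cell P x) z"
      by (cases "z \<in> (\<Union>x\<in>B. cell P x)") auto
  qed
  also have "\<dots> = N * measure \<nu> (\<Union>x\<in>B. cell P x)" using UN by (simp add: sp)
  finally show ?thesis .
qed

lemma cell_two_points:
  assumes "x \<in> level P n"
  obtains z z' where "z \<in> cell P x" "z' \<in> cell P x" "a * r ^ n \<le> dist z z'"
proof -
  obtain z z' where "z \<in> cell P x" "z' \<in> cell P x" "dist z z' = diameter (cell P x)"
    using diameter_compact_attained[OF compact_cell[OF assms] cell_nonempty[OF assms]] by blast
  then show ?thesis using that diameter_cell(1)[OF assms] by simp
qed

text \<open>The bound on \<open>d\<close> holds because the cell contains a \<open>\<rho>\<close>-ball of radius comparable to \<open>d\<close>.\<close>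

lemma cell_center:
  assumes n: "1 \<le> n" and x: "x \<in> level P n"
  shows "\<exists>z d. z \<in> cell P x \<and> 0 < d \<and> (\<forall>y\<in>cell P x. \<rho> z y \<le> d) \<and>
    (\<forall>e. (\<forall>y\<in>cell P x. \<rho> z y \<le> e) \<longrightarrow> d \<le> e) \<and>
    d powr \<alpha> \<le> (\<eta> (b / a) + 1) powr \<alpha> / c * measure \<nu> (cell P x)"
proof -
  interpret \<nu>: finite_measure \<nu> by (rule finite_\<nu>)
  obtain z where z: "z \<in> cell P x" "ball z (a * r ^ n) \<subseteq> cell P x" using ball_in_cell[OF n x] by blast
  define d where "d = (SUP y\<in>cell P x. \<rho> z y)"
  let ?H = "\<eta> (b / a)"
  have H: "0 \<le> ?H" using scale_pos by (intro \<eta>_nonneg) simp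
  have bdd: "bdd_above (\<rho> z ` cell P x)" by (rule bdd_aboveI[of _ R]) (auto simp: \<rho>_le)
  have d: "\<rho> z y \<le> d" if "y \<in> cell P x" for y unfolding d_def by (rule cSUP_upper[OF that bdd])
  have least: "d \<le> e" if "\<forall>y\<in>cell P x. \<rho> z y \<le> e" for e
    unfolding d_def using z that by (intro cSUP_least) auto
  obtain y where y: "y \<in> cell P x" "y \<noteq> z"
  proof -
    obtain q q' where q: "q \<in> cell P x" "q' \<in> cell P x" "a * r ^ n \<le> dist q q'" using cell_two_points[OF x] by metis
    moreover have "0 < a * r ^ n" using scale_pos r by simp
    ultimately have "q \<noteq> q'" by auto
    then show ?thesis using that q by blast
  qed
  have d0: "0 < d" using \<rho>_pos[of z y] d[OF y(1)] y by fastforce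
  let ?s = "d / (?H + 1)"
  have sub: "{q. \<rho> z q < ?s} \<subseteq> cell P x"
  proof (rule ccontr)
    assume "\<not> ?thesis"
    then obtain q where q: "\<rho> z q < ?s" "q \<notin> cell P x" by auto
    then have far: "a * r ^ n \<le> dist z q" using z(2) by (auto simp: subset_iff not_less)
    have "\<rho> z y \<le> ?H * \<rho> z q" if "y \<in> cell P x" for y
    proof (rule quasisymmetric)
      show "z \<noteq> q" using z q by auto
      have "dist z y \<le> b * r ^ n" by (rule dist_cell[OF x z(1) that])
      also have "\<dots> = b / a * (a * r ^ n)" using scale_pos by simp
      also have "\<dots> \<le> b / a * dist z q" using far scale_pos by (intro mult_left_mono) auto
      finally show "dist z y \<le> b / a * dist z q" .
    qed (use scale_pos in simp)
    then have "d \<le> ?H * \<rho> z q" by (intro least) auto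
    also have "\<dots> \<le> ?H * ?s" using q H by (intro mult_left_mono) auto
    also have "\<dots> < d" using H d0 by (simp add: pos_divide_less_eq distrib_left mult.commute)
    finally show False by simp
  qed
  have "?s \<le> d / 1" using d0 H by (intro divide_left_mono) auto
  moreover have "d \<le> R" by (rule least) (auto simp: \<rho>_le)
  ultimately have "c * ?s powr \<alpha> \<le> measure \<nu> {q. \<rho> z q < ?s}" using d0 H by (intro \<nu>_lower) auto
  also have "\<dots> \<le> measure \<nu> (cell P x)" by (rule \<nu>.finite_measure_mono[OF sub cell_sets_\<nu>[OF x]])
  finally have "d powr \<alpha> \<le> (?H + 1) powr \<alpha> / c * measure \<nu> (cell P x)"
    using c_pos H d0 by (simp add: powr_divide field_simps)
  then show ?thesis using z d least d0 by blast
qed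

text \<open>In order: the edge count, the power of a sum, the ratio of the cell size to the width of
  the cut-off, the size of a small cell against its \<nu>-mass, and the total \<nu>-mass of the
  neighbourhood. No factor depends on the level or on m.\<close>

definition capacity_const :: "real \<Rightarrow> real" where
  "capacity_const p = N * (2 powr p * (2 * (\<eta> (b / (a * r\<^sup>2)) + 1)) powr p *
     ((\<eta> (b / a) + 1) powr \<alpha> / c) * (N * c' * (\<eta> ((M + 2) * b / a) + 1) powr \<alpha>))"

text \<open>The test function is a \<rho>-Lipschitz cut-off sampled at the centres from
  \<open>cell_center\<close>. With s the \<rho>-size of a small cell and D that of the cell w, the
  p-th power of s/D splits into a power p - \<alpha>, small by quasisymmetry, and a power \<alpha>,
  which is dominated by \<nu>-mass and sums to a constant. Measuring everything relative to D gives
  uniformity in w.\<close>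

lemma conductance_le_quasisymmetric:
  assumes p: "\<alpha> < p" and m: "1 \<le> m"
  shows "conductance P M p m \<le>
    ennreal (capacity_const p * ((\<eta> ((M + 2) * b / a) + 1) * \<eta> (2 * b * r ^ m / a)) powr (p - \<alpha>))"
  unfolding conductance_def
proof (rule SUP_least)
  interpret \<nu>: finite_measure \<nu> by (rule finite_\<nu>)
  fix w assume "w \<in> {w \<in> vertices P. 1 \<le> depth P w}"
  then obtain n where n: "1 \<le> n" and w: "w \<in> level P n" and dw: "depth P w = n" by (auto simp: level_def)
  define H1 where "H1 = \<eta> (b / (a * r\<^sup>2)) + 1"
  define H2 where "H2 = \<eta> ((M + 2) * b / a) + 1"
  define H3 where "H3 = (\<eta> (b / a) + 1) powr \<alpha> / c"
  define \<epsilon> where "\<epsilon> = H2 * \<eta> (2 * b * r ^ m / a)"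
  have H1: "1 \<le> H1" using scale_pos r by (auto simp: H1_def intro!: \<eta>_nonneg)
  have H2: "1 \<le> H2" using scale_pos by (auto simp: H2_def intro!: \<eta>_nonneg)
  have H3: "0 \<le> H3" using c_pos by (simp add: H3_def)
  have \<epsilon>: "0 \<le> \<epsilon>" using H2 scale_pos r by (auto simp: \<epsilon>_def intro!: \<eta>_nonneg mult_nonneg_nonneg)
  have p0: "0 < p" using p \<alpha>_nonneg by simp
  obtain a0 z0 where az: "a0 \<in> cell P w" "z0 \<in> cell P w" "a * r ^ n \<le> dist a0 z0"
    using cell_two_points[OF w] by metis
  have arn: "0 < a * r ^ n" using scale_pos r by simp
  define D where "D = \<rho> a0 z0"
  have D: "0 < D" unfolding D_def using az arn by (intro \<rho>_pos) auto
  \<comment> \<open>A lower bound for the \<rho>-distance from w to the cells outside its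
    M-neighbourhood: quasisymmetry compares that distance with both \<rho>(z, a0) and \<rho>(z, z0),
    whose sum is at least D.\<close>
  define \<delta> where "\<delta> = D / (2 * H1)"
  have \<delta>: "0 < \<delta>" using D H1 by (simp add: \<delta>_def)
  have far: "\<delta> \<le> \<rho> z z'" if y: "y \<in> level P n - nbhd P M w" and z: "z \<in> cell P w" "z' \<in> cell P y" for y z z'
  proof -
    have dd: "a * r ^ (n + 2) \<le> dist z z'" using far_cells_dist[OF w _ _ z] y by auto
    moreover have "0 < a * r ^ (n + 2)" using scale_pos r by simp
    ultimately have ne: "z \<noteq> z'" by auto
    have *: "\<rho> z q \<le> H1 * \<rho> z z'" if "q \<in> cell P w" for q
    proof -
      have "\<rho> z q \<le> \<eta> (b / (a * r\<^sup>2)) * \<rho> z z'"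
      proof (rule quasisymmetric[OF ne])
        have "dist z q \<le> b * r ^ n" by (rule dist_cell[OF w z(1) that])
        also have "\<dots> = b / (a * r\<^sup>2) * (a * r ^ (n + 2))" using scale_pos r by (simp add: power_add power2_eq_square)
        also have "\<dots> \<le> b / (a * r\<^sup>2) * dist z z'" using dd scale_pos r by (intro mult_left_mono) auto
        finally show "dist z q \<le> b / (a * r\<^sup>2) * dist z z'" .
      qed (use scale_pos r in simp)
      also have "\<dots> \<le> H1 * \<rho> z z'" unfolding H1_def by (intro mult_right_mono \<rho>_nonneg) simp
      finally show ?thesis .
    qed
    have "D \<le> \<rho> a0 z + \<rho> z z0" unfolding D_def by (rule \<rho>_triangle)
    also have "\<dots> \<le> 2 * H1 * \<rho> z z'" using *[OF az(1)] *[OF az(2)] \<rho>_sym[of a0 z] by simp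
    finally show ?thesis using H1 by (simp add: \<delta>_def pos_divide_le_eq mult.commute)
  qed
  have near: "\<rho> a0 z < H2 * D" "\<And>z'. dist z z' \<le> b * r ^ (n + m) \<Longrightarrow> \<rho> z z' \<le> \<epsilon> * D"
    if y: "y \<in> nbhd P (M + 1) w" and z: "z \<in> cell P y" for y z
  proof -
    have ne: "a0 \<noteq> z0" using az arn by auto
    have "\<rho> a0 z \<le> \<eta> ((M + 2) * b / a) * \<rho> a0 z0"
    proof (rule quasisymmetric[OF ne])
      have "dist a0 z \<le> (real (M + 1) + 1) * b * r ^ n" by (rule nbhd_dist[OF w y az(1) z])
      also have "\<dots> = real (M + 2) * b / a * (a * r ^ n)" using scale_pos by simp
      also have "\<dots> \<le> real (M + 2) * b / a * dist a0 z0" using az scale_pos by (intro mult_left_mono) auto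
      finally show "dist a0 z \<le> real (M + 2) * b / a * dist a0 z0" .
    qed (use scale_pos in simp)
    also have "\<dots> = (H2 - 1) * D" by (simp add: H2_def D_def)
    finally have le: "\<rho> a0 z \<le> (H2 - 1) * D" .
    then show "\<rho> a0 z < H2 * D" using D by (simp add: left_diff_distrib)
    fix z' assume zz: "dist z z' \<le> b * r ^ (n + m)"
    \<comment> \<open>At least one of the two reference points is far from z in the original metric;
      it serves as the third point in the quasisymmetry inequality.\<close>
    obtain q where q: "q = a0 \<or> q = z0" "a * r ^ n / 2 \<le> dist z q"
    proof -
      have "a * r ^ n \<le> dist z a0 + dist z z0" using az(3) dist_triangle3[of a0 z0 z] by linarith
      then have "a * r ^ n / 2 \<le> dist z a0 \<or> a * r ^ n / 2 \<le> dist z z0" by linarith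
      then show ?thesis using that by blast
    qed
    have "\<rho> z z' \<le> \<eta> (2 * b * r ^ m / a) * \<rho> z q"
    proof (rule quasisymmetric)
      show "z \<noteq> q" using q arn by auto
      have "b * r ^ (n + m) = 2 * b * r ^ m / a * (a * r ^ n / 2)" using scale_pos by (simp add: power_add)
      also have "\<dots> \<le> 2 * b * r ^ m / a * dist z q" using q scale_pos r by (intro mult_left_mono) auto
      finally show "dist z z' \<le> 2 * b * r ^ m / a * dist z q" using zz by simp
    qed (use scale_pos r in simp)
    also have "\<dots> \<le> \<eta> (2 * b * r ^ m / a) * (H2 * D)"
    proof (intro mult_left_mono)
      have "\<rho> z q \<le> \<rho> z a0 + \<rho> a0 q" by (rule \<rho>_triangle)
      also have "\<dots> \<le> (H2 - 1) * D + D" using le q D \<rho>_sym[of z a0] by (auto simp: D_def \<rho>_refl)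
      finally show "\<rho> z q \<le> H2 * D" by (simp add: left_diff_distrib)
      show "0 \<le> \<eta> (2 * b * r ^ m / a)" using scale_pos r by (intro \<eta>_nonneg) simp
    qed
    finally show "\<rho> z z' \<le> \<epsilon> * D" by (simp add: \<epsilon>_def mult_ac)
  qed
  define g where "g z = (INF q\<in>cell P w. \<rho> z q)" for z
  have bdd: "bdd_below (\<rho> z ` cell P w)" for z by (rule bdd_belowI[of _ 0]) (auto simp: \<rho>_nonneg)
  have g_le: "g z \<le> \<rho> z z' + g z'" for z z'
  proof -
    have "g z - \<rho> z z' \<le> g z'"
      unfolding g_def[of z']
    proof (rule cINF_greatest)
      fix q assume q: "q \<in> cell P w"
      have "g z \<le> \<rho> z q" unfolding g_def by (rule cINF_lower[OF bdd q])
      then show "g z - \<rho> z z' \<le> \<rho> z' q" using \<rho>_triangle[of z q z'] by simp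
    qed (use az in auto)
    then show ?thesis by simp
  qed
  have g_0: "g z \<le> 0" if "z \<in> cell P w" for z
    unfolding g_def using cINF_lower[OF bdd that, of z] by (simp add: \<rho>_refl)
  have g_far: "\<delta> \<le> g z'" if "y \<in> level P n - nbhd P M w" "z' \<in> cell P y" for y z'
    unfolding g_def using far[OF that(1) _ that(2)] az by (intro cINF_greatest) (auto simp: \<rho>_sym[of z'])
  have g_nonneg: "0 \<le> g z" for z unfolding g_def using az by (intro cINF_greatest) (auto simp: \<rho>_nonneg)
  \<comment> \<open>Equal to 1 on w, equal to 0 beyond \<rho>-distance \<delta>, and Lipschitz for
    \<rho> with constant 1/\<delta>.\<close>
  define \<phi> where "\<phi> z = max 0 (1 - g z / \<delta>)" for z
  have \<phi>_diff: "\<bar>\<phi> z - \<phi> z'\<bar> \<le> \<rho> z z' / \<delta>" for z z'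
  proof -
    have "\<bar>g z - g z'\<bar> \<le> \<rho> z z'" using g_le[of z z'] g_le[of z' z] \<rho>_sym[of z z'] by linarith
    then have "\<bar>g z / \<delta> - g z' / \<delta>\<bar> \<le> \<rho> z z' / \<delta>"
      using \<delta> by (simp add: diff_divide_distrib[symmetric] abs_divide divide_right_mono)
    then show ?thesis unfolding \<phi>_def by linarith
  qed
  have "\<forall>v\<in>level P (n + m). \<exists>z d. z \<in> cell P v \<and> 0 < d \<and> (\<forall>y\<in>cell P v. \<rho> z y \<le> d) \<and>
      (\<forall>e. (\<forall>y\<in>cell P v. \<rho> z y \<le> e) \<longrightarrow> d \<le> e) \<and> d powr \<alpha> \<le> H3 * measure \<nu> (cell P v)"
    unfolding H3_def using n by (intro ballI cell_center) auto
  then obtain \<xi> s where "\<forall>v\<in>level P (n + m). \<xi> v \<in> cell P v \<and> 0 < s v \<and> (\<forall>y\<in>cell P v. \<rho> (\<xi> v) y \<le> s v) \<and>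
      (\<forall>e. (\<forall>y\<in>cell P v. \<rho> (\<xi> v) y \<le> e) \<longrightarrow> s v \<le> e) \<and> s v powr \<alpha> \<le> H3 * measure \<nu> (cell P v)"
    by metis
  then have \<xi>: "\<xi> v \<in> cell P v" and s: "0 < s v" "\<And>y. y \<in> cell P v \<Longrightarrow> \<rho> (\<xi> v) y \<le> s v"
    and s_least: "\<And>e. (\<And>y. y \<in> cell P v \<Longrightarrow> \<rho> (\<xi> v) y \<le> e) \<Longrightarrow> s v \<le> e"
    and s_powr: "s v powr \<alpha> \<le> H3 * measure \<nu> (cell P v)" if "v \<in> level P (n + m)" for v
    using that by auto
  define f where "f v = \<phi> (\<xi> v)" for v
  have f1: "f v = 1" if "v \<in> descendants P m w" for v
  proof -
    have "v \<in> level P (n + m)" using descendants_level[OF w] that by blast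
    then have "\<xi> v \<in> cell P w" using \<xi> cell_subset[OF w that] by blast
    then have "g (\<xi> v) = 0" using g_0[of "\<xi> v"] g_nonneg[of "\<xi> v"] by simp
    then show ?thesis by (simp add: f_def \<phi>_def)
  qed
  have f0: "f v = 0" if v: "v \<in> descendants P m y" and y: "y \<in> level P n - nbhd P M w" for v y
  proof -
    have yl: "y \<in> level P n" using y by simp
    then have "v \<in> level P (n + m)" using descendants_level[OF yl] v by blast
    then have "\<xi> v \<in> cell P y" using \<xi> cell_subset[OF yl v] by blast
    then have "1 \<le> g (\<xi> v) / \<delta>" using g_far[OF y] \<delta> by (simp add: pos_le_divide_eq)
    then show ?thesis by (simp add: f_def \<phi>_def)
  qed
  \<comment> \<open>One more neighbourhood step than in the conductance: an edge with an end outside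
    B has both ends outside the subtrees of the M-neighbourhood, where f vanishes.\<close>
  define B where "B = descendants_of_set P m (nbhd P (M + 1) w)"
  have B_sub: "B \<subseteq> level P (n + m)"
    using descendants_level nbhd_in_level[OF w] by (fastforce simp: B_def descendants_of_set_def)
  define G where "G v = (if v \<in> B then 2 powr p * (s v / \<delta>) powr p else 0)" for v
  have en: "energy P p (n + m) f \<le> N * (\<Sum>v\<in>level P (n + m). G v)"
  proof (rule energy_le_double_sum)
    fix u v assume uv: "(u, v) \<in> edges P (n + m)"
    then have l: "u \<in> level P (n + m)" "v \<in> level P (n + m)" by (auto simp: edges_def)
    obtain q where q: "q \<in> cell P u" "q \<in> cell P v" using uv by (auto simp: edges_def)
    show "\<bar>f u - f v\<bar> powr p \<le> G u + G v"
    proof (cases "u \<in> B \<and> v \<in> B")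
      case True
      have "\<bar>f u - f v\<bar> \<le> \<rho> (\<xi> u) (\<xi> v) / \<delta>" unfolding f_def by (rule \<phi>_diff)
      also have "\<dots> \<le> (s u + s v) / \<delta>"
        using \<rho>_triangle[of "\<xi> u" "\<xi> v" q] s(2)[OF l(1) q(1)] s(2)[OF l(2) q(2)] \<rho>_sym[of q "\<xi> v"] \<delta>
        by (intro divide_right_mono) auto
      finally have "\<bar>f u - f v\<bar> powr p \<le> (s u / \<delta> + s v / \<delta>) powr p"
        using p0 by (intro powr_mono2) (auto simp: add_divide_distrib)
      also have "\<dots> \<le> 2 powr p * ((s u / \<delta>) powr p + (s v / \<delta>) powr p)"
        using p0 \<delta> s(1)[OF l(1)] s(1)[OF l(2)] by (intro powr_add_le) auto
      finally show ?thesis using True by (simp add: G_def distrib_left)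
    next
      case False
      obtain u' where u': "u' \<in> level P n" "u \<in> descendants P m u'" using ancestor_at[OF l(1)] by blast
      obtain v' where v': "v' \<in> level P n" "v \<in> descendants P m v'" using ancestor_at[OF l(2)] by blast
      have meet: "cell P u' \<inter> cell P v' \<noteq> {}"
        using q cell_subset[OF u'] cell_subset[OF v'] by blast
      have "u' \<notin> nbhd P (Suc M) w \<or> v' \<notin> nbhd P (Suc M) w"
        using False u' v' by (auto simp: B_def descendants_of_set_def)
      then have "u' \<notin> nbhd P M w \<and> v' \<notin> nbhd P M w"
        using nbhd_Suc[OF w] nbhd_Suc_mono[OF w] u' v' meet by blast
      then have "f u = 0" "f v = 0" using f0[OF u'(2)] f0[OF v'(2)] u' v' by auto
      then show ?thesis by (simp add: G_def)
    qed
  qed (simp add: G_def)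
  have G_le: "G v \<le> 2 powr p * (2 * H1) powr p * \<epsilon> powr (p - \<alpha>) * (H3 * measure \<nu> (cell P v)) / D powr \<alpha>"
    if v: "v \<in> B" for v
  proof -
    have vl: "v \<in> level P (n + m)" using v B_sub by blast
    obtain y where y: "y \<in> nbhd P (M + 1) w" "v \<in> descendants P m y"
      using v by (auto simp: B_def descendants_of_set_def)
    have "\<xi> v \<in> cell P y"
      using \<xi>[OF vl] cell_subset[of y n v m] y nbhd_in_level[OF w] by blast
    then have "s v \<le> \<epsilon> * D"
      using dist_cell[OF vl \<xi>[OF vl]] near(2)[OF y(1)] by (intro s_least[OF vl]) auto
    then have sD: "s v / D \<le> \<epsilon>" using D by (simp add: pos_divide_le_eq)
    have eq: "(s v / \<delta>) powr p = (2 * H1) powr p * (s v / D) powr p"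
      unfolding \<delta>_def by (simp add: powr_mult[symmetric] mult_ac)
    \<comment> \<open>The decisive splitting. It needs \<alpha> < p, so that the first factor is
      monotone in s/D and small.\<close>
    have "(s v / D) powr p = (s v / D) powr (p - \<alpha>) * (s v / D) powr \<alpha>"
      by (simp add: powr_add[symmetric])
    also have "\<dots> \<le> \<epsilon> powr (p - \<alpha>) * (s v powr \<alpha> / D powr \<alpha>)"
      using sD s(1)[OF vl] D p by (intro mult_mono powr_mono2) (auto simp: powr_divide)
    also have "\<dots> \<le> \<epsilon> powr (p - \<alpha>) * (H3 * measure \<nu> (cell P v) / D powr \<alpha>)"
      by (intro mult_left_mono divide_right_mono s_powr[OF vl]) auto
    finally have "2 powr p * ((2 * H1) powr p * (s v / D) powr p)
        \<le> 2 powr p * ((2 * H1) powr p * (\<epsilon> powr (p - \<alpha>) * (H3 * measure \<nu> (cell P v) / D powr \<alpha>)))"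
      by (intro mult_left_mono) auto
    then show ?thesis using v by (simp add: G_def eq mult_ac)
  qed
  have "(\<Sum>v\<in>level P (n + m). G v) = (\<Sum>v\<in>B. G v)"
    using B_sub by (intro sum.mono_neutral_right) (auto simp: finite_level G_def)
  also have "\<dots> \<le> (\<Sum>v\<in>B. 2 powr p * (2 * H1) powr p * \<epsilon> powr (p - \<alpha>) * (H3 * measure \<nu> (cell P v)) / D powr \<alpha>)"
    by (intro sum_mono G_le)
  also have "\<dots> = 2 powr p * (2 * H1) powr p * \<epsilon> powr (p - \<alpha>) * H3 / D powr \<alpha> * (\<Sum>v\<in>B. measure \<nu> (cell P v))"
    by (simp add: sum_distrib_left sum_divide_distrib mult_ac)
  also have "\<dots> \<le> 2 powr p * (2 * H1) powr p * \<epsilon> powr (p - \<alpha>) * H3 / D powr \<alpha> * (N * (c' * (H2 * D) powr \<alpha>))"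
  proof (intro mult_left_mono)
    have "(\<Sum>v\<in>B. measure \<nu> (cell P v)) \<le> N * measure \<nu> (\<Union>v\<in>B. cell P v)"
      by (rule sum_measure_cells_le[OF B_sub])
    also have "measure \<nu> (\<Union>v\<in>B. cell P v) \<le> measure \<nu> {z. \<rho> a0 z < H2 * D}"
    proof (rule \<nu>.finite_measure_mono)
      show "(\<Union>v\<in>B. cell P v) \<subseteq> {z. \<rho> a0 z < H2 * D}"
      proof
        fix z assume "z \<in> (\<Union>v\<in>B. cell P v)"
        then obtain v y where "y \<in> nbhd P (M + 1) w" "v \<in> descendants P m y" "z \<in> cell P v"
          by (auto simp: B_def descendants_of_set_def)
        moreover from this have "z \<in> cell P y"
          using cell_subset[of y n v m] nbhd_in_level[OF w] by blast
        ultimately show "z \<in> {z. \<rho> a0 z < H2 * D}" using near(1) by blast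
      qed
    qed (simp add: sets_\<nu> \<rho>_ball)
    also have "\<dots> \<le> c' * (H2 * D) powr \<alpha>" using H2 D by (intro \<nu>_upper) simp
    finally show "(\<Sum>v\<in>B. measure \<nu> (cell P v)) \<le> N * (c' * (H2 * D) powr \<alpha>)"
      by (simp add: mult_left_mono)
  qed (use H3 in auto)
  also have "\<dots> = 2 powr p * (2 * H1) powr p * \<epsilon> powr (p - \<alpha>) * H3 * (N * (c' * H2 powr \<alpha>))"
    using D by (simp add: powr_mult)
  finally have "N * (\<Sum>v\<in>level P (n + m). G v) \<le> N * (2 powr p * (2 * H1) powr p * \<epsilon> powr (p - \<alpha>) * H3 * (N * (c' * H2 powr \<alpha>)))"
    by (intro mult_left_mono) auto
  also have "\<dots> = capacity_const p * \<epsilon> powr (p - \<alpha>)"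
    by (simp add: capacity_const_def H1_def H2_def H3_def mult_ac)
  finally have "energy P p (n + m) f \<le> capacity_const p * \<epsilon> powr (p - \<alpha>)" using en by simp
  then have "ennreal (energy P p (depth P w + m) f) \<le> ennreal (capacity_const p * \<epsilon> powr (p - \<alpha>))"
    unfolding dw by (rule ennreal_leI)
  moreover have "f \<in> {f. (\<forall>u\<in>descendants P m w. f u = 1) \<and>
      (\<forall>u\<in>descendants_of_set P m (level P (depth P w) - nbhd P M w). f u = 0)}"
    using f1 f0 by (auto simp: dw descendants_of_set_def)
  ultimately show "(INF f\<in>{f. (\<forall>u\<in>descendants P m w. f u = 1) \<and>
      (\<forall>u\<in>descendants_of_set P m (level P (depth P w) - nbhd P M w). f u = 0)}. ennreal (energy P p (depth P w + m) f))
      \<le> ennreal (capacity_const p * ((\<eta> ((M + 2) * b / a) + 1) * \<eta> (2 * b * r ^ m / a)) powr (p - \<alpha>))"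
    unfolding \<epsilon>_def H2_def by (intro INF_lower2)
qed

text \<open>The argument of \<eta> tends to 0 with r^m while the prefactor is fixed; the number t is
  the solution of Q t^(p - \<alpha>) = e.\<close>

lemma conductance_small:
  assumes p: "\<alpha> < p" and e: "0 < e"
  shows "\<exists>m\<ge>1. conductance P M p m \<le> ennreal e"
proof -
  define Q where "Q = \<bar>capacity_const p\<bar> + 1"
  define H where "H = \<eta> ((M + 2) * b / a) + 1"
  have Q: "0 < Q" "capacity_const p \<le> Q" by (auto simp: Q_def)
  have H: "0 < H" using scale_pos by (auto simp: H_def intro!: add_nonneg_pos \<eta>_nonneg)
  define t where "t = (e / Q) powr (1 / (p - \<alpha>))"
  have t: "0 < t" using e Q by (simp add: t_def)
  obtain d where d: "0 < d" "\<And>u. 0 \<le> u \<Longrightarrow> u < d \<Longrightarrow> \<eta> u < t / H" using \<eta>_small[of "t / H"] t H by auto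
  have "(\<lambda>m. 2 * b * r ^ m / a) \<longlonglongrightarrow> 2 * b * 0 / a"
    using r scale_pos by (intro tendsto_intros LIMSEQ_realpow_zero) auto
  then have "\<forall>\<^sub>F m in sequentially. 2 * b * r ^ m / a < d" using d by (intro order_tendstoD(2)) auto
  then obtain m0 where m0: "\<forall>m\<ge>m0. 2 * b * r ^ m / a < d" by (auto simp: eventually_sequentially)
  define m where "m = max 1 m0"
  have "\<eta> (2 * b * r ^ m / a) < t / H" using m0 scale_pos r by (intro d) (auto simp: m_def)
  then have le: "H * \<eta> (2 * b * r ^ m / a) \<le> t" using H by (simp add: pos_less_divide_eq mult.commute)
  have "capacity_const p * (H * \<eta> (2 * b * r ^ m / a)) powr (p - \<alpha>) \<le> Q * t powr (p - \<alpha>)"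
    using Q le p H scale_pos r by (intro mult_mono powr_mono2) (auto intro!: mult_nonneg_nonneg \<eta>_nonneg)
  also have "\<dots> = e" using e Q p by (simp add: t_def powr_powr)
  finally have "ennreal (capacity_const p * (H * \<eta> (2 * b * r ^ m / a)) powr (p - \<alpha>)) \<le> ennreal e"
    by (rule ennreal_leI)
  then have "conductance P M p m \<le> ennreal e"
    using conductance_le_quasisymmetric[OF p, of m] order.trans by (force simp: H_def m_def)
  then show ?thesis by (intro exI[of _ m]) (simp add: m_def)
qed

end

context cell_space
begin

text \<open>Compactness brings the definitions into the shape of \<open>ahlfors_space\<close>: it
  bounds \<rho> and makes \<nu> finite. Finiteness of \<nu> in turn forces \<alpha> to be
  nonnegative, whence p is positive.\<close>

lemma quasisymmetric_conductance_small:
  fixes \<rho> :: "'k \<Rightarrow> 'k \<Rightarrow> real"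
  assumes qs: "quasisymmetric_metric \<rho>" and sets_\<nu>: "sets \<nu> = sets borel" and ar: "ahlfors_regular \<rho> \<nu> \<alpha>"
    and p: "\<alpha> < p"
  shows "0 < p \<and> (\<forall>e>0. \<exists>m\<ge>1. conductance P M p m \<le> ennreal e)"
proof -
  interpret \<rho>: Metric_space UNIV \<rho> using qs by (simp add: quasisymmetric_metric_def)
  obtain \<eta> \<theta> where \<eta>: "homeomorphism {0..} {0..} \<eta> \<theta>"
    and ratio: "\<And>x y z. x \<noteq> z \<Longrightarrow> \<rho> x y / \<rho> x z \<le> \<eta> (dist x y / dist x z)"
    using qs unfolding quasisymmetric_metric_def by blast
  note hom = homeomorphism_halfline[OF \<eta>]
  have top: "\<rho>.mtopology = euclidean" using qs by (simp add: quasisymmetric_metric_def)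
  have mball: "\<rho>.mball x s = {y. \<rho> x y < s}" for x s by (auto simp: \<rho>.in_mball)
  have open_ball: "open {y. \<rho> x y < s}" for x s
    using \<rho>.openin_mball[of x s] unfolding top mball by simp
  have pos: "0 < \<rho> x y" if "x \<noteq> y" for x y
    using \<rho>.nonneg[of x y] \<rho>.zero[of x y] that by (simp add: less_le)
  define R where "R = (SUP (y, z). \<rho> y z)"
  define o' :: 'k where "o' = undefined"
  have "(UNIV :: 'k set) \<subseteq> (\<Union>n\<in>(UNIV :: nat set). {y. \<rho> o' y < real n})"
    using reals_Archimedean2 by auto
  then obtain I where I: "finite I" "(UNIV :: 'k set) \<subseteq> (\<Union>n\<in>I. {y. \<rho> o' y < real n})"
    using compactE_image[OF compact_UNIV, of "UNIV :: nat set"] open_ball by metis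
  define n0 where "n0 = Max (insert 0 I)"
  have o_le: "\<rho> o' y \<le> real n0" for y
  proof -
    obtain n where "n \<in> I" "\<rho> o' y < real n" using I by blast
    moreover from this have "n \<le> n0" using I by (simp add: n0_def)
    ultimately show ?thesis by (meson less_imp_le of_nat_le_iff order.trans)
  qed
  have bdd: "bdd_above (range (\<lambda>(y, z). \<rho> y z))"
  proof (rule bdd_aboveI)
    fix t assume "t \<in> range (\<lambda>(y, z). \<rho> y z)"
    then obtain y z where "t = \<rho> y z" by auto
    then show "t \<le> 2 * real n0"
      using \<rho>.triangle[of y o' z] o_le[of y] o_le[of z] \<rho>.commute[of y o'] by simp
  qed
  have le_R: "\<rho> x y \<le> R" for x y
    unfolding R_def using cSUP_upper[OF UNIV_I bdd, of "(x, y)"] by simp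
  have "\<exists>x y :: 'k. x \<noteq> y"
  proof -
    obtain x y :: 'k where "dist x y = diameter (UNIV :: 'k set)"
      using diameter_compact_attained[OF compact_UNIV] by blast
    then have "dist x y \<noteq> 0" by (simp add: diameter_UNIV)
    then show ?thesis by auto
  qed
  then have R: "0 < R" using pos le_R by (meson less_le_trans)
  obtain c1 c2 where c: "0 < c1" "0 < c2" and ball: "\<And>x s. 0 < s \<Longrightarrow> s \<le> R \<Longrightarrow>
      ennreal (c1 * s powr \<alpha>) \<le> emeasure \<nu> {y. \<rho> x y < s} \<and> emeasure \<nu> {y. \<rho> x y < s} \<le> ennreal (c2 * s powr \<alpha>)"
    using ar unfolding ahlfors_regular_def mball R_def[symmetric] by blast
  have "(UNIV :: 'k set) \<subseteq> (\<Union>x\<in>UNIV. {y. \<rho> x y < R})" using R \<rho>.zero by auto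
  then obtain J where J: "finite J" "(UNIV :: 'k set) \<subseteq> (\<Union>x\<in>J. {y. \<rho> x y < R})"
    using compactE_image[OF compact_UNIV, of "UNIV :: 'k set"] open_ball by metis
  interpret \<nu>: finite_measure \<nu>
  proof
    have "emeasure \<nu> (space \<nu>) \<le> emeasure \<nu> (\<Union>x\<in>J. {y. \<rho> x y < R})"
      using J open_ball by (intro emeasure_mono) (auto simp: sets_\<nu> intro!: borel_open)
    also have "\<dots> \<le> (\<Sum>x\<in>J. emeasure \<nu> {y. \<rho> x y < R})"
      using J open_ball by (intro emeasure_subadditive_finite) (auto simp: sets_\<nu> intro!: borel_open)
    also have "\<dots> \<le> (\<Sum>x\<in>J. ennreal (c2 * R powr \<alpha>))" using ball R by (intro sum_mono) auto
    also have "\<dots> < \<infinity>" by (simp add: ennreal_mult_less_top of_nat_less_top)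
    finally show "emeasure \<nu> (space \<nu>) \<noteq> \<infinity>" by simp
  qed
  define V where "V = measure \<nu> UNIV"
  have sp: "UNIV \<in> sets \<nu>" by (simp add: sets_\<nu>)
  have lower: "c1 * s powr \<alpha> \<le> measure \<nu> {y. \<rho> x y < s}" if "0 < s" "s \<le> R" for x s
    using ball[OF that, of x] c by (simp add: \<nu>.emeasure_eq_measure)
  have V: "measure \<nu> A \<le> V" for A unfolding V_def
    by (cases "A \<in> sets \<nu>") (auto intro: \<nu>.finite_measure_mono sp simp: measure_notin_sets)
  \<comment> \<open>For negative \<alpha> the lower volume bound blows up at small radii, beyond the
    total mass.\<close>
  have \<alpha>: "0 \<le> \<alpha>"
  proof (rule ccontr)
    assume neg: "\<not> 0 \<le> \<alpha>"
    have V0: "0 \<le> V" by (simp add: V_def)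
    define s where "s = min R (((V + 1) / c1) powr (1 / \<alpha>))"
    have s: "0 < s" "s \<le> R" using R V0 c by (auto simp: s_def)
    have "(V + 1) / c1 = (((V + 1) / c1) powr (1 / \<alpha>)) powr \<alpha>" using neg V0 c by (simp add: powr_powr)
    also have "\<dots> \<le> s powr \<alpha>" using neg s V0 c by (intro powr_mono2') (auto simp: s_def)
    finally have "V + 1 \<le> c1 * s powr \<alpha>" using c by (simp add: pos_divide_le_eq mult.commute)
    then show False using lower[OF s] V by (metis add_le_same_cancel1 not_one_le_zero order.trans)
  qed
  \<comment> \<open>Beyond radius R the total mass V serves as an upper bound; it is at most V /
    R^\<alpha> times s^\<alpha> because \<alpha> is nonnegative.\<close>
  define c3 where "c3 = c2 + V / R powr \<alpha>"
  have V0: "0 \<le> V" by (simp add: V_def)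
  have upper: "measure \<nu> {y. \<rho> x y < s} \<le> c3 * s powr \<alpha>" if "0 < s" for x s
  proof (cases "s \<le> R")
    case True
    then have "measure \<nu> {y. \<rho> x y < s} \<le> c2 * s powr \<alpha>"
      using ball[OF that True, of x] c by (simp add: \<nu>.emeasure_eq_measure)
    also have "\<dots> \<le> c3 * s powr \<alpha>" unfolding c3_def using V0 by (intro mult_right_mono) auto
    finally show ?thesis .
  next
    case False
    have "measure \<nu> {y. \<rho> x y < s} \<le> V / R powr \<alpha> * R powr \<alpha>" using V R by simp
    also have "\<dots> \<le> V / R powr \<alpha> * s powr \<alpha>"
      using False R \<alpha> V0 by (intro mult_left_mono powr_mono2) auto
    also have "\<dots> \<le> c3 * s powr \<alpha>" unfolding c3_def using c by (intro mult_right_mono) auto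
    finally show ?thesis .
  qed
  interpret ahlfors_space P \<mu> r a b M N \<rho> \<nu> \<eta> \<alpha> c1 c3 R
  proof
    show "\<rho> x z \<le> \<rho> x y + \<rho> y z" for x y z using \<rho>.triangle by simp
    show "\<rho> x y = \<rho> y x" for x y by (rule \<rho>.commute)
    show "\<rho> x x = 0" for x using \<rho>.zero by simp
    show "\<rho> x y \<le> \<eta> t * \<rho> x z" if "x \<noteq> z" "dist x y \<le> t * dist x z" "0 \<le> t" for x y z t
    proof -
      have "dist x y / dist x z \<le> t" using that by (simp add: pos_divide_le_eq)
      then have "\<eta> (dist x y / dist x z) \<le> \<eta> t" by (intro hom(2)) auto
      then have "\<rho> x y / \<rho> x z \<le> \<eta> t" using ratio[OF that(1), of y] by simp
      then show ?thesis using pos[OF that(1)] by (simp add: pos_divide_le_eq)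
    qed
    show "\<exists>d>0. \<forall>t. 0 \<le> t \<and> t < d \<longrightarrow> \<eta> t < e" if "0 < e" for e
    proof -
      obtain d where "0 < d" "\<forall>t\<in>{0..}. dist t 0 < d \<longrightarrow> dist (\<eta> t) (\<eta> 0) < e"
        using hom(3) \<open>0 < e\<close> unfolding continuous_on_iff by force
      then show ?thesis using hom(1) by (intro exI[of _ d]) (auto simp: dist_real_def)
    qed
    show "{y. \<rho> x y < s} \<in> sets borel" for x s by (intro borel_open open_ball)
    show "0 < c3" using c V0 by (simp add: c3_def add_pos_nonneg)
  qed (use pos le_R hom sets_\<nu> lower upper c \<alpha> in auto)
  show ?thesis using \<alpha> p conductance_small[OF p] by simp
qed

lemma dim_AR_conductance_small:
  assumes "ereal p > dim_AR TYPE('k)"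
  shows "0 < p" "0 < e \<Longrightarrow> \<exists>m\<ge>1. conductance P M p m \<le> ennreal e"
proof -
  obtain \<alpha> and \<rho> :: "'k \<Rightarrow> 'k \<Rightarrow> real" and \<nu> where "quasisymmetric_metric \<rho>" "sets \<nu> = sets borel"
    "ahlfors_regular \<rho> \<nu> \<alpha>" "\<alpha> < p"
    using assms unfolding dim_AR_def Inf_less_iff by auto
  then have *: "0 < p \<and> (\<forall>e>0. \<exists>m\<ge>1. conductance P M p m \<le> ennreal e)"
    by (rule quasisymmetric_conductance_small)
  then show "0 < p" "0 < e \<Longrightarrow> \<exists>m\<ge>1. conductance P M p m \<le> ennreal e" by auto
qed

text \<open>Otherwise one ball of radius below 1/4 would cover a space of diameter 1. The result
  makes the boundary condition of the conductance at x effective.\<close>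

lemma far_cells_exist:
  obtains n x y where "1 \<le> n" "x \<in> level P n" "y \<in> level P n" "y \<notin> nbhd P M x"
proof -
  have "(\<lambda>n. b * r ^ n) \<longlonglongrightarrow> b * 0"
    using r by (intro tendsto_intros LIMSEQ_realpow_zero) auto
  then have "\<forall>\<^sub>F n in sequentially. b * r ^ n < 1 / 4" by (intro order_tendstoD(2)) auto
  then obtain n0 where n0: "\<forall>n\<ge>n0. b * r ^ n < 1 / 4" by (auto simp: eventually_sequentially)
  define n where "n = max 1 n0"
  have n: "1 \<le> n" "b * r ^ n < 1 / 4" using n0 by (auto simp: n_def)
  obtain x where x: "x \<in> level P n" using level_nonempty by blast
  obtain z where z: "z \<in> cell P x" using cell_nonempty[OF x] by blast
  have "\<exists>y\<in>level P n. y \<notin> nbhd P M x"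
  proof (rule ccontr)
    assume "\<not> ?thesis"
    then have "cell_nbhd P M z n = UNIV"
      using x z cover_level[of n] by (fastforce simp: cell_nbhd_def)
    then have "dist z y < b * r ^ n" for y using ball_cell_nbhd(2)[OF n(1), of z] by auto
    then have close: "dist z y < 1 / 4" for y using n(2) by (meson less_trans)
    obtain y y' :: 'k where "dist y y' = diameter (UNIV :: 'k set)"
      using diameter_compact_attained[OF compact_UNIV] by blast
    then have "dist y y' = 1" by (simp add: diameter_UNIV)
    then show False using close[of y] close[of y'] dist_triangle3[of y y' z] by linarith
  qed
  then show ?thesis using that n(1) x by blast
qed

text \<open>A discrete intermediate value theorem along a path.\<close>

lemma crossing_edge:
  fixes f :: "'t \<Rightarrow> real"
  assumes "(u, v) \<in> R\<^sup>*" "t < f u" "f v \<le> t"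
  shows "\<exists>(u', v')\<in>R. t < f u' \<and> f v' \<le> t"
  using assms
proof (induction rule: converse_rtrancl_induct)
  case (step y z)
  show ?case
  proof (cases "t < f z")
    case True
    then show ?thesis using step by blast
  next
    case False
    then show ?thesis using step by (intro bexI[of _ "(y, z)"]) auto
  qed
qed simp

text \<open>The jumps along edges must cover [0, 1), so they sum to at least 1. For p at most 1 the
  p-th power of a jump below 1 is no smaller than the jump, and a jump of at least 1 suffices alone.
  The half is the factor in the energy.\<close>

lemma conductance_ge_half:
  assumes p: "0 < p" "p \<le> 1"
  shows "ennreal (1 / 2) \<le> conductance P M p m"
proof -
  obtain n x y where n: "1 \<le> n" "x \<in> level P n" "y \<in> level P n" "y \<notin> nbhd P M x"
    by (rule far_cells_exist)
  have d: "depth P x = n" by (rule depth_level[OF n(2)])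
  obtain u where u: "u \<in> descendants P m x" using descendants_nonempty[OF n(2)] by blast
  obtain v where v: "v \<in> descendants P m y" using descendants_nonempty[OF n(3)] by blast
  let ?F = "{f. (\<forall>u\<in>descendants P m x. f u = 1) \<and>
      (\<forall>u\<in>descendants_of_set P m (level P (depth P x) - nbhd P M x). f u = (0::real))}"
  have "1 / 2 \<le> energy P p (n + m) f" if f: "f \<in> ?F" for f
  proof -
    let ?E = "edges P (n + m)"
    have fuv: "f u = 1" "f v = 0" using f u v n by (auto simp: d descendants_of_set_def)
    have l: "u \<in> level P (n + m)" "v \<in> level P (n + m)" using u v n descendants_level by blast+
    have path: "(u, v) \<in> ?E\<^sup>*"
    proof -
      have "(u, v) \<in> (?E \<inter> level P (n + m) \<times> level P (n + m))\<^sup>*"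
        using l cover_level connected_UNIV_space by (intro edge_path) auto
      then show ?thesis by (rule rtrancl_mono[THEN subsetD, rotated]) auto
    qed
    have en: "energy P p (n + m) f = (1 / 2) * (\<Sum>(u, v)\<in>?E. \<bar>f u - f v\<bar> powr p)"
      unfolding energy_def energy_on_def by (simp add: edges_def Int_absorb2 subset_iff)
    have "{0..<1} \<subseteq> (\<Union>(u, v)\<in>?E. {f v..<f u})"
    proof
      fix t :: real assume "t \<in> {0..<1}"
      then show "t \<in> (\<Union>(u, v)\<in>?E. {f v..<f u})"
        using crossing_edge[OF path, of t f] fuv by fastforce
    qed
    then have "emeasure lborel {0..<1::real} \<le> emeasure lborel (\<Union>e\<in>?E. case e of (u, v) \<Rightarrow> {f v..<f u})"
      using finite_edges by (intro emeasure_mono sets.finite_UN) (auto simp: case_prod_unfold)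
    also have "\<dots> \<le> (\<Sum>e\<in>?E. emeasure lborel (case e of (u, v) \<Rightarrow> {f v..<f u}))"
      using finite_edges by (intro emeasure_subadditive_finite) (auto simp: case_prod_unfold)
    also have "\<dots> \<le> (\<Sum>e\<in>?E. ennreal (case e of (u, v) \<Rightarrow> \<bar>f u - f v\<bar>))"
    proof (intro sum_mono)
      fix e :: "'t \<times> 't"
      show "emeasure lborel (case e of (u, v) \<Rightarrow> {f v..<f u}) \<le> ennreal (case e of (u, v) \<Rightarrow> \<bar>f u - f v\<bar>)"
        by (cases e, cases "f (snd e) \<le> f (fst e)") (auto intro: ennreal_leI)
    qed
    also have "\<dots> = ennreal (\<Sum>(u, v)\<in>?E. \<bar>f u - f v\<bar>)"
      by (simp add: case_prod_unfold sum_ennreal)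
    finally have "ennreal 1 \<le> ennreal (\<Sum>(u, v)\<in>?E. \<bar>f u - f v\<bar>)" by simp
    then have sum1: "1 \<le> (\<Sum>(u, v)\<in>?E. \<bar>f u - f v\<bar>)"
      by (rule contrapos_pp) (auto simp: not_le intro!: ennreal_lessI)
    show ?thesis
    proof (cases "\<exists>(u, v)\<in>?E. 1 \<le> \<bar>f u - f v\<bar>")
      case True
      then obtain u v where uv: "(u, v) \<in> ?E" "1 \<le> \<bar>f u - f v\<bar>" by blast
      have "1 \<le> \<bar>f u - f v\<bar> powr p" using uv p by (simp add: ge_one_powr_ge_zero)
      also have "\<dots> \<le> energy P p (n + m) f"
        unfolding energy_def by (rule edge_le_energy_on[OF uv(1)]) (use uv in \<open>auto simp: edges_def\<close>)
      finally show ?thesis by simp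
    next
      case False
      have "(\<Sum>(u, v)\<in>?E. \<bar>f u - f v\<bar>) \<le> (\<Sum>(u, v)\<in>?E. \<bar>f u - f v\<bar> powr p)"
      proof (rule sum_mono)
        fix e assume e: "e \<in> ?E"
        obtain u v where uv: "e = (u, v)" by (cases e)
        have le: "\<bar>f u - f v\<bar> \<le> 1" using False e uv by force
        have "\<bar>f u - f v\<bar> powr 1 \<le> \<bar>f u - f v\<bar> powr p"
          using le p by (intro powr_mono') auto
        then show "(case e of (u, v) \<Rightarrow> \<bar>f u - f v\<bar>) \<le> (case e of (u, v) \<Rightarrow> \<bar>f u - f v\<bar> powr p)"
          by (simp add: uv)
      qed
      then show ?thesis using sum1 en by simp
    qed
  qed
  then have "ennreal (1 / 2) \<le> (INF f\<in>?F. ennreal (energy P p (depth P x + m) f))"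
    unfolding d by (intro INF_greatest ennreal_leI) blast
  also have "\<dots> \<le> conductance P M p m"
    unfolding conductance_def using n d by (intro SUP_upper) (auto simp: level_def)
  finally show ?thesis .
qed

end

context disparity_space
begin

text \<open>Averaging an admissible function down to the fixed level n leaves the values 1 at x and
  0 at a far cell y, which costs a fixed amount of energy there; \<open>energy_mean_le\<close>
  converts this into energy at level n + m.\<close>

lemma conductance_disparity_lower:
  obtains Q where "0 < Q" "\<And>m. ennreal (1 / (Q * \<sigma> ^ m)) \<le> conductance P M p m"
proof -
  obtain n x y where n: "1 \<le> n" "x \<in> level P n" "y \<in> level P n" "y \<notin> nbhd P M x"
    by (rule far_cells_exist)
  have d: "depth P x = n" by (rule depth_level[OF n(2)])
  define q where "q = (real (card (level P n)) * real (card (level P n))) powr p"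
  have q: "0 < q" using level_nonempty finite_level by (auto simp: q_def card_gt_0_iff)
  have "ennreal (1 / (q * K1 * \<sigma> ^ m)) \<le> conductance P M p m" for m
  proof -
    let ?F = "{f. (\<forall>u\<in>descendants P m x. f u = 1) \<and>
        (\<forall>u\<in>descendants_of_set P m (level P (depth P x) - nbhd P M x). f u = (0::real))}"
    have "1 / (q * K1 * \<sigma> ^ m) \<le> energy P p (n + m) f" if f: "f \<in> ?F" for f
    proof -
      let ?h = "\<lambda>z. weighted_mean P \<mu> (descendants P m z) f"
      have "?h x = 1" using f by (intro weighted_mean_const[OF n(2)]) auto
      moreover have "?h y = 0"
        using f n by (intro weighted_mean_const[OF n(3)]) (auto simp: d descendants_of_set_def)
      ultimately have "1 = \<bar>?h x - ?h y\<bar> powr p" by simp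
      also have "\<dots> \<le> q * energy_on P p n (level P n) ?h"
        unfolding q_def using n cover_level connected_UNIV_space
        by (intro connected_difference_le) auto
      also have "\<dots> \<le> q * (K1 * \<sigma> ^ m * energy P p (n + m) f)"
        using energy_mean_le[OF n(1), of m f] q by (intro mult_left_mono) (auto simp: energy_def)
      finally show ?thesis using q K1_pos \<sigma>_pos by (simp add: pos_divide_le_eq mult_ac)
    qed
    then have "ennreal (1 / (q * K1 * \<sigma> ^ m)) \<le> (INF f\<in>?F. ennreal (energy P p (depth P x + m) f))"
      unfolding d by (intro INF_greatest ennreal_leI) blast
    also have "\<dots> \<le> conductance P M p m"
      unfolding conductance_def using n d by (intro SUP_upper) (auto simp: level_def)
    finally show ?thesis .
  qed
  then show ?thesis using that[of "q * K1"] q K1_pos by simp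
qed

text \<open>Arbitrarily small conductances contradict \<open>conductance_ge_half\<close> if p is at
  most 1, and \<open>conductance_disparity_lower\<close> if \<sigma> is at most 1.\<close>

lemma exponents_gt_1:
  assumes "ereal p > dim_AR TYPE('k)"
  shows "1 < p" "1 < \<sigma>"
proof -
  note small = dim_AR_conductance_small(2)[OF assms]
  show "1 < p"
  proof (rule ccontr)
    assume "\<not> 1 < p"
    then have "ennreal (1 / 2) \<le> ennreal (1 / 4)"
      using small[of "1 / 4"] conductance_ge_half[OF p_pos] by (force intro: order.trans)
    then show False by (subst (asm) ennreal_le_iff) auto
  qed
  show "1 < \<sigma>"
  proof (rule ccontr)
    assume "\<not> 1 < \<sigma>"
    then have le: "\<sigma> ^ m \<le> 1" for m using \<sigma>_pos by (intro power_le_one) auto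
    obtain Q where Q: "0 < Q" "\<And>m. ennreal (1 / (Q * \<sigma> ^ m)) \<le> conductance P M p m"
      by (rule conductance_disparity_lower) blast
    obtain m where "conductance P M p m \<le> ennreal (1 / (2 * Q))" using small[of "1 / (2 * Q)"] Q by auto
    then have "ennreal (1 / (Q * \<sigma> ^ m)) \<le> ennreal (1 / (2 * Q))" using Q(2)[of m] by (rule order.trans[rotated])
    then have "1 / (Q * \<sigma> ^ m) \<le> 1 / (2 * Q)" using Q by (subst (asm) ennreal_le_iff) auto
    moreover have "1 / Q \<le> 1 / (Q * \<sigma> ^ m)"
      using Q le[of m] \<sigma>_pos by (intro divide_left_mono) auto
    ultimately have "1 / Q \<le> 1 / (2 * Q)" by simp
    then show False using Q by (simp add: field_simps)
  qed
qed

end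

section \<open>Self-similar trees\<close>

locale self_similar =
  fixes S :: "'s set" and f :: "'s \<Rightarrow> 'k::metric_space \<Rightarrow> 'k" and r \<alpha>\<^sub>H :: real
    and j :: "'s \<Rightarrow> nat" and M :: nat and \<mu> :: "'k measure"
  assumes structure_S: "self_similar_structure S f" and r: "0 < r" "r < 1"
    and sum_weights: "(\<Sum>s\<in>S. r powr (real (j s) * \<alpha>\<^sub>H)) = 1"
    and self_similar_\<mu>: "self_similar_measure S f (\<lambda>s. r powr (real (j s) * \<alpha>\<^sub>H)) \<mu>"
    and standing: "standing_assumption (self_similar_tree S f r j) r \<mu> M"
begin

abbreviation T :: "(nat \<times> 's list, 'k) cell_tree" where "T \<equiv> self_similar_tree S f r j"
abbreviation \<Lambda> :: "nat \<Rightarrow> 's list set" where "\<Lambda> \<equiv> scale_words S r j"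
abbreviation J :: "'s list \<Rightarrow> nat" where "J w \<equiv> (\<Sum>s\<leftarrow>w. j s)"
abbreviation q :: "'s \<Rightarrow> real" where "q s \<equiv> r powr (real (j s) * \<alpha>\<^sub>H)"

lemma finite_S: "finite S"
  using structure_S by (simp add: self_similar_structure_def)

lemma continuous_f: "s \<in> S \<Longrightarrow> continuous_on UNIV (f s)"
  using structure_S by (simp add: self_similar_structure_def)

lemma inj_f: "s \<in> S \<Longrightarrow> inj (f s)"
  using structure_S by (simp add: self_similar_structure_def)

lemma q_pos: "0 < q s"
  using r by simp

lemma two_points: "\<exists>x y :: 'k. x \<noteq> y"
proof -
  have "compact (UNIV :: 'k set)" using standing unfolding standing_assumption_def by (elim conjE)
  moreover have "diameter (UNIV :: 'k set) = 1" using standing unfolding standing_assumption_def by (elim conjE)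
  ultimately obtain x y :: 'k where "dist x y = 1"
    using diameter_compact_attained[of "UNIV :: 'k set"] by auto
  then have "x \<noteq> y" by auto
  then show ?thesis by blast
qed

text \<open>A letter with exponent 0 would carry all the weight; since every weight is positive it
  would be the only letter, and the space, coded by a single infinite word, would be a
  point.\<close>

lemma j_pos:
  assumes s: "s \<in> S"
  shows "1 \<le> j s"
proof (rule ccontr)
  assume "\<not> 1 \<le> j s"
  then have "q s = 1" using r by simp
  then have "(\<Sum>t\<in>S - {s}. q t) = 0"
    using sum_weights sum.remove[OF finite_S s, of q] by simp
  then have "\<forall>t\<in>S - {s}. q t = 0"
    using finite_S by (subst (asm) sum_nonneg_eq_0_iff) auto
  then have "S - {s} = {}" using q_pos by (metis all_not_in_conv less_irrefl)
  then have S: "S = {s}" using s by blast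
  obtain \<kappa> :: "(nat \<Rightarrow> 's) \<Rightarrow> 'k" where \<kappa>: "\<kappa> ` {\<omega>. range \<omega> \<subseteq> S} = UNIV"
    using structure_S by (auto simp: self_similar_structure_def)
  have "{\<omega> :: nat \<Rightarrow> 's. range \<omega> \<subseteq> S} = {\<lambda>_. s}" by (auto simp: S fun_eq_iff image_subset_iff)
  then have "(UNIV :: 'k set) = {\<kappa> (\<lambda>_. s)}" using \<kappa> by auto
  then show False using two_points by (metis UNIV_I singletonD)
qed

lemma word_weight: "word_weight r j w = r ^ J w"
  by (simp add: word_weight_def)

lemma scale_words_0: "\<Lambda> 0 = {[]}"
  by (simp add: scale_words_def)

text \<open>Since r < 1 the scale inequalities reverse into integer ones: \<open>J\<close> first
  reaches n at the last letter.\<close>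

lemma scale_words_iff:
  "1 \<le> n \<Longrightarrow> w \<in> \<Lambda> n \<longleftrightarrow> w \<in> lists S \<and> w \<noteq> [] \<and> J (butlast w) < n \<and> n \<le> J w"
  using r by (simp add: scale_words_def word_weight power_strict_decreasing_iff power_decreasing_iff)

lemma scale_words_lists: "w \<in> \<Lambda> n \<Longrightarrow> w \<in> lists S"
  by (cases "n = 0") (auto simp: scale_words_0 scale_words_iff)

lemma length_le_J: "w \<in> lists S \<Longrightarrow> length w \<le> J w"
proof (induction w)
  case (Cons s w)
  then have "1 \<le> j s" "length w \<le> J w" using j_pos by auto
  then show ?case by simp
qed simp

lemma finite_scale_words: "finite (\<Lambda> n)"
proof (cases "n = 0")
  case False
  have "\<Lambda> n \<subseteq> {w. set w \<subseteq> S \<and> length w \<le> n}"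
  proof
    fix w assume "w \<in> \<Lambda> n"
    then have w: "w \<in> lists S" "w \<noteq> []" "J (butlast w) < n" using False by (auto simp: scale_words_iff)
    then have "butlast w \<in> lists S" by (auto simp: in_lists_conv_set dest: in_set_butlastD)
    then have "length w - 1 < n" using length_le_J[of "butlast w"] w by simp
    then show "w \<in> {w. set w \<subseteq> S \<and> length w \<le> n}" using w by (auto simp: in_lists_conv_set)
  qed
  then show ?thesis using finite_lists_length_le[OF finite_S] finite_subset by blast
qed (simp add: scale_words_0)

lemma butlast_lists: "w \<in> lists S \<Longrightarrow> butlast w \<in> lists S"
  by (auto simp: in_lists_conv_set dest: in_set_butlastD)

lemma J_butlast_less: "w \<in> lists S \<Longrightarrow> w \<noteq> [] \<Longrightarrow> J (butlast w) < J w"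
proof (induction w rule: rev_induct)
  case (snoc s w)
  then show ?case using j_pos[of s] by simp
qed simp

text \<open>\<open>J (butlast w)\<close> is at most n. If it is smaller, w itself has scale n; if it
  equals n, \<open>butlast w\<close> has. The two cases exclude each other, which gives
  uniqueness.\<close>

lemma scale_words_parent:
  assumes w: "w \<in> \<Lambda> (Suc n)"
  shows "\<exists>!v. v \<in> \<Lambda> n \<and> (w = v \<or> v = butlast w)"
proof -
  have w': "w \<in> lists S" "w \<noteq> []" "J (butlast w) < Suc n" "Suc n \<le> J w" using w by (auto simp: scale_words_iff)
  show ?thesis
  proof (cases "n = 0")
    case True
    then have "length (butlast w) \<le> 0" using length_le_J[OF butlast_lists[OF w'(1)]] w'(3) by linarith
    then have "butlast w = []" by (simp del: length_butlast)
    then show ?thesis using w' by (auto simp: True scale_words_0)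
  next
    case False
    show ?thesis
    proof (cases "J (butlast w) < n")
      case True
      then show ?thesis using False w' by (intro ex1I[of _ w]) (auto simp: scale_words_iff)
    next
      case n: False
      then have eq: "J (butlast w) = n" using w' by simp
      then have ne: "butlast w \<noteq> []" using False by auto
      then have "J (butlast (butlast w)) < n" using J_butlast_less[OF butlast_lists[OF w'(1)] ne] eq by simp
      then have "butlast w \<in> \<Lambda> n" using False ne eq butlast_lists[OF w'(1)] by (simp add: scale_words_iff)
      then show ?thesis using False eq by (intro ex1I[of _ "butlast w"]) (auto simp: scale_words_iff)
    qed
  qed
qed

lemma tree_simps:
  "tree_root T = (0, [])" "vertices T = {(n, w). w \<in> \<Lambda> n}" "depth T (n, w) = n"
  "children T (n, v) = {(Suc n, w) |w. w \<in> \<Lambda> (Suc n) \<and> (w = v \<or> v = butlast w)}"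
  "cell T (n, w) = range (word_map f w)"
  by (simp_all add: self_similar_tree_def)

lemma level_T: "level T n = Pair n ` \<Lambda> n"
  by (auto simp: level_def tree_simps)

lemma level_vertices: "x \<in> level T n \<Longrightarrow> x \<in> vertices T"
  by (simp add: level_def)

lemma sum_level_T: "(\<Sum>x\<in>level T n. F x) = (\<Sum>w\<in>\<Lambda> n. F (n, w))"
  unfolding level_T by (subst sum.reindex) (auto simp: inj_on_def)

lemma level_Suc_T: "level T (Suc n) = (\<Union>x\<in>level T n. children T x)"
proof (intro equalityI subsetI)
  fix x assume "x \<in> level T (Suc n)"
  then obtain w where w: "x = (Suc n, w)" "w \<in> \<Lambda> (Suc n)" by (auto simp: level_T)
  then obtain v where "v \<in> \<Lambda> n" "w = v \<or> v = butlast w" using scale_words_parent by blast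
  then show "x \<in> (\<Union>x\<in>level T n. children T x)" using w by (auto simp: level_T tree_simps)
qed (auto simp: level_T tree_simps)

lemma children_disjoint_T:
  assumes "x \<in> level T n" "y \<in> level T n" "x \<noteq> y"
  shows "children T x \<inter> children T y = {}"
proof -
  obtain v v' where v: "x = (n, v)" "y = (n, v')" "v \<in> \<Lambda> n" "v' \<in> \<Lambda> n" "v \<noteq> v'" using assms by (auto simp: level_T)
  show ?thesis
  proof (rule ccontr)
    assume "children T x \<inter> children T y \<noteq> {}"
    then obtain w where "w \<in> \<Lambda> (Suc n)" "w = v \<or> v = butlast w" "w = v' \<or> v' = butlast w"
      using v by (auto simp: tree_simps)
    then show False using scale_words_parent[of w n] v by blast
  qed
qed

lemma parent_T:
  assumes "x \<in> level T n" "y \<in> children T x"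
  shows "parent T y = x"
proof -
  obtain v w where v: "x = (n, v)" "v \<in> \<Lambda> n" and w: "y = (Suc n, w)" "w \<in> \<Lambda> (Suc n)" "w = v \<or> v = butlast w"
    using assms by (auto simp: level_T tree_simps)
  have "(THE z. z \<in> vertices T \<and> y \<in> children T z) = x"
  proof (rule the_equality)
    show "x \<in> vertices T \<and> y \<in> children T x" using assms level_vertices by blast
    fix z assume z: "z \<in> vertices T \<and> y \<in> children T z"
    then obtain v' where "z = (n, v')" "v' \<in> \<Lambda> n" "w = v' \<or> v' = butlast w"
      using w by (cases z) (auto simp: tree_simps)
    then show "z = x" using scale_words_parent[OF w(2)] v w(3) by blast
  qed
  then show ?thesis by (simp add: parent_def tree_simps w)
qed

lemma card_children_T: "x \<in> level T n \<Longrightarrow> card (children T x) \<le> card S + 1"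
proof -
  assume "x \<in> level T n"
  then obtain v where v: "x = (n, v)" "v \<in> \<Lambda> n" by (auto simp: level_T)
  have "children T x \<subseteq> insert (Suc n, v) ((\<lambda>s. (Suc n, v @ [s])) ` S)"
  proof
    fix y assume "y \<in> children T x"
    then obtain w where w: "y = (Suc n, w)" "w \<in> \<Lambda> (Suc n)" "w = v \<or> v = butlast w" using v by (auto simp: tree_simps)
    then have "w \<noteq> []" "w \<in> lists S" by (auto simp: scale_words_iff)
    then have "w = butlast w @ [last w]" "last w \<in> S" by (auto simp: in_lists_conv_set)
    then show "y \<in> insert (Suc n, v) ((\<lambda>s. (Suc n, v @ [s])) ` S)" using w by auto
  qed
  then have "card (children T x) \<le> card (insert (Suc n, v) ((\<lambda>s. (Suc n, v @ [s])) ` S))"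
    using finite_S by (intro card_mono) auto
  also have "\<dots> \<le> Suc (card ((\<lambda>s. (Suc n, v @ [s])) ` S))" by (rule card_insert_le_m1) auto
  also have "\<dots> \<le> card S + 1" using card_image_le[OF finite_S] by simp
  finally show ?thesis .
qed

lemma standing_partition:
  assumes "x \<in> level T n"
  shows "cell T x \<noteq> {}" "compact (cell T x)" "connected (cell T x)"
    "cell T x = (\<Union>y\<in>children T x. cell T y)"
    "measure \<mu> (cell T x) = (\<Sum>y\<in>children T x. measure \<mu> (cell T y))"
proof -
  note x = level_vertices[OF assms]
  have "is_partition T" using standing unfolding standing_assumption_def by (elim conjE)
  then have "\<forall>w\<in>vertices T. cell T w \<noteq> {} \<and> compact (cell T w) \<and>
        (\<forall>x\<in>cell T w. x islimpt cell T w) \<and> cell T w = (\<Union>v\<in>children T w. cell T v)"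
    unfolding is_partition_def by (elim conjE)
  from bspec[OF this x]
  show "cell T x \<noteq> {}" "compact (cell T x)" "cell T x = (\<Union>y\<in>children T x. cell T y)"
    by blast+
  have "\<forall>w\<in>vertices T. connected (cell T w)"
    using standing unfolding standing_assumption_def by (elim conjE)
  then show "connected (cell T x)" using x by blast
  have "\<forall>w\<in>vertices T. measure \<mu> (cell T w) = (\<Sum>v\<in>children T w. measure \<mu> (cell T v))"
    using standing unfolding standing_assumption_def by (elim conjE)
  then show "measure \<mu> (cell T x) = (\<Sum>y\<in>children T x. measure \<mu> (cell T y))"
    using x by blast
qed

lemma sets_\<mu>: "sets \<mu> = sets borel"
  using self_similar_\<mu> by (simp add: self_similar_measure_def)

lemma prob_space_\<mu>: "prob_space \<mu>"
  using self_similar_\<mu> by (simp add: self_similar_measure_def)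

lemma root_T: "level T 0 = {tree_root T}" "cell T (tree_root T) = UNIV"
  using standing by (auto simp: level_T scale_words_0 tree_simps standing_assumption_def is_partition_def)

lemma cover_T: "(\<Union>x\<in>level T n. cell T x) = UNIV"
proof (induction n)
  case (Suc n)
  have "(\<Union>x\<in>level T (Suc n). cell T x) = (\<Union>x\<in>level T n. cell T x)"
    unfolding level_Suc_T using standing_partition(4) by auto
  then show ?case using Suc by simp
qed (simp add: root_T)

lemma finite_level_T: "finite (level T n)"
  by (simp add: level_T finite_scale_words)

lemma sum_measure_level: "(\<Sum>x\<in>level T n. measure \<mu> (cell T x)) = 1"
proof (induction n)
  case 0
  interpret prob_space \<mu> by (rule prob_space_\<mu>)
  show ?case using prob_space sets_eq_imp_space_eq[OF sets_\<mu>] by (simp add: root_T)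
next
  case (Suc n)
  have fin: "finite (children T x)" if "x \<in> level T n" for x
    using finite_level_T[of "Suc n"] that level_Suc_T by (auto intro: finite_subset)
  have "(\<Sum>x\<in>level T (Suc n). measure \<mu> (cell T x)) = (\<Sum>x\<in>level T n. \<Sum>y\<in>children T x. measure \<mu> (cell T y))"
    unfolding level_Suc_T using fin children_disjoint_T
    by (intro sum.UNION_disjoint) (auto simp: finite_level_T)
  also have "\<dots> = (\<Sum>x\<in>level T n. measure \<mu> (cell T x))"
    by (intro sum.cong refl standing_partition(5)[symmetric])
  finally show ?case using Suc by simp
qed

text \<open>The cells of a level cover the space and their masses already add up to 1, so
  inclusion-exclusion leaves no mass for an overlap.\<close>

lemma overlap_T:
  assumes xy: "x \<in> level T n" "y \<in> level T n" "x \<noteq> y"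
  shows "measure \<mu> (cell T x \<inter> cell T y) = 0"
proof -
  interpret prob_space \<mu> by (rule prob_space_\<mu>)
  have meas: "cell T z \<in> sets \<mu>" if "z \<in> level T n" for z
    unfolding sets_\<mu> using standing_partition(2)[OF that] by (intro borel_closed compact_imp_closed)
  let ?R = "level T n - {x, y}"
  have fin: "finite ?R" using finite_level_T by simp
  have "(1 :: real) = prob (cell T x \<union> cell T y \<union> (\<Union>z\<in>?R. cell T z))"
  proof -
    have "cell T x \<union> cell T y \<union> (\<Union>z\<in>?R. cell T z) = (\<Union>z\<in>level T n. cell T z)" using xy by blast
    then show ?thesis using cover_T[of n] prob_space sets_eq_imp_space_eq[OF sets_\<mu>] by simp
  qed
  also have "\<dots> \<le> prob (cell T x \<union> cell T y) + prob (\<Union>z\<in>?R. cell T z)"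
    using meas xy fin by (intro measure_Un_le sets.Un sets.finite_UN) auto
  also have "\<dots> \<le> prob (cell T x \<union> cell T y) + (\<Sum>z\<in>?R. prob (cell T z))"
    using meas fin by (intro add_left_mono finite_measure_subadditive_finite) auto
  also have "prob (cell T x \<union> cell T y) = prob (cell T x) + prob (cell T y) - prob (cell T x \<inter> cell T y)"
    using meas xy by (intro measure_Un3) (auto simp: fmeasurable_eq_sets)
  also have "(\<Sum>z\<in>?R. prob (cell T z)) = 1 - prob (cell T x) - prob (cell T y)"
  proof -
    have "(\<Sum>z\<in>level T n. prob (cell T z)) = prob (cell T x) + (prob (cell T y) + (\<Sum>z\<in>?R. prob (cell T z)))"
      using xy finite_level_T[of n]
      by (simp add: sum.remove[of _ x] sum.remove[of "level T n - {x}" y] Diff_insert2[symmetric] insert_commute)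
    then show ?thesis using sum_measure_level[of n] by simp
  qed
  finally show ?thesis using measure_nonneg[of \<mu> "cell T x \<inter> cell T y"] by simp
qed

text \<open>By the exponential clause each child keeps at least a fixed share of its parent's
  mass.\<close>

lemma measure_pos_T: "x \<in> level T n \<Longrightarrow> 0 < measure \<mu> (cell T x)"
proof (induction n arbitrary: x)
  case 0
  interpret prob_space \<mu> by (rule prob_space_\<mu>)
  show ?case using 0 prob_space sets_eq_imp_space_eq[OF sets_\<mu>] by (simp add: root_T)
next
  case (Suc n)
  then obtain y where y: "y \<in> level T n" "x \<in> children T y" by (auto simp: level_Suc_T)
  have "exponential_measure T \<mu>" using standing unfolding standing_assumption_def by (elim conjE)
  then obtain \<gamma> where "0 < \<gamma>" "\<forall>w\<in>vertices T. measure \<mu> (cell T w) \<ge> \<gamma> * measure \<mu> (cell T (parent T w))"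
    unfolding exponential_measure_def by blast
  then have "\<gamma> * measure \<mu> (cell T y) \<le> measure \<mu> (cell T x)" "0 < \<gamma> * measure \<mu> (cell T y)"
    using level_vertices[OF Suc.prems] parent_T[OF y] Suc.IH[OF y(1)] by auto
  then show ?case by linarith
qed

lemma ex_cell_space: "\<exists>a b N. cell_space T \<mu> r a b M N"
proof -
  have "\<exists>c\<^sub>1>0. \<exists>c\<^sub>2>0.
        (\<forall>w\<in>vertices T. c\<^sub>1 * r ^ depth T w \<le> diameter (cell T w) \<and>
           diameter (cell T w) \<le> c\<^sub>2 * r ^ depth T w) \<and>
        (\<forall>x. \<forall>n\<ge>1. ball x (c\<^sub>1 * r ^ n) \<subseteq> cell_nbhd T M x n \<and>
           cell_nbhd T M x n \<subseteq> ball x (c\<^sub>2 * r ^ n))"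
    using standing unfolding standing_assumption_def by (elim conjE)
  then obtain c\<^sub>1 c\<^sub>2 where c: "0 < c\<^sub>1" "0 < c\<^sub>2"
    and diam: "\<And>w. w \<in> vertices T \<Longrightarrow> c\<^sub>1 * r ^ depth T w \<le> diameter (cell T w) \<and> diameter (cell T w) \<le> c\<^sub>2 * r ^ depth T w"
    and nb: "\<And>x n. 1 \<le> n \<Longrightarrow> ball x (c\<^sub>1 * r ^ n) \<subseteq> cell_nbhd T M x n \<and> cell_nbhd T M x n \<subseteq> ball x (c\<^sub>2 * r ^ n)"
    by blast
  have "\<exists>c>0. \<forall>n\<ge>1. \<forall>w\<in>level T n. \<exists>x\<in>cell T w. ball x (c * r ^ n) \<subseteq> cell T w"
    using standing unfolding standing_assumption_def by (elim conjE)
  then obtain c where c0: "0 < c" and inner: "\<And>n w. 1 \<le> n \<Longrightarrow> w \<in> level T n \<Longrightarrow> \<exists>x\<in>cell T w. ball x (c * r ^ n) \<subseteq> cell T w"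
    by blast
  have "uniformly_finite T" using standing unfolding standing_assumption_def by (elim conjE)
  then obtain N where N: "\<And>w. w \<in> vertices T \<Longrightarrow> card (nbhd T 1 w) \<le> N"
    unfolding uniformly_finite_def by blast
  have "\<forall>w\<in>vertices T. parent T ` nbhd T (M + 1) w \<subseteq> nbhd T M (parent T w)"
    using standing unfolding standing_assumption_def by (elim conjE)
  then have five: "\<And>w. w \<in> vertices T \<Longrightarrow> parent T ` nbhd T (M + 1) w \<subseteq> nbhd T M (parent T w)"
    by blast
  \<comment> \<open>A single lower constant for both kinds of balls and for diameters.\<close>
  define a where "a = min c\<^sub>1 c"
  have a: "0 < a" "a \<le> c\<^sub>1" "a \<le> c" using c c0 by (auto simp: a_def)
  have ar: "a * r ^ n \<le> c\<^sub>1 * r ^ n" "a * r ^ n \<le> c * r ^ n" for n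
    using a r by (auto intro!: mult_right_mono)
  have "cell_space T \<mu> r a c\<^sub>2 M (N + card S + 1)"
  proof (rule cell_space.intro)
    show "0 < r" "r < 1" by (rule r)+
    show "0 < a" "0 < c\<^sub>2" by (rule a c)+
    show "level T 0 = {tree_root T}" "cell T (tree_root T) = UNIV" by (rule root_T)+
    show "sets \<mu> = sets borel" by (rule sets_\<mu>)
    show "prob_space \<mu>" by (rule prob_space_\<mu>)
    show "diameter (UNIV :: 'k set) = 1" using standing unfolding standing_assumption_def by (elim conjE)
    fix n
    show "finite (level T n)" by (rule finite_level_T)
    show "level T (Suc n) = (\<Union>x\<in>level T n. children T x)" by (rule level_Suc_T)
    fix x
    show "ball z (a * r ^ n) \<subseteq> cell_nbhd T M z n" "cell_nbhd T M z n \<subseteq> ball z (c\<^sub>2 * r ^ n)" if "1 \<le> n" for z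
      using nb[OF that, of z] subset_ball[OF ar(1), of z n] by auto
    show "\<exists>z\<in>cell T x. ball z (a * r ^ n) \<subseteq> cell T x" if "1 \<le> n" "x \<in> level T n"
      using inner[OF that] subset_ball[OF ar(2)[of n]] by (meson order.trans)
    assume x: "x \<in> level T n"
    have d: "depth T x = n" using x by (simp add: level_def)
    show "a * r ^ n \<le> diameter (cell T x)" "diameter (cell T x) \<le> c\<^sub>2 * r ^ n"
      using diam[OF level_vertices[OF x]] ar(1)[of n] d by auto
    show "card (children T x) \<le> N + card S + 1" using card_children_T[OF x] by simp
    show "card (nbhd T 1 x) \<le> N + card S + 1" using N[OF level_vertices[OF x]] by simp
    show "cell T x \<noteq> {}" "compact (cell T x)" "connected (cell T x)" "cell T x = (\<Union>y\<in>children T x. cell T y)"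
      by (rule standing_partition[OF x])+
    show "0 < measure \<mu> (cell T x)" by (rule measure_pos_T[OF x])
    fix y assume y: "y \<in> level T n"
    show "x \<noteq> y \<Longrightarrow> children T x \<inter> children T y = {}" by (rule children_disjoint_T[OF x y])
    show "x \<noteq> y \<Longrightarrow> measure \<mu> (cell T x \<inter> cell T y) = 0" by (rule overlap_T[OF x y])
    show "y \<in> nbhd T M x" if uv: "u \<in> children T x" "v \<in> children T y" "v \<in> nbhd T (M + 1) u" for u v
    proof -
      have "u \<in> vertices T" using level_vertices[of u "Suc n"] x uv by (auto simp: level_Suc_T)
      from five[OF this] show ?thesis using parent_T[OF x uv(1)] parent_T[OF y uv(2)] uv(3) by auto
    qed
  qed
  then show ?thesis by blast
qed

section \<open>Word maps and splitting off the first letter\<close>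

lemma word_map_Nil: "word_map f [] = id" and word_map_Cons: "word_map f (s # w) = f s \<circ> word_map f w"
  by (simp_all add: word_map_def)

lemma word_map_snoc: "word_map f (w @ [s]) = word_map f w \<circ> f s"
  by (induction w) (auto simp: word_map_def fun_eq_iff)

lemma continuous_word_map: "w \<in> lists S \<Longrightarrow> continuous_on UNIV (word_map f w)"
proof (induction w)
  case (Cons s w)
  then have s: "s \<in> S" and w: "continuous_on UNIV (word_map f w)" by auto
  show ?case
    unfolding word_map_Cons comp_def by (rule continuous_on_compose2[OF continuous_f[OF s] w]) simp
qed (simp add: word_map_Nil id_def)

lemma scale_words_Cons:
  assumes "1 \<le> n" "s \<in> S"
  shows "s # v \<in> \<Lambda> (n + j s) \<and> v \<noteq> [] \<longleftrightarrow> v \<in> \<Lambda> n"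
  using assms by (auto simp: scale_words_iff)

text \<open>\<open>J\<close> is additive, so removing the letter s lowers the scale by
  \<open>j s\<close>. The hypothesis on n excludes one-letter words, whose remainder would be
  empty.\<close>

lemma scale_words_split:
  assumes n: "\<And>s. s \<in> S \<Longrightarrow> j s < n"
  shows "\<Lambda> n = (\<Union>s\<in>S. (#) s ` \<Lambda> (n - j s))"
proof (intro equalityI subsetI)
  fix w assume w: "w \<in> \<Lambda> n"
  have n1: "1 \<le> n"
  proof -
    have "S \<noteq> {}" using sum_weights by auto
    then show ?thesis using n by fastforce
  qed
  then obtain s v where sv: "w = s # v" "s \<in> S" using w by (cases w) (auto simp: scale_words_iff)
  have "v \<noteq> []" using w sv n1 n[OF sv(2)] by (auto simp: scale_words_iff)
  then have "v \<in> \<Lambda> (n - j s)" using scale_words_Cons[of "n - j s" s v] w sv n[OF sv(2)] by simp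
  then show "w \<in> (\<Union>s\<in>S. (#) s ` \<Lambda> (n - j s))" using sv by blast
next
  fix w assume "w \<in> (\<Union>s\<in>S. (#) s ` \<Lambda> (n - j s))"
  then obtain s v where "w = s # v" "s \<in> S" "v \<in> \<Lambda> (n - j s)" by blast
  then show "w \<in> \<Lambda> n" using scale_words_Cons[of "n - j s" s v] n[of s] by simp
qed

section \<open>The self-similar measure\<close>

lemma space_\<mu>: "space \<mu> = UNIV"
  using sets_eq_imp_space_eq[OF sets_\<mu>] by simp

lemma measure_eq: "A \<in> sets borel \<Longrightarrow> measure \<mu> A = (\<Sum>s\<in>S. q s * measure \<mu> (f s -` A))"
  using self_similar_\<mu> by (simp add: self_similar_measure_def)

lemma range_word_map_closed: "w \<in> lists S \<Longrightarrow> closed (range (word_map f w))"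
proof -
  assume w: "w \<in> lists S"
  have "compact (UNIV :: 'k set)" using structure_S by (simp add: self_similar_structure_def)
  then show ?thesis using continuous_word_map[OF w] by (intro compact_imp_closed compact_continuous_image)
qed

lemma range_f_closed: "s \<in> S \<Longrightarrow> closed (range (f s))"
  using range_word_map_closed[of "[s]"] by (simp add: word_map_def)

lemma vimage_f_borel: "s \<in> S \<Longrightarrow> A \<in> sets borel \<Longrightarrow> f s -` A \<in> sets borel"
  using measurable_sets[OF borel_measurable_continuous_onI[OF continuous_f], of s A] by simp

text \<open>At a scale exceeding both \<open>j s\<close> and \<open>j t\<close> the two images
  decompose into cells of words with different first letters; all pairwise overlaps of these are
  null by \<open>overlap_T\<close>.\<close>

lemma measure_letter_overlap:
  assumes st: "s \<in> S" "t \<in> S" "s \<noteq> t"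
  shows "measure \<mu> (range (f s) \<inter> range (f t)) = 0"
proof -
  interpret prob_space \<mu> by (rule prob_space_\<mu>)
  let ?n = "1 + j s + j t"
  have sub: "\<exists>w\<in>\<Lambda> ?n. hd w = s \<and> z \<in> range (word_map f w)"
    if s: "s \<in> S" "j s < ?n" and z: "z \<in> range (f s)" for s z
  proof -
    obtain y where y: "z = f s y" using z by blast
    obtain x where "x \<in> level T (?n - j s)" "y \<in> cell T x" using cover_T[of "?n - j s"] by blast
    then obtain v where v: "v \<in> \<Lambda> (?n - j s)" "y \<in> range (word_map f v)" by (auto simp: level_T tree_simps)
    have "s # v \<in> \<Lambda> (?n - j s + j s)" using scale_words_Cons[of "?n - j s" s v] s v by simp
    then have "s # v \<in> \<Lambda> ?n" using s by simp
    moreover have "z \<in> range (word_map f (s # v))" using v y by (auto simp: word_map_Cons)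
    ultimately show ?thesis by force
  qed
  let ?I = "{(w, w'). w \<in> \<Lambda> ?n \<and> w' \<in> \<Lambda> ?n \<and> w \<noteq> w'}"
  have fin: "finite ?I" by (rule finite_subset[of _ "\<Lambda> ?n \<times> \<Lambda> ?n"]) (auto simp: finite_scale_words)
  have meas: "cell T x \<in> sets \<mu>" if "x \<in> level T ?n" for x
    unfolding sets_\<mu> using standing_partition(2)[OF that] by (intro borel_closed compact_imp_closed)
  have "range (f s) \<inter> range (f t) \<subseteq> (\<Union>(w, w')\<in>?I. cell T (?n, w) \<inter> cell T (?n, w'))"
  proof
    fix z assume z: "z \<in> range (f s) \<inter> range (f t)"
    obtain w where w: "w \<in> \<Lambda> ?n" "hd w = s" "z \<in> range (word_map f w)" using sub[of s z] z st by auto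
    obtain w' where w': "w' \<in> \<Lambda> ?n" "hd w' = t" "z \<in> range (word_map f w')" using sub[of t z] z st by auto
    show "z \<in> (\<Union>(w, w')\<in>?I. cell T (?n, w) \<inter> cell T (?n, w'))"
      using w w' st by (intro UN_I[of "(w, w')"]) (auto simp: tree_simps)
  qed
  then have "prob (range (f s) \<inter> range (f t)) \<le> prob (\<Union>(w, w')\<in>?I. cell T (?n, w) \<inter> cell T (?n, w'))"
    using fin meas by (intro finite_measure_mono sets.finite_UN) (auto simp: level_T)
  also have "\<dots> \<le> (\<Sum>(w, w')\<in>?I. prob (cell T (?n, w) \<inter> cell T (?n, w')))"
    using finite_measure_subadditive_finite[OF fin, of "\<lambda>(w, w'). cell T (?n, w) \<inter> cell T (?n, w')"] meas
    by (force simp: case_prod_unfold level_T image_subset_iff)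
  also have "\<dots> = 0" using overlap_T[of _ ?n] by (intro sum.neutral) (auto simp: level_T)
  finally show ?thesis using measure_nonneg[of \<mu>] by (simp add: order.antisym)
qed

text \<open>In the self-similarity identity for \<open>A \<inter> range (f s)\<close> all terms with
  another letter t vanish: the preimage under \<open>f t\<close> only sees the null set where the
  two images overlap.\<close>

lemma measure_letter:
  assumes s: "s \<in> S" and A: "A \<in> sets borel"
  shows "measure \<mu> (A \<inter> range (f s)) = q s * measure \<mu> (f s -` A)"
proof -
  interpret prob_space \<mu> by (rule prob_space_\<mu>)
  have Rs: "range (f s) \<in> sets borel" using range_f_closed[OF s] by (rule borel_closed)
  have zero: "q t * prob (f t -` (A \<inter> range (f s))) = 0" if t: "t \<in> S - {s}" for t
  proof -
    have Rt: "range (f t) \<in> sets borel" using range_f_closed t by (intro borel_closed) auto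
    have "q t * prob (f t -` (A \<inter> range (f s))) \<le> q t * prob (f t -` (range (f s) \<inter> range (f t)))"
      using t Rs Rt by (intro mult_left_mono finite_measure_mono) (auto simp: sets_\<mu> intro!: vimage_f_borel)
    also have "\<dots> \<le> (\<Sum>u\<in>S. q u * prob (f u -` (range (f s) \<inter> range (f t))))"
      using t finite_S by (intro member_le_sum) auto
    also have "\<dots> = prob (range (f s) \<inter> range (f t))" using measure_eq[of "range (f s) \<inter> range (f t)"] Rs Rt by simp
    also have "\<dots> = 0" using measure_letter_overlap[OF s, of t] t by auto
    finally show ?thesis by (rule order.antisym) simp
  qed
  let ?F = "\<lambda>t. q t * prob (f t -` (A \<inter> range (f s)))"
  have "(\<Sum>t\<in>S - {s}. ?F t) = 0" by (rule sum.neutral) (use zero in blast)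
  moreover have "prob (A \<inter> range (f s)) = (\<Sum>t\<in>S. ?F t)" using A Rs by (intro measure_eq) auto
  ultimately have "prob (A \<inter> range (f s)) = ?F s" using sum.remove[OF finite_S s, of ?F] by linarith
  also have "f s -` (A \<inter> range (f s)) = f s -` A" by auto
  finally show ?thesis .
qed

definition weight :: "'s list \<Rightarrow> real" where "weight w = prod_list (map q w)"

lemma weight_pos: "0 < weight w"
  unfolding weight_def using r by (induction w) auto

lemma measure_word:
  assumes "w \<in> lists S" "A \<in> sets borel"
  shows "measure \<mu> (A \<inter> range (word_map f w)) = weight w * measure \<mu> (word_map f w -` A)"
  using assms
proof (induction w arbitrary: A)
  case (Cons s w)
  then have s: "s \<in> S" and w: "w \<in> lists S" by auto
  have Rw: "range (word_map f (s # w)) \<in> sets borel"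
    using s w by (intro borel_closed range_word_map_closed) simp
  have "measure \<mu> (A \<inter> range (word_map f (s # w))) = measure \<mu> ((A \<inter> range (word_map f (s # w))) \<inter> range (f s))"
    by (rule arg_cong[of _ _ "measure \<mu>"]) (auto simp: word_map_Cons)
  also have "\<dots> = q s * measure \<mu> (f s -` (A \<inter> range (word_map f (s # w))))"
    using Cons.prems Rw by (intro measure_letter[OF s]) auto
  also have "f s -` (A \<inter> range (word_map f (s # w))) = f s -` A \<inter> range (word_map f w)"
    using inj_f[OF s] by (auto simp: word_map_Cons inj_def)
  also have "measure \<mu> \<dots> = weight w * measure \<mu> (word_map f w -` (f s -` A))"
    using Cons.prems by (intro Cons.IH vimage_f_borel s w) auto
  also have "word_map f w -` (f s -` A) = word_map f (s # w) -` A" by (auto simp: word_map_Cons)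
  finally show ?case by (simp add: weight_def)
qed (simp add: word_map_Nil weight_def)

text \<open>The image of \<mu> under a word map is \<mu> restricted to the image cell and normalised
  by the weight; injectivity and null overlaps enter through \<open>measure_word\<close>.\<close>

lemma integral_word_map:
  fixes g :: "'k \<Rightarrow> real"
  assumes w: "w \<in> lists S" and g: "g \<in> borel_measurable borel"
  shows "(\<integral>z. g (word_map f w z) \<partial>\<mu>) = (\<integral>z. indicator (range (word_map f w)) z * g z \<partial>\<mu>) / weight w"
proof -
  interpret prob_space \<mu> by (rule prob_space_\<mu>)
  let ?R = "range (word_map f w)"
  have R: "?R \<in> sets borel" using range_word_map_closed[OF w] by (rule borel_closed)
  have wm: "word_map f w \<in> measurable \<mu> borel"
    using borel_measurable_continuous_onI[OF continuous_word_map[OF w]] measurable_cong_sets[OF sets_\<mu> refl] by blast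
  have eq: "distr \<mu> borel (word_map f w) = density \<mu> (\<lambda>z. ennreal (indicator ?R z / weight w))"
  proof (rule measure_eqI)
    show "sets (distr \<mu> borel (word_map f w)) = sets (density \<mu> (\<lambda>z. ennreal (indicator ?R z / weight w)))"
      by (simp add: sets_\<mu>)
    fix A assume "A \<in> sets (distr \<mu> borel (word_map f w))"
    then have A: "A \<in> sets borel" by simp
    have "emeasure (density \<mu> (\<lambda>z. ennreal (indicator ?R z / weight w))) A
        = (\<integral>\<^sup>+z. ennreal (indicator ?R z / weight w) * indicator A z \<partial>\<mu>)"
    proof (rule emeasure_density)
      have [measurable]: "?R \<in> sets \<mu>" using R by (simp add: sets_\<mu>)
      show "(\<lambda>z. ennreal (indicator ?R z / weight w)) \<in> borel_measurable \<mu>" by measurable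
    qed (use A in \<open>simp add: sets_\<mu>\<close>)
    also have "\<dots> = (\<integral>\<^sup>+z. ennreal (1 / weight w) * indicator (A \<inter> ?R) z \<partial>\<mu>)"
      by (intro nn_integral_cong) (auto simp: indicator_def)
    also have "\<dots> = ennreal (1 / weight w) * emeasure \<mu> (A \<inter> ?R)"
      using R A by (intro nn_integral_cmult_indicator) (auto simp: sets_\<mu>)
    also have "\<dots> = ennreal (1 / weight w * (weight w * measure \<mu> (word_map f w -` A)))"
      using weight_pos[of w] measure_word[OF w A]
      by (simp add: emeasure_eq_measure ennreal_mult[symmetric])
    also have "\<dots> = emeasure (distr \<mu> borel (word_map f w)) A"
      using weight_pos[of w] wm A by (simp add: emeasure_distr emeasure_eq_measure space_\<mu>)
    finally show "emeasure (distr \<mu> borel (word_map f w)) A = emeasure (density \<mu> (\<lambda>z. ennreal (indicator ?R z / weight w))) A"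
      by simp
  qed
  have "(\<integral>z. g (word_map f w z) \<partial>\<mu>) = (\<integral>z. g z \<partial>distr \<mu> borel (word_map f w))"
    using wm g by (intro integral_distr[symmetric])
  also have "\<dots> = (\<integral>z. (indicator ?R z / weight w) *\<^sub>R g z \<partial>\<mu>)"
    unfolding eq
  proof (rule integral_density)
    show "g \<in> borel_measurable \<mu>" using g measurable_cong_sets[OF sets_\<mu> refl, of borel] by blast
    have [measurable]: "?R \<in> sets \<mu>" using R by (simp add: sets_\<mu>)
    show "(\<lambda>z. indicator ?R z / weight w) \<in> borel_measurable \<mu>" by measurable
    show "AE z in \<mu>. 0 \<le> indicator ?R z / weight w"
      using weight_pos[of w] by (intro AE_I2 divide_nonneg_pos) auto
  qed
  also have "\<dots> = (\<integral>z. indicator ?R z * g z / weight w \<partial>\<mu>)" by simp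
  also have "\<dots> = (\<integral>z. indicator ?R z * g z \<partial>\<mu>) / weight w" by (rule integral_divide_zero)
  finally show ?thesis .
qed

text \<open>The mean over a cell is the global mean of the pulled back function. Hence estimates
  proved once on the whole space transfer to every cell with the same constants.\<close>

lemma cell_mean_T:
  assumes w: "w \<in> \<Lambda> n" and u: "u \<in> borel_measurable borel"
  shows "cell_mean T \<mu> u (n, w) = (\<integral>z. u (word_map f w z) \<partial>\<mu>)"
proof -
  have wl: "w \<in> lists S" using w scale_words_lists by blast
  have "measure \<mu> (range (word_map f w)) = weight w"
    using measure_word[OF wl, of UNIV] prob_space.prob_space[OF prob_space_\<mu>] by (simp add: space_\<mu>)
  then show ?thesis
    using integral_word_map[OF wl u] by (simp add: cell_mean_def set_lebesgue_integral_def tree_simps)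
qed

end

section \<open>The self-similar energy\<close>

locale self_similar_conductive =
  self_similar S f r \<alpha>\<^sub>H j M \<mu> + conductive_space "self_similar_tree S f r j" \<mu> r a b M N p \<sigma> C
  for S :: "'s set" and f :: "'s \<Rightarrow> 'k::metric_space \<Rightarrow> 'k" and r \<alpha>\<^sub>H :: real
    and j :: "'s \<Rightarrow> nat" and M :: nat and \<mu> :: "'k measure" and a b :: real and N :: nat and p \<sigma> C :: real
begin

abbreviation W :: "('k \<Rightarrow> real) set" where "W \<equiv> Wp T \<mu> p \<sigma>"

lemma measurable_continuous: "continuous_on UNIV g \<Longrightarrow> g \<in> borel_measurable \<mu>" for g :: "'k \<Rightarrow> real"
  by (rule borel_measurable_integrable[OF continuous_integrable])

lemma continuous_bounded:
  fixes g :: "'k \<Rightarrow> real"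
  assumes "continuous_on UNIV g"
  obtains B where "0 \<le> B" "\<And>x. \<bar>g x\<bar> \<le> B"
proof -
  have "bounded (range g)" by (intro compact_imp_bounded compact_continuous_image assms compact_UNIV)
  then obtain B where B: "\<And>x. \<bar>g x\<bar> \<le> B" by (auto simp: bounded_iff)
  moreover have "0 \<le> B" using B[of undefined] by linarith
  ultimately show ?thesis using that by blast
qed

lemma continuous_abs_powr:
  "continuous_on UNIV g \<Longrightarrow> continuous_on UNIV (\<lambda>x. \<bar>g x - c\<bar> powr p)" for g :: "'k \<Rightarrow> real"
  using p_pos by (intro continuous_on_powr' continuous_intros) auto

text \<open>The functional Q of the overview, as one integral over the product measure.\<close>

definition variation :: "('k \<Rightarrow> real) \<Rightarrow> real" where
  "variation g = (\<integral>z. \<bar>g (fst z) - g (snd z)\<bar> powr p \<partial>(\<mu> \<Otimes>\<^sub>M \<mu>))"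

lemma pair_integrable:
  fixes h :: "'k \<times> 'k \<Rightarrow> real"
  assumes "h \<in> borel_measurable (\<mu> \<Otimes>\<^sub>M \<mu>)" "\<And>z. \<bar>h z\<bar> \<le> B"
  shows "integrable (\<mu> \<Otimes>\<^sub>M \<mu>) h"
proof -
  interpret pair_prob_space \<mu> \<mu> ..
  show ?thesis using assms by (intro P.integrable_const_bound[of _ B]) auto
qed

lemma variation_integrable:
  assumes g: "continuous_on UNIV g"
  shows "integrable (\<mu> \<Otimes>\<^sub>M \<mu>) (\<lambda>z. \<bar>g (fst z) - g (snd z)\<bar> powr p)"
proof -
  obtain B where B: "0 \<le> B" "\<And>x. \<bar>g x\<bar> \<le> B" using continuous_bounded[OF g] by metis
  note [measurable] = measurable_continuous[OF g]
  show ?thesis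
  proof (rule pair_integrable[of _ "(2 * B) powr p"])
    fix z :: "'k \<times> 'k"
    have "\<bar>g (fst z) - g (snd z)\<bar> \<le> 2 * B" using B(2)[of "fst z"] B(2)[of "snd z"] by linarith
    then show "\<bar>\<bar>g (fst z) - g (snd z)\<bar> powr p\<bar> \<le> (2 * B) powr p"
      using p_pos by (simp add: powr_mono2)
  qed measurable
qed

lemma variation_nonneg: "0 \<le> variation g"
  unfolding variation_def by (rule integral_nonneg_AE) auto

lemma variation_mono:
  assumes "continuous_on UNIV g" "continuous_on UNIV h" "\<And>x y. \<bar>g x - g y\<bar> \<le> \<bar>h x - h y\<bar>"
  shows "variation g \<le> variation h"
  unfolding variation_def using assms p_pos
  by (intro integral_mono variation_integrable powr_mono2) auto

lemma variation_scale: "variation (\<lambda>x. c * g x) = \<bar>c\<bar> powr p * variation g"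
  unfolding variation_def right_diff_distrib[symmetric] abs_mult powr_mult by simp

lemma variation_convex:
  assumes g: "continuous_on UNIV g" and h: "continuous_on UNIV h" and t: "0 \<le> t" "t \<le> 1"
  shows "variation (\<lambda>x. (1 - t) * g x + t * h x) \<le> (1 - t) * variation g + t * variation h"
proof -
  have "variation (\<lambda>x. (1 - t) * g x + t * h x)
      \<le> (\<integral>z. (1 - t) * \<bar>g (fst z) - g (snd z)\<bar> powr p + t * \<bar>h (fst z) - h (snd z)\<bar> powr p \<partial>(\<mu> \<Otimes>\<^sub>M \<mu>))"
    unfolding variation_def
  proof (rule integral_mono)
    show "integrable (\<mu> \<Otimes>\<^sub>M \<mu>) (\<lambda>z. (1 - t) * \<bar>g (fst z) - g (snd z)\<bar> powr p + t * \<bar>h (fst z) - h (snd z)\<bar> powr p)"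
      by (intro Bochner_Integration.integrable_add integrable_mult_right variation_integrable g h)
    show "integrable (\<mu> \<Otimes>\<^sub>M \<mu>) (\<lambda>z. \<bar>(1 - t) * g (fst z) + t * h (fst z) - ((1 - t) * g (snd z) + t * h (snd z))\<bar> powr p)"
      by (intro variation_integrable[of "\<lambda>x. (1 - t) * g x + t * h x"] continuous_intros g h)
    fix z :: "'k \<times> 'k"
    have "(1 - t) * g (fst z) + t * h (fst z) - ((1 - t) * g (snd z) + t * h (snd z))
        = (1 - t) * (g (fst z) - g (snd z)) + t * (h (fst z) - h (snd z))" by (simp add: algebra_simps)
    then show "\<bar>(1 - t) * g (fst z) + t * h (fst z) - ((1 - t) * g (snd z) + t * h (snd z))\<bar> powr p
        \<le> (1 - t) * \<bar>g (fst z) - g (snd z)\<bar> powr p + t * \<bar>h (fst z) - h (snd z)\<bar> powr p"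
      using abs_convex_combination_powr[OF less_imp_le[OF p_gt_1] t] by simp
  qed
  also have "\<dots> = (1 - t) * variation g + t * variation h"
    unfolding variation_def using variation_integrable[OF g] variation_integrable[OF h] by simp
  finally show ?thesis .
qed

lemma variation_le:
  assumes g: "continuous_on UNIV g" and e: "\<And>x y. \<bar>g x - g y\<bar> \<le> e"
  shows "variation g \<le> e powr p"
proof -
  interpret pair_prob_space \<mu> \<mu> ..
  have "variation g \<le> (\<integral>z. e powr p \<partial>(\<mu> \<Otimes>\<^sub>M \<mu>))"
    unfolding variation_def using e p_pos
    by (intro integral_mono variation_integrable[OF g] powr_mono2) auto
  then show ?thesis by (simp add: P.prob_space)
qed

text \<open>By Fubini the variation is the average over x of the deviation of g from g(x); some x
  does not exceed the average, and c = g(x).\<close>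

lemma variation_point:
  assumes g: "continuous_on UNIV g"
  shows "\<exists>c. (\<integral>y. \<bar>g y - c\<bar> powr p \<partial>\<mu>) \<le> variation g"
proof (rule ccontr)
  assume no: "\<not> ?thesis"
  let ?G = "\<lambda>x. \<integral>y. \<bar>g (fst (x, y)) - g (snd (x, y))\<bar> powr p \<partial>\<mu>"
  have G: "variation g < ?G x" for x
    using no by (auto simp: not_le abs_minus_commute[of "g x"])
  have strict: "(\<integral>x. variation g \<partial>\<mu>) < (\<integral>x. ?G x \<partial>\<mu>)" if "integrable \<mu> ?G"
  proof (rule integral_less_AE_space[OF _ that])
    show "AE x in \<mu>. variation g < ?G x" by (intro AE_I2 G)
  qed (simp_all add: emeasure_space_1)
  have one: "measure \<mu> (space \<mu>) = 1" by (rule prob_space)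
  interpret pair_prob_space \<mu> \<mu> ..
  have "(\<integral>x. variation g \<partial>\<mu>) < (\<integral>x. ?G x \<partial>\<mu>)"
    by (rule strict[OF integrable_fst'[OF variation_integrable[OF g]]])
  also have "(\<integral>x. ?G x \<partial>\<mu>) = variation g"
    unfolding variation_def by (rule integral_fst'[OF variation_integrable[OF g]])
  finally show False by (simp add: one)
qed

lemma mean_powr_le:
  assumes g: "continuous_on UNIV g"
  shows "\<bar>(\<integral>y. g y \<partial>\<mu>) - c\<bar> powr p \<le> (\<integral>y. \<bar>g y - c\<bar> powr p \<partial>\<mu>)"
  by (rule jensens_inequality[of g UNIV undefined undefined "\<lambda>x. \<bar>x - c\<bar> powr p"])
    (use p_gt_1 in \<open>auto intro!: continuous_integrable g continuous_abs_powr convex_on_abs_powr\<close>)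

lemma comp_f_continuous: "continuous_on UNIV g \<Longrightarrow> s \<in> S \<Longrightarrow> continuous_on UNIV (g \<circ> f s)" for g :: "'k \<Rightarrow> real"
  by (rule continuous_on_compose[OF continuous_f]) (auto intro: continuous_on_subset)

lemma comp_word_continuous:
  "continuous_on UNIV g \<Longrightarrow> w \<in> lists S \<Longrightarrow> continuous_on UNIV (g \<circ> word_map f w)" for g :: "'k \<Rightarrow> real"
  by (rule continuous_on_compose[OF continuous_word_map]) (auto intro: continuous_on_subset)

definition L1 :: real where "L1 = 2 powr p * (1 + (\<Sum>s\<in>S. 1 / q s))"

lemma L1_pos: "0 < L1"
  unfolding L1_def using q_pos by (intro mult_pos_pos add_pos_nonneg sum_nonneg) (auto simp: less_imp_le)

text \<open>Both means are compared with one constant c from \<open>variation_point\<close> by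
  Jensen's inequality. Restricting the integral to the image of \<open>f s\<close> costs the factor
  1 / \<open>q s\<close>; \<open>L1\<close> sums these over all letters to be uniform in s.\<close>

lemma variation_child:
  assumes g: "continuous_on UNIV g" and s: "s \<in> S"
  shows "\<bar>(\<integral>y. g y \<partial>\<mu>) - (\<integral>y. g (f s y) \<partial>\<mu>)\<bar> powr p \<le> L1 * variation g"
proof -
  obtain c where c: "(\<integral>y. \<bar>g y - c\<bar> powr p \<partial>\<mu>) \<le> variation g" using variation_point[OF g] by blast
  let ?A = "\<integral>y. \<bar>g y - c\<bar> powr p \<partial>\<mu>"
  have A: "0 \<le> ?A" by (rule integral_nonneg_AE) auto
  have cont: "continuous_on UNIV (\<lambda>y. \<bar>g y - c\<bar> powr p)" by (rule continuous_abs_powr[OF g])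
  have 1: "\<bar>(\<integral>y. g y \<partial>\<mu>) - c\<bar> powr p \<le> ?A" by (rule mean_powr_le[OF g])
  have "\<bar>(\<integral>y. g (f s y) \<partial>\<mu>) - c\<bar> powr p \<le> (\<integral>y. \<bar>g (f s y) - c\<bar> powr p \<partial>\<mu>)"
    using mean_powr_le[OF comp_f_continuous[OF g s], of c] by simp
  also have "\<dots> = (\<integral>z. indicator (range (f s)) z * \<bar>g z - c\<bar> powr p \<partial>\<mu>) / q s"
    using integral_word_map[of "[s]" "\<lambda>z. \<bar>g z - c\<bar> powr p"] s borel_measurable_continuous_onI[OF cont]
    by (simp add: word_map_def weight_def)
  also have "\<dots> \<le> ?A / q s"
  proof (intro divide_right_mono integral_mono)
    have "range (f s) \<in> sets \<mu>" using range_f_closed[OF s] by (simp add: sets_\<mu> borel_closed)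
    then show "integrable \<mu> (\<lambda>z. indicator (range (f s)) z * \<bar>g z - c\<bar> powr p)"
      using integrable_mult_indicator[OF _ continuous_integrable[OF cont]] by simp
  qed (auto simp: indicator_def continuous_integrable[OF cont])
  finally have 2: "\<bar>(\<integral>y. g (f s y) \<partial>\<mu>) - c\<bar> powr p \<le> ?A / q s" .
  have "\<bar>(\<integral>y. g y \<partial>\<mu>) - (\<integral>y. g (f s y) \<partial>\<mu>)\<bar> powr p
      \<le> (\<bar>(\<integral>y. g y \<partial>\<mu>) - c\<bar> + \<bar>(\<integral>y. g (f s y) \<partial>\<mu>) - c\<bar>) powr p"
    using p_pos by (intro powr_mono2) auto
  also have "\<dots> \<le> 2 powr p * (\<bar>(\<integral>y. g y \<partial>\<mu>) - c\<bar> powr p + \<bar>(\<integral>y. g (f s y) \<partial>\<mu>) - c\<bar> powr p)"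
    using p_pos by (intro powr_add_le) auto
  also have "\<dots> \<le> 2 powr p * (?A + ?A / q s)" using 1 2 by (intro mult_left_mono add_mono) auto
  also have "\<dots> = 2 powr p * (1 + 1 / q s) * ?A" by (simp add: algebra_simps)
  also have "\<dots> \<le> L1 * variation g"
    unfolding L1_def
  proof (intro mult_mono mult_left_mono add_left_mono c A)
    show "1 / q s \<le> (\<Sum>s\<in>S. 1 / q s)" using s finite_S by (intro member_le_sum) auto
  qed (use less_imp_le[OF L1_pos[unfolded L1_def]] in auto)
  finally show ?thesis .
qed

definition cell_variation :: "('k \<Rightarrow> real) \<Rightarrow> nat \<times> 's list \<Rightarrow> real" where
  "cell_variation u x = variation (u \<circ> word_map f (snd x))"

lemma cell_variation_nonneg: "0 \<le> cell_variation u x"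
  by (simp add: cell_variation_def variation_nonneg)

lemma cell_variation_child:
  assumes u: "continuous_on UNIV u" and x: "x \<in> level T n" and y: "y \<in> children T x"
  shows "\<bar>cell_mean T \<mu> u x - cell_mean T \<mu> u y\<bar> powr p \<le> L1 * cell_variation u x"
proof -
  obtain v w where v: "x = (n, v)" "v \<in> \<Lambda> n" and w: "y = (Suc n, w)" "w \<in> \<Lambda> (Suc n)" "w = v \<or> v = butlast w"
    using x y by (auto simp: level_T tree_simps)
  have vl: "v \<in> lists S" using v scale_words_lists by blast
  note mean = cell_mean_T[OF _ borel_measurable_continuous_onI[OF u]]
  show ?thesis
  proof (cases "w = v")
    case True
    then show ?thesis
      using mean[OF v(2)] mean[OF w(2)] L1_pos cell_variation_nonneg by (simp add: v(1) w(1))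
  next
    case False
    have "w \<noteq> []" "w \<in> lists S" using w by (auto simp: scale_words_iff)
    then have ws: "w = v @ [last w]" "last w \<in> S" using False w by (auto simp: in_lists_conv_set)
    have "word_map f w = word_map f v \<circ> f (last w)" by (subst ws(1)) (rule word_map_snoc)
    then show ?thesis
      using variation_child[OF comp_word_continuous[OF u vl] ws(2)] mean[OF v(2)] mean[OF w(2)]
      by (simp add: v(1) w(1) cell_variation_def)
  qed
qed

definition L2 :: real where "L2 = (1 - \<kappa>) powr (1 - p) * L1"

lemma L2_pos: "0 < L2"
  using L1_pos \<kappa> by (simp add: L2_def)

text \<open>Weighted telescoping with \<kappa> as before, but keeping the contribution of each level
  instead of summing it up. The factor \<open>(\<kappa> * \<sigma>) ^ k\<close> becomes
  \<open>\<kappa> ^ k\<close> once level energies absorb \<open>\<sigma> ^ k\<close>.\<close>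

lemma cell_variation_descendant:
  assumes u: "continuous_on UNIV u" and x: "x \<in> level T n" and y: "y \<in> descendants T m x"
  shows "\<bar>cell_mean T \<mu> u x - cell_mean T \<mu> u y\<bar> powr p
    \<le> L2 * (\<Sum>k<m. (\<kappa> * \<sigma>) ^ k * (\<Sum>z\<in>descendants T k x. cell_variation u z))"
  using x y
proof (induction m arbitrary: x n)
  case (Suc m)
  let ?h = "cell_mean T \<mu> u" and ?V = "cell_variation u"
  obtain z where z: "z \<in> children T x" "y \<in> descendants T m z" using Suc.prems by auto
  have zl: "z \<in> level T (Suc n)" using z Suc.prems level_Suc_T by blast
  have "\<bar>?h x - ?h y\<bar> powr p \<le> (\<bar>?h x - ?h z\<bar> + \<bar>?h z - ?h y\<bar>) powr p"
    using p_pos by (intro powr_mono2) auto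
  also have "\<dots> \<le> (1 - \<kappa>) powr (1 - p) * \<bar>?h x - ?h z\<bar> powr p + \<kappa> powr (1 - p) * \<bar>?h z - ?h y\<bar> powr p"
    using p_gt_1 \<kappa> by (intro powr_add_weighted) auto
  also have "\<dots> \<le> (1 - \<kappa>) powr (1 - p) * (L1 * ?V x) +
      \<kappa> powr (1 - p) * (L2 * (\<Sum>k<m. (\<kappa> * \<sigma>) ^ k * (\<Sum>v\<in>descendants T (Suc k) x. ?V v)))"
  proof (intro add_mono mult_left_mono)
    show "\<bar>?h x - ?h z\<bar> powr p \<le> L1 * ?V x" by (rule cell_variation_child[OF u Suc.prems(1) z(1)])
    have "\<bar>?h z - ?h y\<bar> powr p \<le> L2 * (\<Sum>k<m. (\<kappa> * \<sigma>) ^ k * (\<Sum>v\<in>descendants T k z. ?V v))"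
      by (rule Suc.IH[OF zl z(2)])
    also have "\<dots> \<le> L2 * (\<Sum>k<m. (\<kappa> * \<sigma>) ^ k * (\<Sum>v\<in>descendants T (Suc k) x. ?V v))"
    proof (intro mult_left_mono sum_mono)
      fix k
      show "(\<Sum>v\<in>descendants T k z. ?V v) \<le> (\<Sum>v\<in>descendants T (Suc k) x. ?V v)"
        using z(1) by (intro sum_mono2 finite_descendants[OF Suc.prems(1)]) (auto simp: cell_variation_nonneg)
    qed (use \<kappa> \<sigma>_pos L2_pos in auto)
    finally show "\<bar>?h z - ?h y\<bar> powr p \<le> L2 * (\<Sum>k<m. (\<kappa> * \<sigma>) ^ k * (\<Sum>v\<in>descendants T (Suc k) x. ?V v))" .
  qed auto
  also have "\<dots> = L2 * ?V x + L2 * (\<Sum>k<m. (\<kappa> * \<sigma>) ^ Suc k * (\<Sum>v\<in>descendants T (Suc k) x. ?V v))"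
    by (simp add: L2_def \<kappa>_powr sum_distrib_left mult_ac)
  also have "\<dots> = L2 * (\<Sum>k<Suc m. (\<kappa> * \<sigma>) ^ k * (\<Sum>v\<in>descendants T k x. ?V v))"
    by (simp only: sum.lessThan_Suc_shift distrib_left) simp
  finally show ?case .
qed simp

lemma level_T_word: "x \<in> level T n \<Longrightarrow> snd x \<in> lists S"
  unfolding level_T by (erule imageE) (simp only: snd_conv scale_words_lists)

text \<open>The functional called D with index n in the overview.\<close>

definition level_energy :: "nat \<Rightarrow> ('k \<Rightarrow> real) \<Rightarrow> real" where
  "level_energy n u = \<sigma> ^ n * (\<Sum>x\<in>level T n. cell_variation u x)"

lemma level_energy_nonneg: "0 \<le> level_energy n u"
  unfolding level_energy_def using \<sigma>_pos by (intro mult_nonneg_nonneg sum_nonneg cell_variation_nonneg) auto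

lemma level_energy_le:
  assumes u: "continuous_on UNIV u"
  shows "level_energy n u \<le> \<sigma> ^ n * osc_sum p n u"
  unfolding level_energy_def osc_sum_def
proof (intro mult_left_mono sum_mono)
  fix x assume "x \<in> level T n"
  then obtain w where w: "x = (n, w)" "w \<in> lists S" using scale_words_lists by (auto simp: level_T)
  show "cell_variation u x \<le> diameter (u ` cell T x) powr p"
    unfolding cell_variation_def using u w
    by (intro variation_le comp_word_continuous) (auto simp: tree_simps intro!: oscillation_le)
qed (use \<sigma>_pos in simp)

lemma level_energy_bound:
  assumes "continuous_on UNIV u" "energy_bound p \<sigma> (cell_mean T \<mu> u) B"
  shows "level_energy n u \<le> K4 * B"
  using level_energy_le[OF assms(1)] osc_sum_le[OF assms] by (rule order.trans)

definition L3 :: real where "L3 = N * 4 powr p * (L2 + 1)"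

lemma L3_pos: "0 < L3"
  using N_pos L2_pos by (simp add: L3_def)

text \<open>The energy of means at level n is controlled by variations on m successive levels with
  geometric weights; the remaining oscillation at level n + m contributes only a term of order
  \<sigma>^(-m), which the a priori bound B makes available.\<close>

lemma energy_le_level_energy:
  assumes u: "continuous_on UNIV u" and B: "energy_bound p \<sigma> (cell_mean T \<mu> u) B"
  shows "\<sigma> ^ n * energy T p n (cell_mean T \<mu> u) \<le> L3 * ((\<Sum>k<m. \<kappa> ^ k * level_energy (n + k) u) + K4 * B / \<sigma> ^ m)"
proof -
  let ?h = "cell_mean T \<mu> u" and ?V = "cell_variation u"
  define A where "A x = (\<Sum>k<m. (\<kappa> * \<sigma>) ^ k * (\<Sum>z\<in>descendants T k x. ?V z))" for x
  \<comment> \<open>All descendants of x are summed, although only one contains z, so that the bound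
    depends on x alone and adds up to \<open>osc_sum\<close>.\<close>
  define O' where "O' x = (\<Sum>z\<in>descendants T m x. diameter (u ` cell T z) powr p)" for x
  have A0: "0 \<le> A x" for x unfolding A_def using \<kappa> \<sigma>_pos
    by (intro sum_nonneg mult_nonneg_nonneg cell_variation_nonneg) auto
  have O0: "0 \<le> O' x" for x by (simp add: O'_def sum_nonneg)
  have near: "\<bar>?h x - u z\<bar> powr p \<le> 2 powr p * (L2 * A x + O' x)" if x: "x \<in> level T n" and z: "z \<in> cell T x" for x z
  proof -
    obtain y where y: "y \<in> descendants T m x" "z \<in> cell T y" using descendant_at[OF x z] by metis
    have yl: "y \<in> level T (n + m)" using descendants_level[OF x] y by blast
    have "\<bar>?h x - u z\<bar> powr p \<le> (\<bar>?h x - ?h y\<bar> + \<bar>?h y - u z\<bar>) powr p"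
      using p_pos by (intro powr_mono2) auto
    also have "\<dots> \<le> 2 powr p * (\<bar>?h x - ?h y\<bar> powr p + \<bar>?h y - u z\<bar> powr p)"
      using p_pos by (intro powr_add_le) auto
    also have "\<dots> \<le> 2 powr p * (L2 * A x + O' x)"
    proof (intro mult_left_mono add_mono)
      show "\<bar>?h x - ?h y\<bar> powr p \<le> L2 * A x" unfolding A_def by (rule cell_variation_descendant[OF u x y(1)])
      have "\<bar>?h y - u z\<bar> powr p \<le> diameter (u ` cell T y) powr p"
        using cell_mean_osc[OF yl u y(2)] p_pos by (intro powr_mono2) auto
      also have "\<dots> \<le> O' x" unfolding O'_def by (rule member_le_sum[OF y(1)]) (auto simp: finite_descendants[OF x])
      finally show "\<bar>?h y - u z\<bar> powr p \<le> O' x" .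
    qed simp
    finally show ?thesis .
  qed
  have "energy T p n ?h \<le> N * (\<Sum>x\<in>level T n. 4 powr p * (L2 * A x + O' x))"
  proof (rule energy_le_double_sum)
    fix x y assume "(x, y) \<in> edges T n"
    then obtain z where z: "x \<in> level T n" "y \<in> level T n" "z \<in> cell T x" "z \<in> cell T y" by (auto simp: edges_def)
    have "\<bar>?h x - ?h y\<bar> powr p \<le> (\<bar>?h x - u z\<bar> + \<bar>?h y - u z\<bar>) powr p"
      using p_pos by (intro powr_mono2) auto
    also have "\<dots> \<le> 2 powr p * (\<bar>?h x - u z\<bar> powr p + \<bar>?h y - u z\<bar> powr p)"
      using p_pos by (intro powr_add_le) auto
    also have "\<dots> \<le> 2 powr p * (2 powr p * (L2 * A x + O' x) + 2 powr p * (L2 * A y + O' y))"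
      by (intro mult_left_mono add_mono near z) auto
    also have "\<dots> = 4 powr p * (L2 * A x + O' x) + 4 powr p * (L2 * A y + O' y)"
      using powr_mult[of 2 2 p] by (simp add: algebra_simps)
    finally show "\<bar>?h x - ?h y\<bar> powr p \<le> 4 powr p * (L2 * A x + O' x) + 4 powr p * (L2 * A y + O' y)" .
  qed (use A0 O0 L2_pos in auto)
  also have "(\<Sum>x\<in>level T n. 4 powr p * (L2 * A x + O' x))
      = 4 powr p * (L2 * (\<Sum>x\<in>level T n. A x) + osc_sum p (n + m) u)"
    unfolding osc_sum_def sum_level_add O'_def by (simp add: sum.distrib sum_distrib_left distrib_left)
  finally have "\<sigma> ^ n * energy T p n ?h \<le> \<sigma> ^ n * (N * (4 powr p * (L2 * (\<Sum>x\<in>level T n. A x) + osc_sum p (n + m) u)))"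
    using \<sigma>_pos by (intro mult_left_mono) auto
  also have "\<dots> = N * 4 powr p * (L2 * (\<sigma> ^ n * (\<Sum>x\<in>level T n. A x)) + \<sigma> ^ n * osc_sum p (n + m) u)"
    by (simp add: algebra_simps)
  also have "\<sigma> ^ n * (\<Sum>x\<in>level T n. A x) = (\<Sum>k<m. \<kappa> ^ k * level_energy (n + k) u)"
  proof -
    have "(\<Sum>x\<in>level T n. A x) = (\<Sum>k<m. (\<kappa> * \<sigma>) ^ k * (\<Sum>z\<in>level T (n + k). ?V z))"
      unfolding A_def sum_level_add by (subst sum.swap) (simp add: sum_distrib_left)
    then show ?thesis
      by (simp add: level_energy_def sum_distrib_left power_mult_distrib power_add mult_ac)
  qed
  also have "N * 4 powr p * (L2 * (\<Sum>k<m. \<kappa> ^ k * level_energy (n + k) u) + \<sigma> ^ n * osc_sum p (n + m) u)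
      \<le> N * 4 powr p * ((L2 + 1) * (\<Sum>k<m. \<kappa> ^ k * level_energy (n + k) u) + (L2 + 1) * (K4 * B / \<sigma> ^ m))"
  proof (intro mult_left_mono add_mono mult_right_mono)
    show "0 \<le> (\<Sum>k<m. \<kappa> ^ k * level_energy (n + k) u)"
      using \<kappa> by (intro sum_nonneg mult_nonneg_nonneg level_energy_nonneg) auto
    have "\<sigma> ^ n * osc_sum p (n + m) u = \<sigma> ^ (n + m) * osc_sum p (n + m) u / \<sigma> ^ m"
      using \<sigma>_pos by (simp add: power_add)
    also have "\<dots> \<le> K4 * B / \<sigma> ^ m"
      using osc_sum_le[OF u B, of "n + m"] \<sigma>_pos by (intro divide_right_mono) auto
    also have "\<dots> = 1 * (K4 * B / \<sigma> ^ m)" by simp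
    also have "\<dots> \<le> (L2 + 1) * (K4 * B / \<sigma> ^ m)"
      using L2_pos K4_pos energy_bound_nonneg[OF B] \<sigma>_pos by (intro mult_right_mono) auto
    finally show "\<sigma> ^ n * osc_sum p (n + m) u \<le> (L2 + 1) * (K4 * B / \<sigma> ^ m)" .
  qed auto
  finally show ?thesis by (simp only: L3_def distrib_left[symmetric] mult.assoc)
qed

subsection \<open>Self-similarity of the level energies\<close>

text \<open>Level-n cells carry \<open>u \<circ> f s\<close> exactly as level-(n + j s) cells with
  first letter s carry u, so oscillation sums can only decrease.\<close>

lemma Wp_comp_f:
  assumes u: "u \<in> W" and s: "s \<in> S"
  shows "u \<circ> f s \<in> W"
proof -
  have cu: "continuous_on UNIV u" by (rule Wp_continuous[OF u])
  obtain B where B: "\<forall>n\<ge>1. \<sigma> ^ n * osc_sum p n u \<le> B" using u Wp_osc_iff by blast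
  have "\<sigma> ^ n * osc_sum p n (u \<circ> f s) \<le> B" if n: "1 \<le> n" for n
  proof -
    have "osc_sum p n (u \<circ> f s) = (\<Sum>w\<in>\<Lambda> n. diameter (u ` cell T (n + j s, s # w)) powr p)"
      unfolding osc_sum_def sum_level_T
      by (intro sum.cong refl) (simp add: tree_simps word_map_Cons image_comp comp_assoc)
    also have "\<dots> = (\<Sum>w\<in>(#) s ` \<Lambda> n. diameter (u ` cell T (n + j s, w)) powr p)"
      by (subst sum.reindex) auto
    also have "\<dots> \<le> (\<Sum>w\<in>\<Lambda> (n + j s). diameter (u ` cell T (n + j s, w)) powr p)"
      using scale_words_Cons[OF n s] by (intro sum_mono2 finite_scale_words) auto
    also have "\<dots> = osc_sum p (n + j s) u" by (simp add: osc_sum_def sum_level_T)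
    finally have "\<sigma> ^ n * osc_sum p n (u \<circ> f s) \<le> \<sigma> ^ (n + j s) * osc_sum p (n + j s) u"
      using \<sigma>_gt_1 by (intro mult_mono power_increasing) (auto simp: osc_sum_def intro!: sum_nonneg)
    also have "\<dots> \<le> B" using B n by auto
    finally show ?thesis .
  qed
  then show ?thesis unfolding Wp_osc_iff using comp_f_continuous[OF cu s] by blast
qed

lemma Wp_comp_word: "w \<in> lists S \<Longrightarrow> u \<in> W \<Longrightarrow> u \<circ> word_map f w \<in> W"
proof (induction w arbitrary: u)
  case (Cons s w)
  then have "(u \<circ> f s) \<circ> word_map f w \<in> W" by (intro Cons.IH Wp_comp_f) auto
  then show ?case by (simp only: word_map_Cons comp_assoc)
qed (simp add: word_map_Nil)

text \<open>Exact because variations live on single cells; there are no interaction terms between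
  different letters.\<close>

lemma level_energy_self_similar:
  assumes n: "\<And>s. s \<in> S \<Longrightarrow> j s < n"
  shows "level_energy n u = (\<Sum>s\<in>S. \<sigma> ^ j s * level_energy (n - j s) (u \<circ> f s))"
proof -
  have "(\<Sum>x\<in>level T n. cell_variation u x) = (\<Sum>w\<in>\<Lambda> n. variation (u \<circ> word_map f w))"
    by (simp add: sum_level_T cell_variation_def)
  also have "\<dots> = (\<Sum>w\<in>(\<Union>s\<in>S. (#) s ` \<Lambda> (n - j s)). variation (u \<circ> word_map f w))"
    using scale_words_split[OF n] by simp
  also have "\<dots> = (\<Sum>s\<in>S. \<Sum>w\<in>(#) s ` \<Lambda> (n - j s). variation (u \<circ> word_map f w))"
    by (rule sum.UNION_disjoint) (auto simp: finite_S finite_scale_words)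
  also have "\<dots> = (\<Sum>s\<in>S. \<Sum>w\<in>\<Lambda> (n - j s). variation (u \<circ> f s \<circ> word_map f w))"
    by (rule sum.cong[OF refl], subst sum.reindex) (auto simp: word_map_Cons comp_assoc)
  finally have "level_energy n u = (\<Sum>s\<in>S. \<sigma> ^ n * (\<Sum>w\<in>\<Lambda> (n - j s). variation (u \<circ> f s \<circ> word_map f w)))"
    by (simp add: level_energy_def sum_distrib_left)
  also have "\<dots> = (\<Sum>s\<in>S. \<sigma> ^ j s * level_energy (n - j s) (u \<circ> f s))"
  proof (rule sum.cong[OF refl])
    fix s assume "s \<in> S"
    then have "\<sigma> ^ n = \<sigma> ^ j s * \<sigma> ^ (n - j s)" using n by (simp add: power_add[symmetric] less_imp_le)
    then show "\<sigma> ^ n * (\<Sum>w\<in>\<Lambda> (n - j s). variation (u \<circ> f s \<circ> word_map f w)) = \<sigma> ^ j s * level_energy (n - j s) (u \<circ> f s)"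
      by (simp add: level_energy_def sum_level_T cell_variation_def)
  qed
  finally show ?thesis .
qed

subsection \<open>The limit energy\<close>

lemma Wp_energy_bound: "u \<in> W \<Longrightarrow> energy_bound p \<sigma> (cell_mean T \<mu> u) (Np_real p \<sigma> u)"
  by (rule energy_bound_Np)

lemma level_energy_Wp: "u \<in> W \<Longrightarrow> \<bar>level_energy n u\<bar> \<le> K4 * Np_real p \<sigma> u"
  using level_energy_bound[OF Wp_continuous Wp_energy_bound] level_energy_nonneg by simp

lemma ex_limit_filter:
  "\<exists>F. F \<noteq> bot \<and> F \<le> sequentially \<and> (\<forall>u\<in>W. \<exists>l. ((\<lambda>n. average (\<lambda>i. level_energy i u) n) \<longlongrightarrow> l) F)"
proof -
  define A where "A n u = (if u \<in> W then average (\<lambda>i. level_energy i u) n else 0)" for n u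
  have "\<bar>A n u\<bar> \<le> K4 * Np_real p \<sigma> u" for n u
    using level_energy_Wp K4_pos by (auto simp: A_def intro!: average_abs_le)
  then obtain F where F: "F \<noteq> bot" "F \<le> sequentially" "\<And>u. \<exists>l. ((\<lambda>n. A n u) \<longlongrightarrow> l) F"
    using bounded_family_filter[of A "\<lambda>u. K4 * Np_real p \<sigma> u"] by blast
  have "\<exists>l. ((\<lambda>n. average (\<lambda>i. level_energy i u) n) \<longlongrightarrow> l) F" if "u \<in> W" for u
    using F(3)[of u] that by (simp add: A_def)
  then show ?thesis using F by blast
qed

text \<open>One filter chosen once for all u, so that limits for different functions can be compared
  and combined.\<close>

definition limit_filter :: "nat filter" where
  "limit_filter = (SOME F. F \<noteq> bot \<and> F \<le> sequentially \<and>
     (\<forall>u\<in>W. \<exists>l. ((\<lambda>n. average (\<lambda>i. level_energy i u) n) \<longlongrightarrow> l) F))"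

lemma limit_filter: "limit_filter \<noteq> bot" "limit_filter \<le> sequentially"
  "u \<in> W \<Longrightarrow> \<exists>l. ((\<lambda>n. average (\<lambda>i. level_energy i u) n) \<longlongrightarrow> l) limit_filter"
  using someI_ex[OF ex_limit_filter] unfolding limit_filter_def by blast+

definition E :: "('k \<Rightarrow> real) \<Rightarrow> real" where
  "E u = Lim limit_filter (\<lambda>n. average (\<lambda>i. level_energy i u) n)"

lemma E_tendsto:
  assumes "u \<in> W"
  shows "((\<lambda>n. average (\<lambda>i. level_energy i u) n) \<longlongrightarrow> E u) limit_filter"
proof -
  obtain l where l: "((\<lambda>n. average (\<lambda>i. level_energy i u) n) \<longlongrightarrow> l) limit_filter"
    using limit_filter(3)[OF assms] by blast
  moreover have "E u = l" unfolding E_def by (rule tendsto_Lim[OF limit_filter(1) l])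
  ultimately show ?thesis by simp
qed

text \<open>Shift invariance of the limit, the reason for averaging.\<close>

lemma E_tendsto_shift:
  assumes u: "u \<in> W"
  shows "((\<lambda>n. average (\<lambda>i. level_energy (i + k) u) n) \<longlongrightarrow> E u) limit_filter"
proof -
  have "((\<lambda>n. average (\<lambda>i. level_energy (i + k) u) n - average (\<lambda>i. level_energy i u) n) \<longlongrightarrow> 0) limit_filter"
    by (rule tendsto_mono[OF limit_filter(2)]) (rule average_shift_tendsto[OF level_energy_Wp[OF u]])
  from tendsto_add[OF this E_tendsto[OF u]] show ?thesis by simp
qed

lemma E_le:
  assumes "u \<in> W" "\<And>i. level_energy i u \<le> c" "0 \<le> c"
  shows "E u \<le> c"
proof (rule tendsto_upperbound[OF E_tendsto[OF assms(1)] _ limit_filter(1)])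
  have "average (\<lambda>i. level_energy i u) n \<le> c" for n
    using average_abs_le[of "\<lambda>i. level_energy i u" c n] assms level_energy_nonneg by fastforce
  then show "\<forall>\<^sub>F n in limit_filter. average (\<lambda>i. level_energy i u) n \<le> c" by simp
qed

lemma E_le_bound:
  assumes "u \<in> W" "energy_bound p \<sigma> (cell_mean T \<mu> u) B"
  shows "E u \<le> K4 * B"
  using assms level_energy_bound[OF Wp_continuous] K4_pos energy_bound_nonneg by (intro E_le) auto

lemma E_nonneg:
  assumes "u \<in> W"
  shows "0 \<le> E u"
proof (rule tendsto_lowerbound[OF E_tendsto[OF assms] _ limit_filter(1)])
  have "0 \<le> average (\<lambda>i. level_energy i u) n" for n
    unfolding average_def by (intro divide_nonneg_nonneg sum_nonneg level_energy_nonneg) simp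
  then show "\<forall>\<^sub>F n in limit_filter. 0 \<le> average (\<lambda>i. level_energy i u) n" by simp
qed

definition L4 :: real where "L4 = K1 * L3 / (1 - \<kappa>)"

lemma L4_pos: "0 < L4"
  using K1_pos L3_pos \<kappa> by (simp add: L4_def)

text \<open>The energy at level n is bounded through every finer level n + i by shifted level
  energies. Averaging over i and passing to the limit replaces each of them by E, the weights sum to
  at most 1/(1 - \<kappa>), and m tending to infinity removes the error.\<close>

lemma E_lower:
  assumes u: "u \<in> W"
  shows "energy_bound p \<sigma> (cell_mean T \<mu> u) (L4 * E u)"
proof (intro allI impI)
  fix n :: nat assume n: "1 \<le> n"
  let ?h = "cell_mean T \<mu> u"
  define B where "B = Np_real p \<sigma> u"
  have cu: "continuous_on UNIV u" by (rule Wp_continuous[OF u])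
  have B: "energy_bound p \<sigma> ?h B" unfolding B_def by (rule Wp_energy_bound[OF u])
  have mart: "martingale ?h" by (rule martingale_cell_mean[OF continuous_integrable[OF cu]])
  have le: "\<sigma> ^ n * energy T p n ?h \<le> K1 * L3 * (E u / (1 - \<kappa>) + K4 * B / \<sigma> ^ m)" for m
  proof -
    \<comment> \<open>The left side does not depend on i thanks to weak monotonicity, so the right
      side may be averaged over i.\<close>
    have pointwise: "\<sigma> ^ n * energy T p n ?h \<le> K1 * L3 * ((\<Sum>k<m. \<kappa> ^ k * level_energy (i + (n + k)) u) + K4 * B / \<sigma> ^ m)" for i
    proof -
      have "\<sigma> ^ n * energy T p n ?h \<le> K1 * (\<sigma> ^ (n + i) * energy T p (n + i) ?h)"
        by (rule energy_martingale_le[OF n _ mart]) simp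
      also have "\<dots> \<le> K1 * (L3 * ((\<Sum>k<m. \<kappa> ^ k * level_energy (n + i + k) u) + K4 * B / \<sigma> ^ m))"
        using K1_pos by (intro mult_left_mono energy_le_level_energy[OF cu B]) auto
      finally show ?thesis by (simp add: add_ac mult.assoc)
    qed
    have avg: "\<sigma> ^ n * energy T p n ?h \<le>
        K1 * L3 * ((\<Sum>k<m. \<kappa> ^ k * average (\<lambda>i. level_energy (i + (n + k)) u) l) + K4 * B / \<sigma> ^ m)"
      if l: "1 \<le> l" for l
    proof -
      have "\<sigma> ^ n * energy T p n ?h = average (\<lambda>_. \<sigma> ^ n * energy T p n ?h) l" by (simp add: average_const[OF l])
      also have "\<dots> \<le> average (\<lambda>i. K1 * L3 * (\<Sum>k<m. \<kappa> ^ k * level_energy (i + (n + k)) u) + K1 * L3 * (K4 * B / \<sigma> ^ m)) l"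
        using pointwise by (intro average_mono) (simp add: distrib_left)
      also have "\<dots> = K1 * L3 * average (\<lambda>i. \<Sum>k<m. \<kappa> ^ k * level_energy (i + (n + k)) u) l + K1 * L3 * (K4 * B / \<sigma> ^ m)"
        using average_linear[of "K1 * L3" "\<lambda>i. \<Sum>k<m. \<kappa> ^ k * level_energy (i + (n + k)) u" "K1 * L3 * (K4 * B / \<sigma> ^ m)" "\<lambda>_. 1" l]
        by (simp add: average_const[OF l])
      finally show ?thesis by (simp add: average_sum distrib_left)
    qed
    have lim: "((\<lambda>l. K1 * L3 * ((\<Sum>k<m. \<kappa> ^ k * average (\<lambda>i. level_energy (i + (n + k)) u) l) + K4 * B / \<sigma> ^ m))
        \<longlongrightarrow> K1 * L3 * ((\<Sum>k<m. \<kappa> ^ k * E u) + K4 * B / \<sigma> ^ m)) limit_filter"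
      by (intro tendsto_intros E_tendsto_shift[OF u])
    have "eventually (\<lambda>l. 1 \<le> l) limit_filter"
      by (rule filter_leD[OF limit_filter(2)]) (rule eventually_ge_at_top)
    then have "\<sigma> ^ n * energy T p n ?h \<le> K1 * L3 * ((\<Sum>k<m. \<kappa> ^ k * E u) + K4 * B / \<sigma> ^ m)"
      by (intro tendsto_lowerbound[OF lim _ limit_filter(1)]) (auto elim!: eventually_mono intro: avg)
    also have "\<dots> \<le> K1 * L3 * (E u / (1 - \<kappa>) + K4 * B / \<sigma> ^ m)"
    proof (intro mult_left_mono add_right_mono)
      have "(\<Sum>k<m. \<kappa> ^ k * E u) = (1 - \<kappa> ^ m) / (1 - \<kappa>) * E u"
        using \<kappa> by (simp add: sum_distrib_right[symmetric] sum_gp_strict)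
      also have "\<dots> \<le> 1 / (1 - \<kappa>) * E u"
        using \<kappa> E_nonneg[OF u] by (intro mult_right_mono divide_right_mono) auto
      finally show "(\<Sum>k<m. \<kappa> ^ k * E u) \<le> E u / (1 - \<kappa>)" by simp
    qed (use K1_pos L3_pos in auto)
    finally show ?thesis .
  qed
  have "(\<lambda>m. K1 * L3 * (E u / (1 - \<kappa>) + K4 * B * (1 / \<sigma>) ^ m)) \<longlonglongrightarrow> K1 * L3 * (E u / (1 - \<kappa>) + K4 * B * 0)"
    using \<sigma>_gt_1 by (intro tendsto_intros LIMSEQ_realpow_zero) auto
  then have "\<sigma> ^ n * energy T p n ?h \<le> K1 * L3 * (E u / (1 - \<kappa>) + K4 * B * 0)"
    using le by (intro tendsto_lowerbound) (auto simp: power_divide)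
  then show "\<sigma> ^ n * energy T p n ?h \<le> L4 * E u" by (simp add: L4_def)
qed

section \<open>Properties passed on from level energies to their limit\<close>

lemma level_energy_mono:
  assumes "continuous_on UNIV u" "continuous_on UNIV v" "\<And>x y. \<bar>u x - u y\<bar> \<le> \<bar>v x - v y\<bar>"
  shows "level_energy n u \<le> level_energy n v"
  unfolding level_energy_def
proof (intro mult_left_mono sum_mono)
  fix x assume "x \<in> level T n"
  then have "snd x \<in> lists S" by (rule level_T_word)
  then show "cell_variation u x \<le> cell_variation v x"
    unfolding cell_variation_def using assms by (intro variation_mono comp_word_continuous) auto
qed (use \<sigma>_pos in simp)

lemma E_mono:
  assumes "u \<in> W" "v \<in> W" "\<And>x y. \<bar>u x - u y\<bar> \<le> \<bar>v x - v y\<bar>"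
  shows "E u \<le> E v"
proof (rule tendsto_le[OF limit_filter(1) E_tendsto[OF assms(2)] E_tendsto[OF assms(1)]])
  show "\<forall>\<^sub>F n in limit_filter. average (\<lambda>i. level_energy i u) n \<le> average (\<lambda>i. level_energy i v) n"
    using assms by (intro always_eventually allI average_mono level_energy_mono Wp_continuous)
qed

lemma level_energy_scale: "level_energy n (\<lambda>x. c * u x) = \<bar>c\<bar> powr p * level_energy n u"
  using variation_scale[of c "u \<circ> _"]
  by (simp add: level_energy_def cell_variation_def comp_def sum_distrib_left mult_ac)

lemma E_scale:
  assumes u: "u \<in> W"
  shows "E (\<lambda>x. c * u x) = \<bar>c\<bar> powr p * E u"
proof (rule tendsto_unique[OF limit_filter(1)])
  show "((\<lambda>n. average (\<lambda>i. level_energy i (\<lambda>x. c * u x)) n) \<longlongrightarrow> E (\<lambda>x. c * u x)) limit_filter"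
    using u function_space_Wp by (intro E_tendsto) (auto simp: function_space_def)
  show "((\<lambda>n. average (\<lambda>i. level_energy i (\<lambda>x. c * u x)) n) \<longlongrightarrow> \<bar>c\<bar> powr p * E u) limit_filter"
    using tendsto_mult_left[OF E_tendsto[OF u], of "\<bar>c\<bar> powr p"] average_linear[of "\<bar>c\<bar> powr p" _ 0]
    by (simp add: level_energy_scale)
qed

lemma level_energy_convex:
  assumes "continuous_on UNIV u" "continuous_on UNIV v" "0 \<le> t" "t \<le> 1"
  shows "level_energy n (\<lambda>x. (1 - t) * u x + t * v x) \<le> (1 - t) * level_energy n u + t * level_energy n v"
proof -
  have "(\<Sum>x\<in>level T n. cell_variation (\<lambda>x. (1 - t) * u x + t * v x) x)
      \<le> (\<Sum>x\<in>level T n. (1 - t) * cell_variation u x + t * cell_variation v x)"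
  proof (rule sum_mono)
    fix x assume "x \<in> level T n"
    then have "snd x \<in> lists S" by (rule level_T_word)
    then show "cell_variation (\<lambda>x. (1 - t) * u x + t * v x) x \<le> (1 - t) * cell_variation u x + t * cell_variation v x"
      using variation_convex[OF comp_word_continuous comp_word_continuous assms(3,4), of u "snd x" v "snd x"] assms(1,2)
      by (simp add: cell_variation_def comp_def)
  qed
  also have "\<dots> = (1 - t) * (\<Sum>x\<in>level T n. cell_variation u x) + t * (\<Sum>x\<in>level T n. cell_variation v x)"
    by (simp only: sum.distrib sum_distrib_left)
  finally have "level_energy n (\<lambda>x. (1 - t) * u x + t * v x) \<le>
      \<sigma> ^ n * ((1 - t) * (\<Sum>x\<in>level T n. cell_variation u x) + t * (\<Sum>x\<in>level T n. cell_variation v x))"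
    unfolding level_energy_def using \<sigma>_pos by (intro mult_left_mono) auto
  then show ?thesis by (simp add: level_energy_def algebra_simps)
qed

lemma Wp_linear: "u \<in> W \<Longrightarrow> v \<in> W \<Longrightarrow> (\<lambda>x. c * u x + d * v x) \<in> W"
  using function_space_Wp by (simp add: function_space_def)

lemma E_convex:
  assumes u: "u \<in> W" "v \<in> W" and t: "0 \<le> t" "t \<le> 1"
  shows "E (\<lambda>x. (1 - t) * u x + t * v x) \<le> (1 - t) * E u + t * E v"
proof (rule tendsto_le[OF limit_filter(1)])
  show "((\<lambda>n. (1 - t) * average (\<lambda>i. level_energy i u) n + t * average (\<lambda>i. level_energy i v) n)
      \<longlongrightarrow> (1 - t) * E u + t * E v) limit_filter"
    by (intro tendsto_intros E_tendsto u)
  show "((\<lambda>n. average (\<lambda>i. level_energy i (\<lambda>x. (1 - t) * u x + t * v x)) n) \<longlongrightarrow> E (\<lambda>x. (1 - t) * u x + t * v x)) limit_filter"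
    by (intro E_tendsto Wp_linear u)
  show "\<forall>\<^sub>F n in limit_filter. average (\<lambda>i. level_energy i (\<lambda>x. (1 - t) * u x + t * v x)) n
      \<le> (1 - t) * average (\<lambda>i. level_energy i u) n + t * average (\<lambda>i. level_energy i v) n"
    unfolding average_linear[symmetric]
    using u t by (intro always_eventually allI average_mono level_energy_convex Wp_continuous)
qed

lemma E_seminorm: "seminorm_on_space W (\<lambda>u. E u powr (1 / p))"
  unfolding seminorm_on_space_def
proof (intro conjI ballI allI)
  show "function_space W" by (rule function_space_Wp)
  show "E (\<lambda>x. c * u x) powr (1 / p) = \<bar>c\<bar> * E u powr (1 / p)" if "u \<in> W" for c u
    using p_pos by (simp add: E_scale[OF that] powr_mult powr_powr)
  show "E (\<lambda>x. u x + v x) powr (1 / p) \<le> E u powr (1 / p) + E v powr (1 / p)" if "u \<in> W" "v \<in> W" for u v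
    using that p_gt_1 by (intro homogeneous_convex_triangle[OF _ function_space_Wp]) (auto intro: E_nonneg E_scale E_convex)
qed simp

lemma E_truncation: "u \<in> W \<Longrightarrow> E (unit_truncation u) \<le> E u"
  by (rule E_mono[OF truncation_in_Wp]) (auto simp: unit_truncation_def)

text \<open>The exact identity at the indices i + \<open>?k\<close> is averaged. The shift on the
  left and the different shifts by \<open>?k - j s\<close> on the right all vanish in the
  limit.\<close>

lemma E_self_similar:
  assumes u: "u \<in> W"
  shows "E u = (\<Sum>s\<in>S. \<sigma> ^ j s * E (u \<circ> f s))"
proof (rule tendsto_unique[OF limit_filter(1) E_tendsto_shift[OF u]])
  let ?k = "\<Sum>s\<in>S. j s"
  have j_le: "j s \<le> ?k" if "s \<in> S" for s using that finite_S by (intro member_le_sum) auto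
  have "average (\<lambda>i. level_energy (i + ?k) u) n
      = (\<Sum>s\<in>S. \<sigma> ^ j s * average (\<lambda>i. level_energy (i + (?k - j s)) (u \<circ> f s)) n)" for n
  proof -
    have "average (\<lambda>i. level_energy (i + ?k) u) n
        = average (\<lambda>i. \<Sum>s\<in>S. \<sigma> ^ j s * level_energy (i + (?k - j s)) (u \<circ> f s)) n"
      unfolding average_def
    proof (intro arg_cong2[where f="(/)"] sum.cong refl)
      fix i :: nat assume i: "i \<in> {1..n}"
      have "j s < i + ?k" if "s \<in> S" for s using j_le[OF that] i by simp
      from level_energy_self_similar[OF this]
      show "level_energy (i + ?k) u = (\<Sum>s\<in>S. \<sigma> ^ j s * level_energy (i + (?k - j s)) (u \<circ> f s))"
        using j_le by simp
    qed
    then show ?thesis by (simp only: average_sum)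
  qed
  then show "((\<lambda>n. average (\<lambda>i. level_energy (i + ?k) u) n) \<longlongrightarrow> (\<Sum>s\<in>S. \<sigma> ^ j s * E (u \<circ> f s))) limit_filter"
    by (simp only:) (intro tendsto_intros E_tendsto_shift Wp_comp_f u)
qed

subsection \<open>Comparison with the Besov-type seminorm and resistance estimates\<close>

lemma Np_real_le_E: "u \<in> W \<Longrightarrow> Np_real p \<sigma> u \<le> L4 * E u"
  using E_lower E_nonneg L4_pos by (intro Np_real_le) auto

lemma E_le_Np_real: "u \<in> W \<Longrightarrow> E u \<le> K4 * Np_real p \<sigma> u"
  by (rule E_le_bound[OF _ Wp_energy_bound])

lemma E_equivalent:
  assumes u: "u \<in> W"
  shows "(1 / L4) powr (1 / p) * Np T \<mu> p \<sigma> u \<le> E u powr (1 / p)"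
    "E u powr (1 / p) \<le> K4 powr (1 / p) * Np T \<mu> p \<sigma> u"
proof -
  have "(1 / L4 * Np_real p \<sigma> u) powr (1 / p) \<le> E u powr (1 / p)"
    using Np_real_le_E[OF u] L4_pos p_pos by (intro powr_mono2) (auto simp: pos_divide_le_eq mult.commute)
  then show "(1 / L4) powr (1 / p) * Np T \<mu> p \<sigma> u \<le> E u powr (1 / p)"
    by (simp only: powr_mult Np_def)
  have "E u powr (1 / p) \<le> (K4 * Np_real p \<sigma> u) powr (1 / p)"
    using E_le_Np_real[OF u] E_nonneg[OF u] p_pos by (intro powr_mono2) auto
  then show "E u powr (1 / p) \<le> K4 powr (1 / p) * Np T \<mu> p \<sigma> u"
    by (simp only: powr_mult Np_def)
qed

lemma E_holder:
  assumes "u \<in> W"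
  shows "\<bar>u x - u y\<bar> powr p \<le> K6 * L4 * dist x y powr \<tau> * E u"
  using holder[OF Wp_continuous[OF assms] E_lower[OF assms], of x y] by (simp add: mult_ac)

lemma resistance_upper:
  "(SUP u\<in>{u \<in> W. E u \<noteq> 0}. ennreal (\<bar>u x - u y\<bar> powr p / E u)) \<le> ennreal (K6 * L4 * dist x y powr \<tau>)"
proof (rule SUP_least)
  fix u assume u: "u \<in> {u \<in> W. E u \<noteq> 0}"
  then have "0 < E u" using E_nonneg[of u] by auto
  then show "ennreal (\<bar>u x - u y\<bar> powr p / E u) \<le> ennreal (K6 * L4 * dist x y powr \<tau>)"
    using E_holder[of u x y] u by (intro ennreal_leI) (simp add: pos_divide_le_eq)
qed

text \<open>\<open>separating_function\<close> is a competitor with the right energy.\<close>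

lemma resistance_lower:
  "ennreal (1 / (K4 * K8) * dist x y powr \<tau>) \<le> (SUP u\<in>{u \<in> W. E u \<noteq> 0}. ennreal (\<bar>u x - u y\<bar> powr p / E u))"
proof (cases "x = y")
  case False
  obtain u where u: "continuous_on UNIV u" "u x = 1" "u y = 0"
    "energy_bound p \<sigma> (cell_mean T \<mu> u) (K8 * dist x y powr (- \<tau>))"
    by (rule separating_function[OF False])
  have uW: "u \<in> W" using u Wp_iff[OF p_pos] by blast
  have up: "E u \<le> K4 * (K8 * dist x y powr (- \<tau>))" by (rule E_le_bound[OF uW u(4)])
  \<comment> \<open>Zero energy would force u(x) = u(y) by the Hoelder estimate.\<close>
  have "E u \<noteq> 0" using E_holder[OF uW, of x y] u by auto
  then have pos: "0 < E u" using E_nonneg[OF uW] by simp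
  have d: "0 < dist x y" using False by simp
  have "1 / (K4 * K8) * dist x y powr \<tau> = 1 / (K4 * (K8 * dist x y powr (- \<tau>)))"
    using d K4_pos K8_pos by (simp add: powr_minus field_simps)
  also have "\<dots> \<le> 1 / E u" using up pos by (intro divide_left_mono) (auto intro!: mult_pos_pos)
  also have "\<dots> = \<bar>u x - u y\<bar> powr p / E u" using u by simp
  finally have "ennreal (1 / (K4 * K8) * dist x y powr \<tau>) \<le> ennreal (\<bar>u x - u y\<bar> powr p / E u)"
    by (rule ennreal_leI)
  then show ?thesis using uW pos by (intro SUP_upper2[of u]) auto
qed simp

end

section \<open>The Dirichlet form\<close>

context self_similar_conductive
begin

text \<open>Every nonempty open set contains a small cell, and cells have positive mass. Thus
  continuous representatives are unique.\<close>

lemma full_support: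
  assumes U: "open U" and null: "AE x in \<mu>. x \<notin> U"
  shows "U = {}"
proof (rule ccontr)
  assume "U \<noteq> {}"
  then obtain z e where z: "z \<in> U" "0 < e" "ball z e \<subseteq> U" using U by (meson all_not_in_conv open_contains_ball)
  have "(\<lambda>n. b * r ^ n) \<longlonglongrightarrow> b * 0"
    using r by (intro tendsto_intros LIMSEQ_realpow_zero) auto
  then have "\<forall>\<^sub>F n in sequentially. b * r ^ n < e" using z by (intro order_tendstoD(2)) auto
  then obtain n where n: "b * r ^ n < e" by (auto simp: eventually_sequentially)
  obtain x where x: "x \<in> level T n" "z \<in> cell T x" using cover_level[of n] by blast
  have sub: "cell T x \<subseteq> U"
  proof
    fix y assume "y \<in> cell T x"
    then have "dist z y < e" using dist_cell[OF x] n by fastforce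
    then show "y \<in> U" using z by auto
  qed
  have "AE y in \<mu>. y \<notin> cell T x" using null by (rule eventually_mono) (use sub in auto)
  then have "measure \<mu> (cell T x) = 0"
    using cell_sets[OF x(1)] by (simp add: AE_iff_measurable[OF _ refl] measure_def space_\<mu>)
  then show False using measure_cell_pos[OF x(1)] by simp
qed

lemma zero_on_open:
  fixes u :: "'k \<Rightarrow> real"
  assumes u: "continuous_on UNIV u" and U: "open U" and ae: "AE x in \<mu>. x \<in> U \<longrightarrow> u x = 0"
  shows "x \<in> U \<Longrightarrow> u x = 0"
proof -
  have "open (u -` (- {0}))" by (rule open_vimage[OF _ u]) auto
  then have "open (U \<inter> u -` (- {0}))" using U by auto
  moreover have "AE x in \<mu>. x \<notin> U \<inter> u -` (- {0})" using ae by eventually_elim auto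
  ultimately have "U \<inter> u -` (- {0}) = {}" by (rule full_support)
  then show "x \<in> U \<Longrightarrow> u x = 0" by auto
qed

subsection \<open>Density\<close>

text \<open>Density is first proved in the integral norm, where the class is closed under dominated
  limits; \<open>dense_L2\<close> upgrades it by clipping.\<close>

definition approximable :: "('k \<Rightarrow> real) \<Rightarrow> bool" where
  "approximable g \<longleftrightarrow> integrable \<mu> g \<and> (\<forall>e>0. \<exists>u\<in>W. (\<integral>x. \<bar>g x - u x\<bar> \<partial>\<mu>) < e)"

lemma Wp_integrable: "u \<in> W \<Longrightarrow> integrable \<mu> u"
  by (rule continuous_integrable[OF Wp_continuous])

lemma approximable_add:
  assumes "approximable g" "approximable h"
  shows "approximable (\<lambda>x. g x + h x)"
  unfolding approximable_def
proof (intro conjI allI impI)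
  show "integrable \<mu> (\<lambda>x. g x + h x)" using assms by (simp add: approximable_def)
  fix e :: real assume "0 < e"
  then obtain u v where u: "u \<in> W" "(\<integral>x. \<bar>g x - u x\<bar> \<partial>\<mu>) < e / 2" and v: "v \<in> W" "(\<integral>x. \<bar>h x - v x\<bar> \<partial>\<mu>) < e / 2"
    using assms unfolding approximable_def by (meson half_gt_zero)
  have int: "integrable \<mu> (\<lambda>x. \<bar>g x - u x\<bar>)" "integrable \<mu> (\<lambda>x. \<bar>h x - v x\<bar>)"
    using assms u v by (auto simp: approximable_def Wp_integrable)
  have "(\<integral>x. \<bar>g x + h x - (u x + v x)\<bar> \<partial>\<mu>) \<le> (\<integral>x. \<bar>g x - u x\<bar> + \<bar>h x - v x\<bar> \<partial>\<mu>)"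
    using assms u v int by (intro integral_mono) (auto simp: approximable_def Wp_integrable)
  also have "\<dots> < e" using u v int by simp
  finally show "\<exists>w\<in>W. (\<integral>x. \<bar>g x + h x - w x\<bar> \<partial>\<mu>) < e"
    using u v Wp_linear[of u v 1 1] by (intro bexI[of _ "\<lambda>x. u x + v x"]) auto
qed

lemma approximable_scale:
  assumes "approximable g"
  shows "approximable (\<lambda>x. g x * c)"
  unfolding approximable_def
proof (intro conjI allI impI)
  show "integrable \<mu> (\<lambda>x. g x * c)" using assms by (simp add: approximable_def)
  fix e :: real assume e: "0 < e"
  then have "0 < e / (\<bar>c\<bar> + 1)" by (intro divide_pos_pos) auto
  then obtain u where u: "u \<in> W" "(\<integral>x. \<bar>g x - u x\<bar> \<partial>\<mu>) < e / (\<bar>c\<bar> + 1)"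
    using assms unfolding approximable_def by blast
  have "(\<integral>x. \<bar>g x * c - c * u x\<bar> \<partial>\<mu>) = \<bar>c\<bar> * (\<integral>x. \<bar>g x - u x\<bar> \<partial>\<mu>)"
    by (simp add: right_diff_distrib[symmetric] abs_mult mult.commute[of _ c])
  also have "\<dots> \<le> \<bar>c\<bar> * (e / (\<bar>c\<bar> + 1))" using u by (intro mult_left_mono) auto
  also have "\<dots> < e" using e by (simp add: field_simps)
  finally show "\<exists>w\<in>W. (\<integral>x. \<bar>g x * c - w x\<bar> \<partial>\<mu>) < e"
    using function_space_Wp u(1) by (intro bexI[of _ "\<lambda>x. c * u x"]) (auto simp: function_space_def)
qed

lemma approximable_limit:
  assumes s: "\<And>i. approximable (s i)" and lim: "\<And>x. (\<lambda>i. s i x) \<longlonglongrightarrow> g x"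
    and w: "integrable \<mu> w" and le: "\<And>i x. \<bar>s i x\<bar> \<le> w x"
  shows "approximable g"
proof -
  have si: "integrable \<mu> (s i)" for i using s by (simp add: approximable_def)
  have g_meas: "g \<in> borel_measurable \<mu>"
    by (rule borel_measurable_LIMSEQ_real[OF lim borel_measurable_integrable[OF si]])
  have g: "integrable \<mu> g"
  proof (rule integrable_dominated_convergence[OF g_meas borel_measurable_integrable[OF si] w])
    show "AE x in \<mu>. (\<lambda>i. s i x) \<longlonglongrightarrow> g x" by (intro AE_I2 lim)
    show "AE x in \<mu>. norm (s i x) \<le> w x" for i using le by (intro AE_I2) simp
  qed
  have "(\<lambda>i. \<integral>x. \<bar>g x - s i x\<bar> \<partial>\<mu>) \<longlonglongrightarrow> (\<integral>x. 0 \<partial>\<mu>)"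
  proof (rule integral_dominated_convergence[of _ _ _ "\<lambda>x. \<bar>g x\<bar> + w x"])
    show "AE x in \<mu>. (\<lambda>i. \<bar>g x - s i x\<bar>) \<longlonglongrightarrow> 0"
    proof (intro AE_I2)
      fix x
      show "(\<lambda>i. \<bar>g x - s i x\<bar>) \<longlonglongrightarrow> 0"
        using tendsto_rabs[OF tendsto_diff[OF tendsto_const[of "g x"] lim[of x]]] by simp
    qed
    show "AE x in \<mu>. norm \<bar>g x - s i x\<bar> \<le> \<bar>g x\<bar> + w x" for i
    proof (intro AE_I2)
      fix x
      show "norm \<bar>g x - s i x\<bar> \<le> \<bar>g x\<bar> + w x"
        using le[of i x] abs_triangle_ineq4[of "g x" "s i x"] by simp
    qed
  qed (use g w si in auto)
  then have lim0: "(\<lambda>i. \<integral>x. \<bar>g x - s i x\<bar> \<partial>\<mu>) \<longlonglongrightarrow> 0" by simp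
  show ?thesis
    unfolding approximable_def
  proof (intro conjI allI impI g)
    fix e :: real assume e: "0 < e"
    then have "\<forall>\<^sub>F i in sequentially. (\<integral>x. \<bar>g x - s i x\<bar> \<partial>\<mu>) < e / 2"
      using lim0 by (intro order_tendstoD(2)) auto
    then obtain i where i: "(\<integral>x. \<bar>g x - s i x\<bar> \<partial>\<mu>) < e / 2" by (auto simp: eventually_sequentially)
    obtain u where u: "u \<in> W" "(\<integral>x. \<bar>s i x - u x\<bar> \<partial>\<mu>) < e / 2"
      using s[of i] e unfolding approximable_def by (meson half_gt_zero)
    have int: "integrable \<mu> (\<lambda>x. \<bar>g x - s i x\<bar>)" "integrable \<mu> (\<lambda>x. \<bar>s i x - u x\<bar>)"
      using g si u by (auto simp: Wp_integrable)
    have "(\<integral>x. \<bar>g x - u x\<bar> \<partial>\<mu>) \<le> (\<integral>x. \<bar>g x - s i x\<bar> + \<bar>s i x - u x\<bar> \<partial>\<mu>)"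
      using g u int by (intro integral_mono) (auto simp: Wp_integrable)
    also have "\<dots> < e" using i u int by simp
    finally show "\<exists>u\<in>W. (\<integral>x. \<bar>g x - u x\<bar> \<partial>\<mu>) < e" using u by blast
  qed
qed

lemma approximable_continuous:
  assumes "continuous_on UNIV g"
  shows "approximable g"
  unfolding approximable_def
proof (intro conjI allI impI continuous_integrable assms)
  fix e :: real assume e: "0 < e"
  obtain u where u: "u \<in> W" "\<And>x. \<bar>g x - u x\<bar> < e / 2" using Wp_dense[OF assms, of "e / 2"] e by auto
  have "(\<integral>x. \<bar>g x - u x\<bar> \<partial>\<mu>) \<le> (\<integral>x. e / 2 \<partial>\<mu>)"
    using u continuous_integrable[OF assms]
    by (intro integral_mono) (auto simp: Wp_integrable less_imp_le)
  also have "\<dots> < e" using e by (simp add: prob_space)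
  finally show "\<exists>u\<in>W. (\<integral>x. \<bar>g x - u x\<bar> \<partial>\<mu>) < e" using u by blast
qed

lemma approximable_open:
  assumes U: "open U"
  shows "approximable (indicator U)"
proof (cases "U = UNIV")
  case True
  then have "indicator U = (\<lambda>x::'k. 1 :: real)" by (simp add: fun_eq_iff)
  then show ?thesis using approximable_continuous[of "\<lambda>_. 1"] by simp
next
  case False
  \<comment> \<open>Continuous functions increasing to the indicator. The whole space was set aside
    because the distance to the empty set is 0 by convention.\<close>
  let ?s = "\<lambda>i x. min 1 (real i * infdist x (- U))"
  show ?thesis
  proof (rule approximable_limit[of ?s _ "\<lambda>_. 1"])
    show "approximable (?s i)" for i
      by (intro approximable_continuous continuous_on_min continuous_intros continuous_on_infdist)
    show "(\<lambda>i. ?s i x) \<longlonglongrightarrow> indicator U x" for x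
    proof (cases "x \<in> U")
      case True
      have "infdist x (- U) \<noteq> 0"
        using in_closed_iff_infdist_zero[of "- U" x] U False True by (auto simp: closed_def)
      then have pos: "0 < infdist x (- U)" using infdist_nonneg[of x "- U"] by simp
      obtain n where "1 / infdist x (- U) < real n" using reals_Archimedean2 by blast
      then have "1 \<le> real i * infdist x (- U)" if "n \<le> i" for i
      proof -
        have "1 / infdist x (- U) \<le> real i" using \<open>1 / infdist x (- U) < real n\<close> that by linarith
        then show ?thesis using pos by (simp add: pos_divide_le_eq)
      qed
      then have "\<forall>\<^sub>F i in sequentially. ?s i x = indicator U x"
        using True by (auto simp: eventually_sequentially intro!: exI[of _ n])
      then show ?thesis by (rule tendsto_eventually)
    qed simp
    show "\<bar>?s i x\<bar> \<le> 1" for i x using infdist_nonneg[of x "- U"] by (simp add: min_def)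
  qed simp
qed

text \<open>Dynkin's argument from open sets, which are stable under intersection.\<close>

lemma approximable_indicator:
  assumes "A \<in> sets \<mu>"
  shows "approximable (indicator A)"
proof -
  have "A \<in> sigma_sets UNIV {U :: 'k set. open U}" using assms by (simp add: sets_\<mu> sets_borel)
  then show ?thesis
  proof (induct rule: sigma_sets_induct_disjoint[rotated 2, consumes 1, case_names basic empty compl union stable sub])
    case (basic A)
    then show ?case by (intro approximable_open) simp
  next
    case empty
    show ?case using approximable_continuous[of "\<lambda>_. 0"] by (simp add: indicator_def[abs_def])
  next
    case (compl A)
    have "indicator (UNIV - A) = (\<lambda>x. 1 + indicator A x * (- 1 :: real))"
      by (auto simp: fun_eq_iff indicator_def)
    then show ?case
      using approximable_add[OF approximable_continuous[of "\<lambda>_. 1"] approximable_scale[OF compl(2), of "- 1"]] by simp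
  next
    case (union A)
    let ?s = "\<lambda>n x. \<Sum>i<n. indicator (A i) x :: real"
    have s: "?s n x = indicator (\<Union>i<n. A i) x" for n x
      using union(1) by (subst indicator_UN_disjoint) (auto simp: disjoint_family_on_def)
    show ?case
    proof (rule approximable_limit[of ?s _ "\<lambda>_. 1"])
      show "approximable (?s n)" for n
      proof (induction n)
        case 0
        show ?case using approximable_continuous[of "\<lambda>_. 0"] by simp
      next
        case (Suc n)
        show ?case using approximable_add[OF Suc union(3)[of n]] by simp
      qed
      show "(\<lambda>n. ?s n x) \<longlonglongrightarrow> indicator (\<Union>i. A i) x" for x
        unfolding s by (rule LIMSEQ_indicator_UN)
      show "\<bar>?s n x\<bar> \<le> 1" for n x unfolding s by (simp add: indicator_def)
    qed simp
  next
    case stable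
    show ?case by (auto simp: Int_stable_def)
  qed auto
qed

lemma approximable_integrable: "integrable \<mu> g \<Longrightarrow> approximable g" for g :: "'k \<Rightarrow> real"
proof (induct rule: integrable_induct)
  case (base A c)
  then show ?case using approximable_scale[OF approximable_indicator, of A c] by simp
next
  case (add g h)
  then show ?case by (intro approximable_add)
next
  case (lim g s)
  show ?case
  proof (rule approximable_limit[of s g "\<lambda>x. 2 * \<bar>g x\<bar>"])
    show "approximable (s i)" for i by (rule lim)
    show "(\<lambda>i. s i x) \<longlonglongrightarrow> g x" for x using lim(3)[of x] by (simp add: space_\<mu>)
    show "integrable \<mu> (\<lambda>x. 2 * \<bar>g x\<bar>)" using lim(5) by simp
    show "\<bar>s i x\<bar> \<le> 2 * \<bar>g x\<bar>" for i x using lim(4)[of x i] by (simp add: space_\<mu>)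
  qed
qed

text \<open>After clipping g at height k, clip its integral-norm approximation u too: the difference
  is then at most 2k, so its square is at most 2k times the absolute error.\<close>

lemma dense_L2:
  assumes g: "g \<in> Lp_functions \<mu> 2" and e: "0 < e"
  shows "\<exists>u\<in>W. (\<integral>x. (g x - u x)\<^sup>2 \<partial>\<mu>) < e"
proof -
  have [measurable]: "g \<in> borel_measurable \<mu>" using g by (simp add: Lp_functions_def)
  have sq: "\<bar>t\<bar> powr 2 = t\<^sup>2" for t :: real by (cases "t = 0") (auto simp: powr_numeral)
  have g2: "integrable \<mu> (\<lambda>x. (g x)\<^sup>2)" using g by (simp add: Lp_functions_def sq)
  define clip where "clip k t = max (- real k) (min (real k) t)" for k and t :: real
  have clip_le: "\<bar>clip k t\<bar> \<le> real k" for k t by (auto simp: clip_def)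
  have clip_lip: "\<bar>clip k s - clip k t\<bar> \<le> \<bar>s - t\<bar>" for k s t by (auto simp: clip_def)
  have "(\<lambda>k. \<integral>x. (g x - clip k (g x))\<^sup>2 \<partial>\<mu>) \<longlonglongrightarrow> (\<integral>x. 0 \<partial>\<mu>)"
  proof (rule integral_dominated_convergence[OF _ _ g2])
    show "AE x in \<mu>. (\<lambda>k. (g x - clip k (g x))\<^sup>2) \<longlonglongrightarrow> 0"
    proof (intro AE_I2)
      fix x
      obtain n where n: "\<bar>g x\<bar> < real n" using reals_Archimedean2 by blast
      have "clip k (g x) = g x" if "n \<le> k" for k
        using n that by (auto simp: clip_def max_def min_def)
      then have "\<forall>\<^sub>F k in sequentially. (g x - clip k (g x))\<^sup>2 = 0"
        by (auto simp: eventually_sequentially intro!: exI[of _ n])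
      then show "(\<lambda>k. (g x - clip k (g x))\<^sup>2) \<longlonglongrightarrow> 0" by (rule tendsto_eventually)
    qed
    show "AE x in \<mu>. norm ((g x - clip k (g x))\<^sup>2) \<le> (g x)\<^sup>2" for k
    proof (intro AE_I2)
      fix x
      have "\<bar>g x - clip k (g x)\<bar> \<le> \<bar>g x\<bar>" by (auto simp: clip_def)
      then show "norm ((g x - clip k (g x))\<^sup>2) \<le> (g x)\<^sup>2" by (simp add: abs_le_square_iff)
    qed
    show "(\<lambda>x. (g x - clip k (g x))\<^sup>2) \<in> borel_measurable \<mu>" for k unfolding clip_def by measurable
  qed simp
  then have "\<forall>\<^sub>F k in sequentially. (\<integral>x. (g x - clip k (g x))\<^sup>2 \<partial>\<mu>) < e / 4"
    using e by (intro order_tendstoD(2)) auto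
  then obtain k where k: "(\<integral>x. (g x - clip k (g x))\<^sup>2 \<partial>\<mu>) < e / 4" by (auto simp: eventually_sequentially)
  have m: "(\<lambda>x. clip k (g x)) \<in> borel_measurable \<mu>" unfolding clip_def by measurable
  have "integrable \<mu> (\<lambda>x. clip k (g x))"
    using clip_le m by (intro integrable_const_bound[of _ "real k"]) auto
  then have "approximable (\<lambda>x. clip k (g x))" by (rule approximable_integrable)
  \<comment> \<open>The integral error enters with factor 4k, so this accuracy yields at most e/2; k
    + 1 avoids division by 0.\<close>
  moreover have "0 < e / (8 * (real k + 1))" using e by simp
  ultimately obtain u where u: "u \<in> W" "(\<integral>x. \<bar>clip k (g x) - u x\<bar> \<partial>\<mu>) < e / (8 * (real k + 1))"
    and int: "integrable \<mu> (\<lambda>x. clip k (g x))"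
    unfolding approximable_def by blast
  have [measurable]: "u \<in> borel_measurable \<mu>" using u by (intro measurable_continuous Wp_continuous)
  have v: "(\<lambda>x. clip k (u x)) \<in> W"
  proof (rule Wp_lipschitz[OF u(1) u(1), of _ 1 0])
    show "continuous_on UNIV (\<lambda>x. clip k (u x))"
      unfolding clip_def by (intro continuous_on_max continuous_on_min continuous_on_const Wp_continuous u)
  qed (use clip_lip in auto)
  have i1: "integrable \<mu> (\<lambda>x. (g x - clip k (g x))\<^sup>2)"
  proof (rule Bochner_Integration.integrable_bound[OF g2])
    show "AE x in \<mu>. norm ((g x - clip k (g x))\<^sup>2) \<le> norm ((g x)\<^sup>2)"
    proof (intro AE_I2)
      fix x
      have "\<bar>g x - clip k (g x)\<bar> \<le> \<bar>g x\<bar>" by (auto simp: clip_def)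
      then show "norm ((g x - clip k (g x))\<^sup>2) \<le> norm ((g x)\<^sup>2)" by (simp add: abs_le_square_iff)
    qed
    show "(\<lambda>x. (g x - clip k (g x))\<^sup>2) \<in> borel_measurable \<mu>" unfolding clip_def by measurable
  qed
  have "(\<integral>x. (g x - clip k (u x))\<^sup>2 \<partial>\<mu>)
      \<le> (\<integral>x. 2 * (g x - clip k (g x))\<^sup>2 + 4 * real k * \<bar>clip k (g x) - u x\<bar> \<partial>\<mu>)"
  proof (rule integral_mono)
    show i2: "integrable \<mu> (\<lambda>x. 2 * (g x - clip k (g x))\<^sup>2 + 4 * real k * \<bar>clip k (g x) - u x\<bar>)"
      using i1 int Wp_integrable[OF u(1)] by auto
    show le: "(g x - clip k (u x))\<^sup>2 \<le> 2 * (g x - clip k (g x))\<^sup>2 + 4 * real k * \<bar>clip k (g x) - u x\<bar>" for x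
    proof -
      let ?A = "g x - clip k (g x)" and ?B = "clip k (g x) - clip k (u x)"
      have "(g x - clip k (u x))\<^sup>2 = (?A + ?B)\<^sup>2" by simp
      also have "\<dots> \<le> 2 * ?A\<^sup>2 + 2 * ?B\<^sup>2"
        using zero_le_power2[of "?A - ?B"] by (simp add: power2_eq_square algebra_simps)
      also have "?B\<^sup>2 = \<bar>?B\<bar> * \<bar>?B\<bar>" by (simp add: power2_eq_square)
      also have "\<dots> \<le> (2 * real k) * \<bar>clip k (g x) - u x\<bar>"
      proof (intro mult_mono)
        show "\<bar>?B\<bar> \<le> 2 * real k" using clip_le[of k "g x"] clip_le[of k "u x"] by linarith
        have "clip k (clip k (g x)) = clip k (g x)" by (auto simp: clip_def)
        then show "\<bar>?B\<bar> \<le> \<bar>clip k (g x) - u x\<bar>" using clip_lip[of k "clip k (g x)" "u x"] by simp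
      qed auto
      finally show ?thesis by simp
    qed
    show "integrable \<mu> (\<lambda>x. (g x - clip k (u x))\<^sup>2)"
    proof (rule Bochner_Integration.integrable_bound[OF i2])
      show "AE x in \<mu>. norm ((g x - clip k (u x))\<^sup>2) \<le> norm (2 * (g x - clip k (g x))\<^sup>2 + 4 * real k * \<bar>clip k (g x) - u x\<bar>)"
        using le by (intro AE_I2) (simp add: abs_of_nonneg)
      show "(\<lambda>x. (g x - clip k (u x))\<^sup>2) \<in> borel_measurable \<mu>" unfolding clip_def by measurable
    qed
  qed
  also have "\<dots> = 2 * (\<integral>x. (g x - clip k (g x))\<^sup>2 \<partial>\<mu>) + 4 * real k * (\<integral>x. \<bar>clip k (g x) - u x\<bar> \<partial>\<mu>)"
    using i1 int Wp_integrable[OF u(1)] by simp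
  also have "\<dots> < 2 * (e / 4) + e / 2"
  proof (rule add_less_le_mono)
    have "4 * real k * (\<integral>x. \<bar>clip k (g x) - u x\<bar> \<partial>\<mu>) \<le> 4 * (real k + 1) * (e / (8 * (real k + 1)))"
      using u(2) by (intro mult_mono) (auto intro!: integral_nonneg_AE)
    also have "\<dots> = e / 2" by (simp add: field_simps)
    finally show "4 * real k * (\<integral>x. \<bar>clip k (g x) - u x\<bar> \<partial>\<mu>) \<le> e / 2" .
  qed (use k in simp)
  finally show ?thesis using v by (intro bexI[of _ "\<lambda>x. clip k (u x)"]) simp_all
qed

subsection \<open>Polarization\<close>

definition cross_variation :: "('k \<Rightarrow> real) \<Rightarrow> ('k \<Rightarrow> real) \<Rightarrow> real" where
  "cross_variation g h = (\<integral>z. (g (fst z) - g (snd z)) * (h (fst z) - h (snd z)) \<partial>(\<mu> \<Otimes>\<^sub>M \<mu>))"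

lemma cross_integrable:
  fixes g h :: "'k \<Rightarrow> real"
  assumes g: "continuous_on UNIV g" and h: "continuous_on UNIV h"
  shows "integrable (\<mu> \<Otimes>\<^sub>M \<mu>) (\<lambda>z. (g (fst z) - g (snd z)) * (h (fst z) - h (snd z)))"
proof -
  obtain B where B: "0 \<le> B" "\<And>x. \<bar>g x\<bar> \<le> B" using continuous_bounded[OF g] by metis
  obtain D where D: "0 \<le> D" "\<And>x. \<bar>h x\<bar> \<le> D" using continuous_bounded[OF h] by metis
  note [measurable] = measurable_continuous[OF g] measurable_continuous[OF h]
  show ?thesis
  proof (rule pair_integrable[of _ "(2 * B) * (2 * D)"])
    fix z :: "'k \<times> 'k"
    have "\<bar>g (fst z) - g (snd z)\<bar> \<le> 2 * B" using B(2)[of "fst z"] B(2)[of "snd z"] by linarith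
    moreover have "\<bar>h (fst z) - h (snd z)\<bar> \<le> 2 * D" using D(2)[of "fst z"] D(2)[of "snd z"] by linarith
    ultimately show "\<bar>(g (fst z) - g (snd z)) * (h (fst z) - h (snd z))\<bar> \<le> (2 * B) * (2 * D)"
      unfolding abs_mult using B by (intro mult_mono) auto
  qed measurable
qed

lemma cross_variation_linear:
  assumes "continuous_on UNIV g" "continuous_on UNIV g'" "continuous_on UNIV h"
  shows "cross_variation (\<lambda>x. c * g x + d * g' x) h = c * cross_variation g h + d * cross_variation g' h"
proof -
  have "cross_variation (\<lambda>x. c * g x + d * g' x) h = (\<integral>z. c * ((g (fst z) - g (snd z)) * (h (fst z) - h (snd z)))
      + d * ((g' (fst z) - g' (snd z)) * (h (fst z) - h (snd z))) \<partial>(\<mu> \<Otimes>\<^sub>M \<mu>))"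
    unfolding cross_variation_def by (intro Bochner_Integration.integral_cong refl) (simp add: algebra_simps)
  also have "\<dots> = c * cross_variation g h + d * cross_variation g' h"
    unfolding cross_variation_def using cross_integrable[OF assms(1,3)] cross_integrable[OF assms(2,3)] by simp
  finally show ?thesis .
qed

text \<open>The bilinear form whose diagonal is the level energy when p = 2. Bilinearity is exact
  here at every level and is transported to the limit.\<close>

definition level_form :: "nat \<Rightarrow> ('k \<Rightarrow> real) \<Rightarrow> ('k \<Rightarrow> real) \<Rightarrow> real" where
  "level_form n u v = \<sigma> ^ n * (\<Sum>x\<in>level T n. cross_variation (u \<circ> word_map f (snd x)) (v \<circ> word_map f (snd x)))"

text \<open>Polarization of E; for p = 2 it is the limit of averaged level forms.\<close>

definition form :: "('k \<Rightarrow> real) \<Rightarrow> ('k \<Rightarrow> real) \<Rightarrow> real" where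
  "form u v = (E (\<lambda>x. u x + v x) - E (\<lambda>x. u x - v x)) / 4"

lemma level_form_linear:
  assumes "continuous_on UNIV u" "continuous_on UNIV v" "continuous_on UNIV w"
  shows "level_form n (\<lambda>x. c * u x + d * v x) w = c * level_form n u w + d * level_form n v w"
proof -
  have "(\<Sum>x\<in>level T n. cross_variation ((\<lambda>x. c * u x + d * v x) \<circ> word_map f (snd x)) (w \<circ> word_map f (snd x)))
      = (\<Sum>x\<in>level T n. c * cross_variation (u \<circ> word_map f (snd x)) (w \<circ> word_map f (snd x))
          + d * cross_variation (v \<circ> word_map f (snd x)) (w \<circ> word_map f (snd x)))"
  proof (rule sum.cong[OF refl])
    fix x assume "x \<in> level T n"
    then have "snd x \<in> lists S" by (rule level_T_word)
    from comp_word_continuous[OF assms(1) this] comp_word_continuous[OF assms(2) this] comp_word_continuous[OF assms(3) this]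
    show "cross_variation ((\<lambda>x. c * u x + d * v x) \<circ> word_map f (snd x)) (w \<circ> word_map f (snd x))
        = c * cross_variation (u \<circ> word_map f (snd x)) (w \<circ> word_map f (snd x))
          + d * cross_variation (v \<circ> word_map f (snd x)) (w \<circ> word_map f (snd x))"
      using cross_variation_linear[of "u \<circ> word_map f (snd x)" "v \<circ> word_map f (snd x)" "w \<circ> word_map f (snd x)" c d]
      by (simp add: comp_def)
  qed
  then show ?thesis
    unfolding level_form_def by (simp only: sum.distrib sum_distrib_left[symmetric]) (simp add: algebra_simps)
qed

lemma Wp_diff: "u \<in> W \<Longrightarrow> v \<in> W \<Longrightarrow> (\<lambda>x. u x - v x) \<in> W"
  using Wp_linear[of u v 1 "- 1"] by simp

lemma Wp_add: "u \<in> W \<Longrightarrow> v \<in> W \<Longrightarrow> (\<lambda>x. u x + v x) \<in> W"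
  using Wp_linear[of u v 1 1] by simp

section \<open>The quadratic case p = 2\<close>

context
  assumes p2: "p = 2"
begin

lemma abs_powr_p: "\<bar>t\<bar> powr p = t\<^sup>2" for t :: real
  by (cases "t = 0") (auto simp: p2 powr_numeral)

lemma variation_polarization:
  assumes g: "continuous_on UNIV g" and h: "continuous_on UNIV h"
  shows "variation (\<lambda>x. g x + h x) - variation (\<lambda>x. g x - h x) = 4 * cross_variation g h"
proof -
  have "variation (\<lambda>x. g x + h x) - variation (\<lambda>x. g x - h x)
      = (\<integral>z. \<bar>g (fst z) + h (fst z) - (g (snd z) + h (snd z))\<bar> powr p - \<bar>g (fst z) - h (fst z) - (g (snd z) - h (snd z))\<bar> powr p \<partial>(\<mu> \<Otimes>\<^sub>M \<mu>))"
    unfolding variation_def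
    by (rule Bochner_Integration.integral_diff[symmetric])
      (rule variation_integrable[of "\<lambda>x. g x + h x"] variation_integrable[of "\<lambda>x. g x - h x"],
        intro continuous_intros g h)+
  also have "\<dots> = (\<integral>z. 4 * ((g (fst z) - g (snd z)) * (h (fst z) - h (snd z))) \<partial>(\<mu> \<Otimes>\<^sub>M \<mu>))"
    unfolding abs_powr_p
    by (intro Bochner_Integration.integral_cong refl) (simp add: power2_eq_square algebra_simps)
  finally show ?thesis by (simp add: cross_variation_def)
qed

lemma level_energy_polarization:
  assumes u: "continuous_on UNIV u" and v: "continuous_on UNIV v"
  shows "level_energy n (\<lambda>x. u x + v x) - level_energy n (\<lambda>x. u x - v x) = 4 * level_form n u v"
proof -
  have "(\<Sum>x\<in>level T n. cell_variation (\<lambda>x. u x + v x) x - cell_variation (\<lambda>x. u x - v x) x)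
      = (\<Sum>x\<in>level T n. 4 * cross_variation (u \<circ> word_map f (snd x)) (v \<circ> word_map f (snd x)))"
  proof (rule sum.cong[OF refl])
    fix x assume "x \<in> level T n"
    then have "snd x \<in> lists S" by (rule level_T_word)
    from variation_polarization[OF comp_word_continuous[OF u this] comp_word_continuous[OF v this]]
    show "cell_variation (\<lambda>x. u x + v x) x - cell_variation (\<lambda>x. u x - v x) x
        = 4 * cross_variation (u \<circ> word_map f (snd x)) (v \<circ> word_map f (snd x))"
      by (simp add: cell_variation_def comp_def)
  qed
  then show ?thesis
    unfolding level_energy_def level_form_def right_diff_distrib[symmetric] sum_subtractf[symmetric]
    by (simp add: sum_distrib_left mult_ac)
qed

lemma form_tendsto:
  assumes u: "u \<in> W" and v: "v \<in> W"
  shows "((\<lambda>n. average (\<lambda>i. level_form i u v) n) \<longlongrightarrow> form u v) limit_filter"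
proof -
  have "average (\<lambda>i. level_form i u v) n
      = (average (\<lambda>i. level_energy i (\<lambda>x. u x + v x)) n - average (\<lambda>i. level_energy i (\<lambda>x. u x - v x)) n) / 4" for n
  proof -
    have "level_form i u v = 1 / 4 * level_energy i (\<lambda>x. u x + v x) + (- 1 / 4) * level_energy i (\<lambda>x. u x - v x)" for i
      using level_energy_polarization[OF Wp_continuous[OF u] Wp_continuous[OF v], of i] by simp
    then show ?thesis by (simp only: average_linear) simp
  qed
  then show ?thesis
    unfolding form_def by (simp only:) (intro tendsto_intros E_tendsto Wp_add Wp_diff u v, simp)
qed

text \<open>Averages of level forms are linear in the first argument, and limits along the filter
  are unique; no parallelogram identity for E is used.\<close>

lemma form_linear:
  assumes "u \<in> W" "v \<in> W" "w \<in> W"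
  shows "form (\<lambda>x. c * u x + d * v x) w = c * form u w + d * form v w"
proof (rule tendsto_unique[OF limit_filter(1)])
  show "((\<lambda>n. average (\<lambda>i. level_form i (\<lambda>x. c * u x + d * v x) w) n) \<longlongrightarrow> form (\<lambda>x. c * u x + d * v x) w) limit_filter"
    using assms by (intro form_tendsto Wp_linear)
  show "((\<lambda>n. average (\<lambda>i. level_form i (\<lambda>x. c * u x + d * v x) w) n) \<longlongrightarrow> c * form u w + d * form v w) limit_filter"
    unfolding level_form_linear[OF assms[THEN Wp_continuous]] average_linear
    using assms by (intro tendsto_intros form_tendsto)
qed

lemma E_zero: "E (\<lambda>x. 0) = 0"
  using E_scale[OF const_in_Wp[of 0], of 0] p_pos by simp

lemma form_diag:
  assumes "u \<in> W"
  shows "form u u = E u"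
proof -
  have "(\<lambda>x. u x + u x) = (\<lambda>x. 2 * u x)" by auto
  then show ?thesis using E_scale[OF assms, of 2] E_zero by (simp add: form_def abs_powr_p[of 2, simplified])
qed

lemma form_sym:
  assumes "u \<in> W" "v \<in> W"
  shows "form u v = form v u"
proof -
  have "E (\<lambda>x. v x - u x) = E (\<lambda>x. u x - v x)"
    using E_scale[OF Wp_diff[OF assms], of "- 1"] by simp
  then show ?thesis by (simp add: form_def add.commute)
qed

lemma form_zero:
  assumes "v \<in> W"
  shows "form (\<lambda>x. 0) v = 0"
  using form_linear[OF assms assms assms, of 0 0] by simp

lemma Wp_square_integrable:
  assumes "u \<in> W"
  shows "integrable \<mu> (\<lambda>x. (u x)\<^sup>2)"
  by (intro continuous_integrable continuous_intros Wp_continuous assms)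

lemma symmetric_form: "symmetric_form \<mu> W form"
  unfolding symmetric_form_def
proof (intro conjI ballI allI impI)
  show "function_space W" by (rule function_space_Wp)
  show "W \<subseteq> Lp_functions \<mu> 2" by (auto simp: Wp_def p2)
  show "form u v = form v u" if "u \<in> W" "v \<in> W" for u v by (rule form_sym[OF that])
  show "form (\<lambda>x. u x + v x) w = form u w + form v w" if "u \<in> W" "v \<in> W" "w \<in> W" for u v w
    using form_linear[OF that, of 1 1] by simp
  show "form (\<lambda>x. c * u x) v = c * form u v" if "u \<in> W" "v \<in> W" for c u v
    using form_linear[OF that(1,1,2), of c 0] by simp
  show "0 \<le> form u u" if "u \<in> W" for u using form_diag[OF that] E_nonneg[OF that] by simp
  show "form u v = 0" if "u \<in> W" "v \<in> W" "AE x in \<mu>. u x = 0" for u v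
  proof -
    have "u x = 0" for x
      using zero_on_open[OF Wp_continuous[OF that(1)] open_UNIV, of x] that(3) by simp
    then have "u = (\<lambda>x. 0)" by auto
    then show ?thesis using form_zero[OF that(2)] by simp
  qed
  show "\<exists>u\<in>W. (\<integral>x. (g x - u x)\<^sup>2 \<partial>\<mu>) < e" if "g \<in> Lp_functions \<mu> 2" "0 < e" for g and e :: real
    by (rule dense_L2[OF that])
qed

definition L5 :: real where "L5 = 2 * (K4 * L4) + 2"

text \<open>Average over y the comparison of u(x) with u(y), using the global oscillation bound.
  Consequently a Cauchy sequence for the form is uniformly Cauchy.\<close>

lemma sup_le_form_one:
  assumes u: "u \<in> W"
  shows "(u x)\<^sup>2 \<le> L5 * form_one \<mu> form u"
proof -
  have "(u x)\<^sup>2 \<le> 2 * (K4 * L4 * E u) + 2 * (u y)\<^sup>2" for y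
  proof -
    have "(u x - u y)\<^sup>2 \<le> K4 * (L4 * E u)"
      using global_oscillation[OF Wp_continuous[OF u] E_lower[OF u], of x y] by (simp add: abs_powr_p)
    moreover have "(u x)\<^sup>2 \<le> 2 * (u x - u y)\<^sup>2 + 2 * (u y)\<^sup>2"
      using zero_le_power2[of "u x - 2 * u y"] by (simp add: power2_eq_square algebra_simps)
    ultimately show ?thesis by simp
  qed
  then have "(\<integral>y. (u x)\<^sup>2 \<partial>\<mu>) \<le> (\<integral>y. 2 * (K4 * L4 * E u) + 2 * (u y)\<^sup>2 \<partial>\<mu>)"
    using Wp_square_integrable[OF u] by (intro integral_mono) auto
  then have "(u x)\<^sup>2 \<le> 2 * (K4 * L4 * E u) + 2 * (\<integral>y. (u y)\<^sup>2 \<partial>\<mu>)"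
    using Wp_square_integrable[OF u] by (simp add: prob_space)
  also have "\<dots> \<le> L5 * form_one \<mu> form u"
    using E_nonneg[OF u] K4_pos L4_pos
    by (simp add: L5_def form_one_def form_diag[OF u] algebra_simps)
  finally show ?thesis .
qed

lemma form_one_ge: "u \<in> W \<Longrightarrow> E u \<le> form_one \<mu> form u"
  by (simp add: form_one_def form_diag integral_nonneg_AE)

lemma L5_pos: "0 < L5"
  using K4_pos L4_pos by (simp add: L5_def add_pos_pos)

text \<open>E comes with no semicontinuity of its own, so the limit is taken in the discrete
  energies of \<open>u n - u m\<close> as m grows. Passing from E to these energies and back costs
  \<open>K4 * L4\<close>; the uniform bound supplies \<open>L5\<close>.\<close>

lemma form_one_limit:
  assumes u: "\<And>n. u n \<in> W" and e: "0 < e"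
    and cauchy: "\<And>m n. N0 \<le> m \<Longrightarrow> N0 \<le> n \<Longrightarrow> form_one \<mu> form (\<lambda>x. u m x - u n x) < e"
    and v: "\<And>x. (\<lambda>n. u n x) \<longlonglongrightarrow> v x" "continuous_on UNIV v" and n: "N0 \<le> n"
  shows "(\<lambda>x. u n x - v x) \<in> W \<and> form_one \<mu> form (\<lambda>x. u n x - v x) \<le> (K4 * L4 + L5) * e"
proof -
  let ?w = "\<lambda>x. u n x - v x"
  have cw: "continuous_on UNIV ?w" by (intro continuous_intros Wp_continuous u v)
  have diff: "(\<lambda>x. u n x - u m x) \<in> W" for m by (rule Wp_diff[OF u u])
  have close: "(u k x - u m x)\<^sup>2 \<le> L5 * e" if "N0 \<le> k" "N0 \<le> m" for k m x
  proof -
    have "(u k x - u m x)\<^sup>2 \<le> L5 * form_one \<mu> form (\<lambda>x. u k x - u m x)"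
      by (rule sup_le_form_one[OF Wp_diff[OF u u]])
    also have "\<dots> \<le> L5 * e" using cauchy[OF that] L5_pos by (intro mult_left_mono) auto
    finally show ?thesis .
  qed
  have sup: "(?w x)\<^sup>2 \<le> L5 * e" for x
  proof (rule tendsto_upperbound)
    show "(\<lambda>m. (u n x - u m x)\<^sup>2) \<longlonglongrightarrow> (?w x)\<^sup>2" by (intro tendsto_intros v)
    have "(u n x - u m x)\<^sup>2 \<le> L5 * e" if "N0 \<le> m" for m by (rule close[OF n that])
    then show "\<forall>\<^sub>F m in sequentially. (u n x - u m x)\<^sup>2 \<le> L5 * e" by (auto simp: eventually_sequentially)
  qed simp
  have mean: "(\<lambda>m. cell_mean T \<mu> (\<lambda>x. u n x - u m x) y) \<longlonglongrightarrow> cell_mean T \<mu> ?w y" if y: "y \<in> level T k" for k y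
  proof -
    obtain B where B: "0 \<le> B" "\<And>x. \<bar>v x\<bar> \<le> B" using continuous_bounded[OF v(2)] by metis
    obtain D where D: "0 \<le> D" "\<And>x. \<bar>u N0 x\<bar> \<le> D" using continuous_bounded[OF Wp_continuous[OF u]] by metis
    obtain G where G: "0 \<le> G" "\<And>x. \<bar>u n x\<bar> \<le> G" using continuous_bounded[OF Wp_continuous[OF u]] by metis
    have bound: "\<bar>u m x\<bar> \<le> D + (1 + L5 * e)" if "N0 \<le> m" for m x
    proof -
      have "(u m x - u N0 x)\<^sup>2 \<le> L5 * e" by (rule close[OF that order_refl])
      then have "\<bar>u m x - u N0 x\<bar> \<le> 1 + L5 * e"
        using zero_le_power2[of "\<bar>u m x - u N0 x\<bar> - 1"] mult_nonneg_nonneg[OF less_imp_le[OF L5_pos] less_imp_le[OF e]]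
        by (simp add: power2_diff)
      then show ?thesis using D(2)[of x] by linarith
    qed
    \<comment> \<open>The index is shifted by \<open>N0\<close> because the dominating constant is
      only valid from there on.\<close>
    have "(\<lambda>m. LINT x|\<mu>. indicator (cell T y) x *\<^sub>R (u n x - u (m + N0) x)) \<longlonglongrightarrow> (LINT x|\<mu>. indicator (cell T y) x *\<^sub>R ?w x)"
    proof (rule integral_dominated_convergence[of _ _ _ "\<lambda>x. G + (D + (1 + L5 * e))"])
      show "AE x in \<mu>. (\<lambda>m. indicator (cell T y) x *\<^sub>R (u n x - u (m + N0) x)) \<longlonglongrightarrow> indicator (cell T y) x *\<^sub>R ?w x"
        using v(1) by (intro AE_I2 tendsto_intros LIMSEQ_ignore_initial_segment)
      show "AE x in \<mu>. norm (indicator (cell T y) x *\<^sub>R (u n x - u (m + N0) x)) \<le> G + (D + (1 + L5 * e))" for m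
      proof (intro AE_I2)
        fix x
        have "\<bar>u n x - u (m + N0) x\<bar> \<le> G + (D + (1 + L5 * e))"
          using G(2)[of x] bound[of "m + N0" x] by linarith
        then show "norm (indicator (cell T y) x *\<^sub>R (u n x - u (m + N0) x)) \<le> G + (D + (1 + L5 * e))"
          by (auto simp: indicator_def)
      qed
      have [measurable]: "cell T y \<in> sets \<mu>" by (rule cell_sets[OF y])
      have [measurable]: "u m \<in> borel_measurable \<mu>" "v \<in> borel_measurable \<mu>" for m
        using measurable_continuous[OF Wp_continuous[OF u]] measurable_continuous[OF v(2)] by auto
      show "(\<lambda>x. indicator (cell T y) x *\<^sub>R ?w x) \<in> borel_measurable \<mu>" by measurable
      show "(\<lambda>x. indicator (cell T y) x *\<^sub>R (u n x - u (m + N0) x)) \<in> borel_measurable \<mu>" for m by measurable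
    qed simp
    then have "(\<lambda>m. LINT x:cell T y|\<mu>. u n x - u m x) \<longlonglongrightarrow> (LINT x:cell T y|\<mu>. ?w x)"
      unfolding set_lebesgue_integral_def by (rule LIMSEQ_offset)
    then show ?thesis unfolding cell_mean_def using measure_cell_pos[OF y] by (intro tendsto_intros) auto
  qed
  have bound: "energy_bound p \<sigma> (cell_mean T \<mu> ?w) (L4 * e)"
  proof (intro allI impI)
    fix k :: nat assume k: "1 \<le> k"
    have "(\<lambda>m. energy T p k (cell_mean T \<mu> (\<lambda>x. u n x - u m x))) \<longlonglongrightarrow> energy T p k (cell_mean T \<mu> ?w)"
      unfolding energy_def energy_on_def
    proof (intro tendsto_intros, unfold case_prod_unfold, rule tendsto_abs_powr)
      fix z assume "z \<in> edges T k \<inter> level T k \<times> level T k"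
      then have "fst z \<in> level T k" "snd z \<in> level T k" by auto
      then show "(\<lambda>m. cell_mean T \<mu> (\<lambda>x. u n x - u m x) (fst z)) \<longlonglongrightarrow> cell_mean T \<mu> ?w (fst z)"
        "(\<lambda>m. cell_mean T \<mu> (\<lambda>x. u n x - u m x) (snd z)) \<longlonglongrightarrow> cell_mean T \<mu> ?w (snd z)"
        by (auto intro: mean)
    qed
    then have lim: "(\<lambda>m. \<sigma> ^ k * energy T p k (cell_mean T \<mu> (\<lambda>x. u n x - u m x))) \<longlonglongrightarrow> \<sigma> ^ k * energy T p k (cell_mean T \<mu> ?w)"
      by (intro tendsto_intros)
    have "\<sigma> ^ k * energy T p k (cell_mean T \<mu> (\<lambda>x. u n x - u m x)) \<le> L4 * e" if "N0 \<le> m" for m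
    proof -
      have "\<sigma> ^ k * energy T p k (cell_mean T \<mu> (\<lambda>x. u n x - u m x)) \<le> L4 * E (\<lambda>x. u n x - u m x)"
        using E_lower[OF diff] k by blast
      also have "\<dots> \<le> L4 * e"
        using form_one_ge[OF diff, of m] cauchy[OF n that] L4_pos by (intro mult_left_mono) auto
      finally show ?thesis .
    qed
    then show "\<sigma> ^ k * energy T p k (cell_mean T \<mu> ?w) \<le> L4 * e"
      by (intro tendsto_upperbound[OF lim]) (auto simp: eventually_sequentially)
  qed
  have wW: "?w \<in> W" using cw bound Wp_iff[OF p_pos] by blast
  have "(\<integral>x. (?w x)\<^sup>2 \<partial>\<mu>) \<le> (\<integral>x. L5 * e \<partial>\<mu>)"
    using sup Wp_square_integrable[OF wW] by (intro integral_mono) auto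
  then have "form_one \<mu> form ?w \<le> K4 * (L4 * e) + L5 * e"
    using E_le_bound[OF wW bound] by (simp add: form_one_def form_diag[OF wW] prob_space)
  then show ?thesis using wW by (simp add: algebra_simps)
qed

text \<open>The candidate limit is the uniform limit; the only real point is that it belongs to the
  space, which \<open>form_one_limit\<close> provides together with convergence.\<close>

lemma closed_form: "closed_form \<mu> W form"
  unfolding closed_form_def
proof (intro allI impI)
  fix u :: "nat \<Rightarrow> 'k \<Rightarrow> real"
  assume "(\<forall>n. u n \<in> W) \<and> (\<forall>e>0. \<exists>N. \<forall>m\<ge>N. \<forall>n\<ge>N. form_one \<mu> form (\<lambda>x. u m x - u n x) < e)"
  then have u: "\<And>n. u n \<in> W"
    and cauchy: "\<And>e. 0 < e \<Longrightarrow> \<exists>N. \<forall>m\<ge>N. \<forall>n\<ge>N. form_one \<mu> form (\<lambda>x. u m x - u n x) < e" by auto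
  have unif: "uniformly_Cauchy_on UNIV u"
    unfolding uniformly_Cauchy_on_def
  proof (intro allI impI)
    fix e :: real assume e: "0 < e"
    then have "0 < e\<^sup>2 / L5" using L5_pos by simp
    then obtain N0 where N0: "\<forall>m\<ge>N0. \<forall>n\<ge>N0. form_one \<mu> form (\<lambda>x. u m x - u n x) < e\<^sup>2 / L5"
      using cauchy by blast
    have "dist (u m x) (u n x) < e" if "N0 \<le> m" "N0 \<le> n" for m n x
    proof -
      have "(u m x - u n x)\<^sup>2 \<le> L5 * form_one \<mu> form (\<lambda>x. u m x - u n x)"
        by (rule sup_le_form_one[OF Wp_diff[OF u u]])
      also have "\<dots> < L5 * (e\<^sup>2 / L5)" using N0 that L5_pos by (intro mult_strict_left_mono) auto
      also have "\<dots> = e\<^sup>2" using L5_pos by simp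
      finally have "\<bar>u m x - u n x\<bar> < e" using e abs_le_square_iff[of e "u m x - u n x"] by (simp add: not_le[symmetric])
      then show ?thesis by (simp add: dist_real_def)
    qed
    then show "\<exists>M. \<forall>x\<in>UNIV. \<forall>m\<ge>M. \<forall>n\<ge>M. dist (u m x) (u n x) < e" by blast
  qed
  then obtain v where v: "uniform_limit UNIV u v sequentially"
    using Cauchy_uniformly_convergent uniformly_convergent_on_def by blast
  have vc: "continuous_on UNIV v"
    by (rule uniform_limit_theorem[OF always_eventually v]) (simp_all add: Wp_continuous u)
  have vl: "(\<lambda>n. u n x) \<longlonglongrightarrow> v x" for x by (rule tendsto_uniform_limitI[OF v]) simp
  define c where "c = K4 * L4 + L5"
  have c: "0 < c" using K4_pos L4_pos L5_pos by (simp add: c_def add_pos_pos)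
  have small: "\<exists>N0. \<forall>n\<ge>N0. (\<lambda>x. u n x - v x) \<in> W \<and> form_one \<mu> form (\<lambda>x. u n x - v x) \<le> c * e" if e: "0 < e" for e
  proof -
    obtain N0 where N0: "\<forall>m\<ge>N0. \<forall>n\<ge>N0. form_one \<mu> form (\<lambda>x. u m x - u n x) < e"
      using cauchy[OF e] by blast
    then show ?thesis unfolding c_def using form_one_limit[OF u e _ vl vc] by blast
  qed
  obtain n where "(\<lambda>x. u n x - v x) \<in> W" using small[of 1] by auto
  from Wp_diff[OF u[of n] this] have vW: "v \<in> W" by simp
  have "(\<lambda>n. form_one \<mu> form (\<lambda>x. u n x - v x)) \<longlonglongrightarrow> 0"
  proof (rule LIMSEQ_I)
    fix e :: real assume e: "0 < e"
    then obtain N0 where N0: "\<forall>n\<ge>N0. (\<lambda>x. u n x - v x) \<in> W \<and> form_one \<mu> form (\<lambda>x. u n x - v x) \<le> c * (e / (2 * c))"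
      using small[of "e / (2 * c)"] c by auto
    have "norm (form_one \<mu> form (\<lambda>x. u n x - v x) - 0) < e" if "N0 \<le> n" for n
    proof -
      have w: "(\<lambda>x. u n x - v x) \<in> W" "form_one \<mu> form (\<lambda>x. u n x - v x) \<le> c * (e / (2 * c))" using N0 that by auto
      have "0 \<le> form_one \<mu> form (\<lambda>x. u n x - v x)" using form_one_ge[OF w(1)] E_nonneg[OF w(1)] by linarith
      then show ?thesis using w(2) e c by simp
    qed
    then show "\<exists>no. \<forall>n\<ge>no. norm (form_one \<mu> form (\<lambda>x. u n x - v x) - 0) < e" by blast
  qed
  then show "\<exists>v\<in>W. (\<lambda>n. form_one \<mu> form (\<lambda>x. u n x - v x)) \<longlonglongrightarrow> 0" using vW by blast
qed

lemma dirichlet_form: "dirichlet_form \<mu> W form"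
  unfolding dirichlet_form_def markovian_form_def
proof (intro conjI ballI symmetric_form closed_form)
  fix u assume u: "u \<in> W"
  show "\<exists>v\<in>W. (AE x in \<mu>. v x = unit_truncation u x) \<and> form v v \<le> form u u"
    using truncation_in_Wp[OF u] E_truncation[OF u]
    by (intro bexI[of _ "unit_truncation u"]) (auto simp: form_diag u)
qed

lemma regular_form: "regular_form \<mu> W form"
  unfolding regular_form_def
proof (intro conjI ballI allI impI)
  fix u and e :: real assume u: "u \<in> W" and e: "0 < e"
  have "form_one \<mu> form (\<lambda>x. u x - u x) = 0" using form_zero[OF u] by (simp add: form_one_def form_diag[OF const_in_Wp] E_zero)
  then show "\<exists>v\<in>W. continuous_on UNIV v \<and> form_one \<mu> form (\<lambda>x. u x - v x) < e"
    using u e by (intro bexI[of _ u]) (auto intro: Wp_continuous)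
next
  fix h :: "'k \<Rightarrow> real" and e :: real assume "continuous_on UNIV h" "0 < e"
  then obtain u where "u \<in> W" "\<And>x. \<bar>h x - u x\<bar> < e" by (rule Wp_dense) blast
  then show "\<exists>v\<in>W. continuous_on UNIV v \<and> (\<forall>x. \<bar>h x - v x\<bar> < e)" using Wp_continuous by blast
qed

text \<open>Disjoint supports, being compact, have positive distance. Once cells are smaller than
  that distance, no cell meets both supports, so the level forms vanish from some level on.\<close>

lemma local_form: "local_form \<mu> W form"
  unfolding local_form_def
proof (intro ballI impI)
  fix u v assume u: "u \<in> W" and v: "v \<in> W" and disj: "ae_support \<mu> u \<inter> ae_support \<mu> v = {}"
  have zero: "w x = 0" if w: "w \<in> W" and x: "x \<notin> ae_support \<mu> w" for w x
  proof -
    obtain U where "open U" "AE x in \<mu>. x \<in> U \<longrightarrow> w x = 0" "x \<in> U" using x by (auto simp: ae_support_def)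
    then show ?thesis using zero_on_open[OF Wp_continuous[OF w]] by blast
  qed
  have closed: "closed (ae_support \<mu> w)" for w :: "'k \<Rightarrow> real"
    unfolding ae_support_def by (intro closed_Compl open_Union) auto
  have cpt: "compact (ae_support \<mu> u)" using compact_Int_closed[OF compact_UNIV closed, of u] by simp
  obtain d where d: "0 < d" "\<And>x y. x \<in> ae_support \<mu> u \<Longrightarrow> y \<in> ae_support \<mu> v \<Longrightarrow> d \<le> dist x y"
  proof (cases "ae_support \<mu> u = {} \<or> ae_support \<mu> v = {}")
    case True
    then show ?thesis using that[of 1] by auto
  next
    case False
    have "continuous_on (ae_support \<mu> u) (\<lambda>x. infdist x (ae_support \<mu> v))"
      by (intro continuous_on_infdist continuous_on_id)
    then obtain x0 where x0: "x0 \<in> ae_support \<mu> u"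
      "\<And>x. x \<in> ae_support \<mu> u \<Longrightarrow> infdist x0 (ae_support \<mu> v) \<le> infdist x (ae_support \<mu> v)"
      using continuous_attains_inf[OF cpt] False by blast
    have "x0 \<notin> ae_support \<mu> v" using x0(1) disj by blast
    then have "0 < infdist x0 (ae_support \<mu> v)"
      using in_closed_iff_infdist_zero[OF closed, of v x0] infdist_nonneg[of x0 "ae_support \<mu> v"] False by (auto simp: less_le)
    then show ?thesis using that x0(2) infdist_le order.trans by metis
  qed
  have "(\<lambda>n. b * r ^ n) \<longlonglongrightarrow> b * 0"
    using r by (intro tendsto_intros LIMSEQ_realpow_zero) auto
  then have "\<forall>\<^sub>F n in sequentially. b * r ^ n < d" using d by (intro order_tendstoD(2)) auto
  then obtain n0 where n0: "\<And>n. n0 \<le> n \<Longrightarrow> b * r ^ n < d" by (auto simp: eventually_sequentially)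
  have vanish: "level_form n u v = 0" if n: "n0 \<le> n" for n
    unfolding level_form_def
  proof (intro mult_eq_0_iff[THEN iffD2] disjI2 sum.neutral ballI)
    fix x assume x: "x \<in> level T n"
    obtain w where w: "x = (n, w)" using x by (auto simp: level_T)
    have "cell T x \<inter> ae_support \<mu> u = {} \<or> cell T x \<inter> ae_support \<mu> v = {}"
      using dist_cell[OF x] d(2) n0[OF n] by fastforce
    then have "(\<forall>z. u (word_map f w z) = 0) \<or> (\<forall>z. v (word_map f w z) = 0)"
      using zero[OF u] zero[OF v] by (fastforce simp: w tree_simps)
    then show "cross_variation (u \<circ> word_map f (snd x)) (v \<circ> word_map f (snd x)) = 0"
      by (auto simp: w cross_variation_def)
  qed
  let ?c = "K4 * Np_real p \<sigma> (\<lambda>x. u x + v x) + K4 * Np_real p \<sigma> (\<lambda>x. u x - v x)"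
  have "\<bar>level_form i u v\<bar> \<le> ?c" for i
    using level_energy_polarization[OF Wp_continuous[OF u] Wp_continuous[OF v], of i]
      level_energy_Wp[OF Wp_add[OF u v], of i] level_energy_Wp[OF Wp_diff[OF u v], of i] by linarith
  \<comment> \<open>After the shift by \<open>n0\<close> every averaged term is 0, so the averages
    themselves tend to 0.\<close>
  from average_shift_tendsto[of "\<lambda>i. level_form i u v", OF this, of n0]
  have "(\<lambda>n. - average (\<lambda>i. level_form i u v) n) \<longlonglongrightarrow> 0"
    using vanish by (simp add: average_def)
  then have "(\<lambda>n. average (\<lambda>i. level_form i u v) n) \<longlonglongrightarrow> 0" by (simp add: tendsto_minus_cancel_left[symmetric])
  then have "((\<lambda>n. average (\<lambda>i. level_form i u v) n) \<longlongrightarrow> 0) limit_filter"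
    by (rule tendsto_mono[OF limit_filter(2)])
  then show "form u v = 0" by (rule tendsto_unique[OF limit_filter(1) form_tendsto[OF u v]])
qed

end

end

text \<open>Homogeneity bounds the product of disparity and conductance; dividing by the lower bound
  for the disparity leaves the decay \<sigma>^(-m) of the conductances.\<close>

lemma disparity_rate_conductance:
  assumes hom: "conductively_homogeneous P \<mu> M p" and rate: "disparity_rate P \<mu> p \<sigma>"
  obtains C where "1 \<le> C" "\<And>m n. 1 \<le> m \<Longrightarrow> 1 \<le> n \<Longrightarrow> nbr_disparity_level P \<mu> p m n \<le> ennreal (C * \<sigma> ^ m)"
    "\<And>m. 1 \<le> m \<Longrightarrow> conductance P M p m \<le> ennreal (C / \<sigma> ^ m)"
proof -
  obtain c c' where c: "0 < \<sigma>" "0 < c" "0 < c'" and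
    lower: "\<And>m n. 1 \<le> m \<Longrightarrow> 1 \<le> n \<Longrightarrow> ennreal (c * \<sigma> ^ m) \<le> nbr_disparity_level P \<mu> p m n" and
    upper: "\<And>m n. 1 \<le> m \<Longrightarrow> 1 \<le> n \<Longrightarrow> nbr_disparity_level P \<mu> p m n \<le> ennreal (c' * \<sigma> ^ m)"
    using rate unfolding disparity_rate_def by blast
  define H where "H = (SUP m. nbr_disparity P \<mu> p m * conductance P M p m)"
  have H: "H < \<infinity>" using hom by (simp add: conductively_homogeneous_def H_def)
  define h where "h = enn2real H"
  have Hh: "H = ennreal h" using H by (simp add: h_def less_top[symmetric])
  have h0: "0 \<le> h" by (simp add: h_def)
  define C where "C = 1 + c' + h / c"
  have C: "1 \<le> C" "c' \<le> C" "h / c \<le> C" using c h0 by (auto simp: C_def)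
  have "nbr_disparity_level P \<mu> p m n \<le> ennreal (C * \<sigma> ^ m)" if "1 \<le> m" "1 \<le> n" for m n
    using upper[OF that] C c by (elim order.trans) (auto intro!: ennreal_leI mult_right_mono)
  moreover have "conductance P M p m \<le> ennreal (C / \<sigma> ^ m)" if m: "1 \<le> m" for m
  proof -
    let ?d = "c * \<sigma> ^ m"
    have d: "0 < ?d" using c by simp
    \<comment> \<open>Level 1 alone suffices, as the disparity is a supremum over all positive
      levels.\<close>
    have "ennreal ?d \<le> nbr_disparity P \<mu> p m"
      unfolding nbr_disparity_def using lower[OF m, of 1] by (intro SUP_upper2[of 1]) auto
    then have "ennreal ?d * conductance P M p m \<le> nbr_disparity P \<mu> p m * conductance P M p m"
      by (intro mult_right_mono) auto
    also have "\<dots> \<le> H" unfolding H_def by (rule SUP_upper) simp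
    finally have le: "ennreal ?d * conductance P M p m \<le> ennreal h" by (simp only: Hh)
    have "ennreal (1 / ?d) * ennreal ?d = 1" using d c by (subst ennreal_mult[symmetric]) auto
    then have "conductance P M p m = ennreal (1 / ?d) * (ennreal ?d * conductance P M p m)"
      by (simp only: mult.assoc[symmetric] mult_1)
    also have "\<dots> \<le> ennreal (1 / ?d) * ennreal h" by (intro mult_left_mono le) auto
    also have "\<dots> = ennreal (h / c / \<sigma> ^ m)" using d h0 by (simp add: ennreal_mult[symmetric])
    also have "\<dots> \<le> ennreal (C / \<sigma> ^ m)" using C c by (intro ennreal_leI divide_right_mono) auto
    finally show ?thesis .
  qed
  ultimately show ?thesis using that C(1) by blast
qed

theorem theorem9p3:
  fixes S :: "'s set"
    and f :: "'s \<Rightarrow> 'k::metric_space \<Rightarrow> 'k"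
    and r \<alpha>\<^sub>H p \<sigma> \<tau> :: real
    and j :: "'s \<Rightarrow> nat"
    and M :: nat
    and \<mu> :: "'k measure"
    and P :: "(nat \<times> 's list, 'k) cell_tree"
  assumes "self_similar_structure S f"
    and "0 < r" and "r < 1"
    and "P = self_similar_tree S f r j"
    and "(\<Sum>s\<in>S. r powr (real (j s) * \<alpha>\<^sub>H)) = 1"
    and "self_similar_measure S f (\<lambda>s. r powr (real (j s) * \<alpha>\<^sub>H)) \<mu>"
    and "standing_assumption P r \<mu> M"
    and "ereal p > dim_AR TYPE('k)"
    and "conductively_homogeneous P \<mu> M p"
    and "disparity_rate P \<mu> p \<sigma>"
    and "\<tau> = - ln \<sigma> / ln r"
  shows "(\<forall>w\<in>lists S. \<forall>u\<in>Wp P \<mu> p \<sigma>. u \<circ> word_map f w \<in> Wp P \<mu> p \<sigma>) \<and>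
    (\<exists>E :: ('k \<Rightarrow> real) \<Rightarrow> real.
       (\<forall>u\<in>Wp P \<mu> p \<sigma>. 0 \<le> E u) \<and>
       \<comment> \<open>(a)\<close>
       seminorm_on_space (Wp P \<mu> p \<sigma>) (\<lambda>u. E u powr (1 / p)) \<and>
       (\<exists>c\<^sub>1>0. \<exists>c\<^sub>2>0.
          (\<forall>u\<in>Wp P \<mu> p \<sigma>. c\<^sub>1 * Np P \<mu> p \<sigma> u \<le> E u powr (1 / p) \<and>
             E u powr (1 / p) \<le> c\<^sub>2 * Np P \<mu> p \<sigma> u) \<and>
          (\<forall>x y.
             ennreal (c\<^sub>1 * dist x y powr \<tau>) \<le>
               (SUP u\<in>{u \<in> Wp P \<mu> p \<sigma>. E u \<noteq> 0}. ennreal (\<bar>u x - u y\<bar> powr p / E u)) \<and>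
             (SUP u\<in>{u \<in> Wp P \<mu> p \<sigma>. E u \<noteq> 0}. ennreal (\<bar>u x - u y\<bar> powr p / E u)) \<le>
               ennreal (c\<^sub>2 * dist x y powr \<tau>))) \<and>
       \<comment> \<open>(b)\<close>
       (\<forall>u\<in>Wp P \<mu> p \<sigma>. unit_truncation u \<in> Wp P \<mu> p \<sigma> \<and> E (unit_truncation u) \<le> E u) \<and>
       \<comment> \<open>(c)\<close>
       (\<forall>u\<in>Wp P \<mu> p \<sigma>. E u = (\<Sum>s\<in>S. \<sigma> ^ j s * E (u \<circ> f s))) \<and>
       (p = 2 \<longrightarrow>
          (\<exists>B. (\<forall>u\<in>Wp P \<mu> p \<sigma>. B u u = E u) \<and>
             dirichlet_form \<mu> (Wp P \<mu> p \<sigma>) B \<and>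
             regular_form \<mu> (Wp P \<mu> p \<sigma>) B \<and>
             local_form \<mu> (Wp P \<mu> p \<sigma>) B)))"
proof -
  interpret ss: self_similar S f r \<alpha>\<^sub>H j M \<mu>
    using assms by (intro self_similar.intro) auto
  obtain a b N where "cell_space ss.T \<mu> r a b M N" using ss.ex_cell_space by blast
  then interpret cs: cell_space ss.T \<mu> r a b M N .
  obtain C where C: "1 \<le> C"
    "\<And>m n. 1 \<le> m \<Longrightarrow> 1 \<le> n \<Longrightarrow> nbr_disparity_level ss.T \<mu> p m n \<le> ennreal (C * \<sigma> ^ m)"
    "\<And>m. 1 \<le> m \<Longrightarrow> conductance ss.T M p m \<le> ennreal (C / \<sigma> ^ m)"
    using disparity_rate_conductance[of P \<mu> M p \<sigma>] assms by blast
  have \<sigma>: "0 < \<sigma>" using assms by (simp add: disparity_rate_def)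
  \<comment> \<open>The order matters: positivity of p comes from the conformal dimension, and the
    disparity estimates then yield p > 1 and \<sigma> > 1 for the next interpretation.\<close>
  interpret ds: disparity_space ss.T \<mu> r a b M N p \<sigma> C
    using cs.dim_AR_conductance_small(1)[OF assms(8)] \<sigma> C by unfold_locales auto
  interpret ssc: self_similar_conductive S f r \<alpha>\<^sub>H j M \<mu> a b N p \<sigma> C
    using ds.exponents_gt_1[OF assms(8)] C(3) by unfold_locales auto
  have P: "P = self_similar_tree S f r j" by (rule assms)
  have \<tau>: "\<tau> = ssc.\<tau>" by (simp add: ssc.\<tau>_def assms(11))
  \<comment> \<open>The statement asks for the same pair of constants in both comparisons, hence the
    minimum and the maximum.\<close>
  define c\<^sub>1 where "c\<^sub>1 = min ((1 / ssc.L4) powr (1 / p)) (1 / (ssc.K4 * ssc.K8))"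
  define c\<^sub>2 where "c\<^sub>2 = max (ssc.K4 powr (1 / p)) (ssc.K6 * ssc.L4)"
  have c: "0 < c\<^sub>1" "0 < c\<^sub>2"
    using ssc.L4_pos ssc.K4_pos ssc.K8_pos by (auto simp: c\<^sub>1_def c\<^sub>2_def less_max_iff_disj)
  have equivalent: "c\<^sub>1 * Np P \<mu> p \<sigma> u \<le> ssc.E u powr (1 / p) \<and> ssc.E u powr (1 / p) \<le> c\<^sub>2 * Np P \<mu> p \<sigma> u"
    if "u \<in> Wp P \<mu> p \<sigma>" for u
  proof -
    have N: "0 \<le> Np P \<mu> p \<sigma> u" by (simp add: Np_def)
    have "c\<^sub>1 * Np P \<mu> p \<sigma> u \<le> (1 / ssc.L4) powr (1 / p) * Np P \<mu> p \<sigma> u"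
      "ssc.K4 powr (1 / p) * Np P \<mu> p \<sigma> u \<le> c\<^sub>2 * Np P \<mu> p \<sigma> u"
      by (auto simp: c\<^sub>1_def c\<^sub>2_def intro!: mult_right_mono N)
    then show ?thesis using ssc.E_equivalent[of u] that unfolding P by linarith
  qed
  have resistance: "ennreal (c\<^sub>1 * dist x y powr \<tau>)
        \<le> (SUP u\<in>{u \<in> Wp P \<mu> p \<sigma>. ssc.E u \<noteq> 0}. ennreal (\<bar>u x - u y\<bar> powr p / ssc.E u)) \<and>
      (SUP u\<in>{u \<in> Wp P \<mu> p \<sigma>. ssc.E u \<noteq> 0}. ennreal (\<bar>u x - u y\<bar> powr p / ssc.E u))
        \<le> ennreal (c\<^sub>2 * dist x y powr \<tau>)" for x y
  proof
    have "ennreal (c\<^sub>1 * dist x y powr \<tau>) \<le> ennreal (1 / (ssc.K4 * ssc.K8) * dist x y powr \<tau>)"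
      by (intro ennreal_leI mult_right_mono) (auto simp: c\<^sub>1_def)
    also note ssc.resistance_lower[of x y, folded \<tau> P]
    finally show "ennreal (c\<^sub>1 * dist x y powr \<tau>)
        \<le> (SUP u\<in>{u \<in> Wp P \<mu> p \<sigma>. ssc.E u \<noteq> 0}. ennreal (\<bar>u x - u y\<bar> powr p / ssc.E u))" .
    note ssc.resistance_upper[of x y, folded \<tau> P]
    also have "ennreal (ssc.K6 * ssc.L4 * dist x y powr \<tau>) \<le> ennreal (c\<^sub>2 * dist x y powr \<tau>)"
      by (intro ennreal_leI mult_right_mono) (auto simp: c\<^sub>2_def)
    finally show "(SUP u\<in>{u \<in> Wp P \<mu> p \<sigma>. ssc.E u \<noteq> 0}. ennreal (\<bar>u x - u y\<bar> powr p / ssc.E u))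
        \<le> ennreal (c\<^sub>2 * dist x y powr \<tau>)" .
  qed
  have dirichlet: "\<exists>B. (\<forall>u\<in>Wp P \<mu> p \<sigma>. B u u = ssc.E u) \<and> dirichlet_form \<mu> (Wp P \<mu> p \<sigma>) B \<and>
      regular_form \<mu> (Wp P \<mu> p \<sigma>) B \<and> local_form \<mu> (Wp P \<mu> p \<sigma>) B" if "p = 2"
    unfolding P using ssc.form_diag[OF that] ssc.dirichlet_form[OF that] ssc.regular_form[OF that] ssc.local_form[OF that]
    by (intro exI[of _ ssc.form] conjI ballI)
  show ?thesis
  proof (intro conjI exI[of _ ssc.E] ballI impI)
    show "u \<circ> word_map f w \<in> Wp P \<mu> p \<sigma>" if "w \<in> lists S" "u \<in> Wp P \<mu> p \<sigma>" for w u
      using ssc.Wp_comp_word[of w u] that unfolding P by blast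
    show "seminorm_on_space (Wp P \<mu> p \<sigma>) (\<lambda>u. ssc.E u powr (1 / p))"
      unfolding P by (rule ssc.E_seminorm)
    show "\<exists>c\<^sub>1>0. \<exists>c\<^sub>2>0.
          (\<forall>u\<in>Wp P \<mu> p \<sigma>. c\<^sub>1 * Np P \<mu> p \<sigma> u \<le> ssc.E u powr (1 / p) \<and>
             ssc.E u powr (1 / p) \<le> c\<^sub>2 * Np P \<mu> p \<sigma> u) \<and>
          (\<forall>x y.
             ennreal (c\<^sub>1 * dist x y powr \<tau>) \<le>
               (SUP u\<in>{u \<in> Wp P \<mu> p \<sigma>. ssc.E u \<noteq> 0}. ennreal (\<bar>u x - u y\<bar> powr p / ssc.E u)) \<and>
             (SUP u\<in>{u \<in> Wp P \<mu> p \<sigma>. ssc.E u \<noteq> 0}. ennreal (\<bar>u x - u y\<bar> powr p / ssc.E u)) \<le>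
               ennreal (c\<^sub>2 * dist x y powr \<tau>))"
      using c equivalent resistance by blast
    fix u assume "u \<in> Wp P \<mu> p \<sigma>"
    then have u: "u \<in> ssc.W" unfolding P .
    show "0 \<le> ssc.E u" by (rule ssc.E_nonneg[OF u])
    show "unit_truncation u \<in> Wp P \<mu> p \<sigma>" unfolding P by (rule ssc.truncation_in_Wp[OF u])
    show "ssc.E (unit_truncation u) \<le> ssc.E u" by (rule ssc.E_truncation[OF u])
    show "ssc.E u = (\<Sum>s\<in>S. \<sigma> ^ j s * ssc.E (u \<circ> f s))" by (rule ssc.E_self_similar[OF u])
  qed (rule dirichlet)
qed

end
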